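(* Let $b\geq 3$ be a prime. Up to isomorphism, there are exactly two smallest (i.e. having the fewest flags) non-flat regular polyhedra with $b^2$ vertices: the toroidal map $\{4,4\}_{(b,0)}$ and its Petrial, which has type $\{2b,4\}$.
   Context: An abstract regular polyhedron is a rank-3 abstract polytope with flag-transitive automorphism group generated by distinguished involutions $\rho_0,\rho_1,\rho_2$; type $\{p,q\}$ means $\rho_0\rho_1$ has order $p$ and $\rho_1\rho_2$ has order $q$. Flat means every facet is incident to every vertex. $\{4,4\}_{(b,0)}$ is the regular toroidal map obtained from the square tessellation of the plane by factoring out translations by $(b,0)$ and $(0,b)$. The Petrial (Petrie dual) of a polyhedron has the same vertices and edges, with faces its Petrie polygons (edge paths in which exactly two consecutive edges lie on a common face). *)

theory Defs
  imports
    "HOL-Library.Equipollence"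
    "HOL-Library.Product_Plus"
    "HOL-Algebra.Bij"
    "HOL-Algebra.Multiplicative_Group"
    "HOL-Computational_Algebra.Primes"
begin

section \<open>Abstract polytopes\<close>

text \<open>
  A poset is a reflexive partial order relation \<open>P\<close>; its elements (the faces, including the
  two improper ones) are \<open>Field P\<close>, and \<open>(x, y) \<in> P\<close> means \<open>x \<le> y\<close>.
\<close>

definition flags :: "'a rel \<Rightarrow> 'a set set" where
  "flags P = {\<Phi> \<in> Chains P. \<forall>\<Psi> \<in> Chains P. \<Phi> \<subseteq> \<Psi> \<longrightarrow> \<Psi> = \<Phi>}"

text \<open>
  A face has rank \<open>k\<close> if the section below it has rank \<open>k\<close>, i.e. if the flags of that section
  have \<open>k + 2\<close> elements. So the least face has rank \<open>-1\<close>.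
\<close>

definition faces :: "'a rel \<Rightarrow> int \<Rightarrow> 'a set" where
  "faces P k = {x \<in> Field P. \<forall>\<Phi> \<in> flags (Restr P {y. (y, x) \<in> P}). int (card \<Phi>) = k + 2}"

definition adjacent_flags :: "'a rel \<Rightarrow> int \<Rightarrow> 'a set \<Rightarrow> 'a set \<Rightarrow> bool" where
  "adjacent_flags P i \<Phi> \<Psi> \<longleftrightarrow>
     \<Phi> \<in> flags P \<and> \<Psi> \<in> flags P \<and> \<Phi> \<noteq> \<Psi> \<and> \<Phi> - faces P i = \<Psi> - faces P i"

definition strongly_flag_connected :: "'a rel \<Rightarrow> bool" where
  "strongly_flag_connected P \<longleftrightarrow>
     (\<forall>\<Phi> \<in> flags P. \<forall>\<Psi> \<in> flags P.
        (\<Phi>, \<Psi>) \<in> {(\<Phi>', \<Psi>'). (\<exists>i. adjacent_flags P i \<Phi>' \<Psi>') \<and>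
                             \<Phi> \<inter> \<Psi> \<subseteq> \<Phi>' \<and> \<Phi> \<inter> \<Psi> \<subseteq> \<Psi>'}\<^sup>*)"

definition diamond_condition :: "'a rel \<Rightarrow> bool" where
  "diamond_condition P \<longleftrightarrow>
     (\<forall>k. \<forall>F \<in> faces P (k - 1). \<forall>G \<in> faces P (k + 1). (F, G) \<in> P \<longrightarrow>
        card {H \<in> faces P k. (F, H) \<in> P \<and> (H, G) \<in> P} = 2)"

definition abstract_polytope :: "nat \<Rightarrow> 'a rel \<Rightarrow> bool" where
  "abstract_polytope n P \<longleftrightarrow>
     Partial_order P \<and>
     (\<exists>l \<in> Field P. \<forall>x \<in> Field P. (l, x) \<in> P) \<and>
     (\<exists>g \<in> Field P. \<forall>x \<in> Field P. (x, g) \<in> P) \<and>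
     (\<forall>\<Phi> \<in> flags P. card \<Phi> = n + 2) \<and>
     strongly_flag_connected P \<and>
     diamond_condition P"

definition poset_isomorphic :: "'a rel \<Rightarrow> 'b rel \<Rightarrow> bool" where
  "poset_isomorphic P Q \<longleftrightarrow>
     (\<exists>f. bij_betw f (Field P) (Field Q) \<and>
          (\<forall>x \<in> Field P. \<forall>y \<in> Field P. (x, y) \<in> P \<longleftrightarrow> (f x, f y) \<in> Q))"

definition Aut :: "'a rel \<Rightarrow> ('a \<Rightarrow> 'a) monoid" where
  "Aut P = (BijGroup (Field P))
     \<lparr>carrier := {f \<in> Bij (Field P).
        \<forall>x \<in> Field P. \<forall>y \<in> Field P. (x, y) \<in> P \<longleftrightarrow> (f x, f y) \<in> P}\<rparr>"


section \<open>Regular polyhedra\<close>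

definition regular_polyhedron :: "'a rel \<Rightarrow> bool" where
  "regular_polyhedron P \<longleftrightarrow>
     abstract_polytope 3 P \<and>
     (\<forall>\<Phi> \<in> flags P. \<forall>\<Psi> \<in> flags P. \<exists>f \<in> carrier (Aut P). f ` \<Phi> = \<Psi>)"

text \<open>
  The distinguished generators for a base flag \<open>\<Phi>\<close> are the automorphisms \<open>\<rho>\<^sub>0, \<rho>\<^sub>1, \<rho>\<^sub>2\<close> sending
  \<open>\<Phi>\<close> to its \<open>i\<close>-adjacent flags.  As usual in HOL-Algebra, an element of infinite order
  has \<open>ord\<close> equal to 0.
\<close>

definition distinguished_generators ::
    "'a rel \<Rightarrow> 'a set \<Rightarrow> ('a \<Rightarrow> 'a) \<Rightarrow> ('a \<Rightarrow> 'a) \<Rightarrow> ('a \<Rightarrow> 'a) \<Rightarrow> bool" where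
  "distinguished_generators P \<Phi> \<rho>\<^sub>0 \<rho>\<^sub>1 \<rho>\<^sub>2 \<longleftrightarrow>
     \<rho>\<^sub>0 \<in> carrier (Aut P) \<and> \<rho>\<^sub>1 \<in> carrier (Aut P) \<and> \<rho>\<^sub>2 \<in> carrier (Aut P) \<and>
     adjacent_flags P 0 \<Phi> (\<rho>\<^sub>0 ` \<Phi>) \<and>
     adjacent_flags P 1 \<Phi> (\<rho>\<^sub>1 ` \<Phi>) \<and>
     adjacent_flags P 2 \<Phi> (\<rho>\<^sub>2 ` \<Phi>)"

definition has_type :: "'a rel \<Rightarrow> nat \<Rightarrow> nat \<Rightarrow> bool" where
  "has_type P p q \<longleftrightarrow>
     (\<forall>\<Phi> \<in> flags P. \<exists>\<rho>\<^sub>0 \<rho>\<^sub>1 \<rho>\<^sub>2. distinguished_generators P \<Phi> \<rho>\<^sub>0 \<rho>\<^sub>1 \<rho>\<^sub>2 \<and>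
        group.ord (Aut P) (\<rho>\<^sub>0 \<otimes>\<^bsub>Aut P\<^esub> \<rho>\<^sub>1) = p \<and>
        group.ord (Aut P) (\<rho>\<^sub>1 \<otimes>\<^bsub>Aut P\<^esub> \<rho>\<^sub>2) = q)"

definition flat :: "'a rel \<Rightarrow> bool" where
  "flat P \<longleftrightarrow> (\<forall>v \<in> faces P 0. \<forall>F \<in> faces P 2. (v, F) \<in> P)"

definition nonflat_regular_polyhedron :: "nat \<Rightarrow> 'a rel \<Rightarrow> bool" where
  "nonflat_regular_polyhedron n P \<longleftrightarrow>
     regular_polyhedron P \<and> \<not> flat P \<and> finite (faces P 0) \<and> card (faces P 0) = n"


section \<open>The toroidal map\<close>

text \<open>
  A face of the tessellation of the plane by unit squares is represented by the set of its
  vertices, with \<open>{}\<close> and \<open>UNIV\<close> as the improper faces; incidence is then inclusion.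
\<close>

definition square_tessellation_faces :: "(int \<times> int) set set" where
  "square_tessellation_faces =
     {{}, UNIV} \<union>
     {{(x, y)} | x y. True} \<union>
     {{(x, y), (x + 1, y)} | x y. True} \<union>
     {{(x, y), (x, y + 1)} | x y. True} \<union>
     {{x, x + 1} \<times> {y, y + 1} | x y. True}"

definition translation_orbit :: "nat \<Rightarrow> (int \<times> int) set \<Rightarrow> (int \<times> int) set set" where
  "translation_orbit b F = {(+) (int b * i, int b * j) ` F | i j. True}"

text \<open>
  The map \<open>{4,4}\<^bsub>(b,0)\<^esub>\<close>: orbits of faces under the translations generated by \<open>(b,0)\<close> and \<open>(0,b)\<close>,
  two orbits being incident if they have incident representatives.
\<close>

definition toroidal_map :: "nat \<Rightarrow> (int \<times> int) set set rel" where
  "toroidal_map b =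
     {(translation_orbit b F, translation_orbit b G) | F G.
        F \<in> square_tessellation_faces \<and> G \<in> square_tessellation_faces \<and> F \<subseteq> G}"


section \<open>The Petrial\<close>

text \<open>
  A Petrie path is traversed endlessly in both directions; \<open>e i\<close> joins \<open>v i\<close> to \<open>v (i + 1)\<close>.
  Any two consecutive edges lie on a common face, but no three do.
\<close>

definition petrie_path :: "'a rel \<Rightarrow> (int \<Rightarrow> 'a) \<Rightarrow> (int \<Rightarrow> 'a) \<Rightarrow> bool" where
  "petrie_path P v e \<longleftrightarrow>
     (\<forall>i. v i \<in> faces P 0 \<and> e i \<in> faces P 1 \<and>
          v i \<noteq> v (i + 1) \<and> (v i, e i) \<in> P \<and> (v (i + 1), e i) \<in> P \<and>
          e i \<noteq> e (i + 1) \<and>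
          (\<exists>F \<in> faces P 2. (e i, F) \<in> P \<and> (e (i + 1), F) \<in> P) \<and>
          \<not> (\<exists>F \<in> faces P 2. (e i, F) \<in> P \<and> (e (i + 1), F) \<in> P \<and> (e (i + 2), F) \<in> P))"

text \<open>
  To be independent of starting point and direction, a Petrie polygon is recorded by its corners:
  a vertex together with the two polygon edges meeting there.  (The edges alone would
  not do when distinct Petrie polygons run through the same edges, as on
  polyhedra with two vertices.)
\<close>

definition petrie_polygons :: "'a rel \<Rightarrow> ('a \<times> 'a set) set set" where
  "petrie_polygons P = {{(v (i + 1), {e i, e (i + 1)}) | i. True} | v e. petrie_path P v e}"

text \<open>
  In the Petrial the old faces of rank 2 are replaced by the Petrie polygons; below a polygon lie
  the faces of \<open>P\<close> that lie below one of its edges.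
\<close>

definition petrial :: "'a rel \<Rightarrow> ('a + ('a \<times> 'a set) set) rel" where
  "petrial P =
     {(Inl x, Inl y) | x y. (x, y) \<in> P \<and> x \<notin> faces P 2 \<and> y \<notin> faces P 2} \<union>
     {(Inl x, Inr \<pi>) | x \<pi>. \<pi> \<in> petrie_polygons P \<and> (\<exists>(v, E) \<in> \<pi>. \<exists>e \<in> E. (x, e) \<in> P)} \<union>
     {(Inr \<pi>, Inr \<pi>) | \<pi>. \<pi> \<in> petrie_polygons P} \<union>
     {(Inr \<pi>, Inl y) | \<pi> y. \<pi> \<in> petrie_polygons P \<and> y \<in> faces P 3}"

end

theory Submission
  imports Defs
begin

text \<open>
  A polyhedron is determined by its flags together with the three adjacency involutions on them.
  If it is regular with \<open>b\<^sup>2\<close> vertices, it has \<open>b\<^sup>2 k\<close> flags, where \<open>k\<close> is the order of the vertex stabiliser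
  \<open>D = \<langle>r1, r2\<rangle>\<close> in the automorphism group \<open>G = \<langle>r0, r1, r2\<rangle>\<close>. Since \<open>\<langle>r0, r2\<rangle>\<close> has order 4 and \<open>b\<close> is odd, 4 divides
  \<open>k\<close>; if \<open>k = 4\<close> then \<open>r1\<close> and \<open>r2\<close> commute, which forces flatness. So there are at least \<open>8 b\<^sup>2\<close> flags.

  If there are exactly \<open>8 b\<^sup>2\<close>, then \<open>D\<close> is dihedral of order 8, and by non-flatness the order \<open>p\<close> of \<open>r0 r1\<close> is
  less than \<open>b\<^sup>2\<close>. If \<open>b\<close> does not divide \<open>p\<close>, then \<open>p\<close> divides 4 and the unit translations are explicit words.
  Otherwise let \<open>X\<close> be the subgroup of order \<open>b\<close> of \<open>\<langle>r0 r1\<rangle>\<close>. Its normaliser contains \<open>\<langle>r0, r1\<rangle>\<close> and has order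
  divisible by \<open>b\<^sup>2\<close>. Counting shows that its index is at most 2, and \<open>X\<close> and its conjugate under \<open>r2\<close> generate a normal
  elementary abelian subgroup \<open>N\<close> of order \<open>b\<^sup>2\<close> that complements \<open>D\<close>. In both cases \<open>r0 = n c\<close> with a unit
  translation \<open>n\<close>, where \<open>c\<close> is \<open>r1 r2 r1\<close> or \<open>(r1 r2)\<^sup>2\<close>. The first choice gives the relations of the
  toroidal map, the second those of its Petrial, in which \<open>r0\<close> is replaced by \<open>r0 r2\<close>.
\<close>

section \<open>Flag systems\<close>

text \<open>Polytopes and groups meet in \<open>flag_system\<close>: flags may be arbitrary codes,
  so one set of triples serves the torus and its Petrial, which differ in a single adjacency map,
  and an isomorphism amounts to a bijection of codes that commutes with the adjacency maps.

  The obstacle is to find the translations when \<open>b\<close> divides \<open>p\<close>. Write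
  \<open>p = b t\<close>; then \<open>p < b^2\<close> gives \<open>t < b\<close>, so
  \<open>t\<close> divides 4. The normaliser of \<open>X\<close> has order \<open>b^2 h\<close>,
  where \<open>h\<close> divides 8 and \<open>2 t\<close> divides \<open>h\<close>. Index at most 2
  means \<open>h \<ge> 4\<close>. The remaining value \<open>h = 2\<close> forces
  \<open>t = 1\<close> and puts the half turn \<open>(r1 r2)^2\<close> into the normaliser, whose
  intersection with \<open>D\<close> then has at least 3 elements, although its order divides gcd(8,
  2 b^2) = 2. For \<open>b = 3\<close> the count of moved cosets says nothing, and type {3,4} is
  excluded by the bound 48 on the order instead. If \<open>X\<close> itself is normal, the quotient
  by it is a {4,4} group with only \<open>b\<close> translations, and no such group exists.\<close>

lemma flags_iff: "\<Phi> \<in> flags P \<longleftrightarrow> \<Phi> \<in> Chains P \<and> (\<forall>\<Psi> \<in> Chains P. \<Phi> \<subseteq> \<Psi> \<longrightarrow> \<Psi> = \<Phi>)"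
  unfolding flags_def by (rule mem_Collect_eq)

lemma flagsD: "\<Phi> \<in> flags P \<Longrightarrow> \<Phi> \<in> Chains P"
  "\<Phi> \<in> flags P \<Longrightarrow> \<Psi> \<in> Chains P \<Longrightarrow> \<Phi> \<subseteq> \<Psi> \<Longrightarrow> \<Psi> = \<Phi>"
  unfolding flags_iff by blast+

lemma flagsI: "\<Phi> \<in> Chains P \<Longrightarrow> (\<And>\<Psi>. \<Psi> \<in> Chains P \<Longrightarrow> \<Phi> \<subseteq> \<Psi> \<Longrightarrow> \<Psi> = \<Phi>) \<Longrightarrow> \<Phi> \<in> flags P"
  unfolding flags_iff by blast

text \<open>
  \<open>s i x\<close> is the flag \<open>i\<close>-adjacent to \<open>x\<close>, and \<open>q i x\<close> is the face of rank \<open>i - 1\<close> of \<open>x\<close>;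
  the flags themselves may be encoded in any type. The axiom \<open>strong\<close> is strong flag connectedness.
\<close>

locale flag_system =
  fixes P :: "'a rel" and X :: "'x set" and s :: "nat \<Rightarrow> 'x \<Rightarrow> 'x" and q :: "nat \<Rightarrow> 'x \<Rightarrow> 'a"
  assumes X_nonempty: "X \<noteq> {}"
    and s_closed: "\<And>i x. i < 3 \<Longrightarrow> x \<in> X \<Longrightarrow> s i x \<in> X"
    and s_s: "\<And>i x. i < 3 \<Longrightarrow> x \<in> X \<Longrightarrow> s i (s i x) = x"
    and s_commute: "\<And>x. x \<in> X \<Longrightarrow> s 0 (s 2 x) = s 2 (s 0 x)"
    and q_s: "\<And>i j x. i < 3 \<Longrightarrow> x \<in> X \<Longrightarrow> j \<le> 4 \<Longrightarrow> j \<noteq> Suc i \<Longrightarrow> q j (s i x) = q j x"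
    and q_s_neq: "\<And>i x. i < 3 \<Longrightarrow> x \<in> X \<Longrightarrow> q (Suc i) (s i x) \<noteq> q (Suc i) x"
    and rank_eq: "\<And>i j x y. x \<in> X \<Longrightarrow> y \<in> X \<Longrightarrow> i \<le> 4 \<Longrightarrow> j \<le> 4 \<Longrightarrow> q i x = q j y \<Longrightarrow> i = j"
    and strong: "\<And>x y. x \<in> X \<Longrightarrow> y \<in> X \<Longrightarrow>
      (x, y) \<in> {(u, s i u) | u i. u \<in> X \<and> i < 3 \<and> q (Suc i) x \<noteq> q (Suc i) y}\<^sup>*"
    and P_eq: "P = {(q i x, q j x) | i j x. x \<in> X \<and> i \<le> j \<and> j \<le> 4}"
begin

definition F :: "'x \<Rightarrow> 'a set" where "F x = (\<lambda>i. q i x) ` {..4}"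

text \<open>All uses of \<open>strong\<close> go through this rule: choose an invariant that
  survives the moves at the indices where the two end flags disagree.\<close>

lemma path_induct [consumes 2, case_names base step]:
  assumes "x \<in> X" "y \<in> X"
    and "R x"
    and "\<And>u i. u \<in> X \<Longrightarrow> R u \<Longrightarrow> i < 3 \<Longrightarrow> q (Suc i) x \<noteq> q (Suc i) y \<Longrightarrow> R (s i u)"
  shows "R y"
  using strong[OF assms(1,2)]
proof (induction rule: rtrancl_induct)
  case base show ?case by fact
next
  case (step u w)
  then show ?case using assms(4) by auto
qed

text \<open>No index is left to move, so the path from \<open>x\<close> to \<open>y\<close> is
  empty.\<close>

lemma eq_all: "x \<in> X \<Longrightarrow> y \<in> X \<Longrightarrow> (\<And>i. i < 3 \<Longrightarrow> q (Suc i) x = q (Suc i) y) \<Longrightarrow> y = x"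
  by (rule path_induct[of x y "\<lambda>u. u = x"]) auto

text \<open>Only \<open>s i\<close> can occur on the path, and it is an involution.\<close>

lemma eq_except:
  assumes "x \<in> X" "y \<in> X" "i < 3" "\<And>j. j < 3 \<Longrightarrow> j \<noteq> i \<Longrightarrow> q (Suc j) x = q (Suc j) y"
  shows "y = x \<or> y = s i x"
proof (rule path_induct[of x y "\<lambda>u. u = x \<or> u = s i x"])
  fix u j assume "u = x \<or> u = s i x" "j < 3" "q (Suc j) x \<noteq> q (Suc j) y"
  with assms(4)[of j] have "j = i" by auto
  then show "s j u = x \<or> s j u = s i x" using \<open>u = x \<or> u = s i x\<close> s_s[of i x] assms by auto
qed (use assms in auto)

text \<open>The adjacency maps change only the indices 1, 2 and 3; the improper faces have index 0
  and 4.\<close>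

lemma q_const: assumes "x \<in> X" "y \<in> X" shows "q 0 x = q 0 y" "q 4 x = q 4 y"
  by (rule path_induct[of x y "\<lambda>u. q 0 x = q 0 u"]; use assms q_s in force)
     (rule path_induct[of x y "\<lambda>u. q 4 x = q 4 u"]; use assms q_s in force)

lemma le4_cases: "(i::nat) \<le> 4 \<Longrightarrow> i = 0 \<or> i = 1 \<or> i = 2 \<or> i = 3 \<or> i = 4" by auto
lemma lt3_cases: "(i::nat) < 3 \<Longrightarrow> i = 0 \<or> i = 1 \<or> i = 2" by auto

text \<open>Only \<open>s 0\<close> and \<open>s 2\<close> occur on the path, and these are
  commuting involutions, so the path stays in an orbit of at most four flags.\<close>

lemma same_edge:
  assumes "x \<in> X" "y \<in> X" "q 2 x = q 2 y"
  shows "y \<in> {x, s 0 x, s 2 x, s 0 (s 2 x)}"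
proof (rule path_induct[of x y "\<lambda>u. u \<in> {x, s 0 x, s 2 x, s 0 (s 2 x)}"])
  fix u i assume u: "u \<in> X" "u \<in> {x, s 0 x, s 2 x, s 0 (s 2 x)}" and i: "i < 3" "q (Suc i) x \<noteq> q (Suc i) y"
  then have "i = 0 \<or> i = 2" using assms lt3_cases[of i] by (auto simp: numeral_2_eq_2)
  then show "s i u \<in> {x, s 0 x, s 2 x, s 0 (s 2 x)}"
    using u s_s[of 0] s_s[of 2] s_commute s_closed[of 0] s_closed[of 2] assms(1) by auto
qed (use assms in auto)

text \<open>Joins the part of \<open>x\<close> below a common face to the part of \<open>y\<close>
  above it. Near the ends one part consists of improper faces and of the common face, so
  \<open>x\<close> or \<open>y\<close> itself works. For a common edge, \<open>y\<close> arises from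
  \<open>x\<close> by \<open>s 0\<close> and \<open>s 2\<close>, and only the move
  \<open>s 2\<close> is kept.\<close>

lemma glue:
  assumes "x \<in> X" "y \<in> X" "k \<le> 4" "q k x = q k y"
  shows "\<exists>z\<in>X. (\<forall>i\<le>k. q i z = q i x) \<and> (\<forall>i. k \<le> i \<longrightarrow> i \<le> 4 \<longrightarrow> q i z = q i y)"
proof -
  consider "k \<le> 1" | "k = 2" | "k \<ge> 3" by linarith
  then show ?thesis
  proof cases
    case 1
    then consider "k = 0" | "k = 1" by linarith
    then have "q i y = q i x" if "i \<le> k" for i
    proof cases
      case 1 then show ?thesis using that q_const[OF assms(1,2)] by auto
    next
      case 2
      then have "i = 0 \<or> i = 1" using that by auto
      then show ?thesis using 2 q_const[OF assms(1,2)] assms(4) by auto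
    qed
    then show ?thesis using assms by blast
  next
    case 3
    have "q i x = q i y" if "k \<le> i" "i \<le> 4" for i
    proof -
      have "i = k \<or> i = 4" using that 3 by auto
      then show ?thesis using q_const[OF assms(1,2)] assms by auto
    qed
    then show ?thesis using assms by blast
  next
    case 2
    have "y \<in> {x, s 0 x, s 2 x, s 0 (s 2 x)}" using same_edge assms 2 by simp
    moreover have "s 0 x \<in> X" "s 2 x \<in> X" using s_closed assms by auto
    moreover have "q i (s 0 w) = q i w" if "2 \<le> i" "i \<le> 4" "w \<in> X" for i w using q_s[of 0 w i] that by auto
    moreover have "q i (s 2 x) = q i x" if "i \<le> 2" for i using q_s[of 2 x i] that assms by auto
    ultimately have "(y = x \<or> y = s 0 x) \<or> (y = s 2 x \<or> y = s 0 (s 2 x))" "\<And>i. 2 \<le> i \<Longrightarrow> i \<le> 4 \<Longrightarrow> q i (s 0 x) = q i x"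
      "\<And>i. 2 \<le> i \<Longrightarrow> i \<le> 4 \<Longrightarrow> q i (s 0 (s 2 x)) = q i (s 2 x)" "s 2 x \<in> X" "\<And>i. i \<le> 2 \<Longrightarrow> q i (s 2 x) = q i x" using assms(1) by auto
    then show ?thesis using 2 assms(1) by (elim disjE) (rule bexI[of _ x] bexI[of _ "s 2 x"]; simp)+
  qed
qed

lemma Field_P: "Field P = {q i x | i x. i \<le> 4 \<and> x \<in> X}"
  unfolding Field_def P_eq by (auto 0 4)

lemma q_in_Field: "x \<in> X \<Longrightarrow> i \<le> 4 \<Longrightarrow> q i x \<in> Field P"
  unfolding Field_P by auto

lemma in_P:
  assumes "x \<in> X" "y \<in> X" "i \<le> 4" "j \<le> 4"
  shows "(q i x, q j y) \<in> P \<longleftrightarrow> i \<le> j \<and> (\<exists>z\<in>X. q i z = q i x \<and> q j z = q j y)"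
proof
  assume "(q i x, q j y) \<in> P"
  then obtain i' j' z where "q i x = q i' z" "q j y = q j' z" "z \<in> X" "i' \<le> j'" "j' \<le> 4" unfolding P_eq by auto
  with rank_eq[of x z i i'] rank_eq[of y z j j'] assms show "i \<le> j \<and> (\<exists>z\<in>X. q i z = q i x \<and> q j z = q j y)" by auto
next
  assume "i \<le> j \<and> (\<exists>z\<in>X. q i z = q i x \<and> q j z = q j y)"
  then obtain z where "i \<le> j" "z \<in> X" "q i x = q i z" "q j y = q j z" by auto
  then show "(q i x, q j y) \<in> P" unfolding P_eq using assms by blast
qed

lemma in_P_I: "x \<in> X \<Longrightarrow> i \<le> j \<Longrightarrow> j \<le> 4 \<Longrightarrow> (q i x, q j x) \<in> P"
  unfolding P_eq by auto

text \<open>The flags witnessing the two inequalities share the middle face and can be glued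
  there.\<close>

lemma P_trans: "trans P"
proof (rule transI)
  fix a b c assume "(a, b) \<in> P" "(b, c) \<in> P"
  then obtain i j x k l y where 1: "a = q i x" "b = q j x" "x \<in> X" "i \<le> j" "j \<le> 4"
    "b = q k y" "c = q l y" "y \<in> X" "k \<le> l" "l \<le> 4" unfolding P_eq by blast
  then have "j = k" using rank_eq[of x y j k] by auto
  with glue[of x y j] 1 obtain z where "z \<in> X" "q i z = q i x" "q l z = q l y" by auto
  then show "(a, c) \<in> P" using in_P_I[of z i l] 1 \<open>j = k\<close> by auto
qed

lemma P_partial: "Partial_order P"
proof -
  have "Refl P" unfolding refl_on_def using Field_P in_P_I by (auto simp: Field_def)
  moreover have "antisym P"
  proof (rule antisymI)
    fix a b assume "(a, b) \<in> P" "(b, a) \<in> P"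
    then obtain i j x k l y where 1: "a = q i x" "b = q j x" "x \<in> X" "i \<le> j" "j \<le> 4"
      "b = q k y" "a = q l y" "y \<in> X" "k \<le> l" "l \<le> 4" unfolding P_eq by blast
    then have "j = k" "i = l" using rank_eq[of x y j k] rank_eq[of x y i l] by auto
    then show "a = b" using 1 by auto
  qed
  ultimately show ?thesis using P_trans by (auto simp: partial_order_on_def preorder_on_def Field_def)
qed

section \<open>Maximal chains, ranks and adjacency in the poset of a flag system\<close>

lemma F_chain: "x \<in> X \<Longrightarrow> A \<subseteq> {..4} \<Longrightarrow> (\<lambda>i. q i x) ` A \<in> Chains P"

proof -
  assume "x \<in> X" "A \<subseteq> {..4}"
  then have "(q i x, q j x) \<in> P \<or> (q j x, q i x) \<in> P" if "i \<in> A" "j \<in> A" for i j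
    using in_P_I[of x i j] in_P_I[of x j i] that by (cases "i \<le> j") auto
  then show ?thesis unfolding Chains_def by auto
qed

lemma F_Chains: "x \<in> X \<Longrightarrow> F x \<in> Chains P"
  using F_chain[of x "{..4}"] unfolding F_def by simp

lemma chain_same_rank:
  assumes "C \<in> Chains P" "q k y \<in> C" "q k w \<in> C" "y \<in> X" "w \<in> X" "k \<le> 4"
  shows "q k y = q k w"
  using assms in_P[of y w k k] in_P[of w y k k] unfolding Chains_def by auto

text \<open>Induction on \<open>k\<close> yields a flag that contains all faces of the chain of
  index below \<open>k\<close>. To add a face of index \<open>k\<close>, take a flag through it and
  the highest lower face of the chain, and glue the two flags at that lower face.\<close>

lemma chain_sub_flag:
  assumes C: "C \<in> Chains P"
  shows "\<exists>x\<in>X. C \<subseteq> F x"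
proof -
  have "\<exists>x\<in>X. \<forall>j<k. \<forall>y\<in>X. q j y \<in> C \<longrightarrow> q j x = q j y" if "k \<le> 5" for k
    using that
  proof (induction k)
    case 0 then show ?case using X_nonempty by auto
  next
    case (Suc k)
    then obtain x where x: "x \<in> X" "\<And>j y. j < k \<Longrightarrow> y \<in> X \<Longrightarrow> q j y \<in> C \<Longrightarrow> q j x = q j y" by auto
    show ?case
    proof (cases "\<exists>w\<in>X. q k w \<in> C")
      case False
      then show ?thesis using x by (metis less_Suc_eq)
    next
      case True
      then obtain w where w: "w \<in> X" "q k w \<in> C" by auto
      have k4: "k \<le> 4" using Suc by simp
      define J where "J = {j. j < k \<and> (\<exists>y\<in>X. q j y \<in> C)}"
      have fJ: "finite J" unfolding J_def by auto
      show ?thesis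
      proof (cases "J = {}")
        case True
        then have "\<forall>j<Suc k. \<forall>y\<in>X. q j y \<in> C \<longrightarrow> q j w = q j y"
          unfolding J_def using chain_same_rank[OF C, of k] w k4 by (metis (mono_tags, lifting) empty_iff less_SucE mem_Collect_eq)
        then show ?thesis using w by blast
      next
        case False
        \<comment> \<open>The highest index below \<open>k\<close> that the chain occupies; faces of
          the chain of index between \<open>j\<close> and \<open>k\<close> do not exist, so gluing
          at \<open>j\<close> loses nothing.\<close>
        define j where "j = Max J"
        have jJ: "j \<in> J" and jmax: "\<And>i. i \<in> J \<Longrightarrow> i \<le> j" using False fJ unfolding j_def by auto
        then obtain y where y: "j < k" "y \<in> X" "q j y \<in> C" unfolding J_def by auto
        have xy: "q j x = q j y" using x(2)[of j y] y by blast
        have "(q j y, q k w) \<in> P \<or> (q k w, q j y) \<in> P" using C y w unfolding Chains_def by auto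
        then obtain u where u: "u \<in> X" "q j u = q j y" "q k u = q k w"
          using in_P[of y w j k] in_P[of w y k j] y w k4 by auto
        obtain z where z: "z \<in> X" "\<And>i. i \<le> j \<Longrightarrow> q i z = q i x" "\<And>i. j \<le> i \<Longrightarrow> i \<le> 4 \<Longrightarrow> q i z = q i u"
          proof -
          have "j \<le> 4" "q j x = q j u" using xy u y k4 by auto
          from glue[OF x(1) u(1) this] show ?thesis using that by blast
        qed
        have "q i z = q i v" if "i < Suc k" "v \<in> X" "q i v \<in> C" for i v
        proof (cases "i = k")
          case True
          then show ?thesis using z(3)[of k] y(1) k4 u(3) chain_same_rank[OF C, of k v w] that w by auto
        next
          case False
          then have "i \<in> J" using that unfolding J_def by auto
          then have "i \<le> j" by (rule jmax)
          then show ?thesis using z(2)[of i] x(2)[of i v] that(2,3) y(1) by auto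
        qed
        then show ?thesis using z(1) by blast
      qed
    qed
  qed
  from this[of 5] obtain x where x: "x \<in> X" "\<And>j y. j < 5 \<Longrightarrow> y \<in> X \<Longrightarrow> q j y \<in> C \<Longrightarrow> q j x = q j y" by auto
  have "C \<subseteq> F x"
  proof
    fix c assume c: "c \<in> C"
    then have "c \<in> Field P" using C unfolding Chains_def Field_def by auto
    then obtain j y where "j \<le> 4" "y \<in> X" "c = q j y" unfolding Field_P by auto
    then have "c = q j x" using x(2)[of j y] c by auto
    then show "c \<in> F x" using \<open>j \<le> 4\<close> unfolding F_def by blast
  qed
  then show ?thesis using x by blast
qed

lemma q_inj: "x \<in> X \<Longrightarrow> A \<subseteq> {..4} \<Longrightarrow> inj_on (\<lambda>i. q i x) A"
  using rank_eq[of x x] by (auto intro!: inj_onI)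

lemma card_F: "x \<in> X \<Longrightarrow> card (F x) = 5" "finite (F x)"
  unfolding F_def by (auto simp: card_image q_inj)

lemma in_F: "x \<in> X \<Longrightarrow> y \<in> X \<Longrightarrow> i \<le> 4 \<Longrightarrow> q i y \<in> F x \<longleftrightarrow> q i x = q i y"
proof
  assume xy: "x \<in> X" "y \<in> X" "i \<le> 4" "q i y \<in> F x"
  then obtain j where "q i y = q j x" "j \<le> 4" unfolding F_def by blast
  with rank_eq[OF xy(2,1,3), of j] show "q i x = q i y" by simp
next
  assume "i \<le> 4" "q i x = q i y"
  then show "q i y \<in> F x" unfolding F_def by (intro image_eqI[of _ _ i]) simp_all
qed

lemma F_inj: "inj_on F X"
proof (rule inj_onI)
  fix x y assume xy: "x \<in> X" "y \<in> X" "F x = F y"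
  then have *: "q i x = q i y" if "i \<le> 4" for i using in_F[of x y i] in_F[of y y i] that by auto
  show "x = y" by (rule eq_all[OF xy(2,1)]) (rule *[symmetric], simp)
qed

text \<open>Every chain lies in some \<open>F x\<close>, and all these sets have five elements, so
  they are exactly the maximal chains.\<close>

lemma flags_eq: "flags P = F ` X"
proof
  show "flags P \<subseteq> F ` X"
  proof
    fix C assume C: "C \<in> flags P"
    obtain x where x: "x \<in> X" "C \<subseteq> F x" using chain_sub_flag[OF flagsD(1)[OF C]] by (elim bexE)
    have "F x = C" by (rule flagsD(2)[OF C F_Chains[OF x(1)] x(2)])
    then show "C \<in> F ` X" using x(1) by (metis imageI)
  qed
  show "F ` X \<subseteq> flags P"
  proof
    fix C assume "C \<in> F ` X"
    then obtain x where x: "x \<in> X" "C = F x" by auto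
    have "\<Psi> = C" if t: "\<Psi> \<in> Chains P" "C \<subseteq> \<Psi>" for \<Psi>
    proof -
      obtain y where y: "y \<in> X" "\<Psi> \<subseteq> F y" using chain_sub_flag[OF t(1)] by blast
      have "F x \<subseteq> F y" using t(2) y(2) x(2) by simp
      then have "F x = F y" by (rule card_subset_eq[OF card_F(2)]) (simp add: card_F(1) x(1) y(1))
      then show ?thesis using y t x(2) by simp
    qed
    moreover have "C \<in> Chains P" using F_Chains x by simp
    ultimately show "C \<in> flags P" by (intro flagsI)
  qed
qed

text \<open>A chain below a face stays a chain when that face is added, so it extends to a flag
  through the face. This prepares the computation of ranks, which are defined by the flags of lower
  sections.\<close>

lemma section_flag:
  assumes "x \<in> X" "i \<le> 4" "\<Psi> \<in> Chains (Restr P {y. (y, q i x) \<in> P})"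
  shows "\<exists>z\<in>X. q i z = q i x \<and> \<Psi> \<subseteq> (\<lambda>j. q j z) ` {..i}"
proof -
  have C: "insert (q i x) \<Psi> \<in> Chains P" using assms in_P_I[of x i i] unfolding Chains_def by auto
  then obtain z where z: "z \<in> X" "insert (q i x) \<Psi> \<subseteq> F z" using chain_sub_flag by blast
  then have zi: "q i z = q i x" using in_F[of z x i] assms by auto
  have "\<Psi> \<subseteq> (\<lambda>j. q j z) ` {..i}"
  proof
    fix c assume c: "c \<in> \<Psi>"
    then obtain j where j: "j \<le> 4" "c = q j z" using z unfolding F_def by auto
    have "(c, q i x) \<in> P" using assms(3) c unfolding Chains_def by auto
    then have "j \<le> i" using in_P[of z x j i] z assms j by auto
    then show "c \<in> (\<lambda>j. q j z) ` {..i}" using j by auto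
  qed
  then show ?thesis using z(1) zi by (intro bexI conjI)
qed

lemma section_chain:
  assumes "x \<in> X" "i \<le> 4" "z \<in> X" "q i z = q i x"
  shows "(\<lambda>j. q j z) ` {..i} \<in> Chains (Restr P {y. (y, q i x) \<in> P})"
proof -
  have 1: "(\<lambda>j. q j z) ` {..i} \<in> Chains P" by (rule F_chain) (use assms in auto)
  have 2: "(c, q i x) \<in> P" if c: "c \<in> (\<lambda>j. q j z) ` {..i}" for c
  proof -
    from c obtain j where "c = q j z" "j \<in> {..i}" by (rule imageE)
    then show ?thesis using in_P_I[OF assms(3), of j i] assms(2,4) by simp
  qed
  show ?thesis unfolding Chains_def
  proof (intro CollectI ballI)
    fix a c assume ac: "a \<in> (\<lambda>j. q j z) ` {..i}" "c \<in> (\<lambda>j. q j z) ` {..i}"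
    have "\<forall>a\<in>(\<lambda>j. q j z) ` {..i}. \<forall>c\<in>(\<lambda>j. q j z) ` {..i}. (a, c) \<in> P \<or> (c, a) \<in> P"
      using 1 unfolding Chains_def by (rule CollectD)
    then have "(a, c) \<in> P \<or> (c, a) \<in> P" using ac by metis
    then show "(a, c) \<in> Restr P {y. (y, q i x) \<in> P} \<or> (c, a) \<in> Restr P {y. (y, q i x) \<in> P}"
      using 2[OF ac(1)] 2[OF ac(2)] by simp
  qed
qed

text \<open>The flags of the section below a face of index \<open>i\<close> have the indices 0 to
  \<open>i\<close>, that is \<open>i + 1\<close> elements; hence index is rank plus one.\<close>

lemma section_flags:
  assumes "x \<in> X" "i \<le> 4"
  shows "(\<forall>\<Phi>\<in>flags (Restr P {y. (y, q i x) \<in> P}). int (card \<Phi>) = k + 2) \<longleftrightarrow> int i = k + 1"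
proof -
  have c: "card ((\<lambda>j. q j z) ` {..i}) = i + 1" if "z \<in> X" for z
    using q_inj[of z "{..i}"] that assms by (simp add: card_image)
  have 1: "card \<Phi> = i + 1" if f: "\<Phi> \<in> flags (Restr P {y. (y, q i x) \<in> P})" for \<Phi>
  proof -
    obtain z where z: "z\<in>X" "q i z = q i x" "\<Phi> \<subseteq> (\<lambda>j. q j z) ` {..i}"
      using section_flag[OF assms flagsD(1)[OF f]] by (elim bexE conjE)
    then have "\<Phi> = (\<lambda>j. q j z) ` {..i}" using flagsD(2)[OF f section_chain[OF assms z(1,2)]] by simp
    then show ?thesis using c z by simp
  qed
  have 2: "(\<lambda>j. q j x) ` {..i} \<in> flags (Restr P {y. (y, q i x) \<in> P})"
  proof -
    have "\<Psi> = (\<lambda>j. q j x) ` {..i}" if \<Psi>: "\<Psi> \<in> Chains (Restr P {y. (y, q i x) \<in> P})" "(\<lambda>j. q j x) ` {..i} \<subseteq> \<Psi>" for \<Psi>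
    proof -
      obtain z where z: "z\<in>X" "\<Psi> \<subseteq> (\<lambda>j. q j z) ` {..i}"
        using section_flag[OF assms \<Psi>(1)] by (elim bexE conjE)
      have sub: "(\<lambda>j. q j x) ` {..i} \<subseteq> (\<lambda>j. q j z) ` {..i}" using \<Psi>(2) z(2) by (rule subset_trans)
      then have "(\<lambda>j. q j x) ` {..i} = (\<lambda>j. q j z) ` {..i}"
        using c[of x] c[of z] assms(1) z(1) card_subset_eq[OF _ sub] by simp
      then show ?thesis using z(2) \<Psi>(2) by simp
    qed
    then show ?thesis using section_chain[OF assms assms(1) refl] by (intro flagsI)
  qed
  have "(\<forall>\<Phi>\<in>flags (Restr P {y. (y, q i x) \<in> P}). int (card \<Phi>) = k + 2) \<longleftrightarrow> int (i + 1) = k + 2"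
    using 1 2 c[of x] assms(1) by metis
  then show ?thesis by auto
qed

lemma faces_eq: "faces P k = {q i x | i x. x \<in> X \<and> i \<le> 4 \<and> int i = k + 1}"
proof (rule Set.set_eqI)
  fix t
  have "t \<in> faces P k \<longleftrightarrow> (\<exists>i x. i \<le> 4 \<and> x \<in> X \<and> t = q i x \<and>
      (\<forall>\<Phi>\<in>flags (Restr P {y. (y, q i x) \<in> P}). int (card \<Phi>) = k + 2))"
    unfolding faces_def Field_P by blast
  also have "\<dots> \<longleftrightarrow> (\<exists>i x. i \<le> 4 \<and> x \<in> X \<and> t = q i x \<and> int i = k + 1)"
    using section_flags by metis
  finally show "t \<in> faces P k \<longleftrightarrow> t \<in> {q i x | i x. x \<in> X \<and> i \<le> 4 \<and> int i = k + 1}" by blast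
qed

lemma faces_q: "int i = k + 1 \<Longrightarrow> i \<le> 4 \<Longrightarrow> faces P k = q i ` X"
proof -
  assume i: "int i = k + 1" "i \<le> 4"
  then have "\<And>j. int j = k + 1 \<longleftrightarrow> j = i" by auto
  then show ?thesis unfolding faces_eq using i by auto
qed

lemma faces_simps:
  "faces P 0 = q 1 ` X" "faces P 1 = q 2 ` X" "faces P 2 = q 3 ` X"
  "x \<in> X \<Longrightarrow> faces P 3 = {q 4 x}"
proof -
  show "faces P 0 = q 1 ` X" by (rule faces_q) auto
  show "faces P 1 = q 2 ` X" by (rule faces_q) auto
  show "faces P 2 = q 3 ` X" by (rule faces_q) auto
  assume x: "x \<in> X"
  have "faces P 3 = q 4 ` X" by (rule faces_q) auto
  also have "\<dots> = (\<lambda>_. q 4 x) ` X" by (rule image_cong[OF refl q_const(2)[OF _ x]])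
  finally show "faces P 3 = {q 4 x}" using x by auto
qed

text \<open>Flags that differ in rank \<open>k\<close> only agree in all other indices, and improper
  faces never differ, so \<open>k\<close> is one of 0, 1, 2 and \<open>eq_except\<close> leaves only
  \<open>s i\<close>.\<close>

lemma adjacent_iff:
  assumes "x \<in> X"
  shows "adjacent_flags P k (F x) \<Psi> \<longleftrightarrow> (\<exists>i<3. int i = k \<and> \<Psi> = F (s i x))"
proof
  assume A: "adjacent_flags P k (F x) \<Psi>"
  then obtain y where y: "y \<in> X" "\<Psi> = F y" unfolding adjacent_flags_def flags_eq by blast
  have D: "F x - faces P k = F y - faces P k" "F x \<noteq> F y" using A unfolding adjacent_flags_def y(2) by blast+
  have *: "q j x = q j y" if j: "j \<le> 4" "int j \<noteq> k + 1" for j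
  proof -
    have "q j x \<notin> faces P k"
    proof
      assume "q j x \<in> faces P k"
      then obtain j' w where "w \<in> X" "j' \<le> 4" "int j' = k + 1" "q j x = q j' w" unfolding faces_eq by blast
      then show False using rank_eq[of x w j j'] assms j by simp
    qed
    moreover have "q j x \<in> F x" using j unfolding F_def by blast
    ultimately have "q j x \<in> F y" using D(1) by blast
    then show ?thesis using in_F[of y x j] assms y j by simp
  qed
  have "\<exists>i<3. int i = k"
  proof (rule ccontr)
    assume no: "\<not> ?thesis"
    have "q (Suc j) x = q (Suc j) y" if "j < 3" for j using *[of "Suc j"] no that by simp
    then have "y = x" by (rule eq_all[OF assms y(1)])
    then show False using D(2) by simp
  qed
  then obtain i where i: "i < 3" "int i = k" by blast
  have "y = x \<or> y = s i x" by (rule eq_except[OF assms y(1) i(1)], rule *) (use i in auto)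
  then show "\<exists>i<3. int i = k \<and> \<Psi> = F (s i x)" using D(2) y(2) i by blast
next
  assume "\<exists>i<3. int i = k \<and> \<Psi> = F (s i x)"
  then obtain i where i: "i < 3" "int i = k" "\<Psi> = F (s i x)" by auto
  have sx: "s i x \<in> X" using s_closed i assms by auto
  have ne: "F x \<noteq> F (s i x)" using F_inj q_s_neq[of i x] i assms sx by (metis inj_onD)
  have "F u - faces P k = (\<lambda>j. q j u) ` ({..4} - {Suc i})" if "u \<in> X" for u
  proof -
    have fk: "faces P k = q (Suc i) ` X" by (rule faces_q) (use i in auto)
    have "q j u \<in> faces P k \<longleftrightarrow> j = Suc i" if j: "j \<le> 4" for j
    proof
      assume "q j u \<in> faces P k"
      then obtain w where "w \<in> X" "q j u = q (Suc i) w" unfolding fk by blast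
      then show "j = Suc i" using rank_eq[of u w j "Suc i"] \<open>u \<in> X\<close> i(1) j by simp
    next
      assume "j = Suc i" then show "q j u \<in> faces P k" unfolding fk using \<open>u \<in> X\<close> by blast
    qed
    then show ?thesis unfolding F_def by auto
  qed
  moreover have "(\<lambda>j. q j (s i x)) ` ({..4} - {Suc i}) = (\<lambda>j. q j x) ` ({..4} - {Suc i})"
    using q_s[of i x] i assms by (intro image_cong) auto
  ultimately show "adjacent_flags P k (F x) \<Psi>" unfolding adjacent_flags_def flags_eq using ne i sx assms by auto
qed

theorem polytope: "abstract_polytope 3 P"
  unfolding abstract_polytope_def
proof (intro conjI)
  obtain x where x: "x \<in> X" using X_nonempty by auto
  show "Partial_order P" by (rule P_partial)
  have "(q 0 x, y) \<in> P" if yF: "y \<in> Field P" for y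
  proof -
    obtain i z where "i \<le> 4" "z \<in> X" "y = q i z" using yF unfolding Field_P by blast
    then show ?thesis using in_P_I[of z 0 i] q_const[of x z] x by auto
  qed
  then show "\<exists>l\<in>Field P. \<forall>x\<in>Field P. (l, x) \<in> P" using q_in_Field[OF x, of 0] by auto
  have "(y, q 4 x) \<in> P" if yF: "y \<in> Field P" for y
  proof -
    obtain i z where "i \<le> 4" "z \<in> X" "y = q i z" using yF unfolding Field_P by blast
    then show ?thesis using in_P_I[of z i 4] q_const[of x z] x by auto
  qed
  then show "\<exists>g\<in>Field P. \<forall>x\<in>Field P. (x, g) \<in> P" using q_in_Field[OF x, of 4] by auto
  show "\<forall>\<Phi>\<in>flags P. card \<Phi> = 3 + 2" unfolding flags_eq using card_F by auto
  show "strongly_flag_connected P" unfolding strongly_flag_connected_def flags_eq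
  proof (intro ballI)
    fix \<Phi> \<Psi> assume "\<Phi> \<in> F ` X" "\<Psi> \<in> F ` X"
    then obtain x y where xy: "x \<in> X" "y \<in> X" "\<Phi> = F x" "\<Psi> = F y" by auto
    let ?R = "{(\<Phi>', \<Psi>'). (\<exists>i. adjacent_flags P i \<Phi>' \<Psi>') \<and> \<Phi> \<inter> \<Psi> \<subseteq> \<Phi>' \<and> \<Phi> \<inter> \<Psi> \<subseteq> \<Psi>'}"
    \<comment> \<open>The second conjunct is carried along the path because each step must contain
      the intersection of the two end flags.\<close>
    have "(F x, F y) \<in> ?R\<^sup>* \<and> (\<forall>j\<le>4. q j x = q j y \<longrightarrow> q j y = q j x)"
    proof (rule path_induct[of x y "\<lambda>u. (F x, F u) \<in> ?R\<^sup>* \<and> (\<forall>j\<le>4. q j x = q j y \<longrightarrow> q j u = q j x)"])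
      fix u i assume u: "u \<in> X" "(F x, F u) \<in> ?R\<^sup>* \<and> (\<forall>j\<le>4. q j x = q j y \<longrightarrow> q j u = q j x)"
        and i: "i < 3" "q (Suc i) x \<noteq> q (Suc i) y"
      have *: "\<forall>j\<le>4. q j x = q j y \<longrightarrow> q j (s i u) = q j x" using q_s[of i u] i u by metis
      have sub: "\<Phi> \<inter> \<Psi> \<subseteq> F w" if "\<forall>j\<le>4. q j x = q j y \<longrightarrow> q j w = q j x" for w
      proof
        fix c assume c: "c \<in> \<Phi> \<inter> \<Psi>"
        then obtain j where j: "c = q j x" "j \<le> 4" unfolding xy F_def by auto
        have "q j x = q j y" using c in_F[of y x j] xy j by simp
        then have "c = q j w" using that j by simp
        then show "c \<in> F w" using j unfolding F_def by blast
      qed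
      have "(F u, F (s i u)) \<in> ?R" using adjacent_iff[of u] u i sub[of u] sub[of "s i u"] * by auto
      then show "(F x, F (s i u)) \<in> ?R\<^sup>* \<and> (\<forall>j\<le>4. q j x = q j y \<longrightarrow> q j (s i u) = q j x)"
        using u * by (meson rtrancl.rtrancl_into_rtrancl)
    qed (use xy in auto)
    then show "(\<Phi>, \<Psi>) \<in> ?R\<^sup>*" using xy by auto
  qed
  show "diamond_condition P" unfolding diamond_condition_def
  proof (intro allI ballI impI)
    fix k A B assume A: "A \<in> faces P (k - 1)" and B: "B \<in> faces P (k + 1)" and AB: "(A, B) \<in> P"
    obtain i x where i: "A = q i x" "x \<in> X" "int i = k" using A unfolding faces_eq by auto
    obtain j y where j: "B = q j y" "y \<in> X" "int j = k + 2" "j \<le> 4" using B unfolding faces_eq by auto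
    have ji: "j = Suc (Suc i)" using i j by auto
    have i3: "i < 3" using ji j by auto
    obtain u where u: "u \<in> X" "q i u = A" "q j u = B" using AB in_P[of x y i j] i j ji by (auto simp del: One_nat_def)
    have su: "s i u \<in> X" "q i (s i u) = A" "q j (s i u) = B" "q (Suc i) (s i u) \<noteq> q (Suc i) u"
      using s_closed q_s[of i u i] q_s[of i u j] q_s_neq[of i u] u i3 ji by auto
    have fk: "faces P k = q (Suc i) ` X" by (rule faces_q) (use i j ji in auto)
    have "{H \<in> faces P k. (A, H) \<in> P \<and> (H, B) \<in> P} = {q (Suc i) u, q (Suc i) (s i u)}" (is "?L = ?R")
    proof
      have "q (Suc i) w \<in> ?L" if "w \<in> X" "q i w = A" "q j w = B" for w
        using in_P_I[of w i "Suc i"] in_P_I[of w "Suc i" j] fk that j ji by auto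
      then show "?R \<subseteq> ?L" using u su by blast
      show "?L \<subseteq> ?R"
      proof
        fix H assume "H \<in> ?L"
        then have H: "H \<in> faces P k" "(A, H) \<in> P" "(H, B) \<in> P" by blast+
        \<comment> \<open>For the converse inclusion a flag through \<open>A\<close>,
          \<open>H\<close> and \<open>B\<close> is glued to \<open>u\<close> below \<open>A\<close>
          and above \<open>B\<close>. The result \<open>z2\<close> still contains \<open>H\<close>
          and differs from \<open>u\<close> in the middle index only.\<close>
        then obtain w where w: "w \<in> X" "H = q (Suc i) w" unfolding fk by blast
        have "i \<le> 4" "Suc i \<le> 4" using j ji by auto
        obtain v1 where v1: "v1 \<in> X" "q i v1 = A" "q (Suc i) v1 = H"
          using H(2) unfolding w(2) i(1) in_P[OF i(2) w(1) \<open>i \<le> 4\<close> \<open>Suc i \<le> 4\<close>] by blast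
        obtain v2 where v2: "v2 \<in> X" "q (Suc i) v2 = H" "q j v2 = B"
          using H(3) unfolding w(2) j(1) in_P[OF w(1) j(2) \<open>Suc i \<le> 4\<close> j(4)] by blast
        have "q (Suc i) v1 = q (Suc i) v2" using v1 v2 by simp
        from glue[OF v1(1) v2(1) \<open>Suc i \<le> 4\<close> this]
        obtain z where "z \<in> X" "\<forall>l\<le>Suc i. q l z = q l v1" "\<forall>l. Suc i \<le> l \<longrightarrow> l \<le> 4 \<longrightarrow> q l z = q l v2" by (elim bexE conjE)
        then have z: "z \<in> X" "q i z = A" "q (Suc i) z = H" "q j z = B" using v1 v2 j(4) ji by auto
        have "q i u = q i z" using u z by simp
        from glue[OF u(1) z(1) \<open>i \<le> 4\<close> this]
        obtain z1 where z1: "z1 \<in> X" "\<forall>l\<le>i. q l z1 = q l u" "\<forall>l. i \<le> l \<longrightarrow> l \<le> 4 \<longrightarrow> q l z1 = q l z" by (elim bexE conjE)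
        have "q j z1 = q j z" using z1(3) j(4) ji by simp
        then have "q j z1 = q j u" using z(4) u(3) by simp
        from glue[OF z1(1) u(1) j(4) this]
        obtain z2 where z2: "z2 \<in> X" "\<forall>l\<le>j. q l z2 = q l z1" "\<forall>l. j \<le> l \<longrightarrow> l \<le> 4 \<longrightarrow> q l z2 = q l u" by (elim bexE conjE)
        have "z2 = u \<or> z2 = s i u"
        proof (rule eq_except[OF u(1) z2(1) i3])
          fix l assume l: "l < 3" "l \<noteq> i"
          show "q (Suc l) u = q (Suc l) z2"
          proof (cases "l < i")
            case True then show ?thesis using z2(2) z1(2) ji by simp
          next
            case False then show ?thesis using z2(3) l ji by simp
          qed
        qed
        moreover have "q (Suc i) z2 = H" using z2(2) z1(3) z(3) ji j(4) by simp
        ultimately show "H \<in> ?R" by blast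
      qed
    qed
    then show "card {H \<in> faces P k. (A, H) \<in> P \<and> (H, B) \<in> P} = 2" using su by simp
  qed
qed

end

section \<open>The flags of a polyhedron\<close>

lemma ChainsI: "(\<And>a b. a \<in> C \<Longrightarrow> b \<in> C \<Longrightarrow> (a, b) \<in> R \<or> (b, a) \<in> R) \<Longrightarrow> C \<in> Chains R"
  unfolding Chains_def by (intro CollectI ballI)

lemma ChainsD: "C \<in> Chains R \<Longrightarrow> a \<in> C \<Longrightarrow> b \<in> C \<Longrightarrow> (a, b) \<in> R \<or> (b, a) \<in> R"
  unfolding Chains_def by (drule CollectD) (drule (1) bspec, erule (1) bspec)

text \<open>Zorn's lemma, because it is applied to \<open>P\<close> and also to lower sections of
  \<open>P\<close> before anything is known about the size of chains there.\<close>

lemma Chains_extend: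
  assumes C: "C \<in> Chains R"
  shows "\<exists>\<Phi>\<in>flags R. C \<subseteq> \<Phi>"
proof -
  let ?A = "{D \<in> Chains R. C \<subseteq> D}"
  have "\<exists>M\<in>?A. \<forall>D\<in>?A. M \<subseteq> D \<longrightarrow> D = M"
  proof (rule subset_Zorn_nonempty)
    show "?A \<noteq> {}" using C by blast
    fix K assume K: "K \<noteq> {}" "subset.chain ?A K"
    have sub: "K \<subseteq> ?A" and tot: "\<And>D E. D \<in> K \<Longrightarrow> E \<in> K \<Longrightarrow> D \<subseteq> E \<or> E \<subseteq> D"
      using K(2) unfolding subset_chain_def by blast+
    have "(a, b) \<in> R \<or> (b, a) \<in> R" if ab: "a \<in> \<Union>K" "b \<in> \<Union>K" for a b
    proof -
      obtain D where D: "D \<in> K" "a \<in> D" using ab(1) by (rule UnionE)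
      obtain E where E: "E \<in> K" "b \<in> E" using ab(2) by (rule UnionE)
      have ch: "D \<in> Chains R" "E \<in> Chains R" using sub D(1) E(1) by (simp_all add: subset_iff)
      from tot[OF D(1) E(1)] show ?thesis
      proof
        assume "D \<subseteq> E"
        then have "a \<in> E" using D(2) by (rule subsetD)
        then show ?thesis using E(2) by (rule ChainsD[OF ch(2)])
      next
        assume "E \<subseteq> D"
        then have "b \<in> D" using E(2) by (rule subsetD)
        then show ?thesis by (rule ChainsD[OF ch(1) D(2)])
      qed
    qed
    then have "\<Union>K \<in> Chains R" by (rule ChainsI)
    moreover have "C \<subseteq> \<Union>K" using sub K(1) by blast
    ultimately show "\<Union>K \<in> ?A" by simp
  qed
  then obtain M where "M \<in> ?A" and M: "\<forall>D\<in>?A. M \<subseteq> D \<longrightarrow> D = M" by (rule bexE)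
  then have MC: "M \<in> Chains R" "C \<subseteq> M" by simp_all
  have "M \<in> flags R"
  proof (rule flagsI[OF MC(1)])
    fix D assume D: "D \<in> Chains R" "M \<subseteq> D"
    then have "D \<in> ?A" using MC(2) by (metis (mono_tags) CollectI subset_trans)
    then show "D = M" using bspec[OF M] D(2) by blast
  qed
  then show ?thesis using MC(2) by (rule bexI[rotated])
qed

locale polytope3 =
  fixes P :: "'a rel"
  assumes polytope3: "abstract_polytope 3 P"
begin

lemma order_P: "trans P" "antisym P" "\<And>x. x \<in> Field P \<Longrightarrow> (x, x) \<in> P"
proof -
  have "Partial_order P" using polytope3 unfolding abstract_polytope_def by (rule conjunct1)
  then show "trans P" "antisym P" "\<And>x. x \<in> Field P \<Longrightarrow> (x, x) \<in> P"
    unfolding partial_order_on_def preorder_on_def refl_on_def by simp_all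
qed

lemma card_flag: "\<Phi> \<in> flags P \<Longrightarrow> card \<Phi> = 5" "\<Phi> \<in> flags P \<Longrightarrow> finite \<Phi>"
proof -
  show *: "\<Phi> \<in> flags P \<Longrightarrow> card \<Phi> = 5" for \<Phi> using polytope3 unfolding abstract_polytope_def by simp
  assume "\<Phi> \<in> flags P" from *[OF this] show "finite \<Phi>" using card.infinite by fastforce
qed

definition below :: "'a set \<Rightarrow> 'a \<Rightarrow> 'a set" where "below \<Phi> x = {y \<in> \<Phi>. (y, x) \<in> P \<and> y \<noteq> x}"
definition above :: "'a set \<Rightarrow> 'a \<Rightarrow> 'a set" where "above \<Phi> x = {y \<in> \<Phi>. (x, y) \<in> P \<and> y \<noteq> x}"
text \<open>Rank plus one, counted inside a single flag; that it does not depend on the flag is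
  \<open>pos_pos\<close>.\<close>

definition pos :: "'a set \<Rightarrow> 'a \<Rightarrow> nat" where "pos \<Phi> x = card (below \<Phi> x)"

lemma comparable: "\<Phi> \<in> flags P \<Longrightarrow> x \<in> \<Phi> \<Longrightarrow> y \<in> \<Phi> \<Longrightarrow> (x, y) \<in> P \<or> (y, x) \<in> P"
  by (rule ChainsD[OF flagsD(1)])

lemma flag_Field: "\<Phi> \<in> flags P \<Longrightarrow> x \<in> \<Phi> \<Longrightarrow> x \<in> Field P"
  using comparable[of \<Phi> x x] unfolding Field_def by blast

lemma pos_less:
  assumes "\<Phi> \<in> flags P" "x \<in> \<Phi>" "y \<in> \<Phi>" "(x, y) \<in> P" "x \<noteq> y"
  shows "pos \<Phi> x < pos \<Phi> y"
proof -
  have "x \<in> below \<Phi> y" "x \<notin> below \<Phi> x" using assms unfolding below_def by blast+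
  moreover have "below \<Phi> x \<subseteq> below \<Phi> y"
  proof
    fix z assume z: "z \<in> below \<Phi> x"
    then have "(z, y) \<in> P" using transD[OF order_P(1)] assms(4) unfolding below_def by blast
    moreover have "z \<noteq> y" using z assms antisymD[OF order_P(2)] unfolding below_def by blast
    ultimately show "z \<in> below \<Phi> y" using z unfolding below_def by blast
  qed
  ultimately have "below \<Phi> x \<subset> below \<Phi> y" by blast
  moreover have "finite (below \<Phi> y)" using card_flag(2)[OF assms(1)] unfolding below_def by simp
  ultimately show ?thesis unfolding pos_def by (rule psubset_card_mono[rotated])
qed

lemma pos_bij: assumes "\<Phi> \<in> flags P" shows "bij_betw (pos \<Phi>) \<Phi> {..4}"
proof -
  have inj: "inj_on (pos \<Phi>) \<Phi>"
  proof (rule inj_onI)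
    fix x y assume xy: "x \<in> \<Phi>" "y \<in> \<Phi>" "pos \<Phi> x = pos \<Phi> y"
    then show "x = y" using pos_less[OF assms xy(1,2)] pos_less[OF assms xy(2,1)] comparable[OF assms xy(1,2)] by fastforce
  qed
  have "pos \<Phi> x \<in> {..4}" if "x \<in> \<Phi>" for x
  proof -
    have "below \<Phi> x \<subset> \<Phi>" using that unfolding below_def by blast
    from psubset_card_mono[OF card_flag(2)[OF assms] this] show ?thesis using card_flag(1)[OF assms] unfolding pos_def by simp
  qed
  then have "pos \<Phi> ` \<Phi> \<subseteq> {..4}" by blast
  moreover have "card (pos \<Phi> ` \<Phi>) = card {..4::nat}" using card_image[OF inj] card_flag(1)[OF assms] by simp
  ultimately have "pos \<Phi> ` \<Phi> = {..4}" by (intro card_subset_eq) auto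
  then show ?thesis using inj unfolding bij_betw_def by blast
qed

definition q :: "nat \<Rightarrow> 'a set \<Rightarrow> 'a" where "q i \<Phi> = inv_into \<Phi> (pos \<Phi>) i"

lemma q_in: "\<Phi> \<in> flags P \<Longrightarrow> i \<le> 4 \<Longrightarrow> q i \<Phi> \<in> \<Phi>"
  unfolding q_def using pos_bij[of \<Phi>] by (metis atMost_iff bij_betw_imp_surj_on inv_into_into)

lemma pos_q: "\<Phi> \<in> flags P \<Longrightarrow> i \<le> 4 \<Longrightarrow> pos \<Phi> (q i \<Phi>) = i"
  unfolding q_def using pos_bij[of \<Phi>] by (metis atMost_iff bij_betw_imp_surj_on f_inv_into_f)

lemma q_pos: "\<Phi> \<in> flags P \<Longrightarrow> x \<in> \<Phi> \<Longrightarrow> q (pos \<Phi> x) \<Phi> = x"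
  unfolding q_def using pos_bij[of \<Phi>] by (metis bij_betw_imp_inj_on inv_into_f_f)

lemma pos_le: "\<Phi> \<in> flags P \<Longrightarrow> x \<in> \<Phi> \<Longrightarrow> pos \<Phi> x \<le> 4"
  using pos_bij[of \<Phi>] unfolding bij_betw_def by blast

lemma flag_eq: assumes "\<Phi> \<in> flags P" shows "(\<lambda>i. q i \<Phi>) ` {..4} = \<Phi>"
proof
  show "(\<lambda>i. q i \<Phi>) ` {..4} \<subseteq> \<Phi>" using q_in[OF assms] by (rule image_subsetI) simp
  show "\<Phi> \<subseteq> (\<lambda>i. q i \<Phi>) ` {..4}"
  proof
    fix x assume "x \<in> \<Phi>"
    then show "x \<in> (\<lambda>i. q i \<Phi>) ` {..4}"
      using q_pos[OF assms] pos_le[OF assms] by (intro image_eqI[of _ _ "pos \<Phi> x"]) simp_all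
  qed
qed

lemma q_le:
  assumes "\<Phi> \<in> flags P" "i \<le> j" "j \<le> 4" shows "(q i \<Phi>, q j \<Phi>) \<in> P"
proof -
  have q: "q i \<Phi> \<in> \<Phi>" "q j \<Phi> \<in> \<Phi>" using q_in assms by simp_all
  have "pos \<Phi> (q i \<Phi>) = i" "pos \<Phi> (q j \<Phi>) = j" using pos_q assms by simp_all
  then have "\<not> ((q j \<Phi>, q i \<Phi>) \<in> P \<and> q j \<Phi> \<noteq> q i \<Phi>)" using pos_less[OF assms(1) q(2,1)] assms(2) by fastforce
  then show ?thesis using comparable[OF assms(1) q] by metis
qed

lemma below_above:
  assumes "\<Phi> \<in> flags P" "x \<in> \<Phi>"
  shows "card (below \<Phi> x) + card (above \<Phi> x) = 4" "finite (below \<Phi> x)" "finite (above \<Phi> x)"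
proof -
  have "\<Phi> = insert x (below \<Phi> x \<union> above \<Phi> x)"
    using comparable[OF assms(1)] assms(2) unfolding below_def above_def by blast
  moreover have "x \<notin> below \<Phi> x \<union> above \<Phi> x" "below \<Phi> x \<inter> above \<Phi> x = {}"
    using antisymD[OF order_P(2)] unfolding below_def above_def by blast+
  moreover show f: "finite (below \<Phi> x)" "finite (above \<Phi> x)" using card_flag(2)[OF assms(1)] unfolding below_def above_def by simp_all
  ultimately have "card \<Phi> = Suc (card (below \<Phi> x) + card (above \<Phi> x))"
    by (metis card_Un_disjoint card_insert_disjoint finite_Un)
  then show "card (below \<Phi> x) + card (above \<Phi> x) = 4" using card_flag(1)[OF assms(1)] by simp
qed

text \<open>Exchanging the part of \<open>\<Psi>\<close> below \<open>x\<close> for that of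
  \<open>\<Phi>\<close> gives a chain, and a chain has at most five elements.\<close>

lemma pos_le_pos:
  assumes "\<Phi> \<in> flags P" "\<Psi> \<in> flags P" "x \<in> \<Phi>" "x \<in> \<Psi>"
  shows "pos \<Phi> x \<le> pos \<Psi> x"
proof -
  let ?C = "insert x (below \<Phi> x \<union> above \<Psi> x)"
  have "?C \<in> Chains P"
  proof (rule ChainsI)
    fix a b assume ab: "a \<in> ?C" "b \<in> ?C"
    have 1: "(c, d) \<in> P" if "c \<in> insert x (below \<Phi> x)" "d \<in> insert x (above \<Psi> x)" for c d
    proof -
      have "(c, x) \<in> P" "(x, d) \<in> P" using that order_P(3)[OF flag_Field[OF assms(1,3)]] unfolding below_def above_def by blast+
      then show ?thesis by (rule transD[OF order_P(1)])
    qed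
    have 2: "(c, d) \<in> P \<or> (d, c) \<in> P" if "c \<in> below \<Phi> x" "d \<in> below \<Phi> x" for c d
      using that comparable[OF assms(1)] unfolding below_def by blast
    have 3: "(c, d) \<in> P \<or> (d, c) \<in> P" if "c \<in> above \<Psi> x" "d \<in> above \<Psi> x" for c d
      using that comparable[OF assms(2)] unfolding above_def by blast
    show "(a, b) \<in> P \<or> (b, a) \<in> P" using ab 1[of a b] 1[of b a] 2[of a b] 3[of a b] by blast
  qed
  then obtain \<Theta> where T: "\<Theta> \<in> flags P" "?C \<subseteq> \<Theta>" using Chains_extend[of _ P] by blast
  have "x \<notin> below \<Phi> x \<union> above \<Psi> x" "below \<Phi> x \<inter> above \<Psi> x = {}"
    using antisymD[OF order_P(2)] unfolding below_def above_def by blast+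
  then have "card ?C = Suc (card (below \<Phi> x) + card (above \<Psi> x))"
    using below_above(2)[OF assms(1,3)] below_above(3)[OF assms(2,4)] by (simp add: card_Un_disjoint)
  moreover have "card ?C \<le> 5" using card_mono[OF card_flag(2)[OF T(1)] T(2)] card_flag(1)[OF T(1)] by simp
  ultimately show ?thesis using below_above(1)[OF assms(2,4)] unfolding pos_def by simp
qed

lemma pos_pos: "\<Phi> \<in> flags P \<Longrightarrow> \<Psi> \<in> flags P \<Longrightarrow> x \<in> \<Phi> \<Longrightarrow> x \<in> \<Psi> \<Longrightarrow> pos \<Phi> x = pos \<Psi> x"
  using pos_le_pos by (intro antisym) blast+

lemma q_rank: "\<Phi> \<in> flags P \<Longrightarrow> \<Psi> \<in> flags P \<Longrightarrow> i \<le> 4 \<Longrightarrow> j \<le> 4 \<Longrightarrow> q i \<Phi> = q j \<Psi> \<Longrightarrow> i = j"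
  using pos_pos[of \<Phi> \<Psi> "q i \<Phi>"] q_in[of \<Phi> i] q_in[of \<Psi> j] pos_q by metis

lemma q_mem: "\<Phi> \<in> flags P \<Longrightarrow> \<Psi> \<in> flags P \<Longrightarrow> i \<le> 4 \<Longrightarrow> q i \<Phi> \<in> \<Psi> \<Longrightarrow> q i \<Psi> = q i \<Phi>"
  using pos_pos[of \<Phi> \<Psi> "q i \<Phi>"] q_in[of \<Phi> i] pos_q q_pos by metis

text \<open>Completing a flag of the section by the faces above \<open>x\<close> gives a chain of
  \<open>P\<close>, which lies in a flag \<open>\<Theta>\<close>. By maximality the flag of the
  section is the part of \<open>\<Theta>\<close> up to \<open>x\<close>.\<close>

lemma section_card:
  assumes "\<Phi> \<in> flags P" "x \<in> \<Phi>" "\<Psi> \<in> flags (Restr P {y. (y, x) \<in> P})"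
  shows "card \<Psi> = Suc (pos \<Phi> x)"
proof -
  let ?R = "Restr P {y. (y, x) \<in> P}"
  have xx: "(x, x) \<in> P" using order_P(3) flag_Field assms by blast
  have C: "\<Psi> \<in> Chains ?R" by (rule flagsD(1)[OF assms(3)])
  have le: "(y, x) \<in> P" if "y \<in> \<Psi>" for y using ChainsD[OF C that that] by blast
  have "insert x \<Psi> \<in> Chains ?R"
  proof (rule ChainsI)
    fix a b assume "a \<in> insert x \<Psi>" "b \<in> insert x \<Psi>"
    then show "(a, b) \<in> ?R \<or> (b, a) \<in> ?R" using ChainsD[OF C, of a b] le xx by blast
  qed
  then have x\<Psi>: "x \<in> \<Psi>" using flagsD(2)[OF assms(3)] by blast
  have "\<Psi> \<union> above \<Phi> x \<in> Chains P"
  proof (rule ChainsI)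
    fix a b assume ab: "a \<in> \<Psi> \<union> above \<Phi> x" "b \<in> \<Psi> \<union> above \<Phi> x"
    have 1: "(c, d) \<in> P" if "c \<in> \<Psi>" "d \<in> above \<Phi> x" for c d
    proof -
      have "(x, d) \<in> P" using that unfolding above_def by blast
      with le[OF that(1)] show ?thesis by (rule transD[OF order_P(1)])
    qed
    have 2: "(c, d) \<in> P \<or> (d, c) \<in> P" if "c \<in> above \<Phi> x" "d \<in> above \<Phi> x" for c d
      using that comparable[OF assms(1)] unfolding above_def by blast
    show "(a, b) \<in> P \<or> (b, a) \<in> P" using ab 1[of a b] 1[of b a] 2[of a b] ChainsD[OF C, of a b] by blast
  qed
  then obtain \<Theta> where T: "\<Theta> \<in> flags P" "\<Psi> \<union> above \<Phi> x \<subseteq> \<Theta>" using Chains_extend[of _ P] by blast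
  then have xT: "x \<in> \<Theta>" using x\<Psi> by blast
  let ?D = "insert x (below \<Theta> x)"
  have "?D \<in> Chains ?R"
  proof (rule ChainsI)
    fix a b assume "a \<in> ?D" "b \<in> ?D"
    then show "(a, b) \<in> ?R \<or> (b, a) \<in> ?R" using comparable[OF T(1)] xT xx unfolding below_def by blast
  qed
  moreover have "\<Psi> \<subseteq> ?D" using T(2) le unfolding below_def by blast
  ultimately have "?D = \<Psi>" using flagsD(2)[OF assms(3)] by blast
  moreover have "x \<notin> below \<Theta> x" unfolding below_def by simp
  then have "card ?D = Suc (pos \<Theta> x)" unfolding pos_def using below_above(2)[OF T(1) xT] by simp
  ultimately show ?thesis using pos_pos[OF assms(1) T(1) assms(2) xT] by metis
qed

lemma faces_iff:
  assumes "\<Phi> \<in> flags P" "x \<in> \<Phi>"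
  shows "x \<in> faces P k \<longleftrightarrow> int (pos \<Phi> x) = k + 1"
proof -
  have "{} \<in> Chains (Restr P {y. (y, x) \<in> P})" by (rule ChainsI) simp_all
  from Chains_extend[OF this] obtain \<Psi> where "\<Psi> \<in> flags (Restr P {y. (y, x) \<in> P})" by (rule bexE)
  then have "(\<forall>\<Phi> \<in> flags (Restr P {y. (y, x) \<in> P}). int (card \<Phi>) = k + 2) \<longleftrightarrow> int (Suc (pos \<Phi> x)) = k + 2"
    using section_card[OF assms] by metis
  then show ?thesis using flag_Field[OF assms] unfolding faces_def by auto
qed

lemma faces_q: "\<Phi> \<in> flags P \<Longrightarrow> i \<le> 4 \<Longrightarrow> q i \<Phi> \<in> faces P k \<longleftrightarrow> int i = k + 1"
  using faces_iff[of \<Phi> "q i \<Phi>"] q_in pos_q by metis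

lemma diamond:
  assumes "\<Phi> \<in> flags P" "i < 3"
  shows "card {H \<in> faces P (int i). (q i \<Phi>, H) \<in> P \<and> (H, q (i + 2) \<Phi>) \<in> P} = 2"
proof -
  have "diamond_condition P" using polytope3 unfolding abstract_polytope_def by blast
  moreover have "q i \<Phi> \<in> faces P (int i - 1)" "q (i + 2) \<Phi> \<in> faces P (int i + 1)"
    using faces_q[OF assms(1)] assms(2) by simp_all
  moreover have "(q i \<Phi>, q (i + 2) \<Phi>) \<in> P" using q_le[OF assms(1)] assms(2) by simp
  ultimately show ?thesis unfolding diamond_condition_def by blast
qed

text \<open>The diamond has two elements, so two of them that both differ from a third one
  coincide.\<close>

lemma other_unique:
  assumes "\<Phi> \<in> flags P" "\<Psi> \<in> flags P" "\<Theta> \<in> flags P" "i < 3"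
    "q i \<Psi> = q i \<Phi>" "q (i + 2) \<Psi> = q (i + 2) \<Phi>" "q (Suc i) \<Psi> \<noteq> q (Suc i) \<Phi>"
    "q i \<Theta> = q i \<Phi>" "q (i + 2) \<Theta> = q (i + 2) \<Phi>" "q (Suc i) \<Theta> \<noteq> q (Suc i) \<Phi>"
  shows "q (Suc i) \<Psi> = q (Suc i) \<Theta>"
proof -
  define H where "H = {H \<in> faces P (int i). (q i \<Phi>, H) \<in> P \<and> (H, q (i + 2) \<Phi>) \<in> P}"
  have *: "q (Suc i) \<Xi> \<in> H" if X: "\<Xi> \<in> flags P" "q i \<Xi> = q i \<Phi>" "q (i + 2) \<Xi> = q (i + 2) \<Phi>" for \<Xi>
  proof -
    have "q (Suc i) \<Xi> \<in> faces P (int i)" using faces_q[OF X(1), of "Suc i" "int i"] assms(4) by simp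
    moreover have "(q i \<Xi>, q (Suc i) \<Xi>) \<in> P" "(q (Suc i) \<Xi>, q (i + 2) \<Xi>) \<in> P"
      by (rule q_le[OF X(1)]; use assms(4) in linarith)+
    ultimately show ?thesis unfolding H_def X(2,3) by (intro CollectI conjI)
  qed
  have "card H = 2" unfolding H_def by (rule diamond[OF assms(1,4)])
  then obtain a c where ac: "H = {a, c}" by (meson card_2_iff)
  have "q (Suc i) \<Phi> = a \<or> q (Suc i) \<Phi> = c" "q (Suc i) \<Psi> = a \<or> q (Suc i) \<Psi> = c" "q (Suc i) \<Theta> = a \<or> q (Suc i) \<Theta> = c"
    using *[OF assms(1) refl refl] *[OF assms(2,5,6)] *[OF assms(3,8,9)] unfolding ac by simp_all
  then show ?thesis using assms(7,10) by metis
qed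

lemma flag_cong:
  assumes "\<Phi> \<in> flags P" "\<Psi> \<in> flags P" "\<And>i. i \<le> 4 \<Longrightarrow> q i \<Phi> = q i \<Psi>"
  shows "\<Phi> = \<Psi>"
proof -
  have "(\<lambda>i. q i \<Phi>) ` {..4} = (\<lambda>i. q i \<Psi>) ` {..4}" by (rule image_cong[OF refl]) (rule assms(3), simp)
  then show ?thesis unfolding flag_eq[OF assms(1)] flag_eq[OF assms(2)] .
qed

text \<open>The second element of the diamond fits into the chain of the remaining faces of
  \<open>\<Phi>\<close>; the flag extending that chain is the adjacent one.\<close>

lemma adj_ex:
  assumes \<Phi>: "\<Phi> \<in> flags P" and i: "i < 3"
  shows "\<exists>\<Psi>\<in>flags P. q (Suc i) \<Psi> \<noteq> q (Suc i) \<Phi> \<and> (\<forall>j\<le>4. j \<noteq> Suc i \<longrightarrow> q j \<Psi> = q j \<Phi>)"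
proof -
  define H where "H = {H \<in> faces P (int i). (q i \<Phi>, H) \<in> P \<and> (H, q (i + 2) \<Phi>) \<in> P}"
  have "card H = 2" unfolding H_def by (rule diamond[OF assms])
  then obtain a c where "H = {a, c}" "a \<noteq> c" by (meson card_2_iff)
  then obtain h where hh: "h \<in> H" "h \<noteq> q (Suc i) \<Phi>" by (metis insertI1 insertI2)
  then have h: "h \<in> faces P (int i)" "(q i \<Phi>, h) \<in> P" "(h, q (i + 2) \<Phi>) \<in> P" unfolding H_def by simp_all
  have hF: "(h, h) \<in> P" using h(2) by (intro order_P(3)) (rule FieldI2)
  let ?C = "insert h ((\<lambda>j. q j \<Phi>) ` ({..4} - {Suc i}))"
  have 1: "(q j \<Phi>, h) \<in> P \<or> (h, q j \<Phi>) \<in> P" if j: "j \<in> {..4} - {Suc i}" for j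
  proof (cases "j \<le> i")
    case True
    then have "(q j \<Phi>, q i \<Phi>) \<in> P" using q_le[OF \<Phi>] i by simp
    then show ?thesis using transD[OF order_P(1) _ h(2)] by blast
  next
    case False
    then have "(q (i + 2) \<Phi>, q j \<Phi>) \<in> P" using q_le[OF \<Phi>, of "i + 2" j] i j by simp
    then show ?thesis using transD[OF order_P(1) h(3)] by blast
  qed
  have 2: "(q j \<Phi>, q k \<Phi>) \<in> P \<or> (q k \<Phi>, q j \<Phi>) \<in> P" if "j \<in> {..4} - {Suc i}" "k \<in> {..4} - {Suc i}" for j k
    by (rule comparable[OF \<Phi> q_in[OF \<Phi>] q_in[OF \<Phi>]]) (use that in simp_all)
  have "?C \<in> Chains P" by (rule ChainsI) (use 1 2 hF in blast)
  then obtain \<Psi> where \<Psi>: "\<Psi> \<in> flags P" "?C \<subseteq> \<Psi>" using Chains_extend[of _ P] by blast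
  have 3: "q j \<Psi> = q j \<Phi>" if "j \<le> 4" "j \<noteq> Suc i" for j
    by (rule q_mem[OF \<Phi> \<Psi>(1) that(1)]) (use \<Psi>(2) that in blast)
  have hp: "h \<in> \<Psi>" using \<Psi>(2) by blast
  then have "int (pos \<Psi> h) = int i + 1" using faces_iff[OF \<Psi>(1) hp] h(1) by blast
  then have "pos \<Psi> h = Suc i" by linarith
  then have "q (Suc i) \<Psi> = h" using q_pos[OF \<Psi>(1) hp] by simp
  then show ?thesis using 3 hh(2) \<Psi>(1) by blast
qed

definition s :: "nat \<Rightarrow> 'a set \<Rightarrow> 'a set" where
  "s i \<Phi> = (SOME \<Psi>. \<Psi> \<in> flags P \<and> q (Suc i) \<Psi> \<noteq> q (Suc i) \<Phi> \<and> (\<forall>j\<le>4. j \<noteq> Suc i \<longrightarrow> q j \<Psi> = q j \<Phi>))"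

lemma s_props:
  assumes \<Phi>: "\<Phi> \<in> flags P" and i: "i < 3"
  shows "s i \<Phi> \<in> flags P" "q (Suc i) (s i \<Phi>) \<noteq> q (Suc i) \<Phi>" "\<And>j. j \<le> 4 \<Longrightarrow> j \<noteq> Suc i \<Longrightarrow> q j (s i \<Phi>) = q j \<Phi>"
proof -
  have "\<exists>\<Psi>. \<Psi> \<in> flags P \<and> q (Suc i) \<Psi> \<noteq> q (Suc i) \<Phi> \<and> (\<forall>j\<le>4. j \<noteq> Suc i \<longrightarrow> q j \<Psi> = q j \<Phi>)"
    using adj_ex[OF assms] by blast
  from someI_ex[OF this, folded s_def] show "s i \<Phi> \<in> flags P" "q (Suc i) (s i \<Phi>) \<noteq> q (Suc i) \<Phi>" "\<And>j. j \<le> 4 \<Longrightarrow> j \<noteq> Suc i \<Longrightarrow> q j (s i \<Phi>) = q j \<Phi>"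
    by blast+
qed

lemma s_unique:
  assumes \<Phi>: "\<Phi> \<in> flags P" and i: "i < 3" and \<Psi>: "\<Psi> \<in> flags P" "q (Suc i) \<Psi> \<noteq> q (Suc i) \<Phi>" "\<And>j. j \<le> 4 \<Longrightarrow> j \<noteq> Suc i \<Longrightarrow> q j \<Psi> = q j \<Phi>"
  shows "\<Psi> = s i \<Phi>"
proof (rule flag_cong[OF \<Psi>(1) s_props(1)[OF \<Phi> i]])
  fix j :: nat assume j: "j \<le> 4"
  show "q j \<Psi> = q j (s i \<Phi>)"
  proof (cases "j = Suc i")
    case False then show ?thesis using \<Psi>(3) s_props(3)[OF \<Phi> i] j by simp
  next
    case True
    have "q (Suc i) \<Psi> = q (Suc i) (s i \<Phi>)"
      by (rule other_unique[OF \<Phi> \<Psi>(1) s_props(1)[OF \<Phi> i] i _ _ \<Psi>(2) _ _ s_props(2)[OF \<Phi> i]])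
        (use \<Psi>(3) s_props(3)[OF \<Phi> i] i in simp_all)
    then show ?thesis using True by simp
  qed
qed

lemma q_0_4: "\<Phi> \<in> flags P \<Longrightarrow> \<Psi> \<in> flags P \<Longrightarrow> q 0 \<Phi> = q 0 \<Psi>" "\<Phi> \<in> flags P \<Longrightarrow> \<Psi> \<in> flags P \<Longrightarrow> q 4 \<Phi> = q 4 \<Psi>"
proof -
  obtain l g where l: "l \<in> Field P" "\<And>x. x \<in> Field P \<Longrightarrow> (l, x) \<in> P" and g: "g \<in> Field P" "\<And>x. x \<in> Field P \<Longrightarrow> (x, g) \<in> P"
    using polytope3 unfolding abstract_polytope_def by metis
  have "l \<in> \<Phi>" "g \<in> \<Phi>" if f: "\<Phi> \<in> flags P" for \<Phi>
  proof -
    have "insert l \<Phi> \<in> Chains P" "insert g \<Phi> \<in> Chains P"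
      by (rule ChainsI; use comparable[OF f] flag_Field[OF f] l g in blast)+
    then show "l \<in> \<Phi>" "g \<in> \<Phi>" using flagsD(2)[OF f] by blast+
  qed note lg = this
  have "q 0 \<Phi> = l \<and> q 4 \<Phi> = g" if f: "\<Phi> \<in> flags P" for \<Phi>
  proof
    have "(q 0 \<Phi>, q (pos \<Phi> l) \<Phi>) \<in> P" using q_le[OF f] pos_le[OF f lg(1)[OF f]] by simp
    then have "(q 0 \<Phi>, l) \<in> P" using q_pos[OF f lg(1)[OF f]] by simp
    moreover have "(l, q 0 \<Phi>) \<in> P" using l(2) flag_Field[OF f q_in[OF f]] by simp
    ultimately show "q 0 \<Phi> = l" using antisymD[OF order_P(2)] by blast
    have "(q (pos \<Phi> g) \<Phi>, q 4 \<Phi>) \<in> P" using q_le[OF f] pos_le[OF f lg(2)[OF f]] by simp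
    then have "(g, q 4 \<Phi>) \<in> P" using q_pos[OF f lg(2)[OF f]] by simp
    moreover have "(q 4 \<Phi>, g) \<in> P" using g(2) flag_Field[OF f q_in[OF f]] by simp
    ultimately show "q 4 \<Phi> = g" using antisymD[OF order_P(2)] by blast
  qed
  then show "\<Phi> \<in> flags P \<Longrightarrow> \<Psi> \<in> flags P \<Longrightarrow> q 0 \<Phi> = q 0 \<Psi>" "\<Phi> \<in> flags P \<Longrightarrow> \<Psi> \<in> flags P \<Longrightarrow> q 4 \<Phi> = q 4 \<Psi>" by simp_all
qed

lemma adjacent_s:
  assumes "adjacent_flags P k \<Phi> \<Psi>" shows "\<exists>i<3. \<Psi> = s i \<Phi> \<and> q (Suc i) \<Psi> \<noteq> q (Suc i) \<Phi>"
proof -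
  have fl: "\<Phi> \<in> flags P" "\<Psi> \<in> flags P" and ne: "\<Phi> \<noteq> \<Psi>" and eq: "\<Phi> - faces P k = \<Psi> - faces P k"
    using assms unfolding adjacent_flags_def by blast+
  have *: "q j \<Psi> = q j \<Phi>" if "j \<le> 4" "int j \<noteq> k + 1" for j
  proof -
    have "q j \<Phi> \<in> \<Phi> - faces P k" using faces_q[OF fl(1) that(1)] q_in[OF fl(1) that(1)] that(2) by blast
    then have "q j \<Phi> \<in> \<Psi>" using eq by blast
    then show ?thesis by (rule q_mem[OF fl that(1)])
  qed
  have "\<exists>i<3. int i = k"
  proof (rule ccontr)
    assume no: "\<not> (\<exists>i<3. int i = k)"
    have "q j \<Phi> = q j \<Psi>" if j: "j \<le> 4" for j
    proof (cases "int j = k + 1")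
      case False then show ?thesis using * j by simp
    next
      case True
      have "\<not> (j - 1 < 3 \<and> int (j - 1) = k)" using no by blast
      then have "j = 0 \<or> j = 4" using True j by linarith
      then show ?thesis using q_0_4[OF fl] by blast
    qed
    then show False using flag_cong[OF fl] ne by blast
  qed
  then obtain i where i: "i < 3" "int i = k" by blast
  have **: "q j \<Psi> = q j \<Phi>" if "j \<le> 4" "j \<noteq> Suc i" for j using * that i by simp
  have neq: "q (Suc i) \<Psi> \<noteq> q (Suc i) \<Phi>" using flag_cong[OF fl] ** ne by metis
  have "\<Psi> = s i \<Phi>" by (rule s_unique[OF fl(1) i(1) fl(2) neq **])
  then show ?thesis using i neq by blast
qed

theorem flag_system: "flag_system P (flags P) s q"
proof
  have "{} \<in> Chains P" by (rule ChainsI) simp_all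
  from Chains_extend[OF this] show "flags P \<noteq> {}" by blast
next
  fix i :: nat and \<Phi> assume i: "i < 3" and \<Phi>: "\<Phi> \<in> flags P"
  note sp = s_props[OF \<Phi> i]
  show "s i \<Phi> \<in> flags P" by (rule sp(1))
  show "s i (s i \<Phi>) = \<Phi>" by (rule s_unique[OF sp(1) i \<Phi>, symmetric]) (use sp(2,3) in simp_all)
  show "q (Suc i) (s i \<Phi>) \<noteq> q (Suc i) \<Phi>" by (rule sp(2))
  fix j :: nat assume "j \<le> 4" "j \<noteq> Suc i"
  then show "q j (s i \<Phi>) = q j \<Phi>" by (rule sp(3))
next
  fix \<Phi> assume \<Phi>: "\<Phi> \<in> flags P"
  have a: "0 < (3::nat)" "2 < (3::nat)" by simp_all
  note s0 = s_props[OF \<Phi> a(1)] and s2 = s_props[OF \<Phi> a(2)]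
  note s02 = s_props[OF s2(1) a(1)] and s20 = s_props[OF s0(1) a(2)]
  show "s 0 (s 2 \<Phi>) = s 2 (s 0 \<Phi>)"
  proof (rule flag_cong[OF s02(1) s20(1)])
    fix j :: nat assume j: "j \<le> 4"
    show "q j (s 0 (s 2 \<Phi>)) = q j (s 2 (s 0 \<Phi>))"
    proof (cases "j = 1 \<or> j = 3")
      case False
      then show ?thesis using s02(3)[of j] s2(3)[of j] s20(3)[of j] s0(3)[of j] j by simp
    next
      case True
      \<comment> \<open>Both orders of the two moves change the vertex and the 2-face of
        \<open>\<Phi>\<close>, and each diamond offers only one other choice.\<close>
      have 1: "q (Suc 0) (s 0 (s 2 \<Phi>)) = q (Suc 0) (s 2 (s 0 \<Phi>))"
      proof (rule other_unique[OF \<Phi> s02(1) s20(1) a(1)])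
      qed (use s02(2) s0(2) s2(2) s20(2) in \<open>simp_all add: s02(3) s2(3) s20(3) s0(3)\<close>)
      have 3: "q (Suc 2) (s 0 (s 2 \<Phi>)) = q (Suc 2) (s 2 (s 0 \<Phi>))"
      proof (rule other_unique[OF \<Phi> s02(1) s20(1) a(2)])
      qed (use s02(2) s0(2) s2(2) s20(2) in \<open>simp_all add: s02(3) s2(3) s20(3) s0(3)\<close>)
      have "j = Suc 0 \<or> j = Suc 2" using True by auto
      then show ?thesis using 1 3 by blast
    qed
  qed
next
  fix i j :: nat and \<Phi> \<Psi> assume "\<Phi> \<in> flags P" "\<Psi> \<in> flags P" "i \<le> 4" "j \<le> 4" "q i \<Phi> = q j \<Psi>"
  then show "i = j" by (rule q_rank)
next
  fix \<Phi> \<Psi> assume fl: "\<Phi> \<in> flags P" "\<Psi> \<in> flags P"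
  let ?S = "{(u, s i u) | u i. u \<in> flags P \<and> i < 3 \<and> q (Suc i) \<Phi> \<noteq> q (Suc i) \<Psi>}"
  let ?R = "{(\<Phi>', \<Psi>'). (\<exists>i. adjacent_flags P i \<Phi>' \<Psi>') \<and> \<Phi> \<inter> \<Psi> \<subseteq> \<Phi>' \<and> \<Phi> \<inter> \<Psi> \<subseteq> \<Psi>'}"
  have "(\<Phi>, \<Psi>) \<in> ?R\<^sup>*" using polytope3 fl unfolding abstract_polytope_def strongly_flag_connected_def by blast
  \<comment> \<open>A move at an index where \<open>\<Phi>\<close> and \<open>\<Psi>\<close> agree
    would discard a face of their intersection.\<close>
  moreover have "?R \<subseteq> ?S"
  proof (clarify)
    fix A B k assume A: "adjacent_flags P k A B" "\<Phi> \<inter> \<Psi> \<subseteq> A" "\<Phi> \<inter> \<Psi> \<subseteq> B"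
    then have fA: "A \<in> flags P" "B \<in> flags P" unfolding adjacent_flags_def by blast+
    obtain i where i: "i < 3" "B = s i A" "q (Suc i) B \<noteq> q (Suc i) A" using adjacent_s[OF A(1)] by blast
    have "q (Suc i) \<Phi> \<noteq> q (Suc i) \<Psi>"
    proof
      assume e: "q (Suc i) \<Phi> = q (Suc i) \<Psi>"
      have le: "Suc i \<le> 4" using i by simp
      have "q (Suc i) \<Phi> \<in> \<Phi> \<inter> \<Psi>" using q_in[OF fl(1) le] q_in[OF fl(2) le] e by simp
      then have "q (Suc i) A = q (Suc i) \<Phi>" "q (Suc i) B = q (Suc i) \<Phi>"
        using q_mem[OF fl(1) fA(1) le] q_mem[OF fl(1) fA(2) le] A(2,3) by blast+
      then show False using i(3) by simp
    qed
    then show "\<exists>u i. (A, B) = (u, s i u) \<and> u \<in> flags P \<and> i < 3 \<and> q (Suc i) \<Phi> \<noteq> q (Suc i) \<Psi>" using i fA by blast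
  qed
  ultimately show "(\<Phi>, \<Psi>) \<in> ?S\<^sup>*" using rtrancl_mono by blast
next
  show "P = {(q i x, q j x) | i j x. x \<in> flags P \<and> i \<le> j \<and> j \<le> 4}" (is "_ = ?Q")
  proof
    show "?Q \<subseteq> P" using q_le by blast
    show "P \<subseteq> ?Q"
    proof (rule subrelI)
      fix a c assume ac: "(a, c) \<in> P"
      then have F: "(a, a) \<in> P" "(c, c) \<in> P" using order_P(3) unfolding Field_def by blast+
      have "{a, c} \<in> Chains P" by (rule ChainsI) (use ac F in auto)
      from Chains_extend[OF this] obtain \<Phi> where \<Phi>: "\<Phi> \<in> flags P" "a \<in> \<Phi>" "c \<in> \<Phi>" by auto
      have "pos \<Phi> a \<le> pos \<Phi> c" using pos_less[OF \<Phi> ac] by (cases "a = c") auto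
      moreover have "a = q (pos \<Phi> a) \<Phi>" "c = q (pos \<Phi> c) \<Phi>" using q_pos \<Phi> by simp_all
      ultimately show "(a, c) \<in> ?Q" using pos_le[OF \<Phi>(1,3)] \<Phi>(1) by blast
    qed
  qed
qed

end

section \<open>Isomorphisms and automorphisms in terms of flags\<close>

text \<open>Follows the path from \<open>x0\<close> to \<open>x\<close>. This gives freeness of the
  action of the automorphism group on the flags.\<close>

lemma flag_map_unique:
  fixes s :: "nat \<Rightarrow> 'x \<Rightarrow> 'x" and t :: "nat \<Rightarrow> 'y \<Rightarrow> 'y"
  assumes "flag_system P X s q" "x0 \<in> X" "x \<in> X" "f x0 = g x0"
    and "\<And>i x. i < 3 \<Longrightarrow> x \<in> X \<Longrightarrow> f (s i x) = t i (f x)"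
    and "\<And>i x. i < 3 \<Longrightarrow> x \<in> X \<Longrightarrow> g (s i x) = t i (g x)"
  shows "f x = g x"
proof -
  interpret A: flag_system P X s q by fact
  show ?thesis
  proof (rule A.path_induct[OF assms(2,3), of "\<lambda>u. f u = g u"])
    fix u and i :: nat assume "u \<in> X" "f u = g u" "i < 3"
    then show "f (s i u) = g (s i u)" using assms(5)[of i u] assms(6)[of i u] by simp
  qed (rule assms(4))
qed

text \<open>The path from \<open>x\<close> to \<open>y\<close> avoids the adjacency map that changes
  index \<open>i\<close>, and so does its image under \<open>f\<close>. Hence a map of flags that
  commutes with adjacency induces a map of faces.\<close>

lemma flag_map_q:
  assumes "flag_system P X s q" "flag_system Q Y t r"
    and "\<And>x. x \<in> X \<Longrightarrow> f x \<in> Y"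
    and "\<And>i x. i < 3 \<Longrightarrow> x \<in> X \<Longrightarrow> f (s i x) = t i (f x)"
    and "x \<in> X" "y \<in> X" "i \<le> 4" "q i x = q i y"
  shows "r i (f x) = r i (f y)"
proof -
  interpret A: flag_system P X s q by fact
  interpret B: flag_system Q Y t r by fact
  show ?thesis
  proof (rule A.path_induct[OF assms(5,6), of "\<lambda>u. r i (f x) = r i (f u)"])
    fix u j assume u: "u \<in> X" "r i (f x) = r i (f u)" "j < 3" "q (Suc j) x \<noteq> q (Suc j) y"
    then have "i \<noteq> Suc j" using assms(8) by blast
    then have "r i (t j (f u)) = r i (f u)" by (intro B.q_s u assms(3,7))
    then show "r i (f x) = r i (f (s j u))" using u assms(4)[OF u(3,1)] by simp
  qed simp
qed

lemma inv_flag_map: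
  assumes "flag_system P X s q" "bij_betw f X Y"
    and "\<And>i x. i < 3 \<Longrightarrow> x \<in> X \<Longrightarrow> f (s i x) = t i (f x)" "i < 3" "y \<in> Y"
  shows "inv_into X f (t i y) = s i (inv_into X f y)"
proof -
  interpret A: flag_system P X s q by fact
  obtain x where x: "x \<in> X" "y = f x" using assms(2,5) unfolding bij_betw_def by blast
  have "inv_into X f (f (s i x)) = s i x" using assms(2) A.s_closed[OF assms(4) x(1)] by (meson bij_betw_inv_into_left)
  moreover have "inv_into X f (f x) = x" using assms(2) x(1) by (meson bij_betw_inv_into_left)
  ultimately show ?thesis using assms(3)[OF assms(4) x(1)] x(2) by simp
qed

text \<open>The image of a face is read off from any flag through it: \<open>flag_map_q\<close> for
  \<open>f\<close> makes this well defined, and for the inverse of \<open>f\<close> it makes it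
  injective.\<close>

lemma flag_bij_iso:
  assumes A: "flag_system P X s q" and B: "flag_system Q Y t r" and f: "bij_betw f X Y"
    and comm: "\<And>i x. i < 3 \<Longrightarrow> x \<in> X \<Longrightarrow> f (s i x) = t i (f x)"
  obtains h where "h \<in> extensional (Field P)" "bij_betw h (Field P) (Field Q)"
    "\<And>a c. a \<in> Field P \<Longrightarrow> c \<in> Field P \<Longrightarrow> (a, c) \<in> P \<longleftrightarrow> (h a, h c) \<in> Q"
    "\<And>i x. i \<le> 4 \<Longrightarrow> x \<in> X \<Longrightarrow> h (q i x) = r i (f x)"
proof -
  interpret A: flag_system P X s q by fact
  interpret B: flag_system Q Y t r by fact
  have fY: "f x \<in> Y" if "x \<in> X" for x using f that unfolding bij_betw_def by blast
  have gX: "inv_into X f y \<in> X" if "y \<in> Y" for y using f that inv_into_into[of y f X] unfolding bij_betw_def by simp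
  have gf: "inv_into X f (f x) = x" if "x \<in> X" for x using f that by (meson bij_betw_inv_into_left)
  have fg: "f (inv_into X f y) = y" if "y \<in> Y" for y using f that by (meson bij_betw_inv_into_right)
  have gc: "inv_into X f (t i y) = s i (inv_into X f y)" if "i < 3" "y \<in> Y" for i y
    by (rule inv_flag_map[where f = f and s = s and t = t, OF A f comm that])
  have E1: "r i (f x) = r i (f y)" if "x \<in> X" "y \<in> X" "i \<le> 4" "q i x = q i y" for i x y
    by (rule flag_map_q[where f = f and s = s and t = t, OF A B fY comm that])
  have E2: "q i x = q i y" if xy: "x \<in> X" "y \<in> X" "i \<le> 4" "r i (f x) = r i (f y)" for i x y
  proof -
    have "q i (inv_into X f (f x)) = q i (inv_into X f (f y))"
      by (rule flag_map_q[where f = "inv_into X f" and s = t and t = s, OF B A gX gc fY[OF xy(1)] fY[OF xy(2)] xy(3,4)])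
    then show ?thesis using gf xy by simp
  qed
  \<comment> \<open>Restricted to \<open>Field P\<close>, because elements of \<open>Bij\<close>
    have to be extensional.\<close>
  define h where "h = restrict (\<lambda>a. SOME c. \<exists>i x. i \<le> 4 \<and> x \<in> X \<and> a = q i x \<and> c = r i (f x)) (Field P)"
  have hq: "h (q i x) = r i (f x)" if ix: "i \<le> 4" "x \<in> X" for i x
  proof -
    have "(SOME c. \<exists>j y. j \<le> 4 \<and> y \<in> X \<and> q i x = q j y \<and> c = r j (f y)) = r i (f x)"
    proof (rule some_equality)
      show "\<exists>j y. j \<le> 4 \<and> y \<in> X \<and> q i x = q j y \<and> r i (f x) = r j (f y)" using ix by blast
      fix c assume "\<exists>j y. j \<le> 4 \<and> y \<in> X \<and> q i x = q j y \<and> c = r j (f y)"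
      then obtain j y where jy: "j \<le> 4" "y \<in> X" "q i x = q j y" "c = r j (f y)" by blast
      have "i = j" by (rule A.rank_eq[OF ix(2) jy(2) ix(1) jy(1,3)])
      then show "c = r i (f x)" using E1[OF ix(2) jy(2) ix(1)] jy(3,4) by simp
    qed
    then show ?thesis unfolding h_def using A.q_in_Field[OF ix(2,1)] by simp
  qed
  have Fi: "\<exists>i x. i \<le> 4 \<and> x \<in> X \<and> a = q i x" if "a \<in> Field P" for a
    using that unfolding A.Field_P by blast
  have "inj_on h (Field P)"
  proof (rule inj_onI)
    fix a c assume ac: "a \<in> Field P" "c \<in> Field P" "h a = h c"
    obtain i x where x: "i \<le> 4" "x \<in> X" "a = q i x" using Fi[OF ac(1)] by blast
    obtain j y where y: "j \<le> 4" "y \<in> X" "c = q j y" using Fi[OF ac(2)] by blast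
    have e: "r i (f x) = r j (f y)" using ac(3) hq x y by simp
    have "i = j" by (rule B.rank_eq[OF fY[OF x(2)] fY[OF y(2)] x(1) y(1) e])
    then show "a = c" using E2[OF x(2) y(2) x(1)] e x(3) y(3) by simp
  qed
  moreover have "h ` Field P = Field Q"
  proof
    show "h ` Field P \<subseteq> Field Q"
    proof (rule image_subsetI)
      fix a assume "a \<in> Field P"
      then obtain i x where x: "i \<le> 4" "x \<in> X" "a = q i x" using Fi by blast
      then show "h a \<in> Field Q" using hq B.q_in_Field[OF fY[OF x(2)] x(1)] by simp
    qed
    show "Field Q \<subseteq> h ` Field P"
    proof
      fix c assume "c \<in> Field Q"
      then obtain i y where y: "i \<le> 4" "y \<in> Y" "c = r i y" unfolding B.Field_P by blast
      then have "c = h (q i (inv_into X f y))" using hq gX fg by simp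
      then show "c \<in> h ` Field P" using A.q_in_Field[OF gX[OF y(2)] y(1)] by (rule image_eqI)
    qed
  qed
  ultimately have "bij_betw h (Field P) (Field Q)" unfolding bij_betw_def by blast
  moreover have "(a, c) \<in> P \<longleftrightarrow> (h a, h c) \<in> Q" if ac: "a \<in> Field P" "c \<in> Field P" for a c
  proof -
    obtain i x where x: "i \<le> 4" "x \<in> X" "a = q i x" using Fi[OF ac(1)] by blast
    obtain j y where y: "j \<le> 4" "y \<in> X" "c = q j y" using Fi[OF ac(2)] by blast
    have "(\<exists>z\<in>X. q i z = q i x \<and> q j z = q j y) \<longleftrightarrow> (\<exists>w\<in>Y. r i w = r i (f x) \<and> r j w = r j (f y))"
    proof
      assume "\<exists>z\<in>X. q i z = q i x \<and> q j z = q j y"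
      then obtain z where z: "z \<in> X" "q i z = q i x" "q j z = q j y" by blast
      then show "\<exists>w\<in>Y. r i w = r i (f x) \<and> r j w = r j (f y)"
        using E1[OF z(1) x(2,1)] E1[OF z(1) y(2,1)] fY by blast
    next
      assume "\<exists>w\<in>Y. r i w = r i (f x) \<and> r j w = r j (f y)"
      then obtain w where w: "w \<in> Y" "r i w = r i (f x)" "r j w = r j (f y)" by blast
      have g: "inv_into X f w \<in> X" "f (inv_into X f w) = w" using gX fg w(1) by blast+
      have "q i (inv_into X f w) = q i x" by (rule E2[OF g(1) x(2,1)]) (simp add: g(2) w(2))
      moreover have "q j (inv_into X f w) = q j y" by (rule E2[OF g(1) y(2,1)]) (simp add: g(2) w(3))
      ultimately show "\<exists>z\<in>X. q i z = q i x \<and> q j z = q j y" using g(1) by blast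
    qed
    then show ?thesis unfolding x(3) y(3) hq[OF x(1,2)] hq[OF y(1,2)]
      unfolding A.in_P[OF x(2) y(2) x(1) y(1)] B.in_P[OF fY[OF x(2)] fY[OF y(2)] x(1) y(1)] by simp
  qed
  moreover have "h \<in> extensional (Field P)" unfolding h_def by simp
  ultimately show thesis using that hq by blast
qed

lemma flag_bij_poset_isomorphic:
  assumes "flag_system P X s q" "flag_system Q Y t r" "bij_betw f X Y"
    and "\<And>i x. i < 3 \<Longrightarrow> x \<in> X \<Longrightarrow> f (s i x) = t i (f x)"
  shows "poset_isomorphic P Q" "poset_isomorphic Q P"
proof -
  have gc: "inv_into X f (t i y) = s i (inv_into X f y)" if "i < 3" "y \<in> Y" for i y
    by (rule inv_flag_map[where f = f and s = s and t = t, OF assms(1,3,4) that])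
  obtain h where "bij_betw h (Field P) (Field Q)"
    "\<And>a c. a \<in> Field P \<Longrightarrow> c \<in> Field P \<Longrightarrow> (a, c) \<in> P \<longleftrightarrow> (h a, h c) \<in> Q"
    using flag_bij_iso[where f = f and s = s and t = t, OF assms] by metis
  then show "poset_isomorphic P Q" unfolding poset_isomorphic_def by metis
  obtain h where "bij_betw h (Field Q) (Field P)"
    "\<And>a c. a \<in> Field Q \<Longrightarrow> c \<in> Field Q \<Longrightarrow> (a, c) \<in> Q \<longleftrightarrow> (h a, h c) \<in> P"
    using flag_bij_iso[where f = "inv_into X f" and s = t and t = s, OF assms(2,1) bij_betw_inv_into[OF assms(3)] gc] by metis
  then show "poset_isomorphic Q P" unfolding poset_isomorphic_def by metis
qed

text \<open>The images of the five faces of a flag have strictly increasing indices between 0 and 4,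
  so every index is preserved, and the image chain is a flag. Only one direction of order
  preservation is assumed, so that the lemma applies to an isomorphism and to its inverse.\<close>

lemma iso_flag_ex:
  assumes A: "flag_system P X s q" and B: "flag_system Q Y t r" and h: "inj_on h (Field P)" "h ` Field P \<subseteq> Field Q"
    and ord: "\<And>a c. a \<in> Field P \<Longrightarrow> c \<in> Field P \<Longrightarrow> (a, c) \<in> P \<Longrightarrow> (h a, h c) \<in> Q" and x: "x \<in> X"
  shows "\<exists>y\<in>Y. \<forall>i\<le>4. r i y = h (q i x)"
proof -
  interpret A: flag_system P X s q by fact
  interpret B: flag_system Q Y t r by fact
  have "\<forall>i. \<exists>k y. i \<le> 4 \<longrightarrow> k \<le> 4 \<and> y \<in> Y \<and> h (q i x) = r k y"
  proof
    fix i show "\<exists>k y. i \<le> 4 \<longrightarrow> k \<le> 4 \<and> y \<in> Y \<and> h (q i x) = r k y"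
    proof (cases "i \<le> 4")
      case True
      then have "h (q i x) \<in> Field Q" using h(2) A.q_in_Field[OF x True] by blast
      then show ?thesis unfolding B.Field_P by blast
    qed blast
  qed
  then obtain \<rho> y where ry: "\<And>i. i \<le> 4 \<Longrightarrow> \<rho> i \<le> 4 \<and> y i \<in> Y \<and> h (q i x) = r (\<rho> i) (y i)" by metis
  have R: "\<rho> i < \<rho> j" if ij: "i < j" "j \<le> 4" for i j :: nat
  proof -
    have i4: "i \<le> 4" using ij by simp
    note i = ry[OF i4] and j = ry[OF ij(2)]
    have Fd: "q i x \<in> Field P" "q j x \<in> Field P" by (rule A.q_in_Field[OF x]; use ij in simp)+
    have "(q i x, q j x) \<in> P" using A.in_P_I[OF x] ij by simp
    then have "(h (q i x), h (q j x)) \<in> Q" by (rule ord[OF Fd])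
    then have Q: "(r (\<rho> i) (y i), r (\<rho> j) (y j)) \<in> Q" using i j by simp
    have yi: "y i \<in> Y" "y j \<in> Y" "\<rho> i \<le> 4" "\<rho> j \<le> 4" using i j by simp_all
    have *: "\<rho> i \<le> \<rho> j \<and> (\<exists>z\<in>Y. r (\<rho> i) z = r (\<rho> i) (y i) \<and> r (\<rho> j) z = r (\<rho> j) (y j))"
      using Q unfolding B.in_P[OF yi] .
    have "\<rho> i \<noteq> \<rho> j"
    proof
      assume e: "\<rho> i = \<rho> j"
      then have "r (\<rho> i) (y i) = r (\<rho> j) (y j)" using * by metis
      then have "h (q i x) = h (q j x)" using i j by simp
      then have "q i x = q j x" using inj_onD[OF h(1) _ Fd] by blast
      then show False using A.rank_eq[OF x x i4 ij(2)] ij(1) by simp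
    qed
    then show ?thesis using * by simp
  qed
  have "\<rho> 0 < \<rho> 1" "\<rho> 1 < \<rho> 2" "\<rho> 2 < \<rho> 3" "\<rho> 3 < \<rho> 4" "\<rho> 4 \<le> 4" using R ry by simp_all
  then have r5: "\<rho> 0 = 0" "\<rho> 1 = 1" "\<rho> 2 = 2" "\<rho> 3 = 3" "\<rho> 4 = 4" by linarith+
  have \<rho>: "\<rho> i = i" if "i \<le> 4" for i
    using A.le4_cases[OF that] r5 by (elim disjE) simp_all
  have C: "(\<lambda>i. h (q i x)) ` {..4} \<in> Chains Q"
  proof (rule ChainsI)
    fix a c assume "a \<in> (\<lambda>i. h (q i x)) ` {..4}" "c \<in> (\<lambda>i. h (q i x)) ` {..4}"
    then obtain i j where ij: "a = h (q i x)" "i \<le> 4" "c = h (q j x)" "j \<le> 4" by auto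
    have Fd: "q i x \<in> Field P" "q j x \<in> Field P" by (rule A.q_in_Field[OF x]; use ij in simp)+
    have "(q i x, q j x) \<in> P \<or> (q j x, q i x) \<in> P" using A.in_P_I[OF x, of i j] A.in_P_I[OF x, of j i] ij by linarith
    then show "(a, c) \<in> Q \<or> (c, a) \<in> Q" using ord[OF Fd] ord[OF Fd(2,1)] ij by blast
  qed
  then obtain z where z: "z \<in> Y" "(\<lambda>i. h (q i x)) ` {..4} \<subseteq> B.F z" using B.chain_sub_flag by blast
  have "r i z = h (q i x)" if i: "i \<le> 4" for i
  proof -
    have e: "h (q i x) = r i (y i)" "y i \<in> Y" using ry[OF i] \<rho>[OF i] by simp_all
    have "h (q i x) \<in> B.F z" using z(2) i by blast
    then have "r i (y i) \<in> B.F z" using e(1) by simp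
    then show ?thesis using B.in_F[OF z(1) e(2) i] e(1) by simp
  qed
  then show ?thesis using z(1) by blast
qed

text \<open>Converse of \<open>flag_bij_iso\<close>. It commutes with adjacency because the image of
  \<open>s i x\<close> differs from that of \<open>x\<close>, but only in index
  \<open>i + 1\<close>.\<close>

lemma iso_flag_bij:
  assumes A: "flag_system P X s q" and B: "flag_system Q Y t r" and h: "bij_betw h (Field P) (Field Q)"
    and ord: "\<And>a c. a \<in> Field P \<Longrightarrow> c \<in> Field P \<Longrightarrow> (a, c) \<in> P \<longleftrightarrow> (h a, h c) \<in> Q"
  obtains f where "bij_betw f X Y" "\<And>i x. i < 3 \<Longrightarrow> x \<in> X \<Longrightarrow> f (s i x) = t i (f x)"
    "\<And>i x. i \<le> 4 \<Longrightarrow> x \<in> X \<Longrightarrow> r i (f x) = h (q i x)"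
proof -
  interpret A: flag_system P X s q by fact
  interpret B: flag_system Q Y t r by fact
  have hb: "inj_on h (Field P)" "h ` Field P = Field Q" using h unfolding bij_betw_def by blast+
  let ?g = "inv_into (Field P) h"
  have "\<forall>x\<in>X. \<exists>y\<in>Y. \<forall>i\<le>4. r i y = h (q i x)"
    using iso_flag_ex[where h = h, OF A B hb(1)] hb(2) ord by (metis order_refl)
  then obtain f where f: "\<And>x. x \<in> X \<Longrightarrow> f x \<in> Y" "\<And>x i. x \<in> X \<Longrightarrow> i \<le> 4 \<Longrightarrow> r i (f x) = h (q i x)"
    by metis
  have inj: "inj_on f X"
  proof (rule inj_onI)
    fix x y assume xy: "x \<in> X" "y \<in> X" "f x = f y"
    have "q i y = q i x" if i: "i \<le> 4" for i
      using f(2)[OF xy(1) i] f(2)[OF xy(2) i] xy(3) inj_onD[OF hb(1) _ A.q_in_Field[OF xy(2) i] A.q_in_Field[OF xy(1) i]] by simp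
    then show "x = y" by (intro A.eq_all[OF xy(2,1)]) simp
  qed
  have "f ` X = Y"
  proof
    show "f ` X \<subseteq> Y" using f(1) by blast
    show "Y \<subseteq> f ` X"
    proof
      fix y assume y: "y \<in> Y"
      have "\<exists>x\<in>X. \<forall>i\<le>4. q i x = ?g (r i y)"
      proof (rule iso_flag_ex[where h = ?g, OF B A _ _ _ y])
        show "inj_on ?g (Field Q)" using hb(2) by (metis inj_on_inv_into order_refl)
        show "?g ` Field Q \<subseteq> Field P" using hb(2) by (metis image_subsetI inv_into_into)
        fix a c assume ac: "a \<in> Field Q" "c \<in> Field Q" "(a, c) \<in> Q"
        have "h (?g a) = a" "h (?g c) = c" "?g a \<in> Field P" "?g c \<in> Field P"
          using ac hb(2) by (metis f_inv_into_f inv_into_into)+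
        then show "(?g a, ?g c) \<in> P" using ord ac(3) by metis
      qed
      then obtain x where x: "x \<in> X" "\<And>i. i \<le> 4 \<Longrightarrow> q i x = ?g (r i y)" by blast
      have "r i (f x) = r i y" if i: "i \<le> 4" for i
      proof -
        have "r i y \<in> h ` Field P" using B.q_in_Field[OF y i] hb(2) by simp
        then have "h (?g (r i y)) = r i y" by (rule f_inv_into_f)
        then show ?thesis using f(2)[OF x(1) i] x(2)[OF i] by simp
      qed
      then have "y = f x" by (intro B.eq_all[OF f(1)[OF x(1)] y]) simp
      then show "y \<in> f ` X" using x(1) by blast
    qed
  qed
  then have "bij_betw f X Y" using inj unfolding bij_betw_def by blast
  moreover have "f (s i x) = t i (f x)" if ix: "i < 3" "x \<in> X" for i x
  proof -
    have sx: "s i x \<in> X" by (rule A.s_closed[OF ix])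
    have "f (s i x) = f x \<or> f (s i x) = t i (f x)"
    proof (rule B.eq_except[OF f(1)[OF ix(2)] f(1)[OF sx] ix(1)])
      fix j :: nat assume "j < 3" "j \<noteq> i"
      then have "q (Suc j) (s i x) = q (Suc j) x" by (intro A.q_s ix) simp_all
      then show "r (Suc j) (f x) = r (Suc j) (f (s i x))" using f(2)[OF ix(2), of "Suc j"] f(2)[OF sx, of "Suc j"] \<open>j < 3\<close> by simp
    qed
    moreover have "f (s i x) \<noteq> f x"
    proof
      assume "f (s i x) = f x"
      then have "s i x = x" using inj_onD[OF inj _ sx ix(2)] by blast
      then show False using A.q_s_neq[OF ix] by simp
    qed
    ultimately show ?thesis by blast
  qed
  ultimately show thesis using that f(2) by blast
qed

section \<open>The action of the automorphism group on flags\<close>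

context flag_system
begin

lemma fs: "flag_system P X s q" by unfold_locales

lemma carrier_Aut: "carrier (Aut P) = {f \<in> Bij (Field P). \<forall>x \<in> Field P. \<forall>y \<in> Field P. (x, y) \<in> P \<longleftrightarrow> (f x, f y) \<in> P}"
  unfolding Aut_def by simp

lemma mult_Aut: "\<gamma> \<in> carrier (Aut P) \<Longrightarrow> \<delta> \<in> carrier (Aut P) \<Longrightarrow> \<gamma> \<otimes>\<^bsub>Aut P\<^esub> \<delta> = compose (Field P) \<gamma> \<delta>"
  unfolding carrier_Aut unfolding Aut_def BijGroup_def by simp

lemma one_Aut: "\<one>\<^bsub>Aut P\<^esub> = (\<lambda>x\<in>Field P. x)"
  unfolding Aut_def BijGroup_def by simp

lemma Aut_Field: "\<gamma> \<in> carrier (Aut P) \<Longrightarrow> a \<in> Field P \<Longrightarrow> \<gamma> a \<in> Field P"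
  unfolding carrier_Aut using Bij_imp_funcset by blast

lemma group_Aut: "group (Aut P)"
proof -
  let ?B = "BijGroup (Field P)"
  have "subgroup (carrier (Aut P)) ?B"
  proof (rule group.subgroupI[OF group_BijGroup])
    show "carrier (Aut P) \<subseteq> carrier ?B" unfolding carrier_Aut BijGroup_def by auto
    show "carrier (Aut P) \<noteq> {}"
    proof -
      have "(\<lambda>x\<in>Field P. x) \<in> carrier (Aut P)" unfolding carrier_Aut using id_Bij by simp
      then show ?thesis by blast
    qed
  next
    fix f assume f: "f \<in> carrier (Aut P)"
    then have fB: "f \<in> Bij (Field P)" unfolding carrier_Aut by simp
    then have fb: "bij_betw f (Field P) (Field P)" unfolding Bij_def by simp
    have "(a, c) \<in> P \<longleftrightarrow> (inv_into (Field P) f a, inv_into (Field P) f c) \<in> P" if ac: "a \<in> Field P" "c \<in> Field P" for a c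
    proof -
      have "inv_into (Field P) f a \<in> Field P" "inv_into (Field P) f c \<in> Field P"
        "f (inv_into (Field P) f a) = a" "f (inv_into (Field P) f c) = c"
        using ac fb by (simp_all add: bij_betw_inv_into_right) (metis bij_betw_imp_surj_on inv_into_into)+
      then show ?thesis using f unfolding carrier_Aut by auto
    qed
    then show "inv\<^bsub>?B\<^esub> f \<in> carrier (Aut P)"
      unfolding inv_BijGroup[OF fB] carrier_Aut using restrict_inv_into_Bij[OF fB] by simp
  next
    fix f g assume f: "f \<in> carrier (Aut P)" and g: "g \<in> carrier (Aut P)"
    have "compose (Field P) f g \<in> carrier (Aut P)"
      using f g Aut_Field[OF g] unfolding carrier_Aut by (auto simp: compose_Bij compose_eq)
    then show "f \<otimes>\<^bsub>?B\<^esub> g \<in> carrier (Aut P)" using mult_Aut[OF f g] unfolding Aut_def by simp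
  qed
  then have "group (?B\<lparr>carrier := carrier (Aut P)\<rparr>)" by (rule group.subgroup_imp_group[OF group_BijGroup])
  then show ?thesis unfolding Aut_def by simp
qed

definition act :: "('a \<Rightarrow> 'a) \<Rightarrow> 'x \<Rightarrow> 'x" where
  "act \<gamma> x = (SOME y. y \<in> X \<and> (\<forall>i\<le>4. q i y = \<gamma> (q i x)))"

lemma act_unique: "x \<in> X \<Longrightarrow> y \<in> X \<Longrightarrow> (\<And>i. i \<le> 4 \<Longrightarrow> q i y = \<gamma> (q i x)) \<Longrightarrow> act \<gamma> x = y"
  unfolding act_def
proof (rule some_equality, blast)
  fix z assume "y \<in> X" "\<And>i. i \<le> 4 \<Longrightarrow> q i y = \<gamma> (q i x)" "z \<in> X \<and> (\<forall>i\<le>4. q i z = \<gamma> (q i x))"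
  then show "z = y" by (intro eq_all) simp_all
qed

lemma act_props:
  assumes "\<gamma> \<in> carrier (Aut P)"
  shows "bij_betw (act \<gamma>) X X" "\<And>i x. i < 3 \<Longrightarrow> x \<in> X \<Longrightarrow> act \<gamma> (s i x) = s i (act \<gamma> x)"
    "\<And>i x. i \<le> 4 \<Longrightarrow> x \<in> X \<Longrightarrow> q i (act \<gamma> x) = \<gamma> (q i x)"
proof -
  have g: "bij_betw \<gamma> (Field P) (Field P)" "\<And>a c. a \<in> Field P \<Longrightarrow> c \<in> Field P \<Longrightarrow> (a, c) \<in> P \<longleftrightarrow> (\<gamma> a, \<gamma> c) \<in> P"
    using assms unfolding carrier_Aut Bij_def by simp_all
  obtain f where f: "bij_betw f X X" "\<And>i x. i < 3 \<Longrightarrow> x \<in> X \<Longrightarrow> f (s i x) = s i (f x)"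
    "\<And>i x. i \<le> 4 \<Longrightarrow> x \<in> X \<Longrightarrow> q i (f x) = \<gamma> (q i x)" using iso_flag_bij[where h = \<gamma>, OF fs fs g] by metis
  have fX: "f x \<in> X" if "x \<in> X" for x using f(1) that unfolding bij_betw_def by blast
  have af: "act \<gamma> x = f x" if "x \<in> X" for x by (rule act_unique[OF that fX[OF that] f(3)[OF _ that]])
  show "bij_betw (act \<gamma>) X X" using f(1) af bij_betw_cong[of X "act \<gamma>" f X] by blast
  show "act \<gamma> (s i x) = s i (act \<gamma> x)" if "i < 3" "x \<in> X" for i x
    using f(2)[OF that] af s_closed[OF that] that by simp
  show "q i (act \<gamma> x) = \<gamma> (q i x)" if "i \<le> 4" "x \<in> X" for i x using f(3)[OF that] af[OF that(2)] by simp
qed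

lemma act_closed: "\<gamma> \<in> carrier (Aut P) \<Longrightarrow> x \<in> X \<Longrightarrow> act \<gamma> x \<in> X"
  using act_props(1) unfolding bij_betw_def by blast

lemma act_F: "\<gamma> \<in> carrier (Aut P) \<Longrightarrow> x \<in> X \<Longrightarrow> \<gamma> ` F x = F (act \<gamma> x)"
  unfolding F_def image_image by (rule image_cong[OF refl]) (simp add: act_props(3))

lemma act_mult:
  assumes "\<gamma> \<in> carrier (Aut P)" "\<delta> \<in> carrier (Aut P)" "x \<in> X"
  shows "act (\<gamma> \<otimes>\<^bsub>Aut P\<^esub> \<delta>) x = act \<gamma> (act \<delta> x)"
proof (rule act_unique[OF assms(3)])
  show "act \<gamma> (act \<delta> x) \<in> X" using assms by (intro act_closed)
  show "q i (act \<gamma> (act \<delta> x)) = (\<gamma> \<otimes>\<^bsub>Aut P\<^esub> \<delta>) (q i x)" if "i \<le> 4" for i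
    using assms that by (simp add: act_props(3) act_closed mult_Aut q_in_Field compose_eq)
qed

lemma act_one: "x \<in> X \<Longrightarrow> act \<one>\<^bsub>Aut P\<^esub> x = x"
  by (rule act_unique) (simp_all add: one_Aut q_in_Field)

lemma act_inj:
  assumes "\<gamma> \<in> carrier (Aut P)" "\<delta> \<in> carrier (Aut P)" "x0 \<in> X" "act \<gamma> x0 = act \<delta> x0"
  shows "\<gamma> = \<delta>"
proof -
  have e: "act \<gamma> x = act \<delta> x" if "x \<in> X" for x
    by (rule flag_map_unique[where f = "act \<gamma>" and g = "act \<delta>" and t = s, OF fs assms(3) that assms(4) act_props(2)[OF assms(1)] act_props(2)[OF assms(2)]])
  show ?thesis
  proof (rule extensionalityI)
    show "\<gamma> \<in> extensional (Field P)" "\<delta> \<in> extensional (Field P)" using assms(1,2) unfolding carrier_Aut Bij_def by simp_all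
    fix a assume "a \<in> Field P"
    then obtain i x where ix: "i \<le> 4" "x \<in> X" "a = q i x" unfolding Field_P by blast
    then show "\<gamma> a = \<delta> a" using act_props(3)[OF assms(1) ix(1,2)] act_props(3)[OF assms(2) ix(1,2)] e[OF ix(2)] by simp
  qed
qed

lemma aut_ex:
  assumes "bij_betw f X X" "\<And>i x. i < 3 \<Longrightarrow> x \<in> X \<Longrightarrow> f (s i x) = s i (f x)"
  shows "\<exists>\<gamma>\<in>carrier (Aut P). \<forall>x\<in>X. act \<gamma> x = f x"
proof -
  obtain h where h: "h \<in> extensional (Field P)" "bij_betw h (Field P) (Field P)"
    "\<And>a c. a \<in> Field P \<Longrightarrow> c \<in> Field P \<Longrightarrow> (a, c) \<in> P \<longleftrightarrow> (h a, h c) \<in> P"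
    "\<And>i x. i \<le> 4 \<Longrightarrow> x \<in> X \<Longrightarrow> h (q i x) = q i (f x)"
    using flag_bij_iso[where f = f and s = s and t = s, OF fs fs assms] by metis
  have "h \<in> carrier (Aut P)" unfolding carrier_Aut Bij_def using h(1,2,3) by simp
  moreover have "act h x = f x" if x: "x \<in> X" for x
  proof (rule act_unique[OF x])
    show "f x \<in> X" using assms(1) x unfolding bij_betw_def by blast
    show "q i (f x) = h (q i x)" if "i \<le> 4" for i using h(4)[OF that x] by simp
  qed
  ultimately show ?thesis by blast
qed

lemma regularI:
  assumes "\<And>x y. x \<in> X \<Longrightarrow> y \<in> X \<Longrightarrow> \<exists>f. bij_betw f X X \<and> (\<forall>i<3. \<forall>x\<in>X. f (s i x) = s i (f x)) \<and> f x = y"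
  shows "regular_polyhedron P"
  unfolding regular_polyhedron_def
proof (intro conjI ballI)
  show "abstract_polytope 3 P" by (rule polytope)
  fix \<Phi> \<Psi> assume "\<Phi> \<in> flags P" "\<Psi> \<in> flags P"
  then obtain x y where xy: "x \<in> X" "\<Phi> = F x" "y \<in> X" "\<Psi> = F y" unfolding flags_eq by blast
  obtain f where f: "bij_betw f X X" "\<forall>i<3. \<forall>x\<in>X. f (s i x) = s i (f x)" "f x = y" using assms[OF xy(1,3)] by blast
  obtain \<gamma> where "\<gamma> \<in> carrier (Aut P)" "\<forall>x\<in>X. act \<gamma> x = f x" using aut_ex[OF f(1)] f(2) by blast
  then show "\<exists>\<gamma>\<in>carrier (Aut P). \<gamma> ` \<Phi> = \<Psi>" using act_F[OF _ xy(1)] xy f(3) by (intro bexI[of _ \<gamma>]) simp_all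
qed

lemma regularD:
  assumes "regular_polyhedron P" "x \<in> X" "y \<in> X"
  shows "\<exists>\<gamma>\<in>carrier (Aut P). act \<gamma> x = y"
proof -
  have "F x \<in> flags P" "F y \<in> flags P" unfolding flags_eq using assms by simp_all
  then obtain \<gamma> where g: "\<gamma> \<in> carrier (Aut P)" "\<gamma> ` F x = F y" using assms(1) unfolding regular_polyhedron_def by blast
  then have "F (act \<gamma> x) = F y" using act_F[OF g(1) assms(2)] by simp
  then have "act \<gamma> x = y" using inj_onD[OF F_inj _ act_closed[OF g(1) assms(2)] assms(3)] by blast
  then show ?thesis using g(1) by blast
qed

lemma distinguishedI:
  assumes "x \<in> X" "\<rho>\<^sub>0 \<in> carrier (Aut P)" "\<rho>\<^sub>1 \<in> carrier (Aut P)" "\<rho>\<^sub>2 \<in> carrier (Aut P)"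
    "act \<rho>\<^sub>0 x = s 0 x" "act \<rho>\<^sub>1 x = s 1 x" "act \<rho>\<^sub>2 x = s 2 x"
  shows "distinguished_generators P (F x) \<rho>\<^sub>0 \<rho>\<^sub>1 \<rho>\<^sub>2"
proof -
  have "adjacent_flags P (int i) (F x) (F (s i x))" if "i < 3" for i
    using adjacent_iff[OF assms(1)] that by blast
  from this[of 0] this[of 1] this[of 2] show ?thesis
    unfolding distinguished_generators_def using assms by (simp add: act_F)
qed

text \<open>Automorphisms commute with the adjacency maps, so on the base flag a product of
  generators acts as the product of adjacency maps in reversed order.\<close>

lemma act_pow:
  assumes "x \<in> X" "i < 3" "j < 3" "\<rho> \<in> carrier (Aut P)" "\<sigma> \<in> carrier (Aut P)" "act \<rho> x = s i x" "act \<sigma> x = s j x"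
  shows "act ((\<rho> \<otimes>\<^bsub>Aut P\<^esub> \<sigma>) [^]\<^bsub>Aut P\<^esub> (k::nat)) x = ((\<lambda>u. s j (s i u)) ^^ k) x"
proof (induction k)
  case 0 then show ?case using act_one[OF assms(1)] by simp
next
  case (Suc k)
  interpret G: group "Aut P" by (rule group_Aut)
  let ?g = "\<rho> \<otimes>\<^bsub>Aut P\<^esub> \<sigma>"
  have c: "?g \<in> carrier (Aut P)" using assms by simp
  then have ck: "?g [^]\<^bsub>Aut P\<^esub> k \<in> carrier (Aut P)" by simp
  have "act ?g x = s j (s i x)"
    using act_mult[OF assms(4,5,1)] act_props(2)[OF assms(4,3,1)] assms(6,7) by simp
  then have "act (?g [^]\<^bsub>Aut P\<^esub> Suc k) x = act (?g [^]\<^bsub>Aut P\<^esub> k) (s j (s i x))" using act_mult[OF ck c assms(1)] by simp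
  also have "\<dots> = s j (s i (act (?g [^]\<^bsub>Aut P\<^esub> k) x))"
    using act_props(2)[OF ck assms(3) s_closed[OF assms(2,1)]] act_props(2)[OF ck assms(2,1)] by simp
  finally show ?case using Suc.IH by simp
qed

lemma ord_eq:
  assumes "x \<in> X" "i < 3" "j < 3" "\<rho> \<in> carrier (Aut P)" "\<sigma> \<in> carrier (Aut P)" "act \<rho> x = s i x" "act \<sigma> x = s j x"
    and "\<And>k. ((\<lambda>u. s j (s i u)) ^^ k) x = x \<longleftrightarrow> p dvd k"
  shows "group.ord (Aut P) (\<rho> \<otimes>\<^bsub>Aut P\<^esub> \<sigma>) = p"
proof -
  interpret G: group "Aut P" by (rule group_Aut)
  let ?g = "\<rho> \<otimes>\<^bsub>Aut P\<^esub> \<sigma>"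
  have c: "?g \<in> carrier (Aut P)" using assms by simp
  have "?g [^]\<^bsub>Aut P\<^esub> k = \<one>\<^bsub>Aut P\<^esub> \<longleftrightarrow> p dvd k" for k :: nat
  proof -
    have "?g [^]\<^bsub>Aut P\<^esub> k = \<one>\<^bsub>Aut P\<^esub> \<longleftrightarrow> act (?g [^]\<^bsub>Aut P\<^esub> k) x = x"
      using act_inj[OF _ _ assms(1), of "?g [^]\<^bsub>Aut P\<^esub> k" "\<one>\<^bsub>Aut P\<^esub>"] act_one[OF assms(1)] c by auto
    then show ?thesis using act_pow[OF assms(1-7)] assms(8) by simp
  qed
  then show ?thesis using G.ord_unique[OF c] by blast
qed

text \<open>The image is closed under the adjacency maps, so by connectedness it is all of
  \<open>X\<close>; finiteness then gives injectivity.\<close>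

lemma finite_comm_bij:
  assumes "finite X" "\<And>x. x \<in> X \<Longrightarrow> f x \<in> X" "\<And>i x. i < 3 \<Longrightarrow> x \<in> X \<Longrightarrow> f (s i x) = s i (f x)"
  shows "bij_betw f X X"
proof -
  obtain x0 where x0: "x0 \<in> X" using X_nonempty by blast
  have "X \<subseteq> f ` X"
  proof
    fix y assume y: "y \<in> X"
    show "y \<in> f ` X"
    proof (rule path_induct[OF assms(2)[OF x0] y, of "\<lambda>u. u \<in> f ` X"])
      show "f x0 \<in> f ` X" using x0 by blast
      fix u and i :: nat assume "u \<in> f ` X" "i < 3"
      then obtain w where "w \<in> X" "u = f w" by blast
      then have "s i u = f (s i w)" "s i w \<in> X" using assms(3) s_closed \<open>i < 3\<close> by simp_all
      then show "s i u \<in> f ` X" by (rule image_eqI)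
    qed
  qed
  then have "f ` X = X" using assms(2) by blast
  then show ?thesis using assms(1) by (metis bij_betw_def eq_card_imp_inj_on)
qed

end

section \<open>The toroidal map\<close>

definition path_rel :: "'x set \<Rightarrow> (nat \<Rightarrow> 'x \<Rightarrow> 'x) \<Rightarrow> nat set \<Rightarrow> 'x rel" where
  "path_rel X s J = {(u, s i u) | u i. u \<in> X \<and> i < 3 \<and> i \<in> J}"

lemma path_rel_step:
  "(x, u) \<in> (path_rel X s J)\<^sup>* \<Longrightarrow> u \<in> X \<Longrightarrow> i < 3 \<Longrightarrow> i \<in> J \<Longrightarrow> (x, s i u) \<in> (path_rel X s J)\<^sup>*"
  unfolding path_rel_def by (rule rtrancl.rtrancl_into_rtrancl) auto

lemma path_rel_mono: "J \<subseteq> K \<Longrightarrow> (x, y) \<in> (path_rel X s J)\<^sup>* \<Longrightarrow> (x, y) \<in> (path_rel X s K)\<^sup>*"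
  using rtrancl_mono[of "path_rel X s J" "path_rel X s K"] unfolding path_rel_def by blast

text \<open>One hypothesis for each set of shared proper faces. If all three are shared,
  \<open>A12\<close> leaves \<open>x\<close> and \<open>s 2 x\<close>, and \<open>ne\<close>
  excludes the latter.\<close>

lemma strong_connectedI:
  assumes A0: "(x, y) \<in> (path_rel X s {0, 1, 2})\<^sup>*"
    and A1: "q 1 x = q 1 y \<Longrightarrow> (x, y) \<in> (path_rel X s {1, 2})\<^sup>*"
    and A2: "q 2 x = q 2 y \<Longrightarrow> (x, y) \<in> (path_rel X s {0, 2})\<^sup>*"
    and A3: "q 3 x = q 3 y \<Longrightarrow> (x, y) \<in> (path_rel X s {0, 1})\<^sup>*"
    and A12: "q 1 x = q 1 y \<Longrightarrow> q 2 x = q 2 y \<Longrightarrow> y = x \<or> y = s 2 x"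
    and A23: "q 2 x = q 2 y \<Longrightarrow> q 3 x = q 3 y \<Longrightarrow> y = x \<or> y = s 0 x"
    and A13: "q 1 x = q 1 y \<Longrightarrow> q 3 x = q 3 y \<Longrightarrow> y = x \<or> y = s 1 x"
    and ne: "q 3 (s 2 x) \<noteq> q 3 x" and x: "x \<in> X"
  shows "(x, y) \<in> {(u, s i u) | u i. u \<in> X \<and> i < 3 \<and> q (Suc i) x \<noteq> q (Suc i) y}\<^sup>*"
proof -
  let ?J = "{i. q (Suc i) x \<noteq> q (Suc i) y}"
  have st: "(x, s i x) \<in> (path_rel X s J)\<^sup>*" if "i < 3" "i \<in> J" for i J
    by (rule path_rel_step[OF rtrancl_refl x that])
  have n: "Suc 0 = 1" "Suc 1 = 2" "Suc 2 = 3" by simp_all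
  have J: "0 \<in> ?J \<longleftrightarrow> q 1 x \<noteq> q 1 y" "1 \<in> ?J \<longleftrightarrow> q 2 x \<noteq> q 2 y" "2 \<in> ?J \<longleftrightarrow> q 3 x \<noteq> q 3 y"
    unfolding mem_Collect_eq n by (rule refl)+
  have "(x, y) \<in> (path_rel X s ?J)\<^sup>*"
  proof (cases "q 1 x = q 1 y")
    case 1: True
    show ?thesis
    proof (cases "q 2 x = q 2 y")
      case 2: True
      show ?thesis
      proof (cases "q 3 x = q 3 y")
        case True
        then have "y = x" using A12[OF 1 2] ne by metis
        then show ?thesis by simp
      next
        case False
        then have "2 \<in> ?J" using J by blast
        then show ?thesis using A12[OF 1 2] st[of 2 ?J] by auto
      qed
    next
      case 2: False
      show ?thesis
      proof (cases "q 3 x = q 3 y")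
        case True
        have "1 \<in> ?J" using J 2 by blast
        then show ?thesis using A13[OF 1 True] st[of 1 ?J] by auto
      next
        case False
        then have "{1, 2} \<subseteq> ?J" using J 2 by blast
        then show ?thesis using A1[OF 1] by (rule path_rel_mono)
      qed
    qed
  next
    case 1: False
    show ?thesis
    proof (cases "q 2 x = q 2 y")
      case 2: True
      show ?thesis
      proof (cases "q 3 x = q 3 y")
        case True
        have "0 \<in> ?J" using J 1 by blast
        then show ?thesis using A23[OF 2 True] st[of 0 ?J] by auto
      next
        case False
        then have "{0, 2} \<subseteq> ?J" using J 1 by blast
        then show ?thesis using A2[OF 2] by (rule path_rel_mono)
      qed
    next
      case 2: False
      show ?thesis
      proof (cases "q 3 x = q 3 y")
        case True
        have "{0, 1} \<subseteq> ?J" using J 1 2 by blast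
        then show ?thesis using A3[OF True] by (rule path_rel_mono)
      next
        case False
        then have "{0, 1, 2} \<subseteq> ?J" using J 1 2 by blast
        then show ?thesis using A0 by (rule path_rel_mono)
      qed
    qed
  qed
  then show ?thesis by (simp add: path_rel_def)
qed

text \<open>
  The cell with centre \<open>c / 2\<close>; its rank is the number of odd coordinates of \<open>c\<close>.
\<close>

definition cell :: "int \<times> int \<Rightarrow> (int \<times> int) set" where
  "cell c = {u. \<bar>2 * fst u - fst c\<bar> \<le> 1 \<and> \<bar>2 * snd u - snd c\<bar> \<le> 1}"

text \<open>The lowest and the highest corner of a cell; testing these two suffices to restrict the
  cells that contain it.\<close>

lemma cell_lo_hi: "(fst c div 2, snd c div 2) \<in> cell c" "((fst c + 1) div 2, (snd c + 1) div 2) \<in> cell c"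
  unfolding cell_def by (simp_all, presburger+)

lemma cell_subset1:
  fixes a a' :: int
  assumes "\<bar>2 * (a div 2) - a'\<bar> \<le> 1" "\<bar>2 * ((a + 1) div 2) - a'\<bar> \<le> 1"
  shows "a' = a \<or> (even a \<and> (a' = a + 1 \<or> a' = a - 1))"
  using assms by presburger

lemma cell_subset:
  assumes "cell c \<subseteq> cell c'"
  shows "fst c' = fst c \<or> (even (fst c) \<and> (fst c' = fst c + 1 \<or> fst c' = fst c - 1))"
    "snd c' = snd c \<or> (even (snd c) \<and> (snd c' = snd c + 1 \<or> snd c' = snd c - 1))"
proof -
  have "(fst c div 2, snd c div 2) \<in> cell c'" "((fst c + 1) div 2, (snd c + 1) div 2) \<in> cell c'"
    using cell_lo_hi assms by blast+
  then show "fst c' = fst c \<or> (even (fst c) \<and> (fst c' = fst c + 1 \<or> fst c' = fst c - 1))"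
    "snd c' = snd c \<or> (even (snd c) \<and> (snd c' = snd c + 1 \<or> snd c' = snd c - 1))"
    unfolding cell_def by (simp_all add: cell_subset1)
qed

lemma cell_inj: "cell c = cell c' \<Longrightarrow> c = c'"
proof -
  assume "cell c = cell c'"
  then have i: "cell c \<subseteq> cell c'" "cell c' \<subseteq> cell c" by simp_all
  have "fst c = fst c'" using cell_subset(1)[OF i(1)] cell_subset(1)[OF i(2)] by presburger
  moreover have "snd c = snd c'" using cell_subset(2)[OF i(1)] cell_subset(2)[OF i(2)] by presburger
  ultimately show ?thesis by (rule prod_eqI)
qed

lemma cell_not_trivial: "cell c \<noteq> {}" "cell c \<noteq> UNIV"
proof -
  show "cell c \<noteq> {}" using cell_lo_hi by blast
  have "(fst c + 2, 0) \<notin> cell c \<or> (fst c - 2, 0) \<notin> cell c" unfolding cell_def by auto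
  then show "cell c \<noteq> UNIV" by blast
qed

text \<open>The four kinds of proper faces correspond to the four parities of the doubled
  centre.\<close>

lemma square_tessellation_faces_eq: "square_tessellation_faces = {{}, UNIV} \<union> range cell"
proof -
  have 1: "{(x, y)} = cell (2 * x, 2 * y)" for x y unfolding cell_def by (auto; presburger)
  have 2: "{(x, y), (x + 1, y)} = cell (2 * x + 1, 2 * y)" for x y unfolding cell_def by (auto; presburger)
  have 3: "{(x, y), (x, y + 1)} = cell (2 * x, 2 * y + 1)" for x y unfolding cell_def by (auto; presburger)
  have 4: "{x, x + 1} \<times> {y, y + 1} = cell (2 * x + 1, 2 * y + 1)" for x y unfolding cell_def by (auto; presburger)
  let ?S = square_tessellation_faces
  have m: "cell (2 * x, 2 * y) \<in> ?S" "cell (2 * x + 1, 2 * y) \<in> ?S" "cell (2 * x, 2 * y + 1) \<in> ?S" "cell (2 * x + 1, 2 * y + 1) \<in> ?S" for x y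
    unfolding 1[symmetric] 2[symmetric] 3[symmetric] 4[symmetric] square_tessellation_faces_def by blast+
  have "cell c \<in> ?S" for c
  proof -
    define x where "x = fst c div 2"
    define y where "y = snd c div 2"
    have x: "fst c = 2 * x \<or> fst c = 2 * x + 1" unfolding x_def by presburger
    have y: "snd c = 2 * y \<or> snd c = 2 * y + 1" unfolding y_def by presburger
    have "cell (fst c, snd c) \<in> ?S" using x y m[of x y] by (elim disjE) simp_all
    then show ?thesis by simp
  qed
  then have "range cell \<subseteq> square_tessellation_faces" by blast
  moreover have "{{}, UNIV} \<subseteq> square_tessellation_faces" unfolding square_tessellation_faces_def by auto
  moreover have "{(x, y)} \<in> range cell" "{(x, y), (x + 1, y)} \<in> range cell" "{(x, y), (x, y + 1)} \<in> range cell" "{x, x + 1} \<times> {y, y + 1} \<in> range cell" for x y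
    by (subst 1, rule rangeI, subst 2, rule rangeI, subst 3, rule rangeI, subst 4, rule rangeI)
  then have "square_tessellation_faces \<subseteq> {{}, UNIV} \<union> range cell"
    unfolding square_tessellation_faces_def by auto
  ultimately show ?thesis by (intro subset_antisym Un_least)
qed

text \<open>The rows of the eight signed permutation matrices, which form the point group of the
  square lattice, dihedral of order 8.\<close>

definition frames :: "((int \<times> int) \<times> (int \<times> int)) set" where
  "frames = {((1, 0), (0, 1)), ((1, 0), (0, -1)), ((-1, 0), (0, 1)), ((-1, 0), (0, -1)),
             ((0, 1), (1, 0)), ((0, 1), (-1, 0)), ((0, -1), (1, 0)), ((0, -1), (-1, 0))}"

lemma framesE [consumes 1, case_names 1 2 3 4 5 6 7 8]:
  assumes "(d, e) \<in> frames"
  obtains "d = (1, 0)" "e = (0, 1)" | "d = (1, 0)" "e = (0, -1)" | "d = (-1, 0)" "e = (0, 1)" | "d = (-1, 0)" "e = (0, -1)"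
    | "d = (0, 1)" "e = (1, 0)" | "d = (0, 1)" "e = (-1, 0)" | "d = (0, -1)" "e = (1, 0)" | "d = (0, -1)" "e = (-1, 0)"
  using assms unfolding frames_def by blast

text \<open>
  The flag \<open>(v, d, e)\<close> has the vertex \<open>v\<close>, the edge from \<open>v\<close> to \<open>v + d\<close> and the square spanned at \<open>v\<close>
  by \<open>d\<close> and \<open>e\<close>.
\<close>

type_synonym torus_flag = "(int \<times> int) \<times> (int \<times> int) \<times> (int \<times> int)"

text \<open>Doubled centres of the vertex, the edge and the square of a flag; doubling keeps them
  integral.\<close>

definition centre :: "nat \<Rightarrow> torus_flag \<Rightarrow> int \<times> int" where
  "centre i x = (case x of (v, d, e) \<Rightarrow> if i = 1 then v + v else if i = 2 then v + v + d else v + v + d + e)"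

lemma centre_simps [simp]:
  "centre 1 (v, d, e) = v + v" "centre (Suc 0) (v, d, e) = v + v" "centre 2 (v, d, e) = v + v + d" "centre 3 (v, d, e) = v + v + d + e"
  unfolding centre_def by simp_all

locale torus =
  fixes b :: nat
  assumes b3: "b \<ge> 3"
begin

definition md :: "int \<times> int \<Rightarrow> int \<times> int" where "md v = (fst v mod int b, snd v mod int b)"

definition X :: "torus_flag set" where "X = {(v, d, e). v \<in> {0..<int b} \<times> {0..<int b} \<and> (d, e) \<in> frames}"

definition s :: "nat \<Rightarrow> torus_flag \<Rightarrow> torus_flag" where
  "s i x = (case x of (v, d, e) \<Rightarrow> if i = 0 then (md (v + d), -d, e) else if i = 1 then (v, e, d) else (v, d, -e))"

definition q :: "nat \<Rightarrow> torus_flag \<Rightarrow> (int \<times> int) set set" where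
  "q i x = translation_orbit b (if i = 0 then {} else if i = 4 then UNIV else cell (centre i x))"

lemma s_simps [simp]: "s 0 (v, d, e) = (md (v + d), -d, e)" "s 1 (v, d, e) = (v, e, d)" "s (Suc 0) (v, d, e) = (v, e, d)" "s 2 (v, d, e) = (v, d, -e)"
  unfolding s_def by simp_all

text \<open>Centres are doubled, so a translation by a multiple of \<open>b\<close> becomes a
  congruence modulo \<open>2 b\<close>.\<close>

definition cg :: "int \<times> int \<Rightarrow> int \<times> int \<Rightarrow> bool" where
  "cg c c' \<longleftrightarrow> 2 * int b dvd fst c - fst c' \<and> 2 * int b dvd snd c - snd c'"

lemma translate_cell: "(+) t ` cell c = cell (c + t + t)"
proof
  show "(+) t ` cell c \<subseteq> cell (c + t + t)" unfolding cell_def by auto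
  show "cell (c + t + t) \<subseteq> (+) t ` cell c"
  proof
    fix u assume "u \<in> cell (c + t + t)"
    then have "u - t \<in> cell c" unfolding cell_def by (auto simp: algebra_simps)
    moreover have "u = t + (u - t)" by simp
    ultimately show "u \<in> (+) t ` cell c" by (rule rev_image_eqI)
  qed
qed

lemma orbit_cell: "translation_orbit b (cell c) = {cell c' | c'. cg c' c}"
proof
  show "translation_orbit b (cell c) \<subseteq> {cell c' | c'. cg c' c}"
  proof
    fix A assume "A \<in> translation_orbit b (cell c)"
    then obtain i j where "A = (+) (int b * i, int b * j) ` cell c" unfolding translation_orbit_def by blast
    then have "A = cell (c + (int b * i, int b * j) + (int b * i, int b * j))" unfolding translate_cell .
    moreover have "cg (c + (int b * i, int b * j) + (int b * i, int b * j)) c" unfolding cg_def by (auto simp: algebra_simps)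
    ultimately show "A \<in> {cell c' | c'. cg c' c}" by blast
  qed
  show "{cell c' | c'. cg c' c} \<subseteq> translation_orbit b (cell c)"
  proof
    fix A assume "A \<in> {cell c' | c'. cg c' c}"
    then obtain c' where c': "A = cell c'" "cg c' c" by blast
    then obtain i j where "fst c' - fst c = 2 * int b * i" "snd c' - snd c = 2 * int b * j" unfolding cg_def by (auto elim!: dvdE)
    then have "c' = c + (int b * i, int b * j) + (int b * i, int b * j)" by (intro prod_eqI) (auto simp: algebra_simps)
    then have "A = (+) (int b * i, int b * j) ` cell c" unfolding c'(1) translate_cell by simp
    then show "A \<in> translation_orbit b (cell c)" unfolding translation_orbit_def by blast
  qed
qed

lemma cg_refl: "cg c c" and cg_sym: "cg c c' \<Longrightarrow> cg c' c"
  unfolding cg_def by (simp_all add: dvd_diff_commute)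

lemma cg_trans: "cg c c' \<Longrightarrow> cg c' c'' \<Longrightarrow> cg c c''"
  unfolding cg_def using dvd_add[of "2 * int b" "fst c - fst c'" "fst c' - fst c''"] dvd_add[of "2 * int b" "snd c - snd c'" "snd c' - snd c''"] by simp

lemma orbit_eq: "translation_orbit b (cell c) = translation_orbit b (cell c') \<longleftrightarrow> cg c c'"
proof
  assume e: "translation_orbit b (cell c) = translation_orbit b (cell c')"
  have "cell c \<in> translation_orbit b (cell c)" unfolding orbit_cell using cg_refl by blast
  then have "cell c \<in> {cell d | d. cg d c'}" unfolding e unfolding orbit_cell .
  then show "cg c c'" using cell_inj by blast
next
  assume "cg c c'"
  then show "translation_orbit b (cell c) = translation_orbit b (cell c')"
    unfolding orbit_cell using cg_trans cg_sym by blast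
qed

lemma orbit_trivial: "translation_orbit b {} = {{}}" "translation_orbit b UNIV = {UNIV}"
proof -
  show "translation_orbit b {} = {{}}" unfolding translation_orbit_def by simp
  have "(+) t ` UNIV = UNIV" for t :: "int \<times> int" by (rule surj_plus)
  then show "translation_orbit b UNIV = {UNIV}" unfolding translation_orbit_def by simp
qed

lemma orbit_cell_not_trivial: "translation_orbit b (cell c) \<noteq> translation_orbit b {}" "translation_orbit b (cell c) \<noteq> translation_orbit b UNIV"
  "translation_orbit b {} \<noteq> translation_orbit b UNIV"
proof -
  have "cell c \<in> translation_orbit b (cell c)" unfolding orbit_cell using cg_refl by blast
  then show "translation_orbit b (cell c) \<noteq> translation_orbit b {}" "translation_orbit b (cell c) \<noteq> translation_orbit b UNIV"
    unfolding orbit_trivial using cell_not_trivial by blast+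
  show "translation_orbit b {} \<noteq> translation_orbit b UNIV" unfolding orbit_trivial by simp
qed

lemma q_eq: "i \<in> {1, 2, 3} \<Longrightarrow> q i x = q i y \<longleftrightarrow> cg (centre i x) (centre i y)"
  unfolding q_def using orbit_eq by auto

end

lemma path_word:
  assumes "\<And>i x. i < 3 \<Longrightarrow> x \<in> X \<Longrightarrow> s i x \<in> X" "set word_simps \<subseteq> J" "\<And>i. i \<in> J \<Longrightarrow> i < 3" "x \<in> X"
  shows "fold s word_simps x \<in> X \<and> (x, fold s word_simps x) \<in> (path_rel X s J)\<^sup>*"
  using assms(2)
proof (induction word_simps rule: rev_induct)
  case Nil then show ?case using assms(4) by simp
next
  case (snoc i word_simps)
  have word_simps: "set word_simps \<subseteq> J" and i: "i \<in> J" using snoc.prems by simp_all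
  have i3: "i < 3" by (rule assms(3)[OF i])
  note IH = snoc.IH[OF word_simps]
  have "(x, s i (fold s word_simps x)) \<in> (path_rel X s J)\<^sup>*"
    by (rule path_rel_step[where s = s, OF conjunct2[OF IH] conjunct1[OF IH] i3 i])
  moreover have "s i (fold s word_simps x) \<in> X" by (rule assms(1)[OF i3 conjunct1[OF IH]])
  moreover have "fold s (word_simps @ [i]) x = s i (fold s word_simps x)" unfolding fold_append by (simp only: fold.simps o_apply id_apply)
  ultimately show ?case by (metis)
qed

section \<open>Incidence and strong flag connectedness on the torus\<close>

lemma frames_neg:
  assumes "(d, e) \<in> frames" shows "(-d, e) \<in> frames" "(d, -e) \<in> frames" "(e, d) \<in> frames"
  using assms by (elim framesE; simp add: frames_def)+

lemma frames_rel:
  assumes "(d, e) \<in> frames" "(d', e') \<in> frames"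
  shows "d' = d \<and> e' = e \<or> d' = e \<and> e' = d \<or> d' = -d \<and> e' = e \<or> d' = e \<and> e' = -d \<or>
     d' = d \<and> e' = -e \<or> d' = -e \<and> e' = d \<or> d' = -d \<and> e' = -e \<or> d' = -e \<and> e' = -d"
  using assms by (elim framesE) simp_all

lemma frames_parity:
  assumes "(d, e) \<in> frames"
  shows "odd (fst d) \<and> even (snd d) \<and> even (fst e) \<and> odd (snd e) \<or> even (fst d) \<and> odd (snd d) \<and> odd (fst e) \<and> even (snd e)"
  using assms by (elim framesE) simp_all

lemma frames_unit:
  assumes "(d, e) \<in> frames" "w \<in> {d, e, d + e}"
  shows "fst w \<in> {1, -1} \<or> snd w \<in> {1, -1 :: int}"
  using assms by (elim framesE) auto

context torus
begin

definition box :: "(int \<times> int) set" where "box = {0..<int b} \<times> {0..<int b}"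

lemma X_iff: "(v, d, e) \<in> X \<longleftrightarrow> v \<in> box \<and> (d, e) \<in> frames"
  unfolding X_def box_def by simp

lemma md_box: "md v \<in> box" unfolding md_def box_def using b3 by simp

lemma md_id: "v \<in> box \<Longrightarrow> md v = v" unfolding md_def box_def by (cases v) simp

lemma md_md: "md (md v + w) = md (v + w)" "md (w + md v) = md (w + v)"
  unfolding md_def by (simp_all add: mod_simps)

lemma md_eq_iff: "md v = md w \<longleftrightarrow> int b dvd fst v - fst w \<and> int b dvd snd v - snd w"
  unfolding md_def by (simp add: mod_eq_dvd_iff)

lemma cg_double: "cg (v + v) (w + w) \<longleftrightarrow> md v = md w"
proof -
  have "2 * int b dvd 2 * k \<longleftrightarrow> int b dvd k" for k by simp
  from this[of "fst v - fst w"] this[of "snd v - snd w"] show ?thesis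
    unfolding cg_def md_eq_iff by (simp add: algebra_simps)
qed

lemma cg_shift: "cg (c + w) (c' + w) \<longleftrightarrow> cg c c'"
  unfolding cg_def by simp

lemma cg_md: "cg (md v + md v + w) (v + v + w)"
  unfolding cg_shift cg_double by (simp add: md_id[OF md_box])

text \<open>The modulus \<open>2 b\<close> is even, so the parities of a centre, which give the rank
  and the direction of an edge, survive the passage to orbits.\<close>

lemma cg_parity: "cg c c' \<Longrightarrow> even (fst c) = even (fst c') \<and> even (snd c) = even (snd c')"
proof -
  assume "cg c c'"
  then have "2 dvd fst c - fst c'" "2 dvd snd c - snd c'" unfolding cg_def by (auto dest: dvd_mult_left)
  then show ?thesis by presburger
qed

lemma md_ne:
  assumes "(d, e) \<in> frames" "w \<in> {d, e, d + e}" shows "md (v + w) \<noteq> md v"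
proof
  assume "md (v + w) = md v"
  then have "int b dvd fst w" "int b dvd snd w" unfolding md_eq_iff by simp_all
  moreover have "\<not> int b dvd 1" "\<not> int b dvd -1" using b3 by simp_all
  ultimately show False using frames_unit[OF assms] by auto
qed

lemma s_in_X: "i < 3 \<Longrightarrow> x \<in> X \<Longrightarrow> s i x \<in> X"
proof -
  assume i: "i < 3" and x: "x \<in> X"
  obtain v d e where x': "x = (v, d, e)" by (cases x)
  have "i = 0 \<or> i = 1 \<or> i = 2" using i by auto
  then show ?thesis using x unfolding x' by (elim disjE) (simp_all add: X_iff md_box frames_neg)
qed

lemma s_s: "i < 3 \<Longrightarrow> x \<in> X \<Longrightarrow> s i (s i x) = x"
proof -
  assume i: "i < 3" and x: "x \<in> X"
  obtain v d e where x': "x = (v, d, e)" by (cases x)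
  have "i = 0 \<or> i = 1 \<or> i = 2" using i by auto
  then show ?thesis using x md_md(1)[of "v + d" "-d"] md_id[of v] unfolding x' by (elim disjE) (simp_all add: X_iff)
qed

lemma s_commute: "s 0 (s 2 x) = s 2 (s 0 x)"
  by (cases x) simp

lemma q1: "(v, d, e) \<in> X \<Longrightarrow> (v', d', e') \<in> X \<Longrightarrow> q 1 (v, d, e) = q 1 (v', d', e') \<longleftrightarrow> v = v'"
  using q_eq[of 1] cg_double[of v v'] md_id by (simp add: X_iff)

lemma q2:
  assumes "(v, d, e) \<in> X" "(v', d', e') \<in> X" "q 2 (v, d, e) = q 2 (v', d', e')"
  shows "(d' = d \<and> v' = v \<or> d' = -d \<and> v' = md (v + d)) \<and> (e' = e \<or> e' = -e)"
proof -
  have f: "(d, e) \<in> frames" "(d', e') \<in> frames" and v: "md v = v" "md v' = v'" using assms(1,2) md_id by (simp_all add: X_iff)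
  have cg: "cg (v + v + d) (v' + v' + d')" using assms(3) q_eq[of 2] by simp
  have "even (fst d) = even (fst d')" using cg_parity[OF cg] by simp
  then have "(d' = d \<or> d' = -d) \<and> (e' = e \<or> e' = -e)" using frames_rel[OF f] frames_parity[OF f(1)] by (elim disjE conjE) simp_all
  moreover have "v' = v" if "d' = d" using cg cg_double[of v v'] v unfolding that cg_shift by simp
  moreover have "v' = md (v + d)" if "d' = -d"
  proof -
    have "cg ((v + d) + (v + d)) (v' + v')" using cg cg_shift[of "v + v + d" d "v' + v' - d"] unfolding that by (simp add: algebra_simps)
    then show ?thesis unfolding cg_double v by simp
  qed
  ultimately show ?thesis by blast
qed

text \<open>These are the eight flags of a square: each of the eight possible frames determines the
  corner at which it sits.\<close>

lemma q3:
  assumes "(v, d, e) \<in> X" "(v', d', e') \<in> X" "q 3 (v, d, e) = q 3 (v', d', e')"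
  shows "v' = v \<and> (d' = d \<and> e' = e \<or> d' = e \<and> e' = d) \<or> v' = md (v + d) \<and> (d' = -d \<and> e' = e \<or> d' = e \<and> e' = -d) \<or>
     v' = md (v + e) \<and> (d' = d \<and> e' = -e \<or> d' = -e \<and> e' = d) \<or> v' = md (v + (d + e)) \<and> (d' = -d \<and> e' = -e \<or> d' = -e \<and> e' = -d)"
proof -
  have f: "(d, e) \<in> frames" "(d', e') \<in> frames" and v: "md v = v" "md v' = v'" using assms(1,2) md_id by (simp_all add: X_iff)
  have cg: "cg (v + v + d + e) (v' + v' + d' + e')" using assms(3) q_eq[of 3] by simp
  \<comment> \<open>The doubled centres agree modulo \<open>2 b\<close>, so the two corners differ
    modulo \<open>b\<close> by half the difference of \<open>d + e\<close> and
    \<open>d' + e'\<close>.\<close>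
  have *: "v' = md (v + w)" if w: "d + e = d' + e' + w + w" for w
  proof -
    have "v + v + d + e = v + v + (d + e)" by (simp only: add.assoc)
    then have "v + v + d + e = (v + w) + (v + w) + (d' + e')" unfolding w by (simp add: algebra_simps)
    moreover have "v' + v' + d' + e' = v' + v' + (d' + e')" by (simp only: add.assoc)
    ultimately have "cg ((v + w) + (v + w) + (d' + e')) (v' + v' + (d' + e'))" using cg by (simp only:)
    then show ?thesis unfolding cg_shift cg_double v by simp
  qed
  show ?thesis using frames_rel[OF f]
  proof (elim disjE conjE)
    assume "d' = d" "e' = e" then show ?thesis using *[of 0] v by simp
  next
    assume "d' = e" "e' = d" then show ?thesis using *[of 0] v by (simp add: add.commute)
  next
    assume "d' = -d" "e' = e" then show ?thesis using *[of d] by simp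
  next
    assume "d' = e" "e' = -d" then show ?thesis using *[of d] by simp
  next
    assume "d' = d" "e' = -e" then show ?thesis using *[of e] by simp
  next
    assume "d' = -e" "e' = d" then show ?thesis using *[of e] by simp
  next
    assume "d' = -d" "e' = -e" then show ?thesis using *[of "d + e"] by simp
  next
    assume "d' = -e" "e' = -d" then show ?thesis using *[of "d + e"] by simp
  qed
qed

text \<open>The two squares on an edge have doubled centres that differ by \<open>2 e\<close>, and
  \<open>e\<close> does not vanish modulo \<open>b\<close>.\<close>

lemma q3_s2: "(v, d, e) \<in> X \<Longrightarrow> q 3 (s 2 (v, d, e)) \<noteq> q 3 (v, d, e)"
proof
  assume x: "(v, d, e) \<in> X" and eq: "q 3 (s 2 (v, d, e)) = q 3 (v, d, e)"
  then have "cg (v + v + d - e) (v + v + d + e)" using q_eq[of 3 "s 2 (v, d, e)" "(v, d, e)"] by simp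
  then have "cg (v + v) ((v + e) + (v + e))" using cg_shift[of "v + v" "d - e" "v + v + e + e"] by (simp add: algebra_simps)
  then show False unfolding cg_double using md_ne[of d e e v] x by (simp add: X_iff)
qed

lemma q_s:
  assumes i: "i < 3" and x: "x \<in> X" and j: "j \<le> 4" "j \<noteq> Suc i"
  shows "q j (s i x) = q j x"
proof -
  obtain v d e where x': "x = (v, d, e)" by (cases x)
  have j': "j = 0 \<or> j = 4 \<or> j \<in> {1, 2, 3}" using j by auto
  show ?thesis
  proof (cases "j \<in> {1, 2, 3}")
    case False
    then show ?thesis using j' unfolding q_def by auto
  next
    case True
    have c2: "cg (centre 2 (s 0 x)) (centre 2 x)" using cg_md[of "v + d" "-d"] unfolding x' by (simp add: algebra_simps)
    have c3: "cg (centre 3 (s 0 x)) (centre 3 x)" using cg_md[of "v + d" "-d + e"] unfolding x' by (simp add: algebra_simps)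
    have "i = 0 \<or> i = 1 \<or> i = 2" using i by auto
    then have "cg (centre j (s i x)) (centre j x)" using True j(2) c2 c3 unfolding x'
      by (elim disjE insertE) (auto simp: cg_refl add.commute add.left_commute add.assoc)
    then show ?thesis using q_eq[OF True] by blast
  qed
qed

lemma q_s_ne:
  assumes i: "i < 3" and x: "x \<in> X"
  shows "q (Suc i) (s i x) \<noteq> q (Suc i) x"
proof -
  obtain v d e where x': "x = (v, d, e)" by (cases x)
  have vx: "v \<in> box" "(d, e) \<in> frames" using x unfolding x' by (simp_all add: X_iff)
  have "i = 0 \<or> i = 1 \<or> i = 2" using i by auto
  then show ?thesis
  proof (elim disjE)
    assume "i = 0"
    have "q 1 (s 0 x) \<noteq> q 1 x" using q1[of "md (v + d)" "-d" e v d e] md_ne[OF vx(2), of d v] md_id[OF vx(1)] s_in_X[of 0 x] x unfolding x' by simp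
    then show ?thesis unfolding \<open>i = 0\<close> by simp
  next
    assume "i = 1"
    have "q 2 (s 1 x) \<noteq> q 2 x"
    proof
      assume "q 2 (s 1 x) = q 2 x"
      then have "cg (v + v + e) (v + v + d)" using q_eq[of 2 "s 1 x" x] unfolding x' by simp
      from cg_parity[OF this] have "even (fst e) = even (fst d)" by simp
      then show False using frames_parity[OF vx(2)] by blast
    qed
    then show ?thesis unfolding \<open>i = 1\<close> Suc_1 .
  next
    assume "i = 2"
    have "q 3 (s 2 x) \<noteq> q 3 x" using q3_s2[of v d e] x unfolding x' by blast
    moreover have "Suc 2 = 3" by simp
    ultimately show ?thesis unfolding \<open>i = 2\<close> by metis
  qed
qed

text \<open>The number of odd coordinates of the doubled centre is 0, 1 or 2 for a vertex, an edge
  or a square, and congruence preserves it.\<close>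

lemma q_rank:
  assumes "x \<in> X" "y \<in> X" "i \<le> 4" "j \<le> 4" "q i x = q j y"
  shows "i = j"
proof -
  obtain v d e where x': "x = (v, d, e)" by (cases x)
  obtain v' d' e' where y': "y = (v', d', e')" by (cases y)
  have f: "(d, e) \<in> frames" "(d', e') \<in> frames" using assms(1,2) unfolding x' y' by (simp_all add: X_iff)
  have ij: "i = 0 \<or> i = 4 \<or> i \<in> {1, 2, 3}" "j = 0 \<or> j = 4 \<or> j \<in> {1, 2, 3}" using assms(3,4) by auto
  show ?thesis
  proof (cases "i \<in> {1, 2, 3} \<and> j \<in> {1, 2, 3}")
    case True
    then have "translation_orbit b (cell (centre i x)) = translation_orbit b (cell (centre j y))" using assms(5) unfolding q_def by auto
    then have "cg (centre i x) (centre j y)" unfolding orbit_eq .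
    from cg_parity[OF this] show ?thesis using True frames_parity[OF f(1)] frames_parity[OF f(2)] unfolding x' y' by auto
  next
    case False
    have q_s012: "q 0 u = translation_orbit b {}" "q 4 u = translation_orbit b UNIV" "k \<in> {1, 2, 3} \<Longrightarrow> q k u = translation_orbit b (cell (centre k u))" for u k
      unfolding q_def by auto
    show ?thesis using ij False assms(5) q_s012 orbit_cell_not_trivial by (elim disjE) metis+
  qed
qed

lemma fold_path:
  assumes "set word_simps \<subseteq> J" "J \<subseteq> {..<3}" "x \<in> X"
  shows "(x, fold s word_simps x) \<in> (path_rel X s J)\<^sup>*"
proof -
  have "i < 3" if "i \<in> J" for i using assms(2) that by auto
  then show ?thesis using path_word[where s = s and word_simps = word_simps, OF s_in_X assms(1) _ assms(3)] by blast
qed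

lemma same_vertex_path:
  assumes "(v, d, e) \<in> X" "(v, d', e') \<in> X"
  shows "((v, d, e), (v, d', e')) \<in> (path_rel X s {1, 2})\<^sup>*"
proof -
  have f: "(d, e) \<in> frames" "(d', e') \<in> frames" using assms by (simp_all add: X_iff)
  have "\<exists>word_simps. set word_simps \<subseteq> {1, 2} \<and> (v, d', e') = fold s word_simps (v, d, e)"
    using frames_rel[OF f]
  proof (elim disjE conjE)
    assume "d' = d" "e' = e" then show ?thesis by (intro exI[of _ "[]"]) simp
  next
    assume "d' = e" "e' = d" then show ?thesis by (intro exI[of _ "[1]"]) simp
  next
    assume "d' = -d" "e' = e" then show ?thesis by (intro exI[of _ "[1, 2, 1]"]) simp
  next
    assume "d' = e" "e' = -d" then show ?thesis by (intro exI[of _ "[1, 2]"]) simp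
  next
    assume "d' = d" "e' = -e" then show ?thesis by (intro exI[of _ "[2]"]) simp
  next
    assume "d' = -e" "e' = d" then show ?thesis by (intro exI[of _ "[2, 1]"]) simp
  next
    assume "d' = -d" "e' = -e" then show ?thesis by (intro exI[of _ "[2, 1, 2, 1]"]) simp
  next
    assume "d' = -e" "e' = -d" then show ?thesis by (intro exI[of _ "[2, 1, 2]"]) simp
  qed
  then obtain word_simps where word_simps: "set word_simps \<subseteq> {1, 2}" "(v, d', e') = fold s word_simps (v, d, e)" by blast
  show ?thesis unfolding word_simps(2) by (rule fold_path[OF word_simps(1) _ assms(1)]) simp
qed

lemma same_face_path:
  assumes "x \<in> X" "y \<in> X" "q 3 x = q 3 y"
  shows "(x, y) \<in> (path_rel X s {0, 1})\<^sup>*"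
proof -
  obtain v d e where x': "x = (v, d, e)" by (cases x)
  obtain v' d' e' where y': "y = (v', d', e')" by (cases y)
  have "\<exists>word_simps. set word_simps \<subseteq> {0, 1} \<and> y = fold s word_simps x"
    using q3[OF assms[unfolded x' y']] unfolding x' y'
  proof (elim disjE conjE)
    assume "v' = v" "d' = d" "e' = e" then show "\<exists>word_simps. set word_simps \<subseteq> {0, 1} \<and> (v', d', e') = fold s word_simps (v, d, e)" by (intro exI[of _ "[]"]) simp
  next
    assume "v' = v" "d' = e" "e' = d" then show "\<exists>word_simps. set word_simps \<subseteq> {0, 1} \<and> (v', d', e') = fold s word_simps (v, d, e)" by (intro exI[of _ "[1]"]) simp
  next
    assume "v' = md (v + d)" "d' = -d" "e' = e" then show "\<exists>word_simps. set word_simps \<subseteq> {0, 1} \<and> (v', d', e') = fold s word_simps (v, d, e)" by (intro exI[of _ "[0]"]) simp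
  next
    assume "v' = md (v + d)" "d' = e" "e' = -d" then show "\<exists>word_simps. set word_simps \<subseteq> {0, 1} \<and> (v', d', e') = fold s word_simps (v, d, e)" by (intro exI[of _ "[0, 1]"]) simp
  next
    assume "v' = md (v + e)" "d' = d" "e' = -e" then show "\<exists>word_simps. set word_simps \<subseteq> {0, 1} \<and> (v', d', e') = fold s word_simps (v, d, e)" by (intro exI[of _ "[1, 0, 1]"]) simp
  next
    assume "v' = md (v + e)" "d' = -e" "e' = d" then show "\<exists>word_simps. set word_simps \<subseteq> {0, 1} \<and> (v', d', e') = fold s word_simps (v, d, e)" by (intro exI[of _ "[1, 0]"]) simp
  next
    assume "v' = md (v + (d + e))" "d' = -d" "e' = -e" then show "\<exists>word_simps. set word_simps \<subseteq> {0, 1} \<and> (v', d', e') = fold s word_simps (v, d, e)" by (intro exI[of _ "[0, 1, 0, 1]"]) (simp add: md_md add.assoc)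
  next
    assume "v' = md (v + (d + e))" "d' = -e" "e' = -d" then show "\<exists>word_simps. set word_simps \<subseteq> {0, 1} \<and> (v', d', e') = fold s word_simps (v, d, e)" by (intro exI[of _ "[0, 1, 0]"]) (simp add: md_md add.assoc)
  qed
  then obtain word_simps where word_simps: "set word_simps \<subseteq> {0, 1}" "y = fold s word_simps x" by blast
  show ?thesis unfolding word_simps(2) by (rule fold_path[OF word_simps(1) _ assms(1)]) simp
qed

lemma same_edge_cases:
  assumes "x \<in> X" "y \<in> X" "q 2 x = q 2 y"
  shows "y \<in> {x, s 2 x, s 0 x, s 0 (s 2 x)}"
proof -
  obtain v d e where x': "x = (v, d, e)" by (cases x)
  obtain v' d' e' where y': "y = (v', d', e')" by (cases y)
  show ?thesis using q2[OF assms[unfolded x' y']] unfolding x' y' by auto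
qed

text \<open>Rotate the frame at \<open>v\<close> until it points along \<open>d\<close>, cross the
  edge with \<open>s 0\<close>, and rotate back.\<close>

lemma translate_path:
  assumes f: "(d, e) \<in> frames" and x: "(v, g) \<in> X"
  shows "((v, g), (md (v + d), g)) \<in> (path_rel X s {0, 1, 2})\<^sup>*"
proof -
  obtain d' e' where g: "g = (d', e')" by (cases g)
  have v: "v \<in> box" "(d', e') \<in> frames" using x unfolding g by (simp_all add: X_iff)
  have m: "(u, w) \<in> (path_rel X s {1, 2})\<^sup>* \<Longrightarrow> (u, w) \<in> (path_rel X s {0, 1, 2})\<^sup>*" for u w
    by (erule path_rel_mono[rotated]) simp
  have 1: "((v, d', e'), (v, d, e)) \<in> (path_rel X s {0, 1, 2})\<^sup>*" by (rule m[OF same_vertex_path]) (use v f in \<open>simp_all add: X_iff\<close>)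
  have "((v, d', e'), s 0 (v, d, e)) \<in> (path_rel X s {0, 1, 2})\<^sup>*" by (rule path_rel_step[OF 1]) (use v f in \<open>simp_all add: X_iff\<close>)
  then have 2: "((v, d', e'), (md (v + d), -d, e)) \<in> (path_rel X s {0, 1, 2})\<^sup>*" by simp
  have "((md (v + d), -d, e), (md (v + d), d', e')) \<in> (path_rel X s {0, 1, 2})\<^sup>*"
    by (rule m[OF same_vertex_path]) (use v f md_box frames_neg in \<open>simp_all add: X_iff\<close>)
  with 2 show ?thesis unfolding g by (rule rtrancl_trans)
qed

lemma connected_path:
  assumes "x \<in> X" "y \<in> X"
  shows "(x, y) \<in> (path_rel X s {0, 1, 2})\<^sup>*"
proof -
  obtain v d e where x': "x = (v, d, e)" by (cases x)
  obtain v' d' e' where y': "y = (v', d', e')" by (cases y)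
  let ?R = "(path_rel X s {0, 1, 2})\<^sup>*"
  have vx: "v \<in> box" "(d, e) \<in> frames" "v' \<in> box" "(d', e') \<in> frames" using assms unfolding x' y' by (simp_all add: X_iff)
  have step: "((w, d, e), (md (w + (int k * fst g, int k * snd g)), d, e)) \<in> ?R" if "(g, h) \<in> frames" "w \<in> box" for w g h k
  proof (induction k)
    case 0
    have "(0, 0) = (0 :: int \<times> int)" by (simp add: zero_prod_def)
    then show ?case using md_id[OF that(2)] by simp
  next
    case (Suc k)
    have A: "((md (w + (int k * fst g, int k * snd g)), d, e), (md (md (w + (int k * fst g, int k * snd g)) + g), d, e)) \<in> ?R"
      by (rule translate_path[OF that(1)]) (simp add: X_iff md_box vx)
    have E: "md (md (w + (int k * fst g, int k * snd g)) + g) = md (w + (int (Suc k) * fst g, int (Suc k) * snd g))"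
    proof -
      have "w + (int k * fst g, int k * snd g) + g = w + (int (Suc k) * fst g, int (Suc k) * snd g)" by (cases w; cases g) (simp add: algebra_simps)
      then show ?thesis by (simp only: md_md)
    qed
    from rtrancl_trans[OF Suc.IH A] show ?case unfolding E .
  qed
  define k l where "k = nat ((fst v' - fst v) mod int b)" and "l = nat ((snd v' - snd v) mod int b)"
  have kl: "int k = (fst v' - fst v) mod int b" "int l = (snd v' - snd v) mod int b" unfolding k_def l_def using b3 by simp_all
  have 1: "((v, d, e), (md (v + (int k, 0)), d, e)) \<in> ?R" using step[of "(1, 0)" "(0, 1)" v k] vx by (simp add: frames_def)
  have 2: "((md (v + (int k, 0)), d, e), (md (md (v + (int k, 0)) + (0, int l)), d, e)) \<in> ?R" using step[of "(0, 1)" "(1, 0)" "md (v + (int k, 0))" l] md_box by (simp add: frames_def)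
  have "md (md (v + (int k, 0)) + (0, int l)) = md v'"
    unfolding md_md by (cases v; cases v') (simp add: md_def kl mod_simps)
  then have 3: "md (md (v + (int k, 0)) + (0, int l)) = v'" using md_id[OF vx(3)] by simp
  have "((v', d, e), (v', d', e')) \<in> ?R"
    by (rule path_rel_mono[of "{1, 2}", OF _ same_vertex_path]) (simp_all add: X_iff vx)
  moreover have "((v, d, e), (v', d, e)) \<in> ?R" using rtrancl_trans[OF 1 2] unfolding 3 .
  ultimately show ?thesis unfolding x' y' by (rule rtrancl_trans[rotated])
qed

lemma torus_strong:
  assumes "x \<in> X" "y \<in> X"
  shows "(x, y) \<in> {(u, s i u) | u i. u \<in> X \<and> i < 3 \<and> q (Suc i) x \<noteq> q (Suc i) y}\<^sup>*"
proof (rule strong_connectedI)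
  obtain v d e where x': "x = (v, d, e)" by (cases x)
  obtain v' d' e' where y': "y = (v', d', e')" by (cases y)
  have vx: "v \<in> box" "(d, e) \<in> frames" using assms unfolding x' y' by (simp_all add: X_iff)
  note q1' = q1[OF assms[unfolded x' y']]
  show "(x, y) \<in> (path_rel X s {0, 1, 2})\<^sup>*" by (rule connected_path[OF assms])
  show "(x, y) \<in> (path_rel X s {1, 2})\<^sup>*" if "q 1 x = q 1 y"
    using same_vertex_path assms that q1' unfolding x' y' by simp
  show "(x, y) \<in> (path_rel X s {0, 2})\<^sup>*" if "q 2 x = q 2 y"
  proof -
    have *: "(x, fold s word_simps x) \<in> (path_rel X s {0, 2})\<^sup>*" if "set word_simps \<subseteq> {0, 2}" for word_simps
      by (rule fold_path[OF that _ assms(1)]) simp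
    show ?thesis using same_edge_cases[OF assms that] *[of "[]"] *[of "[0]"] *[of "[2]"] *[of "[2, 0]"] by auto
  qed
  show "(x, y) \<in> (path_rel X s {0, 1})\<^sup>*" if "q 3 x = q 3 y" by (rule same_face_path[OF assms that])
  show "q 3 (s 2 x) \<noteq> q 3 x" using q3_s2 assms unfolding x' by simp
  show "x \<in> X" by fact
  show "y = x \<or> y = s 2 x" if "q 1 x = q 1 y" "q 2 x = q 2 y"
  proof -
    have "v' = v" using that(1) q1' unfolding x' y' by simp
    then have "v' \<noteq> md (v + d)" using md_ne[OF vx(2), of d v] md_id[OF vx(1)] by simp
    then have "d' = d \<and> (e' = e \<or> e' = -e)"
      using q2[OF assms[unfolded x' y'] that(2)[unfolded x' y']] by blast
    then show ?thesis unfolding x' y' \<open>v' = v\<close> by (elim disjE conjE) simp_all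
  qed
  show "y = x \<or> y = s 0 x" if "q 2 x = q 2 y" "q 3 x = q 3 y"
  proof -
    have 1: "q 3 (s 2 x) \<noteq> q 3 x" unfolding x' by (rule q3_s2) (use assms x' in blast)
    have 2: "q 3 (s 0 (s 2 x)) = q 3 (s 2 x)" by (rule q_s[OF _ s_in_X[OF _ assms(1)]]) simp_all
    have "y \<noteq> s 2 x" using 1 that(2) by metis
    moreover have "y \<noteq> s 0 (s 2 x)" using 1 2 that(2) by metis
    ultimately show ?thesis using same_edge_cases[OF assms that(1)] by blast
  qed
  show "y = x \<or> y = s 1 x" if "q 1 x = q 1 y" "q 3 x = q 3 y"
  proof -
    have "v' = v" using that(1) q1' unfolding x' y' by simp
    then have "v' \<noteq> md (v + d)" "v' \<noteq> md (v + e)" "v' \<noteq> md (v + (d + e))"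
      using md_ne[OF vx(2), of d v] md_ne[OF vx(2), of e v] md_ne[OF vx(2), of "d + e" v] md_id[OF vx(1)] by simp_all
    then have "d' = d \<and> e' = e \<or> d' = e \<and> e' = d"
      using q3[OF assms[unfolded x' y'] that(2)[unfolded x' y']] by blast
    then show ?thesis unfolding x' y' \<open>v' = v\<close> by (elim disjE conjE) simp_all
  qed
qed

end

section \<open>The toroidal map as a regular non-flat polyhedron\<close>

context torus
begin

text \<open>A coordinate of the larger centre equals that of the smaller one or, where the latter is
  even, is next to it. In each case a frame at a corner of the smaller cell points towards the
  larger one; reducing the corner modulo \<open>b\<close> yields a flag in \<open>X\<close>.\<close>

lemma cover:
  assumes "cell c \<subseteq> cell c'"
  shows "\<exists>x i j. x \<in> X \<and> i \<in> {1, 2, 3} \<and> j \<in> {1, 2, 3} \<and> i \<le> j \<and> translation_orbit b (cell c) = q i x \<and> translation_orbit b (cell c') = q j x"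
proof -
  have "\<exists>v d e i j. (d, e) \<in> frames \<and> i \<in> {1, 2, 3} \<and> j \<in> {1, 2, 3} \<and> i \<le> j \<and> c = centre i (v, d, e) \<and> c' = centre j (v, d, e)"
  proof -
    obtain a a2 where c: "c = (a, a2)" by (cases c)
    obtain a' a2' where c': "c' = (a', a2')" by (cases c')
    define k where "k = a div 2"
    define l where "l = a2 div 2"
    have k: "a = 2 * k \<or> a = 2 * k + 1" unfolding k_def by presburger
    have l: "a2 = 2 * l \<or> a2 = 2 * l + 1" unfolding l_def by presburger
    have s: "a' = a \<or> (even a \<and> (a' = a + 1 \<or> a' = a - 1))" "a2' = a2 \<or> (even a2 \<and> (a2' = a2 + 1 \<or> a2' = a2 - 1))"
      using cell_subset[OF assms] unfolding c c' by simp_all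
    have W: ?thesis if "(d, e) \<in> frames" "i \<in> {1, 2, 3}" "j \<in> {1, 2, 3}" "i \<le> j" "c = centre i (v, d, e)" "c' = centre j (v, d, e)" for v d e i j
      using that by blast
    have "a2' = a2" if "a2 = 2 * l + 1" using s(2) that by auto
    have "a' = a" if "a = 2 * k + 1" using s(1) that by auto
    from k show ?thesis
    proof
      assume a: "a = 2 * k"
      from l show ?thesis
      proof
        assume a2: "a2 = 2 * l"
        have A: "a' = 2 * k \<or> a' = 2 * k + 1 \<or> a' = 2 * k - 1" "a2' = 2 * l \<or> a2' = 2 * l + 1 \<or> a2' = 2 * l - 1" using s a a2 by auto
        have "?thesis" if "a' = 2 * k" "a2' = 2 * l"
          by (rule W[of "(1, 0)" "(0, 1)" 1 1 "(k, l)"]) (simp_all add: c c' a a2 that frames_def)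
        note K = this
        have "?thesis" if "a' = 2 * k" "a2' = 2 * l + 1"
          by (rule W[of "(0, 1)" "(1, 0)" 1 2 "(k, l)"]) (simp_all add: c c' a a2 that frames_def)
        note K = this K
        have "?thesis" if "a' = 2 * k" "a2' = 2 * l - 1"
          by (rule W[of "(0, -1)" "(1, 0)" 1 2 "(k, l)"]) (simp_all add: c c' a a2 that frames_def)
        note K = this K
        have "?thesis" if "a' = 2 * k + 1" "a2' = 2 * l"
          by (rule W[of "(1, 0)" "(0, 1)" 1 2 "(k, l)"]) (simp_all add: c c' a a2 that frames_def)
        note K = this K
        have "?thesis" if "a' = 2 * k + 1" "a2' = 2 * l + 1"
          by (rule W[of "(1, 0)" "(0, 1)" 1 3 "(k, l)"]) (simp_all add: c c' a a2 that frames_def)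
        note K = this K
        have "?thesis" if "a' = 2 * k + 1" "a2' = 2 * l - 1"
          by (rule W[of "(1, 0)" "(0, -1)" 1 3 "(k, l)"]) (simp_all add: c c' a a2 that frames_def)
        note K = this K
        have "?thesis" if "a' = 2 * k - 1" "a2' = 2 * l"
          by (rule W[of "(-1, 0)" "(0, 1)" 1 2 "(k, l)"]) (simp_all add: c c' a a2 that frames_def)
        note K = this K
        have "?thesis" if "a' = 2 * k - 1" "a2' = 2 * l + 1"
          by (rule W[of "(-1, 0)" "(0, 1)" 1 3 "(k, l)"]) (simp_all add: c c' a a2 that frames_def)
        note K = this K
        have "?thesis" if "a' = 2 * k - 1" "a2' = 2 * l - 1"
          by (rule W[of "(-1, 0)" "(0, -1)" 1 3 "(k, l)"]) (simp_all add: c c' a a2 that frames_def)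
        note K = this K
        from A K show ?thesis by blast
      next
        assume a2: "a2 = 2 * l + 1"
        then have a2': "a2' = a2" using s(2) by auto
        have "a' = a \<or> a' = a + 1 \<or> a' = a - 1" using s by blast
        then show ?thesis
          apply (elim disjE)
          subgoal by (rule W[of "(0, 1)" "(1, 0)" 2 2 "(k, l)"]) (simp_all add: c c' a a2 a2' frames_def)
          subgoal by (rule W[of "(0, 1)" "(1, 0)" 2 3 "(k, l)"]) (simp_all add: c c' a a2 a2' frames_def)
          subgoal by (rule W[of "(0, 1)" "(-1, 0)" 2 3 "(k, l)"]) (simp_all add: c c' a a2 a2' frames_def)
          done
      qed
    next
      assume a: "a = 2 * k + 1"
      then have a': "a' = a" using s(1) by auto
      from l show ?thesis
      proof
        assume a2: "a2 = 2 * l"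
        have "a2' = a2 \<or> a2' = a2 + 1 \<or> a2' = a2 - 1" using s by blast
        then show ?thesis
          apply (elim disjE)
          subgoal by (rule W[of "(1, 0)" "(0, 1)" 2 2 "(k, l)"]) (simp_all add: c c' a a' a2 frames_def)
          subgoal by (rule W[of "(1, 0)" "(0, 1)" 2 3 "(k, l)"]) (simp_all add: c c' a a' a2 frames_def)
          subgoal by (rule W[of "(1, 0)" "(0, -1)" 2 3 "(k, l)"]) (simp_all add: c c' a a' a2 frames_def)
          done
      next
        assume a2: "a2 = 2 * l + 1"
        then have "a2' = a2" using s(2) by auto
        then show ?thesis by (intro W[of "(1, 0)" "(0, 1)" 3 3 "(k, l)"]) (simp_all add: c c' a a' a2 frames_def)
      qed
    qed
  qed
  then obtain v d e i j where f: "(d, e) \<in> frames" "i \<in> {1, 2, 3}" "j \<in> {1, 2, 3}" "i \<le> j" "c = centre i (v, d, e)" "c' = centre j (v, d, e)" by metis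
  have m: "cg (centre k (v, d, e)) (centre k (md v, d, e))" if "k \<in> {1, 2, 3}" for k
  proof -
    have "cg (md v + md v + w) (v + v + w)" for w by (rule cg_md)
    from this[of 0] this[of d] this[of "d + e"] have "cg (md v + md v) (v + v)" "cg (md v + md v + d) (v + v + d)" "cg (md v + md v + d + e) (v + v + d + e)"
      by (simp_all add: add.assoc)
    then show ?thesis using that by (auto intro: cg_sym)
  qed
  have qk: "q k u = translation_orbit b (cell (centre k u))" if "k \<in> {1, 2, 3}" for k u using that unfolding q_def by auto
  have "translation_orbit b (cell c) = q i (md v, d, e)" "translation_orbit b (cell c') = q j (md v, d, e)"
    unfolding qk[OF f(2)] qk[OF f(3)] orbit_eq f(5,6) by (rule m[OF f(2)], rule m[OF f(3)])
  moreover have "(md v, d, e) \<in> X" using md_box f(1) by (simp add: X_iff)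
  ultimately show ?thesis using f(2-4) by blast
qed

lemma centre_subset:
  assumes "(d, e) \<in> frames" "i \<in> {1, 2, 3}" "j \<in> {1, 2, 3}" "i \<le> j"
  shows "cell (centre i (v, d, e)) \<subseteq> cell (centre j (v, d, e))"
proof -
  obtain k l where v: "v = (k, l)" by (cases v)
  have "cell (v + v) \<subseteq> cell (v + v + d)" "cell (v + v + d) \<subseteq> cell (v + v + d + e)"
    using assms(1) by (elim framesE; (simp add: v cell_def; clarsimp; presburger))+
  moreover from this have "cell (v + v) \<subseteq> cell (v + v + d + e)" by (rule subset_trans)
  ultimately show ?thesis using assms(2-4) by auto
qed

lemma toroidal_eq: "toroidal_map b = {(q i x, q j x) | i j x. x \<in> X \<and> i \<le> j \<and> j \<le> 4}"
proof
  have q04: "q 0 x = translation_orbit b {}" "q 4 x = translation_orbit b UNIV" for x unfolding q_def by simp_all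
  have qk: "q k u = translation_orbit b (cell (centre k u))" if "k \<in> {1, 2, 3}" for k u using that unfolding q_def by auto
  show "toroidal_map b \<subseteq> {(q i x, q j x) | i j x. x \<in> X \<and> i \<le> j \<and> j \<le> 4}" (is "_ \<subseteq> ?Q")
  proof
    fix p assume "p \<in> toroidal_map b"
    then obtain A B where p: "p = (translation_orbit b A, translation_orbit b B)" and AB: "A \<in> {{}, UNIV} \<union> range cell" "B \<in> {{}, UNIV} \<union> range cell" "A \<subseteq> B"
      unfolding toroidal_map_def square_tessellation_faces_eq by blast
    have I: "p \<in> ?Q" if "x \<in> X" "i \<le> j" "j \<le> 4" "translation_orbit b A = q i x" "translation_orbit b B = q j x" for x i j
      unfolding p using that by blast
    have x0: "((0, 0), (1, 0), (0, 1)) \<in> X" using b3 by (simp add: X_iff box_def frames_def)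
    have le: "i \<le> 4" if "i \<in> {1, 2, 3}" for i :: nat using that by auto
    consider "A = {}" "B = {}" | "A = {}" "B = UNIV" | c where "A = {}" "B = cell c" | "A = UNIV" "B = UNIV"
      | c where "A = cell c" "B = UNIV" | c c' where "A = cell c" "B = cell c'"
    proof -
      have "A = {} \<or> A = UNIV \<or> (\<exists>c. A = cell c)" "B = {} \<or> B = UNIV \<or> (\<exists>c. B = cell c)" using AB by blast+
      moreover have "\<not> (A = UNIV \<and> B = {})" "\<not> (A = cell c \<and> B = {})" "\<not> (A = UNIV \<and> B = cell c)" for c
        using AB(3) cell_not_trivial[of c] by blast+
      ultimately show thesis using that by metis
    qed
    then show "p \<in> ?Q"
    proof cases
      case 1 then show ?thesis using I[OF x0, of 0 0] q04 by simp
    next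
      case 2 then show ?thesis using I[OF x0, of 0 4] q04 by simp
    next
      case (3 c)
      obtain x i j where "x \<in> X" "j \<in> {1, 2, 3}" "translation_orbit b (cell c) = q j x" using cover[of c c] by blast
      then show ?thesis using I[of x 0 j] 3 q04 le by simp
    next
      case 4 then show ?thesis using I[OF x0, of 4 4] q04 by simp
    next
      case (5 c)
      obtain x i j where "x \<in> X" "j \<in> {1, 2, 3}" "translation_orbit b (cell c) = q j x" using cover[of c c] by blast
      then show ?thesis using I[of x j 4] 5 q04 le by simp
    next
      case (6 c c')
      then obtain x i j where "x \<in> X" "j \<in> {1, 2, 3}" "i \<le> j" "translation_orbit b (cell c) = q i x" "translation_orbit b (cell c') = q j x" using cover[of c c'] AB(3) by blast
      then show ?thesis using I[of x i j] 6 le by simp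
    qed
  qed
  show "?Q \<subseteq> toroidal_map b"
  proof
    fix p assume "p \<in> ?Q"
    then obtain i j x where p: "p = (q i x, q j x)" "x \<in> X" "i \<le> j" "j \<le> 4" by blast
    obtain v d e where x: "x = (v, d, e)" by (cases x)
    have f: "(d, e) \<in> frames" using p(2) unfolding x by (simp add: X_iff)
    have T: "p \<in> toroidal_map b" if "q i x = translation_orbit b A" "q j x = translation_orbit b B" "A \<in> {{}, UNIV} \<union> range cell" "B \<in> {{}, UNIV} \<union> range cell" "A \<subseteq> B" for A B
      unfolding toroidal_map_def square_tessellation_faces_eq p(1) using that by blast
    have "j = 0 \<or> j = 4 \<or> j \<in> {1, 2, 3}" "i = 0 \<or> i = 4 \<or> i \<in> {1, 2, 3}" using p(3,4) by auto
    then consider "i = 0" "j = 0" | "i = 0" "j = 4" | "i = 0" "j \<in> {1, 2, 3}" | "i = 4" "j = 4" | "i \<in> {1, 2, 3}" "j = 4" | "i \<in> {1, 2, 3}" "j \<in> {1, 2, 3}"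
      using p(3) by auto
    then show "p \<in> toroidal_map b"
    proof cases
      case 1 then show ?thesis using T[of "{}" "{}"] q04 by simp
    next
      case 2 then show ?thesis using T[of "{}" UNIV] q04 by simp
    next
      case 3 then show ?thesis using T[of "{}" "cell (centre j x)"] q04 qk[of j x] by simp
    next
      case 4 then show ?thesis using T[of UNIV UNIV] q04 by simp
    next
      case 5 then show ?thesis using T[of "cell (centre i x)" UNIV] q04 qk[of i x] by simp
    next
      case 6
      show ?thesis by (rule T[OF qk[OF 6(1)] qk[OF 6(2)]]) (use centre_subset[OF f 6 p(3)] in \<open>simp_all add: x\<close>)
    qed
  qed
qed

lemma x0: "((0, 0), (1, 0), (0, 1)) \<in> X" using b3 by (simp add: X_iff box_def frames_def)

theorem torus_flag_system: "flag_system (toroidal_map b) X s q"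
proof
  show "X \<noteq> {}" using x0 by blast
  show "\<And>i x. i < 3 \<Longrightarrow> x \<in> X \<Longrightarrow> s i x \<in> X" by (rule s_in_X)
  show "\<And>i x. i < 3 \<Longrightarrow> x \<in> X \<Longrightarrow> s i (s i x) = x" by (rule s_s)
  show "\<And>x. x \<in> X \<Longrightarrow> s 0 (s 2 x) = s 2 (s 0 x)" by (rule s_commute)
  show "\<And>i j x. i < 3 \<Longrightarrow> x \<in> X \<Longrightarrow> j \<le> 4 \<Longrightarrow> j \<noteq> Suc i \<Longrightarrow> q j (s i x) = q j x" by (rule q_s)
  show "\<And>i x. i < 3 \<Longrightarrow> x \<in> X \<Longrightarrow> q (Suc i) (s i x) \<noteq> q (Suc i) x" by (rule q_s_ne)
  show "\<And>i j x y. x \<in> X \<Longrightarrow> y \<in> X \<Longrightarrow> i \<le> 4 \<Longrightarrow> j \<le> 4 \<Longrightarrow> q i x = q j y \<Longrightarrow> i = j" by (rule q_rank)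
  show "\<And>x y. x \<in> X \<Longrightarrow> y \<in> X \<Longrightarrow> (x, y) \<in> {(u, s i u) |u i. u \<in> X \<and> i < 3 \<and> q (Suc i) x \<noteq> q (Suc i) y}\<^sup>*" by (rule torus_strong)
  show "toroidal_map b = {(q i x, q j x) | i j x. x \<in> X \<and> i \<le> j \<and> j \<le> 4}" by (rule toroidal_eq)
qed

text \<open>
  The flags form a semidirect product of the translations and the frames. Its left
  multiplications commute with the adjacency maps, which act by right multiplication.
\<close>

definition lmul :: "torus_flag \<Rightarrow> torus_flag \<Rightarrow> torus_flag" where
  "lmul g x = (case g of ((w1, w2), (a1, a2), (c1, c2)) \<Rightarrow> case x of ((v1, v2), (d1, d2), (e1, e2)) \<Rightarrow>
     (md (w1 + v1 * a1 + v2 * c1, w2 + v1 * a2 + v2 * c2), (d1 * a1 + d2 * c1, d1 * a2 + d2 * c2), (e1 * a1 + e2 * c1, e1 * a2 + e2 * c2)))"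

lemma frames_mul:
  assumes "((a1, a2), (c1, c2)) \<in> frames" "((d1, d2), (e1, e2)) \<in> frames"
  shows "((d1 * a1 + d2 * c1, d1 * a2 + d2 * c2), (e1 * a1 + e2 * c1, e1 * a2 + e2 * c2)) \<in> frames"
  using assms by (elim framesE) (simp_all add: frames_def)

lemma lmul_in: "g \<in> X \<Longrightarrow> x \<in> X \<Longrightarrow> lmul g x \<in> X"
  unfolding lmul_def by (auto simp: X_iff md_box split: prod.splits intro!: frames_mul)

lemma lmul_s: "i < 3 \<Longrightarrow> lmul g (s i x) = s i (lmul g x)"
proof -
  assume "i < 3"
  then have i: "i = 0 \<or> i = 1 \<or> i = 2" by auto
  obtain w1 w2 a1 a2 c1 c2 where g: "g = ((w1, w2), (a1, a2), (c1, c2))" by (metis surj_pair)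
  obtain v1 v2 d1 d2 e1 e2 where x: "x = ((v1, v2), (d1, d2), (e1, e2))" by (metis surj_pair)
  have M: "(w + p mod int b * a + r mod int b * c) mod int b = (w + p * a + r * c) mod int b" for w p a r c :: int
  proof -
    have "int b dvd p mod int b - p" "int b dvd r mod int b - r" by (simp_all add: mod_eq_dvd_iff[symmetric])
    then have "int b dvd (p mod int b - p) * a + (r mod int b - r) * c" by simp
    moreover have "(w + p mod int b * a + r mod int b * c) - (w + p * a + r * c) = (p mod int b - p) * a + (r mod int b - r) * c"
      by (simp add: algebra_simps)
    ultimately show ?thesis unfolding mod_eq_dvd_iff by simp
  qed
  have e: "md (w1 + (v1 + d1) mod int b * a1 + (v2 + d2) mod int b * c1, w2 + (v1 + d1) mod int b * a2 + (v2 + d2) mod int b * c2)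
     = md ((w1 + v1 * a1 + v2 * c1, w2 + v1 * a2 + v2 * c2) + (d1 * a1 + d2 * c1, d1 * a2 + d2 * c2))"
    unfolding md_def fst_conv snd_conv M by (simp add: algebra_simps)
  have mdp: "md ((v1, v2) + (d1, d2)) = ((v1 + d1) mod int b, (v2 + d2) mod int b)" unfolding md_def by simp
  have "lmul g (s 0 x) = s 0 (lmul g x)"
    unfolding g x lmul_def s_simps mdp prod.case md_md(1) e uminus_Pair by simp
  with i show ?thesis unfolding g x
    by (elim disjE) (simp_all add: lmul_def)
qed

lemma lmul_base: "g \<in> X \<Longrightarrow> lmul g ((0, 0), (1, 0), (0, 1)) = g"
  unfolding lmul_def using md_id by (auto simp: X_iff split: prod.splits)

lemma finite_X: "finite X" and card_X: "card X = 8 * b\<^sup>2"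
proof -
  have X: "X = box \<times> frames" unfolding X_def box_def by auto
  have f: "finite frames" "card frames = 8" unfolding frames_def by simp_all
  have bx: "finite box" "card box = b\<^sup>2" unfolding box_def by (simp_all add: power2_eq_square)
  show "finite X" unfolding X using f bx by simp
  show "card X = 8 * b\<^sup>2" unfolding X using f bx by (simp add: card_cartesian_product)
qed

text \<open>Compose the left multiplication by \<open>y\<close> with the inverse of that by
  \<open>x\<close>. The adjacency maps are a parameter, so that the torus and its Petrial are both
  covered.\<close>

lemma transitive_maps:
  assumes fs: "flag_system P X s' r" and s': "\<And>i g x. i < 3 \<Longrightarrow> g \<in> X \<Longrightarrow> x \<in> X \<Longrightarrow> lmul g (s' i x) = s' i (lmul g x)" and xy: "x \<in> X" "y \<in> X"
  shows "\<exists>f. bij_betw f X X \<and> (\<forall>i<3. \<forall>x\<in>X. f (s' i x) = s' i (f x)) \<and> f x = y"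
proof -
  interpret A: flag_system P X s' r by (rule fs)
  have bij: "bij_betw (lmul g) X X" if "g \<in> X" for g
    by (rule A.finite_comm_bij[OF finite_X lmul_in[OF that] s'[OF _ that]])
  let ?g = "inv_into X (lmul x)"
  have g: "bij_betw ?g X X" by (rule bij_betw_inv_into[OF bij[OF xy(1)]])
  have gc: "?g (s' i u) = s' i (?g u)" if "i < 3" "u \<in> X" for i u
    by (rule inv_flag_map[where f = "lmul x" and s = s' and t = s', OF fs bij[OF xy(1)] s'[OF _ xy(1)] that])
  have gX: "?g u \<in> X" if "u \<in> X" for u using g that unfolding bij_betw_def by blast
  have "?g x = ((0, 0), (1, 0), (0, 1))"
    using bij_betw_inv_into_left[OF bij[OF xy(1)] x0] lmul_base[OF xy(1)] by simp
  then have "(lmul y \<circ> ?g) x = y" using lmul_base[OF xy(2)] by simp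
  moreover have "bij_betw (lmul y \<circ> ?g) X X" by (rule bij_betw_trans[OF g bij[OF xy(2)]])
  moreover have "(lmul y \<circ> ?g) (s' i u) = s' i ((lmul y \<circ> ?g) u)" if "i < 3" "u \<in> X" for i u
    using gc[OF that] s'[OF that(1) xy(2) gX[OF that(2)]] by simp
  ultimately show ?thesis by blast
qed

lemma torus_regular: "regular_polyhedron (toroidal_map b)"
  by (rule flag_system.regularI[OF torus_flag_system transitive_maps[OF torus_flag_system lmul_s]])

lemma q1_image: "finite (q 1 ` X)" "card (q 1 ` X) = b\<^sup>2"
proof -
  have "q 1 ` X = (\<lambda>v. q 1 (v, (1, 0), (0, 1))) ` box"
  proof
    show "(\<lambda>v. q 1 (v, (1, 0), (0, 1))) ` box \<subseteq> q 1 ` X" by (auto simp: X_iff frames_def)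
    have qq: "q 1 (v, d, e) = q 1 (v, (1, 0), (0, 1))" for v d e unfolding q_def by simp
    show "q 1 ` X \<subseteq> (\<lambda>v. q 1 (v, (1, 0), (0, 1))) ` box"
    proof (rule image_subsetI)
      fix x assume "x \<in> X"
      moreover obtain v d e where x: "x = (v, d, e)" by (cases x)
      ultimately have "v \<in> box" by (simp add: X_iff)
      then show "q 1 x \<in> (\<lambda>v. q 1 (v, (1, 0), (0, 1))) ` box" unfolding x qq[of v d e] by (rule imageI)
    qed
  qed
  moreover have "inj_on (\<lambda>v. q 1 (v, (1, 0), (0, 1))) box"
    by (rule inj_onI) (subst (asm) q1, simp_all add: X_iff frames_def)
  ultimately show "card (q 1 ` X) = b\<^sup>2" "finite (q 1 ` X)" using card_image[of "\<lambda>v. q 1 (v, (1, 0), (0, 1))" box] finite_X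
    by (simp_all add: box_def power2_eq_square)
qed

lemma torus_nonflat: "nonflat_regular_polyhedron (b\<^sup>2) (toroidal_map b)"
proof -
  interpret A: flag_system "toroidal_map b" X s q by (rule torus_flag_system)
  let ?x = "((0, 0), (1, 0), (0, 1))" and ?y = "((1, 1), (1, 0), (0, 1)) :: torus_flag"
  have y: "?y \<in> X" using b3 by (simp add: X_iff box_def frames_def)
  \<comment> \<open>The square at (1,1) has doubled centre (3,3), while the squares at the origin
    have first coordinate 1 or -1. The differences 2 and 4 are not divisible by \<open>2 b\<close>,
    which is at least 6.\<close>
  have "(q 1 ?x, q 3 ?y) \<notin> toroidal_map b"
  proof
    assume "(q 1 ?x, q 3 ?y) \<in> toroidal_map b"
    then obtain z where z: "z \<in> X" "q 1 z = q 1 ?x" "q 3 z = q 3 ?y" using A.in_P[OF x0 y, of 1 3] by auto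
    obtain v d e where z': "z = (v, d, e)" by (cases z)
    have "v = (0, 0)" using q1[of v d e] z x0 unfolding z' by simp
    then have "cg ((0, 0) + (0, 0) + d + e) (3, 3)" using z(3) q_eq[of 3 z ?y] unfolding z' by simp
    then have "2 * int b dvd fst d + fst e - 3" unfolding cg_def by simp
    moreover have "fst d + fst e \<in> {1, -1}" using z(1) unfolding z' X_iff by (auto elim!: framesE)
    moreover have "\<not> 2 * int b dvd 1 - 3" "\<not> 2 * int b dvd -1 - 3" using b3 by (auto dest!: zdvd_imp_le[rotated] simp: zdvd_not_zless)
    ultimately show False by auto
  qed
  then have "\<not> flat (toroidal_map b)" unfolding flat_def A.faces_simps using x0 y by blast
  then show ?thesis unfolding nonflat_regular_polyhedron_def A.faces_simps using torus_regular q1_image by simp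
qed

end

section \<open>The Petrial of the toroidal map\<close>

text \<open>Gluing gives a flag through the vertex, either edge and the 2-face. The two flags agree
  except in the edge, so they are exchanged by \<open>s 1\<close>.\<close>

lemma (in flag_system) corner_flag:
  assumes "a \<in> q 1 ` X" "f \<in> q 2 ` X" "g \<in> q 2 ` X" "A \<in> q 3 ` X"
    and "(a, f) \<in> P" "(a, g) \<in> P" "(f, A) \<in> P" "(g, A) \<in> P" "f \<noteq> g"
  shows "\<exists>y\<in>X. q 1 y = a \<and> q 2 y = g \<and> q 3 y = A \<and> q 2 (s 1 y) = f"
proof -
  have *: "\<exists>y\<in>X. q 1 y = a \<and> q 2 y = h \<and> q 3 y = A" if h: "h \<in> q 2 ` X" "(a, h) \<in> P" "(h, A) \<in> P" for h
  proof -
    obtain x1 where x1: "x1 \<in> X" "a = q 1 x1" using assms(1) by blast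
    obtain x2 where x2: "x2 \<in> X" "h = q 2 x2" using h(1) by blast
    obtain x3 where x3: "x3 \<in> X" "A = q 3 x3" using assms(4) by blast
    have l: "1 \<le> (4::nat)" "2 \<le> (4::nat)" "3 \<le> (4::nat)" by simp_all
    obtain u where u: "u \<in> X" "q 1 u = a" "q 2 u = h" using h(2) unfolding x1(2) x2(2) in_P[OF x1(1) x2(1) l(1,2)] by blast
    obtain w where w: "w \<in> X" "q 2 w = h" "q 3 w = A" using h(3) unfolding x3(2) x2(2) in_P[OF x2(1) x3(1) l(2,3)] by blast
    have "q 2 u = q 2 w" using u w by simp
    from glue[OF u(1) w(1) l(2) this] obtain y where "y \<in> X" "\<forall>i\<le>2. q i y = q i u" "\<forall>i. 2 \<le> i \<longrightarrow> i \<le> 4 \<longrightarrow> q i y = q i w" by (elim bexE conjE)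
    then show ?thesis using u w by (intro bexI[of _ y]) simp_all
  qed
  obtain y where y: "y \<in> X" "q 1 y = a" "q 2 y = g" "q 3 y = A" using *[OF assms(3,6,8)] by blast
  obtain y' where y': "y' \<in> X" "q 1 y' = a" "q 2 y' = f" "q 3 y' = A" using *[OF assms(2,5,7)] by blast
  have "y' = y \<or> y' = s 1 y"
  proof (rule eq_except[OF y(1) y'(1)])
    fix j :: nat assume "j < 3" "j \<noteq> 1"
    then have "j = 0 \<or> j = 2" by auto
    moreover have "Suc 0 = 1" "Suc 2 = 3" by simp_all
    ultimately show "q (Suc j) y = q (Suc j) y'" using y y' by metis
  qed simp
  then have "y' = s 1 y" using y(3) y'(3) assms(9) by metis
  then show ?thesis using y y'(3) by blast
qed

definition int_scale :: "int \<Rightarrow> int \<times> int \<Rightarrow> int \<times> int" where "int_scale m w = (m * fst w, m * snd w)"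

lemma int_scale_add: "int_scale (m + 1) w = int_scale m w + w" "int_scale 0 w = 0" "int_scale (-m) w = int_scale m (-w)"
  unfolding int_scale_def by (cases w; simp add: algebra_simps zero_prod_def)+

section \<open>Petrie polygons of the torus as zigzags\<close>

context torus
begin

interpretation A: flag_system "toroidal_map b" X s q by (rule torus_flag_system)

definition petrie_s :: "nat \<Rightarrow> torus_flag \<Rightarrow> torus_flag" where "petrie_s i x = (if i = 0 then s 0 (s 2 x) else s i x)"

lemma petrie_s_simps [simp]: "petrie_s 0 x = s 0 (s 2 x)" "petrie_s (Suc 0) x = s 1 x" "petrie_s 1 x = s 1 x" "petrie_s 2 x = s 2 x"
  unfolding petrie_s_def by simp_all

definition turn :: "torus_flag \<Rightarrow> torus_flag" where "turn x = s 1 (s 0 (s 2 x))"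

text \<open>
  The closed form of the iterates of \<open>turn\<close>, which moves on to the next corner of a Petrie polygon:
  two steps translate by \<open>d - e\<close>.
\<close>

definition zigzag :: "torus_flag \<Rightarrow> int \<Rightarrow> torus_flag" where
  "zigzag x k = (case x of (v, d, e) \<Rightarrow> if even k then (md (v + int_scale (k div 2) (d - e)), d, e) else (md (v + int_scale (k div 2) (d - e) + d), -e, -d))"

definition corner :: "torus_flag \<Rightarrow> (int \<times> int) set set \<times> (int \<times> int) set set set" where
  "corner x = (q 1 x, {q 2 x, q 2 (s 1 x)})"

definition polygon :: "torus_flag \<Rightarrow> ((int \<times> int) set set \<times> (int \<times> int) set set set) set" where
  "polygon x = range (\<lambda>i. corner (zigzag x i))"

lemma s012_closed: "x \<in> X \<Longrightarrow> s 0 x \<in> X" "x \<in> X \<Longrightarrow> s 1 x \<in> X" "x \<in> X \<Longrightarrow> s 2 x \<in> X"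
  using s_in_X[of 0 x] s_in_X[of 1 x] s_in_X[of 2 x] by simp_all

lemma s012_s012: "x \<in> X \<Longrightarrow> s 0 (s 0 x) = x" "x \<in> X \<Longrightarrow> s 1 (s 1 x) = x" "x \<in> X \<Longrightarrow> s 2 (s 2 x) = x"
  using s_s[of 0 x] s_s[of 1 x] s_s[of 2 x] by simp_all

lemma q_s012: assumes "x \<in> X"
  shows "q 2 (s 0 x) = q 2 x" "q 3 (s 0 x) = q 3 x" "q 1 (s 1 x) = q 1 x" "q 3 (s 1 x) = q 3 x" "q 1 (s 2 x) = q 1 x" "q 2 (s 2 x) = q 2 x"
    "q 1 (s 0 x) \<noteq> q 1 x" "q 2 (s 1 x) \<noteq> q 2 x" "q 3 (s 2 x) \<noteq> q 3 x"
proof -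
  have n: "Suc 0 = 1" "Suc 1 = 2" "Suc 2 = 3" by simp_all
  show "q 2 (s 0 x) = q 2 x" "q 3 (s 0 x) = q 3 x" "q 1 (s 1 x) = q 1 x" "q 3 (s 1 x) = q 3 x" "q 1 (s 2 x) = q 1 x" "q 2 (s 2 x) = q 2 x"
    by (rule q_s[OF _ assms]; simp)+
  show "q 1 (s 0 x) \<noteq> q 1 x" "q 2 (s 1 x) \<noteq> q 2 x" "q 3 (s 2 x) \<noteq> q 3 x"
    using q_s_ne[OF _ assms, of 0] q_s_ne[OF _ assms, of 1] q_s_ne[OF _ assms, of 2] unfolding n by simp_all
qed

lemma same_12: "x \<in> X \<Longrightarrow> y \<in> X \<Longrightarrow> q 1 x = q 1 y \<Longrightarrow> q 2 x = q 2 y \<Longrightarrow> y = x \<or> y = s 2 x"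
proof (rule A.eq_except[of x y 2])
  fix j :: nat assume a: "q 1 x = q 1 y" "q 2 x = q 2 y" and "j < 3" "j \<noteq> 2"
  then have "j = 0 \<or> j = 1" by auto
  moreover have "Suc 0 = 1" "Suc 1 = 2" by simp_all
  ultimately show "q (Suc j) x = q (Suc j) y" using a by metis
qed simp_all

lemma frames_nz: "(d, e) \<in> frames \<Longrightarrow> e \<noteq> -e \<and> d \<noteq> -d \<and> d \<noteq> e \<and> d \<noteq> -e \<and> e \<noteq> d"
  by (elim framesE) simp_all

text \<open>The edges from \<open>v\<close> along \<open>e\<close> and along \<open>-e\<close> are
  different, since otherwise two flags with incompatible frames would share vertex and edge. Hence a
  corner determines its flag up to \<open>s 1\<close>.\<close>

lemma q2_s1s2: assumes "x \<in> X" shows "q 2 (s 1 (s 2 x)) \<noteq> q 2 (s 1 x)"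
proof
  assume e: "q 2 (s 1 (s 2 x)) = q 2 (s 1 x)"
  obtain v d e' where x: "x = (v, d, e')" by (cases x)
  have "q 1 (s 1 x) = q 1 (s 1 (s 2 x))" using assms by (simp only: q_s012 s012_closed)
  then have "s 1 (s 2 x) = s 1 x \<or> s 1 (s 2 x) = s 2 (s 1 x)" using same_12[of "s 1 x" "s 1 (s 2 x)"] e s012_closed assms by metis
  then show False using assms frames_nz[of d e'] unfolding x by (simp add: X_iff)
qed

lemma corner_s1: "x \<in> X \<Longrightarrow> corner (s 1 x) = corner x"
  unfolding corner_def using q_s012(3)[of x] s012_s012(2)[of x] by (simp only: insert_commute)

lemma corner_eq: assumes "x \<in> X" "y \<in> X" "corner x = corner y" shows "y = x \<or> y = s 1 x"
proof -
  have q1: "q 1 x = q 1 y" and q2: "{q 2 x, q 2 (s 1 x)} = {q 2 y, q 2 (s 1 y)}" using assms(3) unfolding corner_def by simp_all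
  have *: "y = u" if u: "u \<in> X" "q 1 u = q 1 y" "q 2 u = q 2 y" "q 2 (s 1 u) = q 2 (s 1 y)" for u
    using same_12[OF u(1) assms(2) u(2,3)] q2_s1s2[OF u(1)] u(4) by metis
  have "(q 2 x = q 2 y \<and> q 2 (s 1 x) = q 2 (s 1 y)) \<or> (q 2 (s 1 x) = q 2 y \<and> q 2 x = q 2 (s 1 y))"
    using q2 unfolding doubleton_eq_iff by blast
  then show ?thesis
  proof (elim disjE conjE)
    assume "q 2 x = q 2 y" "q 2 (s 1 x) = q 2 (s 1 y)"
    then show ?thesis using *[OF assms(1) q1] by blast
  next
    assume a: "q 2 (s 1 x) = q 2 y" "q 2 x = q 2 (s 1 y)"
    have "y = s 1 x" by (rule *[OF s012_closed(2)[OF assms(1)]]) (use a q1 q_s012(3)[OF assms(1)] s012_s012(2)[OF assms(1)] in simp_all)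
    then show ?thesis by blast
  qed
qed

lemma turn_inv: "x \<in> X \<Longrightarrow> s 2 (s 0 (s 1 (turn x))) = x"
  unfolding turn_def by (simp only: s012_s012 s012_closed)

lemma zigzag_0: "x \<in> X \<Longrightarrow> zigzag x 0 = x"
  unfolding zigzag_def by (cases x) (simp add: int_scale_add md_id X_iff)

lemma zigzag_Suc: "zigzag x (k + 1) = turn (zigzag x k)"
proof -
  obtain v d e where x: "x = (v, d, e)" by (cases x)
  show ?thesis
  proof (cases "even k")
    case True
    then have "(k + 1) div 2 = k div 2" by presburger
    then show ?thesis unfolding x zigzag_def turn_def using True by (simp add: md_md)
  next
    case False
    then have *: "(k + 1) div 2 = k div 2 + 1" by presburger
    have E: "v + int_scale (k div 2 + 1) (d - e) = v + int_scale (k div 2) (d - e) + d + - e" unfolding int_scale_add by (simp add: algebra_simps)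
    have "md (md (v + int_scale (k div 2) (d - e) + d) + - e) = md (v + int_scale (k div 2 + 1) (d - e))" by (simp only: md_md E)
    then show ?thesis unfolding x zigzag_def turn_def using False * by simp
  qed
qed

lemma zigzag_in: "x \<in> X \<Longrightarrow> zigzag x k \<in> X"
proof -
  assume "x \<in> X"
  moreover obtain v d e where x: "x = (v, d, e)" by (cases x)
  ultimately have f: "(d, e) \<in> frames" by (simp add: X_iff)
  have "(-e, -d) \<in> frames" by (rule frames_neg(3)[OF frames_neg(1)[OF frames_neg(2)[OF f]]])
  then show ?thesis unfolding x zigzag_def using f by (simp add: X_iff md_box)
qed

text \<open>\<open>s 1\<close> exchanges the two edges at the corner, so the same polygon is
  traversed backwards.\<close>

lemma zigzag_s1: "zigzag (s 1 x) k = s 1 (zigzag x (-k))"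
proof -
  obtain v d e where x: "x = (v, d, e)" by (cases x)
  show ?thesis
  proof (cases "even k")
    case True
    then have "(-k) div 2 = - (k div 2)" by presburger
    then show ?thesis unfolding x zigzag_def using True by (simp add: int_scale_add)
  next
    case False
    then have 1: "(-k) div 2 = - (k div 2) + - 1" by presburger
    have "int_scale (- (k div 2)) (d - e) = int_scale (- (k div 2) + -1) (d - e) + (d - e)" using int_scale_add(1)[of "- (k div 2) + -1" "d - e"] by simp
    then have "int_scale (- (k div 2) + -1) (d - e) + d = int_scale (k div 2) (e - d) + e" unfolding int_scale_add(3) by (simp add: algebra_simps)
    then have "v + int_scale (k div 2) (e - d) + e = v + int_scale (- (k div 2) + -1) (d - e) + d" by (simp add: add.assoc)
    then have "md (v + int_scale (k div 2) (e - d) + e) = md (v + int_scale (- (k div 2) + -1) (d - e) + d)" by (simp only:)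
    then show ?thesis unfolding x zigzag_def using False 1 by simp
  qed
qed

text \<open>\<open>turn\<close> is invertible on \<open>X\<close>, so a sequence indexed by all
  integers is determined in both directions by its value at 0.\<close>

lemma zigzag_unique:
  assumes "\<And>i. y i \<in> X" "\<And>i::int. y (i + 1) = turn (y i)"
  shows "y i = zigzag (y 0) i"
proof (induction i rule: int_induct[of _ 0])
  case base show ?case using zigzag_0[OF assms(1)] by simp
next
  case (step1 i) then show ?case using assms(2)[of i] zigzag_Suc[of "y 0" i] by simp
next
  case (step2 i)
  have "turn (y (i - 1)) = turn (zigzag (y 0) (i - 1))" using assms(2)[of "i - 1"] zigzag_Suc[of "y 0" "i - 1"] step2 by simp
  then show ?case using turn_inv[OF assms(1)[of "i - 1"]] turn_inv[OF zigzag_in[OF assms(1)[of 0]], of "i - 1"] by simp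
qed

lemma zigzag_turn: "x \<in> X \<Longrightarrow> zigzag (turn x) k = zigzag x (k + 1)"
proof -
  assume x: "x \<in> X"
  have "zigzag x (k + 1) = zigzag (zigzag x (0 + 1)) k"
    by (rule zigzag_unique[where y = "\<lambda>k. zigzag x (k + 1)"]) (rule zigzag_in[OF x], rule zigzag_Suc)
  then show ?thesis using zigzag_Suc[of x 0] zigzag_0[OF x] by simp
qed

lemma polygon_s1: assumes "x \<in> X" shows "polygon (s 1 x) = polygon x"
proof -
  have "corner (zigzag (s 1 x) k) = corner (zigzag x (-k))" for k unfolding zigzag_s1 by (rule corner_s1[OF zigzag_in[OF assms]])
  moreover have "range (\<lambda>k. corner (zigzag x (-k))) = range (\<lambda>k::int. corner (zigzag x k))"
  proof
    show "range (\<lambda>k. corner (zigzag x (-k))) \<subseteq> range (\<lambda>k::int. corner (zigzag x k))" by blast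
    have "corner (zigzag x k) = corner (zigzag x (- (-k)))" for k by simp
    then show "range (\<lambda>k. corner (zigzag x k)) \<subseteq> range (\<lambda>k::int. corner (zigzag x (- k)))" by (metis (mono_tags, lifting) image_subsetI rangeI)
  qed
  ultimately show ?thesis unfolding polygon_def by simp
qed

lemma polygon_turn: assumes "x \<in> X" shows "polygon (turn x) = polygon x"
proof -
  have "range (\<lambda>k. corner (zigzag x (k + 1))) = range (\<lambda>k::int. corner (zigzag x k))"
  proof
    show "range (\<lambda>k. corner (zigzag x (k + 1))) \<subseteq> range (\<lambda>k::int. corner (zigzag x k))" by blast
    have "corner (zigzag x k) = corner (zigzag x ((k - 1) + 1))" for k by simp
    then show "range (\<lambda>k. corner (zigzag x k)) \<subseteq> range (\<lambda>k::int. corner (zigzag x (k + 1)))" by (metis (mono_tags, lifting) image_subsetI rangeI)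
  qed
  then show ?thesis unfolding polygon_def zigzag_turn[OF assms] .
qed

lemma polygon_s02: assumes "x \<in> X" shows "polygon (s 0 (s 2 x)) = polygon x"
proof -
  have "polygon (s 1 (s 0 (s 2 x))) = polygon x" using polygon_turn[OF assms] unfolding turn_def .
  then show ?thesis using polygon_s1[of "s 0 (s 2 x)"] s012_closed assms by simp
qed

lemma polygon_zig: assumes "x \<in> X" shows "polygon (zigzag x k) = polygon x"
proof (induction k rule: int_induct[of _ 0])
  case base show ?case using zigzag_0[OF assms] by simp
next
  case (step1 i) then show ?case using polygon_turn[OF zigzag_in[OF assms, of i]] zigzag_Suc[of x i] by simp
next
  case (step2 i) then show ?case using polygon_turn[OF zigzag_in[OF assms, of "i - 1"]] zigzag_Suc[of x "i - 1"] by simp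
qed

lemma polygon_eq: assumes "x \<in> X" "y \<in> X" "polygon x = polygon y" obtains k where "y = zigzag x k \<or> y = s 1 (zigzag x k)"
proof -
  have "corner (zigzag y 0) \<in> polygon x" unfolding assms(3) unfolding polygon_def by blast
  then obtain k where "corner (zigzag x k) = corner y" unfolding polygon_def zigzag_0[OF assms(2)] by (metis (no_types, lifting) imageE)
  from corner_eq[OF zigzag_in[OF assms(1)] assms(2) this] show thesis by (rule that)
qed

text \<open>The flags of the polygon of \<open>x\<close> have the frames \<open>(d, e)\<close>,
  \<open>(-e, -d)\<close> and their swaps; the frame \<open>(d, -e)\<close> of \<open>s 2 x\<close>
  is not among them.\<close>

lemma polygon_s2: assumes "x \<in> X" shows "polygon (s 2 x) \<noteq> polygon x"
proof
  assume e: "polygon (s 2 x) = polygon x"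
  obtain v d e' where x: "x = (v, d, e')" by (cases x)
  have f: "(d, e') \<in> frames" using assms unfolding x by (simp add: X_iff)
  obtain k where k: "s 2 x = zigzag x k \<or> s 2 x = s 1 (zigzag x k)" by (rule polygon_eq[OF assms s012_closed(3)[OF assms] e[symmetric]])
  show False using k frames_nz[OF f] unfolding x zigzag_def by (cases "even k") auto
qed

text \<open>A Petrie path carries one flag per corner, and the ban on three consecutive edges in a
  common face forces each of these flags to be the \<open>turn\<close> of the preceding one.\<close>

lemma petrie_polygons_torus: "petrie_polygons (toroidal_map b) = polygon ` X"
proof
  let ?T = "toroidal_map b"
  have n: "Suc 0 = 1" by simp
  show "petrie_polygons ?T \<subseteq> polygon ` X"
  proof
    fix \<pi> assume "\<pi> \<in> petrie_polygons ?T"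
    then obtain v e where p: "petrie_path ?T v e" and \<pi>: "\<pi> = {(v (i + 1), {e i, e (i + 1)}) | i. True}" unfolding petrie_polygons_def by blast
    have pp: "v i \<in> q 1 ` X" "e i \<in> q 2 ` X" "v i \<noteq> v (i + 1)" "(v i, e i) \<in> ?T" "(v (i + 1), e i) \<in> ?T" "e i \<noteq> e (i + 1)"
      "\<exists>F \<in> q 3 ` X. (e i, F) \<in> ?T \<and> (e (i + 1), F) \<in> ?T"
      "\<not> (\<exists>F \<in> q 3 ` X. (e i, F) \<in> ?T \<and> (e (i + 1), F) \<in> ?T \<and> (e (i + 2), F) \<in> ?T)" for i
      using p unfolding petrie_path_def A.faces_simps by blast+
    \<comment> \<open>The flag of corner \<open>i + 1\<close> has the outgoing edge as its edge;
      \<open>s 1\<close> exchanges it for the incoming one.\<close>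
    have "\<exists>y\<in>X. q 1 y = v (i + 1) \<and> q 2 y = e (i + 1) \<and> q 2 (s 1 y) = e i" for i
    proof -
      obtain F where F: "F \<in> q 3 ` X" "(e i, F) \<in> ?T" "(e (i + 1), F) \<in> ?T" using pp(7)[of i] by blast
      show ?thesis using A.corner_flag[OF pp(1)[of "i + 1"] pp(2)[of i] pp(2)[of "i + 1"] F(1) pp(5)[of i] pp(4)[of "i + 1"] F(2,3) pp(6)[of i]] by blast
    qed
    then obtain y where y: "\<And>i. y i \<in> X" "\<And>i. q 1 (y i) = v (i + 1)" "\<And>i. q 2 (y i) = e (i + 1)" "\<And>i. q 2 (s 1 (y i)) = e i" by metis
    have i2: "i + 1 + 1 = i + 2" for i :: int by simp
    have inF: "(q 2 u, q 3 u) \<in> ?T" if "u \<in> X" for u using A.in_P_I[OF that, of 2 3] by simp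
    have "y (i + 1) = turn (y i)" for i
    proof -
      \<comment> \<open>\<open>w\<close> shares the edge \<open>e (i + 1)\<close> with
        \<open>y i\<close> but sits at its other end, so it is \<open>s 0 (y i)\<close> or
        \<open>s 0 (s 2 (y i))\<close>.\<close>
      define w where "w = s 1 (y (i + 1))"
      have wX: "w \<in> X" unfolding w_def by (rule s012_closed(2)[OF y(1)])
      have w: "q 1 w = v (i + 2)" "q 2 w = e (i + 1)" "q 3 w = q 3 (y (i + 1))"
        unfolding w_def using q_s012[OF y(1)[of "i + 1"]] y(2)[of "i + 1", unfolded i2] y(4)[of "i + 1"] by simp_all
      have "q 2 (y i) = q 2 w" using w(2) y(3) by simp
      from same_edge_cases[OF y(1) wX this]
      have c: "w = y i \<or> w = s 2 (y i) \<or> w = s 0 (y i) \<or> w = s 0 (s 2 (y i))" by blast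
      have "q 1 w \<noteq> q 1 (y i)" using w(1) y(2)[of i] pp(3)[of "i + 1", unfolded i2] by simp
      then have "w \<noteq> y i" "w \<noteq> s 2 (y i)" using q_s012(5)[OF y(1)[of i]] by metis+
      \<comment> \<open>In this case the two corners would lie in the same square, which then
        contains three consecutive edges.\<close>
      moreover have "w \<noteq> s 0 (y i)"
      proof
        assume "w = s 0 (y i)"
        then have F: "q 3 (y (i + 1)) = q 3 (y i)" using w(3) q_s012(2)[OF y(1)[of i]] by simp
        have "(e i, q 3 (y i)) \<in> ?T" using inF[OF s012_closed(2)[OF y(1)[of i]]] y(4)[of i] q_s012(4)[OF y(1)[of i]] by simp
        moreover have "(e (i + 1), q 3 (y i)) \<in> ?T" using inF[OF y(1)[of i]] y(3)[of i] by simp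
        moreover have "(e (i + 2), q 3 (y i)) \<in> ?T" using inF[OF y(1)[of "i + 1"]] y(3)[of "i + 1", unfolded i2] F by simp
        ultimately show False using pp(8)[of i] y(1)[of i] by blast
      qed
      ultimately have "w = s 0 (s 2 (y i))" using c by blast
      then show ?thesis unfolding turn_def w_def using s012_s012(2)[OF y(1)[of "i + 1"]] by simp
    qed
    then have z: "y i = zigzag (y 0) i" for i using zigzag_unique[of y i] y(1) by blast
    have "(v (i + 1), {e i, e (i + 1)}) = corner (zigzag (y 0) i)" for i
      unfolding corner_def z[symmetric] y(2,3,4) by (simp add: insert_commute)
    then have "\<pi> = polygon (y 0)" unfolding \<pi> polygon_def by auto
    then show "\<pi> \<in> polygon ` X" using y(1) by blast
  qed
  show "polygon ` X \<subseteq> petrie_polygons ?T"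
  proof (rule image_subsetI)
    fix x assume x: "x \<in> X"
    define y where "y = zigzag x"
    have yX: "y i \<in> X" for i unfolding y_def by (rule zigzag_in[OF x])
    have yS: "y (i + 1) = turn (y i)" for i unfolding y_def by (rule zigzag_Suc)
    have s1y: "s 1 (y (i + 1)) = s 0 (s 2 (y i))" for i unfolding yS turn_def by (simp only: s012_s012 s012_closed yX)
    \<comment> \<open>Shifted by one, because the corner that \<open>petrie_polygons\<close> records
      for \<open>i\<close> lies at \<open>v (i + 1)\<close>.\<close>
    define v where "v i = q 1 (y (i - 1))" for i
    define e where "e i = q 2 (y (i - 1))" for i
    have v1: "v (i + 1) = q 1 (y i)" and e1: "e (i + 1) = q 2 (y i)" for i unfolding v_def e_def by simp_all
    have e0: "e i = q 2 (s 1 (y i))" for i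
    proof -
      have "q 2 (s 1 (y ((i - 1) + 1))) = q 2 (y (i - 1))" unfolding s1y using q_s012 s012_closed yX by (simp only:)
      then show ?thesis unfolding e_def by simp
    qed
    have e2: "e (i + 2) = q 2 (y (i + 1))" for i proof -
      have i2: "i + 1 + 1 = i + 2" by simp
      show ?thesis by (rule e1[of "i + 1", unfolded i2])
    qed
    have in12: "(q 1 u, q 2 u) \<in> ?T" and in23: "(q 2 u, q 3 u) \<in> ?T" if "u \<in> X" for u using A.in_P_I[OF that, of 1 2] A.in_P_I[OF that, of 2 3] by simp_all
    \<comment> \<open>A square that contains both edges of a corner is the square of its flag: the
      other square on \<open>q 2 Y\<close> has a different second edge at that vertex by
      \<open>q2_s1s2\<close>.\<close>
    have Fe: "F = q 3 Y" if Y: "Y \<in> X" "F \<in> q 3 ` X" "(q 2 (s 1 Y), F) \<in> ?T" "(q 2 Y, F) \<in> ?T" for F Y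
    proof -
      have "(q 1 Y, q 2 (s 1 Y)) \<in> ?T" using in12[OF s012_closed(2)[OF Y(1)]] q_s012(3)[OF Y(1)] by simp
      then obtain Z where Z: "Z \<in> X" "q 1 Z = q 1 Y" "q 2 Z = q 2 Y" "q 3 Z = F" "q 2 (s 1 Z) = q 2 (s 1 Y)"
        using A.corner_flag[of "q 1 Y" "q 2 (s 1 Y)" "q 2 Y" F] Y s012_closed(2)[OF Y(1)] in12[OF Y(1)] q_s012(8)[OF Y(1)] by blast
      have "Z = Y \<or> Z = s 2 Y" using same_12[OF Y(1) Z(1)] Z(2,3) by simp
      then have "Z = Y" using Z(5) q2_s1s2[OF Y(1)] by metis
      then show ?thesis using Z(4) by simp
    qed
    have "petrie_path ?T v e" unfolding petrie_path_def A.faces_simps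
    proof (intro allI conjI)
      fix i
      show "v i \<in> q 1 ` X" "e i \<in> q 2 ` X" unfolding v_def e_def using yX by simp_all
      show "v i \<noteq> v (i + 1)"
      proof -
        have "q 1 (y ((i - 1) + 1)) \<noteq> q 1 (y (i - 1))" unfolding yS turn_def using q_s012(3,5,7) s012_closed yX by metis
        then show ?thesis unfolding v_def by simp
      qed
      show "(v i, e i) \<in> ?T" unfolding v_def e_def by (rule in12[OF yX])
      show "(v (i + 1), e i) \<in> ?T" unfolding v1 e0 using in12[OF s012_closed(2)[OF yX[of i]]] q_s012(3)[OF yX[of i]] by simp
      show "e i \<noteq> e (i + 1)" unfolding e0[of i] e1 by (rule q_s012(8)[OF yX])
      show "\<exists>F\<in>q 3 ` X. (e i, F) \<in> ?T \<and> (e (i + 1), F) \<in> ?T"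
      proof (intro bexI conjI)
        show "(e i, q 3 (y i)) \<in> ?T" unfolding e0 using in23[OF s012_closed(2)[OF yX[of i]]] q_s012(4)[OF yX[of i]] by simp
        show "(e (i + 1), q 3 (y i)) \<in> ?T" unfolding e1 by (rule in23[OF yX])
      qed (use yX in blast)
      show "\<not> (\<exists>F\<in>q 3 ` X. (e i, F) \<in> ?T \<and> (e (i + 1), F) \<in> ?T \<and> (e (i + 2), F) \<in> ?T)"
      proof
        assume "\<exists>F\<in>q 3 ` X. (e i, F) \<in> ?T \<and> (e (i + 1), F) \<in> ?T \<and> (e (i + 2), F) \<in> ?T"
        then obtain F where F: "F \<in> q 3 ` X" "(e i, F) \<in> ?T" "(e (i + 1), F) \<in> ?T" "(e (i + 2), F) \<in> ?T" by blast
        have "F = q 3 (y i)" by (rule Fe[OF yX F(1)]) (use F(2,3) in \<open>simp_all only: e0[of i] e1[of i]\<close>)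
        moreover have "F = q 3 (y (i + 1))" by (rule Fe[OF yX F(1)]) (use F(3,4) in \<open>simp_all only: e0[of "i + 1"] e2[of i]\<close>)
        moreover have "q 3 (y (i + 1)) \<noteq> q 3 (y i)" unfolding yS turn_def using q_s012(4,2,9) s012_closed yX by metis
        ultimately show False by simp
      qed
    qed
    moreover have "polygon x = {(v (i + 1), {e i, e (i + 1)}) | i. True}"
    proof -
      have "(v (i + 1), {e i, e (i + 1)}) = corner (zigzag x i)" for i unfolding corner_def v1 e1 e0[of i] y_def by (simp add: insert_commute)
      then show ?thesis unfolding polygon_def by auto
    qed
    ultimately show "polygon x \<in> petrie_polygons ?T" unfolding petrie_polygons_def by blast
  qed
qed

end

section \<open>The Petrial as a regular non-flat polyhedron of type {2b,4}\<close>

context torus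
begin

interpretation A: flag_system "toroidal_map b" X s q by (rule torus_flag_system)

definition petrie_q :: "nat \<Rightarrow> torus_flag \<Rightarrow> (int \<times> int) set set + ((int \<times> int) set set \<times> (int \<times> int) set set set) set" where
  "petrie_q i x = (if i = 3 then Inr (polygon x) else Inl (q i x))"

lemma petrie_q_simps [simp]: "petrie_q 3 x = Inr (polygon x)" "i \<noteq> 3 \<Longrightarrow> petrie_q i x = Inl (q i x)" "petrie_q (Suc 2) x = Inr (polygon x)"
  unfolding petrie_q_def by simp_all

lemma dvd_odd_neq: "\<not> int b dvd 1" "\<not> int b dvd -1" "\<not> int b dvd 2" "\<not> int b dvd -2"
  using b3 zdvd_not_zless[of 1 "int b"] zdvd_not_zless[of 2 "int b"] by simp_all

text \<open>A Petrie polygon passes through each of its vertices only once per period. Therefore a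
  vertex and a polygon through it determine the flag up to \<open>s 1\<close>.\<close>

lemma zigzag_same_vertex:
  assumes x: "x \<in> X" and e: "q 1 (zigzag x k) = q 1 x"
  shows "zigzag x k = x \<and> even k \<and> int b dvd k div 2"
proof -
  obtain v d e' where x': "x = (v, d, e')" by (cases x)
  have f: "v \<in> box" "(d, e') \<in> frames" using x unfolding x' by (simp_all add: X_iff)
  have z: "zigzag x k \<in> X" by (rule zigzag_in[OF x])
  show ?thesis
  proof (cases "even k")
    case True
    then have zk: "zigzag x k = (md (v + int_scale (k div 2) (d - e')), d, e')" unfolding x' zigzag_def by simp
    have "md (v + int_scale (k div 2) (d - e')) = v"
      by (rule iffD1[OF q1[OF z[unfolded zk] x[unfolded x']] e[unfolded zk, unfolded x']])
    moreover from this have "md (v + int_scale (k div 2) (d - e')) = md v" using md_id[OF f(1)] by simp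
    then have "int b dvd fst (int_scale (k div 2) (d - e')) \<and> int b dvd snd (int_scale (k div 2) (d - e'))" unfolding md_eq_iff by simp
    then have "int b dvd k div 2" using f(2) unfolding int_scale_def by (elim framesE) simp_all
    ultimately show ?thesis using True zk x' by simp
  next
    case False
    then have zk: "zigzag x k = (md (v + int_scale (k div 2) (d - e') + d), -e', -d)" unfolding x' zigzag_def by simp
    have "md (v + int_scale (k div 2) (d - e') + d) = v"
      by (rule iffD1[OF q1[OF z[unfolded zk] x[unfolded x']] e[unfolded zk, unfolded x']])
    then have "md (v + int_scale (k div 2) (d - e') + d) = md v" using md_id[OF f(1)] by simp
    then have dv: "int b dvd fst (int_scale (k div 2) (d - e')) + fst d" "int b dvd snd (int_scale (k div 2) (d - e')) + snd d" unfolding md_eq_iff by (simp_all add: algebra_simps)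
    \<comment> \<open>The coordinates of \<open>d - e'\<close> are 1 or -1, so either the sum or the
      difference cancels the multiple of \<open>d - e'\<close> and leaves 1 or -1, which
      \<open>b\<close> does not divide.\<close>
    have "int b dvd fst (int_scale (k div 2) (d - e')) + fst d + (snd (int_scale (k div 2) (d - e')) + snd d)"
         "int b dvd fst (int_scale (k div 2) (d - e')) + fst d - (snd (int_scale (k div 2) (d - e')) + snd d)"
      using dvd_add[OF dv] dvd_diff[OF dv] .
    then have False using f(2) dvd_odd_neq unfolding int_scale_def by (elim framesE) simp_all
    then show ?thesis ..
  qed
qed

lemma zigzag_period: assumes x: "x \<in> X" shows "zigzag x k = x \<longleftrightarrow> 2 * int b dvd k"
proof
  assume e: "zigzag x k = x"
  then have "even k" "int b dvd k div 2" using zigzag_same_vertex[OF x, of k] by simp_all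
  then show "2 * int b dvd k" by (metis dvd_mult_div_cancel dvd_refl mult_dvd_mono)
next
  assume "2 * int b dvd k"
  then obtain m where k: "k = 2 * int b * m" by blast
  obtain v d e where x': "x = (v, d, e)" by (cases x)
  have "even k" "k div 2 = int b * m" unfolding k by simp_all
  moreover have "md (v + int_scale (int b * m) (d - e)) = md v" unfolding md_eq_iff int_scale_def by (simp add: mult.assoc)
  moreover have "md v = v" using x unfolding x' by (simp add: X_iff md_id)
  ultimately show "zigzag x k = x" unfolding x' zigzag_def by simp
qed

lemma petrial_eq: "petrial (toroidal_map b) = {(petrie_q i x, petrie_q j x) | i j x. x \<in> X \<and> i \<le> j \<and> j \<le> 4}"
proof
  let ?T = "toroidal_map b" and ?R = "{(petrie_q i x, petrie_q j x) | i j x. x \<in> X \<and> i \<le> j \<and> j \<le> 4}"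
  have R: "(petrie_q i x, petrie_q j x) \<in> ?R" if "x \<in> X" "i \<le> j" "j \<le> 4" for i j x using that by blast
  show "petrial ?T \<subseteq> ?R"
  proof
    fix p assume "p \<in> petrial ?T"
    then have "(\<exists>x y. p = (Inl x, Inl y) \<and> (x, y) \<in> ?T \<and> x \<notin> q 3 ` X \<and> y \<notin> q 3 ` X) \<or>
      (\<exists>a \<pi>. p = (Inl a, Inr \<pi>) \<and> \<pi> \<in> polygon ` X \<and> (\<exists>(v, E) \<in> \<pi>. \<exists>e \<in> E. (a, e) \<in> ?T)) \<or>
      (\<exists>\<pi>. p = (Inr \<pi>, Inr \<pi>) \<and> \<pi> \<in> polygon ` X) \<or>
      (\<exists>\<pi> y. p = (Inr \<pi>, Inl y) \<and> \<pi> \<in> polygon ` X \<and> y \<in> faces ?T 3)"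
      unfolding petrial_def petrie_polygons_torus A.faces_simps(3) Un_iff mem_Collect_eq disj_assoc .
    then show "p \<in> ?R"
    proof (elim disjE exE conjE imageE)
      fix x y assume 1: "p = (Inl x, Inl y)" "(x, y) \<in> ?T" "x \<notin> q 3 ` X" "y \<notin> q 3 ` X"
      from 1(2) obtain i j z where z: "x = q i z" "y = q j z" "z \<in> X" "i \<le> j" "j \<le> 4" unfolding A.P_eq by blast
      have "i \<noteq> 3" "j \<noteq> 3" using 1(3,4) z by auto
      then have "p = (petrie_q i z, petrie_q j z)" unfolding 1(1) z(1,2) by simp
      then show ?thesis using R[OF z(3,4,5)] by (simp only:)
    next
      fix a \<pi> x assume "p = (Inl a, Inr \<pi>)" "\<exists>(v, E) \<in> \<pi>. \<exists>e \<in> E. (a, e) \<in> ?T" and \<pi>: "\<pi> = polygon x" and xX: "x \<in> X"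
      then obtain v E e where 2: "p = (Inl a, Inr (polygon x))" "x \<in> X" "(v, E) \<in> polygon x" "e \<in> E" "(a, e) \<in> ?T" by blast
      obtain k where "(v, E) = corner (zigzag x k)" using 2(3) unfolding polygon_def by blast
      then have "e = q 2 (zigzag x k) \<or> e = q 2 (s 1 (zigzag x k))" using 2(4) unfolding corner_def by auto
      moreover have zk: "zigzag x k \<in> X" by (rule zigzag_in[OF 2(2)])
      moreover have "polygon (zigzag x k) = polygon x" by (rule polygon_zig[OF 2(2)])
      moreover from this have "polygon (s 1 (zigzag x k)) = polygon x" using polygon_s1[OF zk] by simp
      ultimately obtain w where w: "w \<in> X" "e = q 2 w" "polygon w = polygon x" using s012_closed(2)[OF zk] by blast
      from 2(5) obtain i j u where u: "a = q i u" "e = q j u" "u \<in> X" "i \<le> j" "j \<le> 4" unfolding A.P_eq by blast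
      have "j = 2" using q_rank[OF u(3) w(1) u(5), of 2] u(2) w(2) by simp
      then have i: "i \<le> 2" "i \<noteq> 3" and q2: "q 2 w = q 2 u" using u(2,4) w(2) by simp_all
      \<comment> \<open>Of the four flags on the edge, \<open>w\<close> and
        \<open>s 0 (s 2 w)\<close> belong to the polygon of \<open>x\<close>. If \<open>u\<close> is
        one of the other two, \<open>s 2 u\<close> belongs to it and has the same faces of index at
        most 2.\<close>
      have "\<exists>u'\<in>X. polygon u' = polygon x \<and> q i u' = q i u"
      proof (cases "u = w \<or> u = s 0 (s 2 w)")
        case True
        then have "polygon u = polygon x" using w polygon_s02[OF w(1)] by auto
        then show ?thesis using u(3) by blast
      next
        case False
        then have "u = s 2 w \<or> u = s 0 w" using same_edge_cases[OF w(1) u(3) q2] by simp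
        then have "s 2 u = w \<or> s 2 u = s 0 (s 2 w)" using s012_s012(3)[OF w(1)] s_commute[of w] by (elim disjE) simp_all
        then have "polygon (s 2 u) = polygon x" using w(3) polygon_s02[OF w(1)] by (elim disjE) simp_all
        moreover have "q i (s 2 u) = q i u" by (rule q_s) (use i u in simp_all)
        ultimately show ?thesis using s012_closed(3)[OF u(3)] by blast
      qed
      then obtain u' where u': "u' \<in> X" "polygon u' = polygon x" "q i u' = q i u" by blast
      have "p = (petrie_q i u', petrie_q 3 u')" unfolding 2(1) u(1) using u' i by simp
      then show ?thesis using R[OF u'(1), of i 3] i by simp
    next
      fix \<pi> x assume 3: "p = (Inr \<pi>, Inr \<pi>)" "\<pi> = polygon x" "x \<in> X"
      then have "p = (petrie_q 3 x, petrie_q 3 x)" by simp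
      then show ?thesis using R[OF 3(3), of 3 3] by (simp only:)
    next
      fix \<pi> y x assume 4: "p = (Inr \<pi>, Inl y)" "\<pi> = polygon x" "x \<in> X" "y \<in> faces ?T 3"
      then have "p = (petrie_q 3 x, petrie_q 4 x)" using A.faces_simps(4)[OF 4(3)] by simp
      then show ?thesis using R[OF 4(3), of 3 4] by (simp only:)
    qed
  qed
  show "?R \<subseteq> petrial ?T"
  proof
    fix p assume "p \<in> ?R"
    then obtain i j x where p: "p = (petrie_q i x, petrie_q j x)" and x: "x \<in> X" and ij: "i \<le> j" "j \<le> 4" by blast
    have pp: "polygon x \<in> petrie_polygons ?T" unfolding petrie_polygons_torus using x by (rule imageI)
    consider "i \<noteq> 3" "j \<noteq> 3" | "i = 3" "j = 3" | "i = 3" "j = 4" | "i \<le> 2" "j = 3" using ij by linarith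
    then show "p \<in> petrial ?T"
    proof cases
      case 1
      have n: "q k x \<notin> faces ?T 2" if k: "k \<le> 4" "k \<noteq> 3" for k
      proof
        assume "q k x \<in> faces ?T 2"
        then obtain y where y: "y \<in> X" "q k x = q 3 y" unfolding A.faces_simps(3) by blast
        have "k = 3" by (rule q_rank[OF x y(1) k(1) _ y(2)]) simp
        then show False using k by simp
      qed
      have "(q i x, q j x) \<in> ?T" by (rule A.in_P_I[OF x ij])
      moreover have "q i x \<notin> faces ?T 2" "q j x \<notin> faces ?T 2" using n ij 1 by simp_all
      ultimately show ?thesis unfolding p petrial_def using 1 by simp
    next
      case 2
      then show ?thesis unfolding p petrial_def using pp by simp
    next
      case 3
      then show ?thesis unfolding p petrial_def using pp A.faces_simps(4)[OF x] by simp
    next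
      case 4
      have "corner (zigzag x 0) \<in> polygon x" unfolding polygon_def by blast
      then have c: "corner x \<in> polygon x" unfolding zigzag_0[OF x] .
      have "(q i x, q 2 x) \<in> ?T" by (rule A.in_P_I[OF x]) (use 4 in simp_all)
      then have "\<exists>(v, E)\<in>polygon x. \<exists>e\<in>E. (q i x, e) \<in> ?T" by (intro bexI[OF _ c]) (simp add: corner_def)
      then show ?thesis unfolding p petrial_def using pp 4 by simp
    qed
  qed
qed

lemma petrie_s_in: "i < 3 \<Longrightarrow> x \<in> X \<Longrightarrow> petrie_s i x \<in> X"
  unfolding petrie_s_def using s012_closed s_in_X by simp

lemma petrie_s_path_12:
  "(x, y) \<in> (path_rel X s {1, 2})\<^sup>* \<Longrightarrow> (x, y) \<in> (path_rel X petrie_s {1, 2})\<^sup>*"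
proof -
  have "path_rel X s {1, 2} \<subseteq> path_rel X petrie_s {1, 2}"
  proof
    fix p assume "p \<in> path_rel X s {1, 2}"
    then obtain u i where u: "p = (u, s i u)" "u \<in> X" "i < 3" "i \<in> {1, 2}" unfolding path_rel_def by blast
    then have "p = (u, petrie_s i u)" unfolding petrie_s_def by auto
    then show "p \<in> path_rel X petrie_s {1, 2}" unfolding path_rel_def using u(2-4) by blast
  qed
  then show "(x, y) \<in> (path_rel X s {1, 2})\<^sup>* \<Longrightarrow> (x, y) \<in> (path_rel X petrie_s {1, 2})\<^sup>*" using rtrancl_mono by blast
qed

lemma petrie_s_connected:
  assumes "x \<in> X" "y \<in> X" shows "(x, y) \<in> (path_rel X petrie_s {0, 1, 2})\<^sup>*"
proof -
  have "path_rel X s {0, 1, 2} \<subseteq> (path_rel X petrie_s {0, 1, 2})\<^sup>*"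
  proof
    fix p assume "p \<in> path_rel X s {0, 1, 2}"
    then obtain u i where u: "p = (u, s i u)" "u \<in> X" "i < 3" unfolding path_rel_def by blast
    show "p \<in> (path_rel X petrie_s {0, 1, 2})\<^sup>*"
    proof (cases "i = 0")
      case False
      then have "s i u = petrie_s i u" unfolding petrie_s_def by simp
      moreover have "i \<in> {0, 1, 2}" using u(3) by auto
      ultimately show ?thesis unfolding u(1) using path_rel_step[where s = petrie_s, OF rtrancl_refl u(2,3)] by simp
    next
      case True
      have "petrie_s 0 (petrie_s 2 u) = s i u" using True s012_s012(3)[OF u(2)] by simp
      moreover have "(u, petrie_s 0 (petrie_s 2 u)) \<in> (path_rel X petrie_s {0, 1, 2})\<^sup>*"
        by (rule path_rel_step[where s = petrie_s, OF path_rel_step[where s = petrie_s, OF rtrancl_refl u(2)]]) (simp_all add: s012_closed u)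
      ultimately show ?thesis unfolding u(1) by simp
    qed
  qed
  then have "(path_rel X s {0, 1, 2})\<^sup>* \<subseteq> (path_rel X petrie_s {0, 1, 2})\<^sup>*" by (rule rtrancl_subset_rtrancl)
  then show ?thesis using connected_path[OF assms] by blast
qed

lemma zigzag_path: assumes x: "x \<in> X" shows "(x, zigzag x k) \<in> (path_rel X petrie_s {0, 1})\<^sup>*"
proof (induction k rule: int_induct[of _ 0])
  case base show ?case using zigzag_0[OF x] by simp
next
  case (step1 i)
  have "(x, petrie_s 1 (petrie_s 0 (zigzag x i))) \<in> (path_rel X petrie_s {0, 1})\<^sup>*"
    by (rule path_rel_step[where s = petrie_s, OF path_rel_step[where s = petrie_s, OF step1(2)]]) (simp_all add: zigzag_in x s012_closed)
  then show ?case using zigzag_Suc[of x i] by (simp add: turn_def)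
next
  case (step2 i)
  have "(x, petrie_s 0 (petrie_s 1 (zigzag x i))) \<in> (path_rel X petrie_s {0, 1})\<^sup>*"
    by (rule path_rel_step[where s = petrie_s, OF path_rel_step[where s = petrie_s, OF step2(2)]])
      (use zigzag_in[OF x] s012_closed(2)[OF zigzag_in[OF x, of i]] in simp_all)
  moreover have "petrie_s 0 (petrie_s 1 (zigzag x i)) = zigzag x (i - 1)"
    using turn_inv[OF zigzag_in[OF x], of "i - 1"] zigzag_Suc[of x "i - 1"] s_commute[of "s 1 (zigzag x i)"] by simp
  ultimately show ?case by simp
qed

lemma polygon_path: assumes "x \<in> X" "y \<in> X" "polygon x = polygon y" shows "(x, y) \<in> (path_rel X petrie_s {0, 1})\<^sup>*"
proof -
  obtain k where k: "y = zigzag x k \<or> y = s 1 (zigzag x k)" by (rule polygon_eq[OF assms])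
  have "(x, petrie_s 1 (zigzag x k)) \<in> (path_rel X petrie_s {0, 1})\<^sup>*"
    by (rule path_rel_step[where s = petrie_s, OF zigzag_path[OF assms(1)] zigzag_in[OF assms(1)]]) simp_all
  then show ?thesis using k zigzag_path[OF assms(1), of k] by auto
qed

theorem petrial_flag_system: "flag_system (petrial (toroidal_map b)) X petrie_s petrie_q"
proof
  show "X \<noteq> {}" using x0 by blast
  show "\<And>i x. i < 3 \<Longrightarrow> x \<in> X \<Longrightarrow> petrie_s i x \<in> X" by (rule petrie_s_in)
  show "petrie_s i (petrie_s i x) = x" if "i < 3" "x \<in> X" for i x
    using s_s[OF that] s012_s012 s012_closed s_commute[of "s 0 (s 2 x)"] s_commute[of "s 2 x"] that unfolding petrie_s_def by auto
  show "petrie_s 0 (petrie_s 2 x) = petrie_s 2 (petrie_s 0 x)" for x using s_commute[of "s 2 x"] by simp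
  have n: "Suc 0 = 1" "Suc 1 = 2" "Suc 2 = 3" by simp_all
  show "petrie_q j (petrie_s i x) = petrie_q j x" if i: "i < 3" "x \<in> X" "j \<le> 4" "j \<noteq> Suc i" for i j x
  proof -
    have i3: "i = 0 \<or> i = 1 \<or> i = 2" using i by auto
    have qj: "q j (s 0 (s 2 x)) = q j x" if "j \<noteq> 3" "j \<noteq> 1"
    proof -
      have "q j (s 0 (s 2 x)) = q j (s 2 x)" by (rule q_s) (use i that s012_closed in simp_all)
      also have "\<dots> = q j x" by (rule q_s) (use i that in simp_all)
      finally show ?thesis .
    qed
    show ?thesis
    proof (cases "j = 3")
      case True
      then have "i = 0 \<or> i = 1" using i3 i(4) by auto
      then have "polygon (petrie_s i x) = polygon x" using polygon_s1[OF i(2)] polygon_s02[OF i(2)] unfolding petrie_s_def by (elim disjE) simp_all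
      then show ?thesis unfolding petrie_q_def using True by simp
    next
      case False
      have "q j (petrie_s i x) = q j x"
        by (cases "i = 0") (use qj[OF False] q_s[OF i] i(4) in \<open>simp_all add: petrie_s_def\<close>)
      then show ?thesis unfolding petrie_q_def using False by simp
    qed
  qed
  show "petrie_q (Suc i) (petrie_s i x) \<noteq> petrie_q (Suc i) x" if "i < 3" "x \<in> X" for i x
  proof -
    have "i = 0 \<or> i = 1 \<or> i = 2" using that by auto
    moreover have "q 1 (s 0 (s 2 x)) \<noteq> q 1 x" using q_s012(7)[OF s012_closed(3)[OF that(2)]] q_s012(5)[OF that(2)] by simp
    ultimately show ?thesis using q_s012(8)[OF that(2)] polygon_s2[OF that(2)] unfolding petrie_s_def petrie_q_def
      by (elim disjE) (simp_all add: numeral_2_eq_2[symmetric] numeral_3_eq_3[symmetric])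
  qed
  show "i = j" if "x \<in> X" "y \<in> X" "i \<le> 4" "j \<le> 4" "petrie_q i x = petrie_q j y" for i j x y
    using q_rank[OF that(1-4)] that(5) unfolding petrie_q_def by (simp split: if_splits)
  show "(x, y) \<in> {(u, petrie_s i u) |u i. u \<in> X \<and> i < 3 \<and> petrie_q (Suc i) x \<noteq> petrie_q (Suc i) y}\<^sup>*" if xy: "x \<in> X" "y \<in> X" for x y
  proof (rule strong_connectedI[where s = petrie_s and q = petrie_q])
    obtain v d e where x': "x = (v, d, e)" by (cases x)
    obtain v' d' e' where y': "y = (v', d', e')" by (cases y)
    note q1' = q1[OF xy[unfolded x' y']]
    show "(x, y) \<in> (path_rel X petrie_s {0, 1, 2})\<^sup>*" by (rule petrie_s_connected[OF xy])
    show "(x, y) \<in> (path_rel X petrie_s {1, 2})\<^sup>*" if "petrie_q 1 x = petrie_q 1 y"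
    proof (rule petrie_s_path_12)
      have "v' = v" using that q1' unfolding x' y' by simp
      then show "(x, y) \<in> (path_rel X s {1, 2})\<^sup>*" unfolding x' y' using same_vertex_path xy unfolding x' y' by blast
    qed
    show "(x, y) \<in> (path_rel X petrie_s {0, 2})\<^sup>*" if "petrie_q 2 x = petrie_q 2 y"
    proof -
      have "y \<in> {x, s 2 x, s 0 x, s 0 (s 2 x)}" using same_edge_cases[OF xy] that by simp
      then have "y \<in> {x, petrie_s 2 x, petrie_s 0 (petrie_s 2 x), petrie_s 0 x}" using s012_s012(3)[OF xy(1)] by simp
      moreover have 2: "(x, petrie_s 2 x) \<in> (path_rel X petrie_s {0, 2})\<^sup>*" "(x, petrie_s 0 x) \<in> (path_rel X petrie_s {0, 2})\<^sup>*"
        using path_rel_step[where s = petrie_s, OF rtrancl_refl xy(1), of 2 "{0, 2}"] path_rel_step[where s = petrie_s, OF rtrancl_refl xy(1), of 0 "{0, 2}"] by simp_all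
      moreover have "(x, petrie_s 0 (petrie_s 2 x)) \<in> (path_rel X petrie_s {0, 2})\<^sup>*"
        by (rule path_rel_step[where s = petrie_s, OF 2(1)]) (simp_all add: s012_closed xy)
      ultimately show ?thesis by auto
    qed
    show "(x, y) \<in> (path_rel X petrie_s {0, 1})\<^sup>*" if "petrie_q 3 x = petrie_q 3 y" by (rule polygon_path[OF xy]) (use that in simp)
    show "y = x \<or> y = petrie_s 2 x" if "petrie_q 1 x = petrie_q 1 y" "petrie_q 2 x = petrie_q 2 y" using same_12[OF xy] that by simp
    show "y = x \<or> y = petrie_s 0 x" if e: "petrie_q 2 x = petrie_q 2 y" "petrie_q 3 x = petrie_q 3 y"
    proof -
      have "y \<in> {x, s 2 x, s 0 x, s 0 (s 2 x)}" using same_edge_cases[OF xy] e by simp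
      moreover have "y \<noteq> s 2 x" using polygon_s2[OF xy(1)] e by auto
      \<comment> \<open>For \<open>y = s 0 x\<close> the flag \<open>s 2 y\<close> would lie on the
        polygon of \<open>x\<close>, but \<open>s 2\<close> always changes the polygon.\<close>
      moreover have "y \<noteq> s 0 x"
      proof
        assume "y = s 0 x"
        then have "polygon (s 2 y) = polygon x" using polygon_s02[OF xy(1)] s_commute[of x] by simp
        then show False using polygon_s2[OF xy(2)] e by simp
      qed
      ultimately show ?thesis by auto
    qed
    show "y = x \<or> y = petrie_s 1 x" if e: "petrie_q 1 x = petrie_q 1 y" "petrie_q 3 x = petrie_q 3 y"
    proof -
      have "polygon x = polygon y" using e by simp
      then obtain k where k: "y = zigzag x k \<or> y = s 1 (zigzag x k)" by (rule polygon_eq[OF xy])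
      then have "q 1 (zigzag x k) = q 1 x" using e q_s012(3)[OF zigzag_in[OF xy(1)], of k] by auto
      then have "zigzag x k = x" using zigzag_same_vertex[OF xy(1)] by blast
      then show ?thesis using k by auto
    qed
    show "petrie_q 3 (petrie_s 2 x) \<noteq> petrie_q 3 x" using polygon_s2[OF xy(1)] by simp
    show "x \<in> X" by (rule xy(1))
  qed
  show "petrial (toroidal_map b) = {(petrie_q i x, petrie_q j x) | i j x. x \<in> X \<and> i \<le> j \<and> j \<le> 4}" by (rule petrial_eq)
qed

lemma lmul_petrie_s: "i < 3 \<Longrightarrow> lmul g (petrie_s i x) = petrie_s i (lmul g x)"
  unfolding petrie_s_def by (simp add: lmul_s)

lemma petrial_regular: "regular_polyhedron (petrial (toroidal_map b))"
  by (rule flag_system.regularI[OF petrial_flag_system transitive_maps[OF petrial_flag_system lmul_petrie_s]])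

lemma petrial_nonflat: "nonflat_regular_polyhedron (b\<^sup>2) (petrial (toroidal_map b))"
proof -
  interpret B: flag_system "petrial (toroidal_map b)" X petrie_s petrie_q by (rule petrial_flag_system)
  \<comment> \<open>The zigzag from the origin visits only vertices whose coordinate sum is 0 or 1
    modulo \<open>b\<close>; the vertex (2,0) has sum 2.\<close>
  let ?x = "((0, 0), (1, 0), (0, 1)) :: torus_flag" and ?y = "((2, 0), (1, 0), (0, 1)) :: torus_flag"
  have y: "?y \<in> X" using b3 by (simp add: X_iff box_def frames_def)
  have "(petrie_q 1 ?y, petrie_q 3 ?x) \<notin> petrial (toroidal_map b)"
  proof
    assume "(petrie_q 1 ?y, petrie_q 3 ?x) \<in> petrial (toroidal_map b)"
    then obtain z where z: "z \<in> X" "petrie_q 1 z = petrie_q 1 ?y" "petrie_q 3 z = petrie_q 3 ?x" using B.in_P[OF y x0, of 1 3] by auto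
    have "polygon ?x = polygon z" using z(3) by simp
    then obtain k where k: "z = zigzag ?x k \<or> z = s 1 (zigzag ?x k)" by (rule polygon_eq[OF x0 z(1)])
    then have e: "q 1 (zigzag ?x k) = q 1 ?y" using z(2) q_s012(3)[OF zigzag_in[OF x0], of k] by auto
    have zX: "zigzag ?x k \<in> X" by (rule zigzag_in[OF x0])
    obtain u d e' where u: "zigzag ?x k = (u, d, e')" by (cases "zigzag ?x k")
    have "u = (2, 0)" using e q1[of u d e' "(2, 0)" "(1, 0)" "(0, 1)"] zX y unfolding u by blast
    moreover have "u = md (k div 2, - (k div 2)) \<or> u = md (k div 2 + 1, - (k div 2))"
      using u unfolding zigzag_def int_scale_def by (simp split: if_splits)
    moreover have "md (2, 0) = (2, 0)" using b3 unfolding md_def by simp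
    ultimately have "md (k div 2, - (k div 2)) = md (2, 0) \<or> md (k div 2 + 1, - (k div 2)) = md (2, 0)" by auto
    then have "int b dvd (k div 2 - 2) + - (k div 2) \<or> int b dvd (k div 2 + 1 - 2) + - (k div 2)"
      unfolding md_eq_iff fst_conv snd_conv by (metis dvd_add diff_0_right)
    then show False using dvd_odd_neq by simp
  qed
  then have "\<not> flat (petrial (toroidal_map b))" unfolding flat_def B.faces_simps using x0 y by blast
  moreover have "petrie_q 1 ` X = Inl ` q 1 ` X" by (simp add: image_image)
  ultimately show ?thesis unfolding nonflat_regular_polyhedron_def B.faces_simps using petrial_regular q1_image
    by (simp add: card_image)
qed

lemma turn_funpow: "x \<in> X \<Longrightarrow> (turn ^^ k) x = zigzag x (int k)"
proof (induction k)
  case 0 then show ?case using zigzag_0 by simp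
next
  case (Suc k) then show ?case using zigzag_Suc[of x "int k"] by (simp add: add.commute)
qed

lemma petrial_type: "has_type (petrial (toroidal_map b)) (2 * b) 4"
  unfolding has_type_def
proof
  interpret B: flag_system "petrial (toroidal_map b)" X petrie_s petrie_q by (rule petrial_flag_system)
  fix \<Phi> assume "\<Phi> \<in> flags (petrial (toroidal_map b))"
  then obtain x where x: "x \<in> X" "\<Phi> = B.F x" unfolding B.flags_eq by blast
  have "\<exists>\<gamma>\<in>carrier (Aut (petrial (toroidal_map b))). B.act \<gamma> x = petrie_s i x" if "i < 3" for i
    by (rule B.regularD[OF petrial_regular x(1) petrie_s_in[OF that x(1)]])
  then have ex: "\<And>i. i < 3 \<Longrightarrow> \<exists>\<gamma>. \<gamma> \<in> carrier (Aut (petrial (toroidal_map b))) \<and> B.act \<gamma> x = petrie_s i x" by blast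
  obtain r0 where r0: "r0 \<in> carrier (Aut (petrial (toroidal_map b)))" "B.act r0 x = petrie_s 0 x" using ex[of 0] by auto
  obtain r1 where r1: "r1 \<in> carrier (Aut (petrial (toroidal_map b)))" "B.act r1 x = petrie_s 1 x" using ex[of 1] by auto
  obtain r2 where r2: "r2 \<in> carrier (Aut (petrial (toroidal_map b)))" "B.act r2 x = petrie_s 2 x" using ex[of 2] by auto
  have "(\<lambda>u. petrie_s 1 (petrie_s 0 u)) = turn" unfolding turn_def by auto
  then have "((\<lambda>u. petrie_s 1 (petrie_s 0 u)) ^^ k) x = x \<longleftrightarrow> 2 * b dvd k" for k
    using turn_funpow[OF x(1), of k] zigzag_period[OF x(1), of "int k"] by (metis int_dvd_int_iff of_nat_mult of_nat_numeral)
  from B.ord_eq[OF x(1) _ _ r0(1) r1(1) r0(2) r1(2) this]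
  have o1: "group.ord (Aut (petrial (toroidal_map b))) (r0 \<otimes>\<^bsub>Aut (petrial (toroidal_map b))\<^esub> r1) = 2 * b" by simp
  obtain v d e where x': "x = (v, d, e)" by (cases x)
  have f: "(d, e) \<in> frames" using x unfolding x' by (simp add: X_iff)
  have nz: "- e \<noteq> e" "- d \<noteq> d" "d \<noteq> e" "e \<noteq> d" "d \<noteq> - e" "e \<noteq> - d" using f by (elim framesE; simp)+
  let ?g = "\<lambda>u. petrie_s 2 (petrie_s 1 u)"
  have G: "?g = (\<lambda>(v, d, e). (v, e, -d))" by auto
  have g4: "(?g ^^ 4) x = x" unfolding x' G by (simp add: numeral_eq_Suc)
  have gm: "(?g ^^ (k mod 4)) x = (?g ^^ k) x" for k by (rule funpow_mod_eq[OF g4])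
  have "(?g ^^ k) x = x \<longleftrightarrow> 4 dvd k" for k
  proof -
    have "k mod 4 = 0 \<or> k mod 4 = 1 \<or> k mod 4 = 2 \<or> k mod 4 = 3" by auto
    then have "(?g ^^ (k mod 4)) x = x \<longleftrightarrow> k mod 4 = 0"
      using nz unfolding x' G by (elim disjE) (simp_all add: numeral_2_eq_2 numeral_3_eq_3)
    then show ?thesis unfolding gm by (simp add: dvd_eq_mod_eq_0)
  qed
  from B.ord_eq[OF x(1) _ _ r1(1) r2(1) r1(2) r2(2) this]
  have o2: "group.ord (Aut (petrial (toroidal_map b))) (r1 \<otimes>\<^bsub>Aut (petrial (toroidal_map b))\<^esub> r2) = 4" by simp
  show "\<exists>\<rho>\<^sub>0 \<rho>\<^sub>1 \<rho>\<^sub>2. distinguished_generators (petrial (toroidal_map b)) \<Phi> \<rho>\<^sub>0 \<rho>\<^sub>1 \<rho>\<^sub>2 \<and>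
        group.ord (Aut (petrial (toroidal_map b))) (\<rho>\<^sub>0 \<otimes>\<^bsub>Aut (petrial (toroidal_map b))\<^esub> \<rho>\<^sub>1) = 2 * b \<and>
        group.ord (Aut (petrial (toroidal_map b))) (\<rho>\<^sub>1 \<otimes>\<^bsub>Aut (petrial (toroidal_map b))\<^esub> \<rho>\<^sub>2) = 4"
    using B.distinguishedI[OF x(1) r0(1) r1(1) r2(1) r0(2) r1(2) r2(2)] o1 o2 unfolding x(2) by blast
qed

text \<open>An isomorphism would carry the rotation of a square, which returns to the base flag
  after four steps, to \<open>turn\<close>, whose period \<open>2 b\<close> is at least 6.\<close>

lemma petrial_not_isomorphic: "\<not> poset_isomorphic (toroidal_map b) (petrial (toroidal_map b))"
proof
  assume "poset_isomorphic (toroidal_map b) (petrial (toroidal_map b))"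
  then obtain h where h: "bij_betw h (Field (toroidal_map b)) (Field (petrial (toroidal_map b)))"
    "\<And>a c. a \<in> Field (toroidal_map b) \<Longrightarrow> c \<in> Field (toroidal_map b) \<Longrightarrow> (a, c) \<in> toroidal_map b \<longleftrightarrow> (h a, h c) \<in> petrial (toroidal_map b)"
    unfolding poset_isomorphic_def by blast
  obtain f where f: "bij_betw f X X" "\<And>i x. i < 3 \<Longrightarrow> x \<in> X \<Longrightarrow> f (s i x) = petrie_s i (f x)"
    using iso_flag_bij[OF torus_flag_system petrial_flag_system h] by metis
  let ?g = "\<lambda>u. s 1 (s 0 u)" and ?x = "((0, 0), (1, 0), (0, 1)) :: torus_flag"
  have g: "f (?g u) = turn (f u) \<and> ?g u \<in> X" if "u \<in> X" for u
    using f(2)[of 1 "s 0 u"] f(2)[of 0 u] s012_closed that unfolding turn_def by simp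
  have fg: "f ((?g ^^ k) ?x) = (turn ^^ k) (f ?x) \<and> (?g ^^ k) ?x \<in> X" for k
    by (induction k) (use x0 g in simp_all)
  have "1 mod int b = 1" using b3 by simp
  then have "(?g ^^ 4) ?x = ?x" by (simp add: numeral_eq_Suc md_def mod_simps)
  moreover have fx: "f ?x \<in> X" using f(1) x0 unfolding bij_betw_def by blast
  ultimately have "zigzag (f ?x) 4 = f ?x" using fg[of 4] turn_funpow[OF fx, of 4] by simp
  then have "2 * int b dvd 4" unfolding zigzag_period[OF fx] .
  then show False using zdvd_not_zless[of 4 "2 * int b"] b3 by simp
qed

end

section \<open>Groups generated by three involutions\<close>

context group
begin

lemma pow_conj:
  assumes "x \<in> carrier G" "n \<in> carrier G" "m \<in> carrier G" "x \<otimes> n = m \<otimes> x"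
  shows "x \<otimes> n [^] (i::int) = m [^] i \<otimes> x"
proof -
  have nat: "x \<otimes> n' [^] (k::nat) = m' [^] k \<otimes> x" if "n' \<in> carrier G" "m' \<in> carrier G" "x \<otimes> n' = m' \<otimes> x" for n' m' k
  proof (induction k)
    case 0 then show ?case using assms by simp
  next
    case (Suc k)
    have "x \<otimes> (n' [^] k \<otimes> n') = (x \<otimes> n' [^] k) \<otimes> n'" using that assms by (simp add: m_assoc)
    also have "\<dots> = m' [^] k \<otimes> (x \<otimes> n')" unfolding Suc.IH using that assms by (simp add: m_assoc)
    also have "\<dots> = (m' [^] k \<otimes> m') \<otimes> x" unfolding that(3) using that assms by (simp add: m_assoc)
    finally show ?case by simp
  qed
  have inv: "x \<otimes> inv n = inv m \<otimes> x"
  proof -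
    have "inv m \<otimes> (x \<otimes> n) \<otimes> inv n = inv m \<otimes> (m \<otimes> x) \<otimes> inv n" using assms(4) by simp
    moreover have "inv m \<otimes> (x \<otimes> n) \<otimes> inv n = inv m \<otimes> x" using assms(1-3) by (simp add: m_assoc)
    moreover have "inv m \<otimes> (m \<otimes> x) \<otimes> inv n = x \<otimes> inv n" using assms(1-3) by (simp add: m_assoc[symmetric])
    ultimately show ?thesis by simp
  qed
  show ?thesis
  proof (cases i rule: int_cases2)
    case (nonneg k)
    then show ?thesis using nat[OF assms(2-4), of k] by (simp add: int_pow_int)
  next
    case (nonpos k)
    have "n [^] (- int k) = (inv n) [^] k" "m [^] (- int k) = (inv m) [^] k"
      using assms by (simp_all add: int_pow_neg_int nat_pow_inv)
    then show ?thesis using nat[OF _ _ inv, of k] nonpos assms by simp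
  qed
qed

lemma card_powers: "x \<in> carrier G \<Longrightarrow> card (range (\<lambda>i::int. x [^] i)) = ord x"
  using generate_pow_card[of x] generate_pow[of x] by (simp add: full_SetCompr_eq)

lemma subgroup_pow_card:
  assumes "subgroup T G" "y \<in> T"
  shows "y [^] card T = \<one>"
proof -
  interpret T: group "G\<lparr>carrier := T\<rparr>" by (rule subgroup_imp_group[OF assms(1)])
  have "y [^]\<^bsub>G\<lparr>carrier := T\<rparr>\<^esub> order (G\<lparr>carrier := T\<rparr>) = \<one>\<^bsub>G\<lparr>carrier := T\<rparr>\<^esub>"
    by (rule T.pow_order_eq_1) (simp add: assms(2))
  then show ?thesis using nat_pow_consistent[of y "card T" T] by (simp add: order_def)
qed

lemma subgroup_mult_inj:
  assumes "subgroup N G" "subgroup D G" "N \<inter> D \<subseteq> {\<one>}"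
    "n \<in> N" "n' \<in> N" "d \<in> D" "d' \<in> D" "n \<otimes> d = n' \<otimes> d'"
  shows "n = n' \<and> d = d'"
proof -
  have c: "n \<in> carrier G" "n' \<in> carrier G" "d \<in> carrier G" "d' \<in> carrier G"
    using assms subgroup.mem_carrier by metis+
  have "inv n' \<otimes> (n \<otimes> d) \<otimes> inv d = inv n' \<otimes> (n' \<otimes> d') \<otimes> inv d" using assms(8) by simp
  then have e: "inv n' \<otimes> n = d' \<otimes> inv d" using c by (simp add: m_assoc) (simp add: m_assoc[symmetric])
  have "inv n' \<otimes> n \<in> N" "d' \<otimes> inv d \<in> D"
    using assms by (simp_all add: subgroup.m_closed subgroup.m_inv_closed)
  then have "inv n' \<otimes> n = \<one>" "d' \<otimes> inv d = \<one>" using assms(3) e by auto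
  then show ?thesis using c by (metis inv_equality inv_inv inv_closed)
qed

lemma subgroup_mult_card:
  assumes "subgroup N G" "subgroup D G" "N \<inter> D \<subseteq> {\<one>}"
  shows "card ((\<lambda>(n, d). n \<otimes> d) ` (N \<times> D)) = card N * card D"
proof -
  have "inj_on (\<lambda>(n, d). n \<otimes> d) (N \<times> D)"
  proof (rule inj_onI, clarify)
    fix a c a' c' assume "a \<in> N" "c \<in> D" "a' \<in> N" "c' \<in> D" "a \<otimes> c = a' \<otimes> c'"
    then show "a = a' \<and> c = c'" by (intro subgroup_mult_inj[OF assms])
  qed
  then show ?thesis by (simp add: card_image card_cartesian_product)
qed

text \<open>In a finite group the inverse of an element is one of its powers.\<close>

lemma finite_subgroupI:
  assumes "finite (carrier G)" "S \<subseteq> carrier G" "\<one> \<in> S" "\<And>x y. x \<in> S \<Longrightarrow> y \<in> S \<Longrightarrow> x \<otimes> y \<in> S"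
  shows "subgroup S G"
proof (rule subgroupI)
  fix x assume x: "x \<in> S"
  then have xc: "x \<in> carrier G" using assms(2) by blast
  have pw: "x [^] (k::nat) \<in> S" for k by (induction k) (use assms(3,4) x in simp_all)
  have "order G > 0" using assms(1) by (simp add: order_gt_0_iff_finite)
  then have "x [^] (order G - 1) \<otimes> x = x [^] order G" using xc by (metis Suc_diff_1 nat_pow_Suc)
  then have "x [^] (order G - 1) \<otimes> x = \<one>" using pow_order_eq_1[OF xc] by simp
  then have "inv x = x [^] (order G - 1)" using xc by (intro inv_equality) simp_all
  then show "inv x \<in> S" using pw by simp
qed (use assms in auto)

text \<open>For involutions \<open>x\<close> and \<open>y\<close> of a finite group this is the
  subgroup that they generate, listed as rotations and reflections.\<close>

definition Dih :: "'a \<Rightarrow> 'a \<Rightarrow> 'a set" where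
  "Dih x y = range (\<lambda>i::int. (x \<otimes> y) [^] i) \<union> range (\<lambda>i::int. (x \<otimes> y) [^] i \<otimes> x)"

lemma Dih_pow_x:
  assumes "x \<in> carrier G" "y \<in> carrier G" "x \<otimes> x = \<one>" "y \<otimes> y = \<one>"
  shows "x \<otimes> (x \<otimes> y) [^] (i::int) = (x \<otimes> y) [^] (-i) \<otimes> x"
proof -
  have "inv x = x" "inv y = y" using assms by (simp_all add: inv_equality)
  then have iu: "inv (x \<otimes> y) = y \<otimes> x" using assms by (simp add: inv_mult_group)
  have "x \<otimes> (x \<otimes> y) = inv (x \<otimes> y) \<otimes> x"
    unfolding iu using assms by (metis l_one m_assoc r_one)
  then have "x \<otimes> (x \<otimes> y) [^] i = (inv (x \<otimes> y)) [^] i \<otimes> x" using assms by (intro pow_conj) simp_all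
  then show ?thesis using assms by (simp add: int_pow_inv int_pow_neg)
qed

lemma Dih_subgroup:
  assumes fin: "finite (carrier G)" and xy: "x \<in> carrier G" "y \<in> carrier G" "x \<otimes> x = \<one>" "y \<otimes> y = \<one>"
  shows "subgroup (Dih x y) G" "x \<in> Dih x y" "y \<in> Dih x y"
proof -
  let ?u = "x \<otimes> y"
  have uc: "?u \<in> carrier G" using xy by simp
  note px = Dih_pow_x[OF xy]
  show "x \<in> Dih x y"
  proof -
    have "x = ?u [^] (0::int) \<otimes> x" using xy by simp
    then show ?thesis unfolding Dih_def by blast
  qed
  show "subgroup (Dih x y) G"
  proof (rule finite_subgroupI[OF fin])
    show "Dih x y \<subseteq> carrier G" unfolding Dih_def using xy by auto
    have "\<one> = ?u [^] (0::int)" by simp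
    then show "\<one> \<in> Dih x y" unfolding Dih_def by blast
    fix g h assume gh: "g \<in> Dih x y" "h \<in> Dih x y"
    have g: "(\<exists>i::int. g = ?u [^] i) \<or> (\<exists>i::int. g = ?u [^] i \<otimes> x)" using gh(1) unfolding Dih_def by blast
    have h: "(\<exists>i::int. h = ?u [^] i) \<or> (\<exists>i::int. h = ?u [^] i \<otimes> x)" using gh(2) unfolding Dih_def by blast
    have R: "?u [^] k \<in> Dih x y" "?u [^] k \<otimes> x \<in> Dih x y" for k :: int unfolding Dih_def by blast+
    have 1: "?u [^] i \<otimes> ?u [^] j = ?u [^] (i + j)" for i j :: int using uc by (simp add: int_pow_mult)
    have 2: "?u [^] i \<otimes> (?u [^] j \<otimes> x) = ?u [^] (i + j) \<otimes> x" for i j :: int using uc xy by (simp add: int_pow_mult m_assoc)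
    have 3: "?u [^] i \<otimes> x \<otimes> ?u [^] j = ?u [^] (i - j) \<otimes> x" for i j :: int
    proof -
      have "?u [^] i \<otimes> x \<otimes> ?u [^] j = ?u [^] i \<otimes> (x \<otimes> ?u [^] j)" using uc xy by (simp add: m_assoc)
      also have "\<dots> = (?u [^] i \<otimes> ?u [^] (-j)) \<otimes> x" unfolding px using uc xy by (simp add: m_assoc)
      finally show ?thesis unfolding 1 by simp
    qed
    have 4: "?u [^] i \<otimes> x \<otimes> (?u [^] j \<otimes> x) = ?u [^] (i - j)" for i j :: int
    proof -
      have "?u [^] i \<otimes> x \<otimes> (?u [^] j \<otimes> x) = (?u [^] i \<otimes> x \<otimes> ?u [^] j) \<otimes> x" using uc xy by (simp add: m_assoc)
      also have "\<dots> = ?u [^] (i - j) \<otimes> (x \<otimes> x)" unfolding 3 using uc xy by (simp add: m_assoc)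
      finally show ?thesis using uc xy by simp
    qed
    show "g \<otimes> h \<in> Dih x y" using g h
    proof (elim disjE exE)
      fix i j :: int assume "g = ?u [^] i" "h = ?u [^] j" then show ?thesis using 1 R by simp
    next
      fix i j :: int assume "g = ?u [^] i" "h = ?u [^] j \<otimes> x" then show ?thesis using 2 R by simp
    next
      fix i j :: int assume "g = ?u [^] i \<otimes> x" "h = ?u [^] j" then show ?thesis using 3 R by simp
    next
      fix i j :: int assume "g = ?u [^] i \<otimes> x" "h = ?u [^] j \<otimes> x" then show ?thesis using 4 R by simp
    qed
  qed
  have "?u [^] (-1::int) \<otimes> x = inv ?u \<otimes> x" using uc by (simp add: int_pow_neg)
  also have "\<dots> = y \<otimes> x \<otimes> x" using xy by (simp add: inv_mult_group inv_equality)
  also have "\<dots> = y" using xy by (simp add: m_assoc)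
  finally have "y = ?u [^] (-1::int) \<otimes> x" by (rule sym)
  then show "y \<in> Dih x y" unfolding Dih_def by blast
qed

lemma Dih_least:
  assumes "subgroup S G" "x \<in> S" "y \<in> S"
  shows "Dih x y \<subseteq> S"
proof -
  have "(x \<otimes> y) [^] i \<in> S" for i :: int
    using assms by (intro subgroup_int_pow_closed subgroup.m_closed)
  then show ?thesis unfolding Dih_def using assms by (auto intro: subgroup.m_closed)
qed

text \<open>The rotations and the reflections are equally many. They are disjoint if
  \<open>x y\<close> has order above 2: otherwise \<open>x\<close> is a power of \<open>x y\<close>,
  so it commutes with \<open>x y\<close> as well as inverting it.\<close>

lemma card_Dih:
  assumes fin: "finite (carrier G)" and xy: "x \<in> carrier G" "y \<in> carrier G" "x \<otimes> x = \<one>" "y \<otimes> y = \<one>"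
  shows "card (Dih x y) \<le> 2 * ord (x \<otimes> y)" "ord (x \<otimes> y) > 2 \<Longrightarrow> card (Dih x y) = 2 * ord (x \<otimes> y)"
proof -
  let ?u = "x \<otimes> y"
  let ?A = "range (\<lambda>i::int. ?u [^] i)" and ?B = "range (\<lambda>i::int. ?u [^] i \<otimes> x)"
  have uc: "?u \<in> carrier G" using xy by simp
  have fA: "?A \<subseteq> carrier G" "?B \<subseteq> carrier G" using xy by auto
  have B: "?B = (\<lambda>g. g \<otimes> x) ` ?A" by (simp add: image_image)
  have "inj_on (\<lambda>g. g \<otimes> x) ?A"
  proof (rule inj_onI)
    fix g h assume "g \<in> ?A" "h \<in> ?A" and e: "g \<otimes> x = h \<otimes> x"
    then have "g \<in> carrier G" "h \<in> carrier G" using fA(1) by (meson subsetD)+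
    then show "g = h" using e xy(1) by simp
  qed
  then have "card ?B = card ?A" unfolding B by (rule card_image)
  then have cB: "card ?B = ord ?u" using card_powers[OF uc] by (rule trans)
  have fin2: "finite ?A" "finite ?B" by (rule finite_subset[OF fA(1) fin], rule finite_subset[OF fA(2) fin])
  show "card (Dih x y) \<le> 2 * ord ?u" unfolding Dih_def using card_Un_le[of ?A ?B] unfolding cB card_powers[OF uc] by linarith
  assume o: "ord ?u > 2"
  have "?A \<inter> ?B = {}"
  proof (rule ccontr)
    assume "?A \<inter> ?B \<noteq> {}"
    then obtain g where "g \<in> ?A" "g \<in> ?B" by blast
    then obtain i j :: int where ij: "?u [^] i = ?u [^] j \<otimes> x" by (metis (no_types, lifting) imageE)
    have "x = ?u [^] (i - j)"
    proof -
      have "?u [^] (-j) \<otimes> (?u [^] i) = ?u [^] (-j) \<otimes> (?u [^] j \<otimes> x)" using ij by simp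
      then show ?thesis using uc xy by (simp add: m_assoc[symmetric] int_pow_mult[symmetric])
    qed
    then have "x \<otimes> ?u = ?u \<otimes> x" using uc by (metis add.commute int_pow_1 int_pow_mult)
    moreover have "x \<otimes> ?u = inv ?u \<otimes> x" using Dih_pow_x[OF xy, of 1] uc by (simp add: int_pow_neg)
    ultimately have "?u = inv ?u" using uc xy by (metis inv_closed right_cancel)
    then have "?u \<otimes> ?u = \<one>" using uc by (metis r_inv)
    then have "?u [^] (2::nat) = \<one>" using uc by (simp add: numeral_2_eq_2)
    then have "ord ?u dvd 2" using pow_eq_id[OF uc] by blast
    then show False using o by (auto dest: dvd_imp_le)
  qed
  then show "card (Dih x y) = 2 * ord ?u" unfolding Dih_def
    using card_Un_disjoint[OF fin2] unfolding cB card_powers[OF uc] by linarith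
qed

text \<open>Only the inclusion of the conjugate in \<open>N\<close> is demanded; in a finite group
  this is the normaliser.\<close>

definition Norm :: "'a set \<Rightarrow> 'a set" where
  "Norm N = {g \<in> carrier G. \<forall>y\<in>N. g \<otimes> y \<otimes> inv g \<in> N}"

lemma Norm_subgroup: "finite (carrier G) \<Longrightarrow> N \<subseteq> carrier G \<Longrightarrow> subgroup (Norm N) G"
proof (rule finite_subgroupI)
  assume N: "N \<subseteq> carrier G"
  show "\<one> \<in> Norm N" unfolding Norm_def using N by (auto simp: subset_iff)
  fix g h assume gh: "g \<in> Norm N" "h \<in> Norm N"
  then have c: "g \<in> carrier G" "h \<in> carrier G" unfolding Norm_def by blast+
  have "g \<otimes> h \<otimes> y \<otimes> inv (g \<otimes> h) \<in> N" if y: "y \<in> N" for y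
  proof -
    have "g \<otimes> h \<otimes> y \<otimes> inv (g \<otimes> h) = g \<otimes> (h \<otimes> y \<otimes> inv h) \<otimes> inv g"
      using c y N by (simp add: m_assoc inv_mult_group subset_iff)
    moreover have "h \<otimes> y \<otimes> inv h \<in> N" using gh(2) y unfolding Norm_def by blast
    ultimately show ?thesis using gh(1) unfolding Norm_def by simp
  qed
  then show "g \<otimes> h \<in> Norm N" unfolding Norm_def using c by simp
qed (auto simp: Norm_def)

lemma Norm_self: "subgroup N G \<Longrightarrow> N \<subseteq> Norm N"
  unfolding Norm_def using subgroup.mem_carrier[of N G] subgroup.m_closed[of N G] subgroup.m_inv_closed[of N G] by blast

lemma powers2:
  assumes "n \<in> carrier G" "m \<in> carrier G" "n \<otimes> m = m \<otimes> n"
  shows "subgroup {n [^] i \<otimes> m [^] j | (i::int) (j::int). True} G"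
    "\<And>x y. x \<in> {n [^] i \<otimes> m [^] j | (i::int) (j::int). True} \<Longrightarrow> y \<in> {n [^] i \<otimes> m [^] j | (i::int) (j::int). True} \<Longrightarrow> x \<otimes> y = y \<otimes> x"
    "\<And>(i::int) (j::int) (k::int) (l::int). (n [^] i \<otimes> m [^] j) \<otimes> (n [^] k \<otimes> m [^] l) = n [^] (i + k) \<otimes> m [^] (j + l)"
proof -
  let ?T = "{n [^] i \<otimes> m [^] j | (i::int) (j::int). True}"
  have c0: "m \<otimes> n [^] k = n [^] k \<otimes> m" for k :: int by (rule pow_conj[OF assms(2,1,1) assms(3)[symmetric]])
  have c: "n [^] k \<otimes> m [^] j = m [^] j \<otimes> n [^] k" for j k :: int by (rule pow_conj[OF int_pow_closed[OF assms(1)] assms(2,2) c0[symmetric]])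
  show *: "(n [^] i \<otimes> m [^] j) \<otimes> (n [^] k \<otimes> m [^] l) = n [^] (i + k) \<otimes> m [^] (j + l)" for i j k l :: int
  proof -
    have "(n [^] i \<otimes> m [^] j) \<otimes> (n [^] k \<otimes> m [^] l) = n [^] i \<otimes> (m [^] j \<otimes> n [^] k) \<otimes> m [^] l"
      using assms by (simp add: m_assoc)
    also have "\<dots> = (n [^] i \<otimes> n [^] k) \<otimes> (m [^] j \<otimes> m [^] l)" unfolding c[symmetric] using assms by (simp add: m_assoc)
    finally show ?thesis using assms by (simp add: int_pow_mult)
  qed
  show "x \<otimes> y = y \<otimes> x" if xy: "x \<in> ?T" "y \<in> ?T" for x y
  proof -
    obtain i j k l :: int where "x = n [^] i \<otimes> m [^] j" "y = n [^] k \<otimes> m [^] l" using xy by blast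
    then show ?thesis using * by (simp add: add.commute)
  qed
  show "subgroup ?T G"
  proof (rule subgroupI)
    show "?T \<subseteq> carrier G" using assms by auto
    show "?T \<noteq> {}" by blast
    fix x assume "x \<in> ?T"
    then obtain i j :: int where x: "x = n [^] i \<otimes> m [^] j" by blast
    have "(n [^] (-i) \<otimes> m [^] (-j)) \<otimes> x = \<one>" unfolding x * by simp
    then have "inv x = n [^] (-i) \<otimes> m [^] (-j)" using x assms by (intro inv_equality) simp_all
    then show "inv x \<in> ?T" by blast
  next
    fix x y assume "x \<in> ?T" "y \<in> ?T"
    then obtain i j k l :: int where "x = n [^] i \<otimes> m [^] j" "y = n [^] k \<otimes> m [^] l" by blast
    then show "x \<otimes> y \<in> ?T" using * by blast
  qed
qed

end

text \<open>\<open>braid\<close> says that \<open>(r1 r2)^4\<close> is trivial and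
  \<open>z_ne\<close> that \<open>(r1 r2)^2\<close> is not, so \<open>r1\<close> and
  \<open>r2\<close> generate a dihedral group of order 8. Generation by the three involutions is
  stated as induction on right multiplication, which matches steps between adjacent flags.\<close>

locale string_group = group G for G (structure) +
  fixes r0 r1 r2
  assumes r_closed [simp]: "r0 \<in> carrier G" "r1 \<in> carrier G" "r2 \<in> carrier G"
    and sq: "r0 \<otimes> r0 = \<one>" "r1 \<otimes> r1 = \<one>" "r2 \<otimes> r2 = \<one>"
    and c20: "r2 \<otimes> r0 = r0 \<otimes> r2"
    and braid: "r2 \<otimes> (r1 \<otimes> (r2 \<otimes> r1)) = r1 \<otimes> (r2 \<otimes> (r1 \<otimes> r2))"
    and z_ne: "r1 \<otimes> (r2 \<otimes> (r1 \<otimes> r2)) \<noteq> \<one>"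
    and gen: "\<And>S. \<one> \<in> S \<Longrightarrow> (\<And>g. g \<in> carrier G \<Longrightarrow> g \<in> S \<Longrightarrow> g \<otimes> r0 \<in> S \<and> g \<otimes> r1 \<in> S \<and> g \<otimes> r2 \<in> S) \<Longrightarrow> carrier G \<subseteq> S"
    and fin: "finite (carrier G)"
begin

lemma sq': "x \<in> carrier G \<Longrightarrow> r0 \<otimes> (r0 \<otimes> x) = x" "x \<in> carrier G \<Longrightarrow> r1 \<otimes> (r1 \<otimes> x) = x" "x \<in> carrier G \<Longrightarrow> r2 \<otimes> (r2 \<otimes> x) = x"
  by (simp_all add: m_assoc[symmetric] sq)

lemma c20': "x \<in> carrier G \<Longrightarrow> r2 \<otimes> (r0 \<otimes> x) = r0 \<otimes> (r2 \<otimes> x)"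
  by (simp add: m_assoc[symmetric] c20)

lemma braid': "x \<in> carrier G \<Longrightarrow> r2 \<otimes> (r1 \<otimes> (r2 \<otimes> (r1 \<otimes> x))) = r1 \<otimes> (r2 \<otimes> (r1 \<otimes> (r2 \<otimes> x)))"
proof -
  assume x: "x \<in> carrier G"
  have "(r2 \<otimes> (r1 \<otimes> (r2 \<otimes> r1))) \<otimes> x = (r1 \<otimes> (r2 \<otimes> (r1 \<otimes> r2))) \<otimes> x" using braid by simp
  then show ?thesis using x by (simp add: m_assoc)
qed

text \<open>Rewriting for products bracketed to the right: squares cancel, \<open>r0\<close> moves
  left past \<open>r2\<close>, and \<open>r2 r1 r2 r1\<close> becomes \<open>r1 r2 r1 r2\<close>.
  The primed rules do the same in front of a further factor.\<close>

lemmas word_simps = m_assoc sq sq' c20 c20' braid braid'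

lemma inv_r [simp]: "inv r0 = r0" "inv r1 = r1" "inv r2 = r2"
  by (simp_all add: inv_equality sq)

text \<open>The half turn about the base vertex, which generates the centre of
  \<open>D\<close>.\<close>

definition z where "z = r1 \<otimes> (r2 \<otimes> (r1 \<otimes> r2))"

lemma z_closed [simp]: "z \<in> carrier G" unfolding z_def by simp

lemma z_props: "z \<otimes> z = \<one>" "z \<otimes> r1 = r1 \<otimes> z" "z \<otimes> r2 = r2 \<otimes> z" "inv z = z"
proof -
  show 1: "z \<otimes> z = \<one>" "z \<otimes> r1 = r1 \<otimes> z" "z \<otimes> r2 = r2 \<otimes> z" unfolding z_def by (simp_all add: word_simps)
  show "inv z = z" by (rule inv_equality) (simp_all add: 1)
qed

definition D where "D = Dih r1 r2"

lemma D_subgroup: "subgroup D G" and D_r: "r1 \<in> D" "r2 \<in> D"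
  unfolding D_def using Dih_subgroup[OF fin _ _ sq(2,3)] by simp_all

lemma D_least: "subgroup S G \<Longrightarrow> r1 \<in> S \<Longrightarrow> r2 \<in> S \<Longrightarrow> D \<subseteq> S"
  unfolding D_def by (rule Dih_least)

lemma ord_u: "ord (r1 \<otimes> r2) = 4"
proof -
  let ?u = "r1 \<otimes> r2"
  have u2: "?u [^] (2::nat) = z" "?u [^] (4::nat) = \<one>" by (simp_all add: z_def eval_nat_numeral word_simps)
  have uc: "?u \<in> carrier G" by simp
  have "?u [^] (2::nat) \<noteq> \<one>" unfolding u2 z_def by (rule z_ne)
  then have "ord ?u dvd 4" "\<not> ord ?u dvd 2" using u2(2) unfolding pow_eq_id[OF uc] by blast+
  then have "ord ?u \<in> {1..4}" by (auto dest: dvd_imp_le intro!: Suc_leI Nat.gr0I)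
  then have "ord ?u = 1 \<or> ord ?u = 2 \<or> ord ?u = 3 \<or> ord ?u = 4" by auto
  then show ?thesis using \<open>ord ?u dvd 4\<close> \<open>\<not> ord ?u dvd 2\<close> by auto
qed

lemma card_D: "card D = 8"
  unfolding D_def using card_Dih(2)[OF fin _ _ sq(2,3)] ord_u by simp

lemma D_cases:
  assumes "d \<in> D"
  obtains "d = \<one>" | "d = r1" | "d = r2" | "d = r1 \<otimes> r2" | "d = r2 \<otimes> r1" | "d = r1 \<otimes> (r2 \<otimes> r1)" | "d = r2 \<otimes> (r1 \<otimes> r2)" | "d = z"
proof -
  let ?u = "r1 \<otimes> r2"
  have u: "?u [^] (i::int) \<in> {\<one>, ?u, z, r2 \<otimes> r1}" for i
  proof -
    have "?u [^] i = ?u [^] (i mod 4)" using int_pow_eq[of ?u i "i mod 4"] ord_u by (simp add: mod_eq_dvd_iff[symmetric])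
    also have "i mod 4 = int (nat (i mod 4))" by simp
    finally have e: "?u [^] i = ?u [^] (nat (i mod 4))" by (simp only: int_pow_int)
    have "nat (i mod 4) < 4" by simp
    then consider "nat (i mod 4) = 0" | "nat (i mod 4) = 1" | "nat (i mod 4) = 2" | "nat (i mod 4) = 3" by linarith
    then show ?thesis unfolding e by cases (simp_all add: z_def eval_nat_numeral word_simps)
  qed
  have "d \<in> {\<one>, r1, r2, ?u, r2 \<otimes> r1, r1 \<otimes> (r2 \<otimes> r1), r2 \<otimes> (r1 \<otimes> r2), z}"
  proof -
    consider i :: int where "d = ?u [^] i" | i :: int where "d = ?u [^] i \<otimes> r1" using assms unfolding D_def Dih_def by blast
    then show ?thesis
    proof cases
      case 1 then show ?thesis using u[of i] by auto
    next
      case 2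
      then have "d = \<one> \<otimes> r1 \<or> d = ?u \<otimes> r1 \<or> d = z \<otimes> r1 \<or> d = r2 \<otimes> r1 \<otimes> r1" using u[of i] by auto
      then show ?thesis by (auto simp: z_def word_simps)
    qed
  qed
  then show thesis using that by blast
qed

lemma Norm_all:
  assumes N: "subgroup N G" and c: "\<And>y. y \<in> N \<Longrightarrow> r0 \<otimes> y \<otimes> r0 \<in> N" "\<And>y. y \<in> N \<Longrightarrow> r1 \<otimes> y \<otimes> r1 \<in> N" "\<And>y. y \<in> N \<Longrightarrow> r2 \<otimes> y \<otimes> r2 \<in> N"
  shows "N \<lhd> G"
proof -
  have S: "subgroup (Norm N) G" by (rule Norm_subgroup[OF fin subgroup.subset[OF N]])
  have "r0 \<in> Norm N" "r1 \<in> Norm N" "r2 \<in> Norm N" unfolding Norm_def using c by simp_all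
  then have "carrier G \<subseteq> Norm N" by (intro gen) (auto intro: subgroup.m_closed[OF S] subgroup.one_closed[OF S])
  then show ?thesis unfolding normal_inv_iff Norm_def using N by blast
qed

text \<open>The product of \<open>N\<close> and \<open>D\<close> absorbs right multiplication by
  \<open>r1\<close> and \<open>r2\<close>, and by \<open>r0 = n d\<close> because \<open>N\<close>
  is normal.\<close>

lemma ND_all:
  assumes N: "N \<lhd> G" and n: "n \<in> N" and d: "d \<in> D" and r0: "r0 = n \<otimes> d" and g: "g \<in> carrier G"
  shows "\<exists>y\<in>N. \<exists>c\<in>D. g = y \<otimes> c"
proof -
  have Ns: "subgroup N G" using N by (rule normal_imp_subgroup)
  have Nc: "y \<in> carrier G" if "y \<in> N" for y by (rule subgroup.mem_carrier[OF Ns that])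
  have Dc: "y \<in> carrier G" if "y \<in> D" for y by (rule subgroup.mem_carrier[OF D_subgroup that])
  let ?S = "{y \<otimes> c | y c. y \<in> N \<and> c \<in> D}"
  have "carrier G \<subseteq> ?S"
  proof (rule gen)
    show "\<one> \<in> ?S" using subgroup.one_closed[OF Ns] subgroup.one_closed[OF D_subgroup] by force
    fix g assume "g \<in> ?S"
    then obtain y c where yc: "y \<in> N" "c \<in> D" "g = y \<otimes> c" by blast
    have "g \<otimes> r0 = y \<otimes> (c \<otimes> n \<otimes> inv c) \<otimes> (c \<otimes> d)"
      unfolding r0 yc(3) using Nc[OF yc(1)] Nc[OF n] Dc[OF yc(2)] Dc[OF d] by (simp add: m_assoc) (simp add: m_assoc[symmetric])
    moreover have "c \<otimes> n \<otimes> inv c \<in> N" using N n Dc[OF yc(2)] unfolding normal_inv_iff by blast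
    then have "y \<otimes> (c \<otimes> n \<otimes> inv c) \<in> N" by (rule subgroup.m_closed[OF Ns yc(1)])
    moreover have "c \<otimes> d \<in> D" "c \<otimes> r1 \<in> D" "c \<otimes> r2 \<in> D" using yc d D_r by (simp_all add: subgroup.m_closed[OF D_subgroup])
    moreover have "g \<otimes> r1 = y \<otimes> (c \<otimes> r1)" "g \<otimes> r2 = y \<otimes> (c \<otimes> r2)" using yc Nc Dc by (simp_all add: m_assoc)
    ultimately show "g \<otimes> r0 \<in> ?S \<and> g \<otimes> r1 \<in> ?S \<and> g \<otimes> r2 \<in> ?S" using yc(1) by blast
  qed
  then show ?thesis using g by blast
qed

text \<open>
  The commutation rules of the unit translations \<open>n\<close>, \<open>m\<close> in the directions of the two axes.
\<close>

definition trans_pair :: "'a \<Rightarrow> 'a \<Rightarrow> bool" where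
  "trans_pair n m \<longleftrightarrow> n \<in> carrier G \<and> m \<in> carrier G \<and> n \<otimes> m = m \<otimes> n \<and>
     r1 \<otimes> n = m \<otimes> r1 \<and> r2 \<otimes> n = n \<otimes> r2 \<and> r2 \<otimes> m = inv m \<otimes> r2"

definition T :: "'a \<Rightarrow> 'a \<Rightarrow> 'a set" where "T n m = {n [^] i \<otimes> m [^] j | (i::int) (j::int). True}"

lemma trans_pairD:
  assumes "trans_pair n m"
  shows "n \<in> carrier G" "m \<in> carrier G" "n \<otimes> m = m \<otimes> n" "r1 \<otimes> n = m \<otimes> r1" "r2 \<otimes> n = n \<otimes> r2" "r2 \<otimes> m = inv m \<otimes> r2"
    "r1 \<otimes> m = n \<otimes> r1"
proof -
  show *: "n \<in> carrier G" "m \<in> carrier G" "n \<otimes> m = m \<otimes> n" "r1 \<otimes> n = m \<otimes> r1" "r2 \<otimes> n = n \<otimes> r2" "r2 \<otimes> m = inv m \<otimes> r2"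
    using assms unfolding trans_pair_def by blast+
  have "r1 \<otimes> (r1 \<otimes> n) \<otimes> r1 = r1 \<otimes> (m \<otimes> r1) \<otimes> r1" using *(4) by simp
  moreover have "r1 \<otimes> (r1 \<otimes> n) \<otimes> r1 = n \<otimes> r1" "r1 \<otimes> (m \<otimes> r1) \<otimes> r1 = r1 \<otimes> m" using *(1,2) by (simp_all add: m_assoc sq sq')
  ultimately show "r1 \<otimes> m = n \<otimes> r1" by simp
qed

lemma trans_pair_push:
  assumes tp: "trans_pair n m"
  shows "r1 \<otimes> (n [^] (i::int) \<otimes> m [^] (j::int)) = (n [^] j \<otimes> m [^] i) \<otimes> r1"
    "r2 \<otimes> (n [^] i \<otimes> m [^] j) = (n [^] i \<otimes> m [^] (-j)) \<otimes> r2"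
proof -
  note t = trans_pairD[OF tp]
  have 1: "r1 \<otimes> n [^] i = m [^] i \<otimes> r1" for i :: int by (rule pow_conj[OF _ t(1,2,4)]) simp
  have 2: "r1 \<otimes> m [^] i = n [^] i \<otimes> r1" for i :: int by (rule pow_conj[OF _ t(2,1,7)]) simp
  have 3: "r2 \<otimes> n [^] i = n [^] i \<otimes> r2" for i :: int by (rule pow_conj[OF _ t(1,1,5)]) simp
  have "r2 \<otimes> m [^] i = (inv m) [^] i \<otimes> r2" for i :: int by (rule pow_conj[OF _ t(2) _ t(6)]) (use t in simp_all)
  then have 4: "r2 \<otimes> m [^] i = m [^] (-i) \<otimes> r2" for i :: int using t(2) by (simp add: int_pow_inv int_pow_neg)
  have c: "n [^] i \<otimes> m [^] j = m [^] j \<otimes> n [^] i" for i j :: int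
    using powers2(3)[OF t(1-3), of i 0 0 j] powers2(3)[OF t(1-3), of 0 j i 0] t by simp
  have "r1 \<otimes> (n [^] i \<otimes> m [^] j) = m [^] i \<otimes> (n [^] j \<otimes> r1)"
    using t(1,2) by (simp add: m_assoc[symmetric] 1) (simp add: m_assoc 2)
  then show "r1 \<otimes> (n [^] i \<otimes> m [^] j) = (n [^] j \<otimes> m [^] i) \<otimes> r1" unfolding c[of j i] using t by (simp add: m_assoc)
  show "r2 \<otimes> (n [^] i \<otimes> m [^] j) = (n [^] i \<otimes> m [^] (-j)) \<otimes> r2"
    using t(1,2) by (simp add: m_assoc[symmetric] 3) (simp add: m_assoc 4)
qed

lemma T_props:
  assumes tp: "trans_pair n m"
  shows "subgroup (T n m) G" "\<And>x y. x \<in> T n m \<Longrightarrow> y \<in> T n m \<Longrightarrow> x \<otimes> y = y \<otimes> x"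
    "\<And>y. y \<in> T n m \<Longrightarrow> r1 \<otimes> y \<otimes> r1 \<in> T n m" "\<And>y. y \<in> T n m \<Longrightarrow> r2 \<otimes> y \<otimes> r2 \<in> T n m" "n \<in> T n m" "m \<in> T n m"
proof -
  note t = trans_pairD[OF tp]
  show "subgroup (T n m) G" "\<And>x y. x \<in> T n m \<Longrightarrow> y \<in> T n m \<Longrightarrow> x \<otimes> y = y \<otimes> x"
    unfolding T_def by (rule powers2(1)[OF t(1-3)], rule powers2(2)[OF t(1-3)])
  have R: "n [^] i \<otimes> m [^] j \<in> T n m" for i j :: int unfolding T_def by blast
  have "r1 \<otimes> (n [^] i \<otimes> m [^] j) \<otimes> r1 = n [^] j \<otimes> m [^] i" "r2 \<otimes> (n [^] i \<otimes> m [^] j) \<otimes> r2 = n [^] i \<otimes> m [^] (-j)" for i j :: int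
    unfolding trans_pair_push[OF tp] using t(1,2) by (simp_all add: word_simps)
  then show "r1 \<otimes> y \<otimes> r1 \<in> T n m" "r2 \<otimes> y \<otimes> r2 \<in> T n m" if "y \<in> T n m" for y
    using that R unfolding T_def by force+
  show "n \<in> T n m" "m \<in> T n m" using R[of 1 0] R[of 0 1] t by simp_all
qed

text \<open>\<open>r1\<close> and \<open>r2\<close> normalise the translations, hence so does
  \<open>d\<close>; \<open>n\<close> is a translation itself. Thus \<open>r0 = n d\<close>
  normalises them too.\<close>

lemma T_normal:
  assumes tp: "trans_pair n m" and d: "d \<in> D" and r0: "r0 = n \<otimes> d"
  shows "T n m \<lhd> G"
proof (rule Norm_all)
  note t = T_props[OF tp]
  show "subgroup (T n m) G" by (rule t(1))
  have S: "subgroup (Norm (T n m)) G" by (rule Norm_subgroup[OF fin subgroup.subset[OF t(1)]])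
  have "r1 \<in> Norm (T n m)" "r2 \<in> Norm (T n m)" unfolding Norm_def using t by simp_all
  then have "d \<in> Norm (T n m)" using D_least[OF S] d by blast
  moreover have "n \<in> Norm (T n m)" using Norm_self[OF t(1)] t(5) by blast
  ultimately have "r0 \<in> Norm (T n m)" unfolding r0 by (simp add: subgroup.m_closed[OF S])
  then show "\<And>y. y \<in> T n m \<Longrightarrow> r0 \<otimes> y \<otimes> r0 \<in> T n m" unfolding Norm_def by simp
qed (use T_props[OF tp] in blast)+

text \<open>A half turn reverses translations: the factors of \<open>z\<close> carry
  \<open>n\<close> to \<open>m\<close>, to \<open>inv m\<close> and to \<open>inv n\<close> in
  turn.\<close>

lemma trans_pair_z: "trans_pair n m \<Longrightarrow> z \<otimes> n = inv n \<otimes> z"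
proof -
  assume tp: "trans_pair n m"
  note t = trans_pairD[OF tp]
  have i: "r1 \<otimes> inv m = inv n \<otimes> r1"
    using pow_conj[OF r_closed(2) t(2,1,7), of "-1"] t by (simp add: int_pow_neg)
  have "z \<otimes> n = r1 \<otimes> (r2 \<otimes> (r1 \<otimes> (r2 \<otimes> n)))" unfolding z_def using t by (simp add: m_assoc)
  also have "\<dots> = r1 \<otimes> (r2 \<otimes> ((r1 \<otimes> n) \<otimes> r2))" unfolding t(5) using t(1) by (simp add: m_assoc)
  also have "\<dots> = r1 \<otimes> ((r2 \<otimes> m) \<otimes> (r1 \<otimes> r2))" unfolding t(4) using t(2) by (simp add: m_assoc)
  also have "\<dots> = (r1 \<otimes> inv m) \<otimes> (r2 \<otimes> (r1 \<otimes> r2))" unfolding t(6) using t(2) by (simp add: m_assoc)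
  also have "\<dots> = inv n \<otimes> z" unfolding i z_def using t(1) by (simp add: m_assoc)
  finally show ?thesis .
qed

text \<open>A nontrivial normal subgroup of the dihedral group of order 8 contains its centre: in
  every noncentral case the product of the element with itself or with a suitable conjugate is
  \<open>z\<close>.\<close>

lemma normal_D_z:
  assumes N: "N \<lhd> G" and d: "d \<in> D" "d \<in> N" "d \<noteq> \<one>"
  shows "z \<in> N"
proof -
  have s: "subgroup N G" by (rule normal_imp_subgroup[OF N])
  have c: "r1 \<otimes> (y \<otimes> r1) \<in> N" "r2 \<otimes> (y \<otimes> r2) \<in> N" if "y \<in> N" for y
  proof -
    have "r1 \<otimes> y \<otimes> inv r1 \<in> N" "r2 \<otimes> y \<otimes> inv r2 \<in> N" using N that r_closed unfolding normal_inv_iff by blast+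
    then show "r1 \<otimes> (y \<otimes> r1) \<in> N" "r2 \<otimes> (y \<otimes> r2) \<in> N" using subgroup.mem_carrier[OF s that] by (simp_all add: m_assoc)
  qed
  note mc = subgroup.m_closed[OF s]
  from d(1) show ?thesis
  proof (cases rule: D_cases)
    case 1 then show ?thesis using d by simp
  next
    case 2
    then have "r1 \<otimes> (r2 \<otimes> (r1 \<otimes> r2)) \<in> N" using mc[OF _ c(2)[of r1]] d(2) by simp
    then show ?thesis by (simp add: z_def)
  next
    case 3
    then have "r1 \<otimes> (r2 \<otimes> r1) \<otimes> r2 \<in> N" using mc[OF c(1)[of r2]] d(2) by simp
    then show ?thesis by (simp add: z_def word_simps)
  next
    case 4
    then have "(r1 \<otimes> r2) \<otimes> (r1 \<otimes> r2) \<in> N" using mc d(2) by simp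
    then show ?thesis by (simp add: z_def word_simps)
  next
    case 5
    then have "(r2 \<otimes> r1) \<otimes> (r2 \<otimes> r1) \<in> N" using mc d(2) by simp
    then show ?thesis by (simp add: z_def word_simps)
  next
    case 6
    then have "d \<otimes> (r1 \<otimes> (d \<otimes> r1)) \<in> N" using mc[OF _ c(1)[of d]] d(2) by simp
    then show ?thesis unfolding 6 by (simp add: z_def word_simps)
  next
    case 7
    then have "r2 \<otimes> (d \<otimes> r2) \<otimes> d \<in> N" using mc[OF c(2)[of d]] d(2) by simp
    then show ?thesis unfolding 7 by (simp add: z_def word_simps)
  next
    case 8 then show ?thesis using d by simp
  qed
qed

end

section \<open>Translation subgroups and the relations of the two maps\<close>

context string_group
begin

lemma carrier_ND:
  assumes "N \<lhd> G" "n \<in> N" "d \<in> D" "r0 = n \<otimes> d" "N \<inter> D \<subseteq> {\<one>}"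
  shows "order G = 8 * card N"
proof -
  have Ns: "subgroup N G" by (rule normal_imp_subgroup[OF assms(1)])
  let ?S = "(\<lambda>(n, d). n \<otimes> d) ` (N \<times> D)"
  have "carrier G \<subseteq> ?S" using ND_all[OF assms(1-4)] by force
  moreover have "?S \<subseteq> carrier G" using subgroup.mem_carrier[OF Ns] subgroup.mem_carrier[OF D_subgroup] by auto
  ultimately have "carrier G = ?S" by blast
  then show ?thesis using subgroup_mult_card[OF Ns D_subgroup assms(5)] card_D unfolding order_def by simp
qed

text \<open>
  In a map of type \<open>{4,4}\<close> these words are the unit translations.
\<close>

lemma trans_pair_44:
  assumes p4: "r0 \<otimes> (r1 \<otimes> (r0 \<otimes> r1)) = r1 \<otimes> (r0 \<otimes> (r1 \<otimes> r0))"
  shows "trans_pair (r0 \<otimes> (r1 \<otimes> (r2 \<otimes> r1))) (r1 \<otimes> (r0 \<otimes> (r1 \<otimes> r2)))"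
  unfolding trans_pair_def
proof (intro conjI)
  let ?n = "r0 \<otimes> (r1 \<otimes> (r2 \<otimes> r1))" and ?m = "r1 \<otimes> (r0 \<otimes> (r1 \<otimes> r2))"
  show "?n \<in> carrier G" "?m \<in> carrier G" by simp_all
  have "?n \<otimes> ?m = r0 \<otimes> (r1 \<otimes> (r2 \<otimes> (r0 \<otimes> (r1 \<otimes> r2))))" by (simp add: word_simps)
  \<comment> \<open>The product is \<open>(r0 r1)^2 (r1 r2)^2\<close>; reversing both squares by
    \<open>p4\<close> and \<open>braid\<close> gives the product in the other order.\<close>
  also have "\<dots> = (r0 \<otimes> (r1 \<otimes> (r0 \<otimes> r1))) \<otimes> (r1 \<otimes> (r2 \<otimes> (r1 \<otimes> r2)))" by (simp add: word_simps)
  also have "\<dots> = (r1 \<otimes> (r0 \<otimes> (r1 \<otimes> r0))) \<otimes> (r1 \<otimes> (r2 \<otimes> (r1 \<otimes> r2)))" by (simp only: p4)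
  also have "\<dots> = ?m \<otimes> ?n"
  proof -
    have "r1 \<otimes> (r2 \<otimes> (r1 \<otimes> r2)) = r2 \<otimes> (r1 \<otimes> (r2 \<otimes> r1))" by (rule braid[symmetric])
    then have "(r1 \<otimes> (r0 \<otimes> (r1 \<otimes> r0))) \<otimes> (r1 \<otimes> (r2 \<otimes> (r1 \<otimes> r2))) = (r1 \<otimes> (r0 \<otimes> (r1 \<otimes> r0))) \<otimes> (r2 \<otimes> (r1 \<otimes> (r2 \<otimes> r1)))" by simp
    also have "\<dots> = r1 \<otimes> (r0 \<otimes> (r1 \<otimes> (r0 \<otimes> (r2 \<otimes> (r1 \<otimes> (r2 \<otimes> r1))))))" by (simp add: m_assoc)
    also have "r0 \<otimes> (r2 \<otimes> (r1 \<otimes> (r2 \<otimes> r1))) = r2 \<otimes> (r0 \<otimes> (r1 \<otimes> (r2 \<otimes> r1)))" by (rule c20'[symmetric]) simp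
    also have "r1 \<otimes> (r0 \<otimes> (r1 \<otimes> (r2 \<otimes> (r0 \<otimes> (r1 \<otimes> (r2 \<otimes> r1)))))) = ?m \<otimes> ?n" by (simp add: m_assoc)
    finally show ?thesis .
  qed
  finally show "?n \<otimes> ?m = ?m \<otimes> ?n" .
  show "r1 \<otimes> ?n = ?m \<otimes> r1" by (simp add: word_simps)
  show "r2 \<otimes> ?n = ?n \<otimes> r2" by (simp add: word_simps)
  have "inv ?m = r2 \<otimes> (r1 \<otimes> (r0 \<otimes> r1))" by (simp add: inv_mult_group m_assoc)
  then show "r2 \<otimes> ?m = inv ?m \<otimes> r2" by (simp add: word_simps)
qed

text \<open>If \<open>z\<close> is a translation, it commutes with \<open>n\<close> and also inverts
  it, so \<open>n\<close> and \<open>m\<close> have square 1. Then there are at most four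
  translations, and \<open>z\<close> in the factor from \<open>D\<close> can be absorbed by them,
  which leaves four elements of \<open>D\<close>.\<close>

lemma T_z_small:
  assumes tp: "trans_pair n m" and d: "d \<in> D" and r0: "r0 = n \<otimes> d" and zT: "z \<in> T n m"
  shows "order G \<le> 16"
proof -
  note t = trans_pairD[OF tp] and Tp = T_props[OF tp]
  have "z \<otimes> n = n \<otimes> z" by (rule Tp(2)[OF zT Tp(5)])
  then have "inv n \<otimes> z = n \<otimes> z" using trans_pair_z[OF tp] by simp
  then have "inv n = n" using t(1) by simp
  then have nn: "n \<otimes> n = \<one>" using t(1) by (metis r_inv)
  have "r1 \<otimes> (n \<otimes> n) = m \<otimes> (m \<otimes> r1)" using t by (metis m_assoc r_closed(2))
  then have mm: "m \<otimes> m = \<one>" using nn t(2) by (metis l_one m_assoc one_closed r_closed(2) r_one right_cancel m_closed)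
  have pw: "x [^] (i::int) \<in> {\<one>, x}" if x: "x \<in> carrier G" "x \<otimes> x = \<one>" for x i
  proof -
    have "x [^] (2::int) = \<one>" using x by (metis int_pow_1 int_pow_mult one_add_one)
    then have e: "x [^] (2 * (i div 2)) = \<one>" using x(1) by (metis int_pow_one int_pow_pow)
    have "x [^] i = x [^] (2 * (i div 2) + i mod 2)" by simp
    also have "\<dots> = x [^] (i mod 2)" unfolding int_pow_mult[OF x(1)] e using x(1) by simp
    finally have "x [^] i = x [^] (i mod 2)" .
    moreover have "i mod 2 = 0 \<or> i mod 2 = 1" by auto
    ultimately show ?thesis using x(1) by auto
  qed
  define A where "A = {\<one>, n, m, n \<otimes> m}"
  \<comment> \<open>Representatives of \<open>D\<close> modulo \<open>z\<close>.\<close>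
  define E where "E = {\<one>, r1, r2, r1 \<otimes> r2}"
  have TA: "T n m \<subseteq> A"
  proof
    fix y assume "y \<in> T n m"
    then obtain i j :: int where y: "y = n [^] i \<otimes> m [^] j" unfolding T_def by blast
    have "n [^] i = \<one> \<or> n [^] i = n" "m [^] j = \<one> \<or> m [^] j = m" using pw[OF t(1) nn, of i] pw[OF t(2) mm, of j] by simp_all
    then show "y \<in> A" unfolding y A_def using t(1,2) by auto
  qed
  have "carrier G \<subseteq> (\<lambda>(a, e). a \<otimes> e) ` (A \<times> E)"
  proof
    fix g assume "g \<in> carrier G"
    then obtain y c where yc: "y \<in> T n m" "c \<in> D" "g = y \<otimes> c" using ND_all[OF T_normal[OF tp d r0] Tp(5) d r0] by blast
    have yC: "y \<in> carrier G" by (rule subgroup.mem_carrier[OF Tp(1) yc(1)])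
    have yz: "y \<otimes> z \<in> A" using TA subgroup.m_closed[OF Tp(1) yc(1) zT] by blast
    have yA: "y \<in> A" using TA yc(1) by blast
    have "(\<exists>e\<in>E. c = e) \<or> (\<exists>e\<in>E. c = z \<otimes> e)"
    proof (cases rule: D_cases[OF yc(2)])
      case 5 then have "c = z \<otimes> (r1 \<otimes> r2)" by (simp add: z_def word_simps) then show ?thesis unfolding E_def by blast
    next
      case 6 then have "c = z \<otimes> r2" by (simp add: z_def word_simps) then show ?thesis unfolding E_def by blast
    next
      case 7 then have "c = z \<otimes> r1" by (simp add: z_def word_simps) then show ?thesis unfolding E_def by blast
    next
      case 8 then have "c = z \<otimes> \<one>" by simp then show ?thesis unfolding E_def by blast
    qed (simp_all add: E_def)
    then show "g \<in> (\<lambda>(a, e). a \<otimes> e) ` (A \<times> E)"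
    proof (elim disjE bexE)
      fix e assume "e \<in> E" "c = e"
      then show ?thesis using yA yc(3) by force
    next
      fix e assume e: "e \<in> E" "c = z \<otimes> e"
      then have "e \<in> carrier G" unfolding E_def by auto
      then have "g = (y \<otimes> z) \<otimes> e" using yC yc(3) e(2) by (simp add: m_assoc)
      then show ?thesis using yz e(1) by force
    qed
  qed
  then have "card (carrier G) \<le> card ((\<lambda>(a, e). a \<otimes> e) ` (A \<times> E))" by (rule card_mono[rotated]) (simp add: A_def E_def)
  also have "\<dots> \<le> card (A \<times> E)" by (rule card_image_le) (simp add: A_def E_def)
  finally have "card (carrier G) \<le> card A * card E" by (simp add: card_cartesian_product)
  moreover have "card A \<le> 4" "card E \<le> 4"
    using card_length[of "[\<one>, n, m, n \<otimes> m]"] card_length[of "[\<one>, r1, r2, r1 \<otimes> r2]"] unfolding A_def E_def by simp_all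
  ultimately show ?thesis unfolding order_def using mult_le_mono[of "card A" 4 "card E" 4] by linarith
qed

text \<open>The order \<open>8 w\<close> exceeds 16, so by \<open>T_z_small\<close> the half turn is
  no translation, and therefore the translations meet \<open>D\<close> trivially.\<close>

lemma T_44:
  assumes p4: "r0 \<otimes> (r1 \<otimes> (r0 \<otimes> r1)) = r1 \<otimes> (r0 \<otimes> (r1 \<otimes> r0))"
    and w: "order G = 8 * w" "w \<ge> 3"
  obtains n m where "trans_pair n m" "r0 = n \<otimes> (r1 \<otimes> (r2 \<otimes> r1))" "card (T n m) = w"
proof -
  let ?n = "r0 \<otimes> (r1 \<otimes> (r2 \<otimes> r1))" and ?m = "r1 \<otimes> (r0 \<otimes> (r1 \<otimes> r2))"
  have tp: "trans_pair ?n ?m" by (rule trans_pair_44[OF p4])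
  have r0: "r0 = ?n \<otimes> (r1 \<otimes> (r2 \<otimes> r1))" by (simp add: word_simps)
  have d: "r1 \<otimes> (r2 \<otimes> r1) \<in> D" using D_r by (simp add: subgroup.m_closed[OF D_subgroup])
  have "z \<notin> T ?n ?m" using T_z_small[OF tp d r0] w by auto
  then have "T ?n ?m \<inter> D \<subseteq> {\<one>}" using normal_D_z[OF T_normal[OF tp d r0]] by blast
  then have "order G = 8 * card (T ?n ?m)" using T_props(5)[OF tp] by (intro carrier_ND[OF T_normal[OF tp d r0] _ d r0])
  then show thesis using that[OF tp r0] w by simp
qed

text \<open>If \<open>n\<close> generated all translations, \<open>m\<close> would be a power of
  \<open>n\<close> and commute with \<open>r2\<close>, which inverts it. Odd order then gives
  \<open>m = \<one>\<close>, and \<open>n\<close> is conjugate to \<open>m\<close>.\<close>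

lemma T_not_cyclic:
  assumes tp: "trans_pair n m" and w: "card (T n m) = w" "odd w" "w \<ge> 3"
  shows "ord n \<noteq> w"
proof
  assume o: "ord n = w"
  note t = trans_pairD[OF tp] and Tp = T_props[OF tp]
  have "finite (T n m)" using w by (metis card.infinite not_numeral_le_zero)
  moreover have "range (\<lambda>i::int. n [^] i) \<subseteq> T n m" using Tp(1,5) by (auto intro: subgroup_int_pow_closed)
  ultimately have "range (\<lambda>i::int. n [^] i) = T n m" using card_powers[OF t(1)] o w by (intro card_subset_eq) simp_all
  then obtain k :: int where k: "m = n [^] k" using Tp(6) by blast
  have "r2 \<otimes> m = m \<otimes> r2" unfolding k by (rule pow_conj[OF _ t(1,1,5)]) simp
  then have "inv m = m" using t(2,6) by simp
  then have "m \<otimes> m = \<one>" using t(2) by (metis r_inv)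
  then have "m [^] (2::nat) = \<one>" using t(2) by (simp add: numeral_2_eq_2)
  then have "ord m dvd 2" using pow_eq_id[OF t(2)] by blast
  moreover have "ord m dvd w" using subgroup_pow_card[OF Tp(1,6)] w(1) pow_eq_id[OF t(2)] by simp
  ultimately have "ord m = 1" using w(2) two_is_prime_nat by (metis prime_nat_iff)
  then have "m = \<one>" using ord_eq_1[OF t(2)] by simp
  then have "r1 \<otimes> n = r1" using t(4) by simp
  then have "n = \<one>" using sq'(2)[OF t(1)] by (simp add: sq)
  then show False using o w by simp
qed

definition torus_relations :: "nat \<Rightarrow> bool" where
  "torus_relations b \<longleftrightarrow> (\<exists>n m. trans_pair n m \<and> n [^] b = \<one> \<and> m [^] b = \<one> \<and> (r0 = n \<otimes> (r1 \<otimes> (r2 \<otimes> r1)) \<or> r0 = n \<otimes> z))"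

lemma trans_pair_pow: "trans_pair n m \<Longrightarrow> n [^] (b::nat) = \<one> \<Longrightarrow> m [^] b = \<one>"
proof -
  assume tp: "trans_pair n m" and n: "n [^] b = \<one>"
  note t = trans_pairD[OF tp]
  have "r1 \<otimes> n [^] int b = m [^] int b \<otimes> r1" by (rule pow_conj[OF _ t(1,2,4)]) simp
  then have "m [^] b \<otimes> r1 = r1" using n t by (simp add: int_pow_int)
  then show "m [^] b = \<one>" using t(2) by (metis l_one nat_pow_closed one_closed r_closed(2) right_cancel)
qed

text \<open>There are \<open>b^2\<close> translations and \<open>n\<close> does not generate them,
  so the order of \<open>n\<close> divides \<open>b\<close>.\<close>

lemma torus_relations_of_44:
  assumes p4: "r0 \<otimes> (r1 \<otimes> (r0 \<otimes> r1)) = r1 \<otimes> (r0 \<otimes> (r1 \<otimes> r0))"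
    and b: "prime b" "b \<ge> 3" "order G = 8 * b\<^sup>2"
  shows "torus_relations b"
proof -
  have ob: "odd b" using prime_odd_nat[of b] b by simp
  have b9: "b\<^sup>2 \<ge> 3" using mult_le_mono[OF b(2) b(2)] by (simp add: power2_eq_square)
  obtain n m where nm: "trans_pair n m" "r0 = n \<otimes> (r1 \<otimes> (r2 \<otimes> r1))" "card (T n m) = b\<^sup>2"
    using T_44[OF p4 b(3) b9] by blast
  note t = trans_pairD[OF nm(1)] and Tp = T_props[OF nm(1)]
  have "ord n dvd b ^ 2" using subgroup_pow_card[OF Tp(1,5)] nm(3) pow_eq_id[OF t(1)] by simp
  then obtain i where i: "i \<le> 2" "ord n = b ^ i" using b(1) by (auto simp: divides_primepow_nat)
  have "ord n \<noteq> b\<^sup>2" by (rule T_not_cyclic[OF nm(1,3)]) (use ob b9 in simp_all)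
  then have "i \<noteq> 2" using i by auto
  then have "i = 0 \<or> i = 1" using i by auto
  then have "ord n dvd b" using i by auto
  then have "n [^] b = \<one>" using pow_eq_id[OF t(1)] by blast
  then show ?thesis unfolding torus_relations_def using nm trans_pair_pow[OF nm(1)] by blast
qed

text \<open>A translation group of prime order would be generated by \<open>n\<close> unless
  \<open>n\<close> is trivial, and both are impossible. It is applied to the quotient by a normal
  subgroup of order \<open>b\<close>.\<close>

lemma no_44_of_prime_index:
  assumes p4: "r0 \<otimes> (r1 \<otimes> (r0 \<otimes> r1)) = r1 \<otimes> (r0 \<otimes> (r1 \<otimes> r0))"
    and b: "prime b" "b \<ge> 3" "order G = 8 * b"
  shows False
proof -
  have ob: "odd b" using prime_odd_nat[of b] b by simp
  obtain n m where nm: "trans_pair n m" "card (T n m) = b"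
    using T_44[OF p4 b(3,2)] by blast
  note t = trans_pairD[OF nm(1)] and Tp = T_props[OF nm(1)]
  have "ord n dvd b" using subgroup_pow_card[OF Tp(1,5)] nm(2) pow_eq_id[OF t(1)] by simp
  moreover have "ord n \<noteq> b" by (rule T_not_cyclic[OF nm ob b(2)])
  ultimately have "ord n = 1" using b(1) by (meson prime_nat_iff)
  then have n: "n = \<one>" using ord_eq_1[OF t(1)] by simp
  then have "m [^] (1::nat) = \<one>" using trans_pair_pow[OF nm(1), of 1] by simp
  then have "m = \<one>" using t(2) by simp
  then have "T n m \<subseteq> {\<one>}" unfolding T_def n by auto
  then have "card (T n m) \<le> 1" using card_mono[of "{\<one>}" "T n m"] by simp
  then show False using nm(2) b(2) by simp
qed

text \<open>
  Comparing components in \<open>G = N D\<close>, the \<open>D\<close>-component of \<open>r0\<close> commutes with \<open>r2\<close> and inverts the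
  \<open>N\<close>-component, which leaves only two possibilities for it.
\<close>

lemma torus_relations_of_normal:
  assumes N: "N \<lhd> G" and comm: "\<And>x y. x \<in> N \<Longrightarrow> y \<in> N \<Longrightarrow> x \<otimes> y = y \<otimes> x"
    and ND: "N \<inter> D \<subseteq> {\<one>}" and card: "order G = 8 * card N" and b: "odd b" "\<And>y. y \<in> N \<Longrightarrow> y [^] b = \<one>"
    and r0D: "r0 \<notin> D"
  shows "torus_relations b"
proof -
  have Ns: "subgroup N G" by (rule normal_imp_subgroup[OF N])
  have NC: "y \<in> carrier G" if "y \<in> N" for y by (rule subgroup.mem_carrier[OF Ns that])
  have DC: "y \<in> carrier G" if "y \<in> D" for y by (rule subgroup.mem_carrier[OF D_subgroup that])
  have conj: "g \<otimes> y \<otimes> inv g \<in> N" if "g \<in> carrier G" "y \<in> N" for g y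
    using N that unfolding normal_inv_iff by blast
  let ?S = "(\<lambda>(n, d). n \<otimes> d) ` (N \<times> D)"
  have "?S \<subseteq> carrier G" using NC DC by auto
  moreover have "card ?S = card (carrier G)" using subgroup_mult_card[OF Ns D_subgroup ND] card_D card unfolding order_def by simp
  ultimately have "?S = carrier G" using fin by (intro card_subset_eq)
  then have "r0 \<in> ?S" by simp
  then obtain n d where nd: "n \<in> N" "d \<in> D" "r0 = n \<otimes> d" by auto
  have nC: "n \<in> carrier G" and dC: "d \<in> carrier G" using nd NC DC by blast+
  \<comment> \<open>Elements of \<open>N\<close> have odd order, so none of them is an
    involution.\<close>
  have odd1: "y = \<one>" if y: "y \<in> N" "inv y = y" for y
  proof -
    have yC: "y \<in> carrier G" using NC y by blast
    have "y \<otimes> y = \<one>" using y yC by (metis r_inv)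
    then have "y [^] (2::nat) = \<one>" using yC by (simp add: numeral_2_eq_2)
    then have "ord y dvd 2" "ord y dvd b" using b(2)[OF y(1)] pow_eq_id[OF yC] by blast+
    then have "ord y = 1" using b(1) two_is_prime_nat by (metis prime_nat_iff)
    then show ?thesis using ord_eq_1[OF yC] by simp
  qed
  have "(r2 \<otimes> n \<otimes> inv r2) \<otimes> (r2 \<otimes> d \<otimes> r2) = n \<otimes> d"
  proof -
    have "(r2 \<otimes> n \<otimes> inv r2) \<otimes> (r2 \<otimes> d \<otimes> r2) = r2 \<otimes> (n \<otimes> d) \<otimes> r2" using nC dC by (simp add: m_assoc sq')
    also have "\<dots> = r0" unfolding nd(3)[symmetric] by (simp add: word_simps)
    finally show ?thesis using nd(3) by simp
  qed
  moreover have "r2 \<otimes> d \<otimes> r2 \<in> D" using nd(2) D_r by (simp add: subgroup.m_closed[OF D_subgroup])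
  ultimately have r2n: "r2 \<otimes> n \<otimes> inv r2 = n" and r2d: "r2 \<otimes> d \<otimes> r2 = d"
    using subgroup_mult_inj[OF Ns D_subgroup ND conj[OF r_closed(3) nd(1)] nd(1) _ nd(2)] by blast+
  have "(n \<otimes> (d \<otimes> n \<otimes> inv d)) \<otimes> (d \<otimes> d) = \<one> \<otimes> \<one>"
  proof -
    have "(n \<otimes> (d \<otimes> n \<otimes> inv d)) \<otimes> (d \<otimes> d) = (n \<otimes> d) \<otimes> (n \<otimes> d)" using nC dC by (simp add: m_assoc) (simp add: m_assoc[symmetric])
    then show ?thesis unfolding nd(3)[symmetric] by (simp add: sq)
  qed
  moreover have "n \<otimes> (d \<otimes> n \<otimes> inv d) \<in> N" "d \<otimes> d \<in> D" "\<one> \<in> N" "\<one> \<in> D"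
    using conj[OF dC nd(1)] nd subgroup.m_closed[OF Ns] subgroup.m_closed[OF D_subgroup] subgroup.one_closed[OF Ns] subgroup.one_closed[OF D_subgroup] by blast+
  ultimately have n1: "n \<otimes> (d \<otimes> n \<otimes> inv d) = \<one>" and dd: "d \<otimes> d = \<one>"
    using subgroup_mult_inj[OF Ns D_subgroup ND] by blast+
  have "inv (d \<otimes> n \<otimes> inv d) = n" using n1 nC dC by (intro inv_equality) simp_all
  then have dn: "d \<otimes> n \<otimes> inv d = inv n" using nC dC by (metis inv_closed inv_inv m_closed)
  have r2n': "r2 \<otimes> n = n \<otimes> r2"
  proof -
    have "r2 \<otimes> n \<otimes> r2 \<otimes> r2 = n \<otimes> r2" using r2n by simp
    then show ?thesis using nC by (simp add: m_assoc sq)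
  qed
  \<comment> \<open>Commuting with \<open>r2\<close> and having square 1 leaves
    \<open>\<one>\<close>, \<open>r2\<close>, \<open>z\<close> and \<open>r1 r2 r1\<close>. The
    first two commute with \<open>n\<close> and invert it, which makes \<open>n\<close> trivial and
    puts \<open>r0\<close> into \<open>D\<close>.\<close>
  have zd: "d = z \<or> d = r1 \<otimes> (r2 \<otimes> r1)"
  proof (cases rule: D_cases[OF nd(2)])
    case 1
    then have "n = inv n" using dn nC by simp
    then have "r0 = \<one>" using odd1[OF nd(1)] nd(3) 1 by simp
    then show ?thesis using r0D subgroup.one_closed[OF D_subgroup] by simp
  next
    case 2
    then have "r2 \<otimes> (r1 \<otimes> r2) = r1" using r2d by (simp add: m_assoc)
    then have "r1 \<otimes> (r2 \<otimes> (r1 \<otimes> r2)) = \<one>" by (simp add: sq)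
    then show ?thesis using z_ne by simp
  next
    case 3
    then have "n = inv n" using dn r2n by simp
    then have "r0 = r2" using odd1[OF nd(1)] nd(3) 3 by simp
    then show ?thesis using r0D D_r by simp
  next
    case 4
    then have "r1 \<otimes> (r2 \<otimes> (r1 \<otimes> r2)) = \<one>" using dd by (simp add: m_assoc)
    then show ?thesis using z_ne by simp
  next
    case 5
    then have "r1 \<otimes> (r2 \<otimes> (r1 \<otimes> r2)) = \<one>" using dd by (simp add: word_simps)
    then show ?thesis using z_ne by simp
  next
    case 7
    have e: "r1 = r2 \<otimes> (r1 \<otimes> r2)" using r2d unfolding 7 by (simp add: m_assoc sq sq')
    have "r1 \<otimes> (r2 \<otimes> (r1 \<otimes> r2)) = r1 \<otimes> r1" using e by simp
    then show ?thesis using z_ne by (simp add: sq)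
  qed simp_all
  \<comment> \<open>In both cases \<open>r1 r2 r1\<close> inverts \<open>n\<close>, because
    \<open>z\<close> is \<open>r1 r2 r1\<close> times \<open>r2\<close> and \<open>r2\<close>
    commutes with \<open>n\<close>. Conjugation by \<open>r1\<close> turns this into the statement
    that \<open>r2\<close> inverts \<open>m\<close>.\<close>
  have z1: "r1 \<otimes> (r2 \<otimes> (r1 \<otimes> (n \<otimes> (r1 \<otimes> (r2 \<otimes> r1))))) = inv n"
    using zd
  proof
    assume d: "d = z"
    have "inv n = z \<otimes> n \<otimes> z" using dn d z_props by simp
    also have "\<dots> = r1 \<otimes> (r2 \<otimes> (r1 \<otimes> ((r2 \<otimes> n) \<otimes> (r2 \<otimes> (r1 \<otimes> (r2 \<otimes> r1))))))" unfolding z_def braid[symmetric] using nC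
      by (simp add: m_assoc braid)
    also have "\<dots> = r1 \<otimes> (r2 \<otimes> (r1 \<otimes> (n \<otimes> (r1 \<otimes> (r2 \<otimes> r1)))))" unfolding r2n' using nC by (simp add: m_assoc sq sq')
    finally show ?thesis by simp
  next
    assume d: "d = r1 \<otimes> (r2 \<otimes> r1)"
    then have "inv d = r1 \<otimes> (r2 \<otimes> r1)" by (simp add: inv_mult_group m_assoc)
    then show ?thesis using dn d nC by (simp add: m_assoc)
  qed
  define m where "m = r1 \<otimes> (n \<otimes> r1)"
  have mC: "m \<in> carrier G" unfolding m_def using nC by simp
  have mN: "m \<in> N" using conj[OF r_closed(2) nd(1)] nC unfolding m_def by (simp add: m_assoc)
  have "trans_pair n m" unfolding trans_pair_def
  proof (intro conjI)
    show "n \<in> carrier G" "m \<in> carrier G" "r2 \<otimes> n = n \<otimes> r2" "n \<otimes> m = m \<otimes> n" using nC mC r2n' comm nd(1) mN by blast+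
    show "r1 \<otimes> n = m \<otimes> r1" unfolding m_def using nC by (simp add: m_assoc sq)
    have "inv m = r1 \<otimes> (inv n \<otimes> r1)" unfolding m_def using nC by (simp add: inv_mult_group m_assoc)
    then have "inv m \<otimes> r2 = r1 \<otimes> ((r1 \<otimes> (r2 \<otimes> (r1 \<otimes> (n \<otimes> (r1 \<otimes> (r2 \<otimes> r1)))))) \<otimes> (r1 \<otimes> r2))" unfolding z1 using nC by (simp add: m_assoc)
    also have "\<dots> = r2 \<otimes> m" unfolding m_def using nC by (simp add: m_assoc sq sq')
    finally show "r2 \<otimes> m = inv m \<otimes> r2" by simp
  qed
  then show ?thesis unfolding torus_relations_def using b(2) nd(1,3) mN zd by blast
qed

end

text \<open>All orbits of \<open>f\<close> have length \<open>b\<close>, as \<open>b\<close> is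
  prime and nothing is fixed; the induction removes one orbit at a time.\<close>

lemma prime_cycle_card:
  assumes "prime (b::nat)" "finite S" "\<And>x. x \<in> S \<Longrightarrow> f x \<in> S" "\<And>x. x \<in> S \<Longrightarrow> (f ^^ b) x = x" "\<And>x. x \<in> S \<Longrightarrow> f x \<noteq> x"
  shows "b dvd card S"
  using assms(2-)
proof (induction "card S" arbitrary: S rule: less_induct)
  case less
  show ?case
  proof (cases "S = {}")
    case True then show ?thesis by simp
  next
    case False
    then obtain w where w: "w \<in> S" by blast
    have b1: "b > 1" using assms(1) by (rule prime_gt_1_nat)
    have pS: "(f ^^ i) w \<in> S" for i by (induction i) (use w less.prems(2) in simp_all)
    define W where "W = (\<lambda>i. (f ^^ i) w) ` {..<b}"
    have W: "(f ^^ i) w \<in> W" for i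
    proof -
      have "(f ^^ i) w = (f ^^ (i mod b)) w" using funpow_mod_eq[OF less.prems(3)[OF w], of i] by simp
      then show ?thesis unfolding W_def using b1 by (intro image_eqI[of _ _ "i mod b"]) simp_all
    qed
    have no: "(f ^^ i) w \<noteq> (f ^^ j) w" if ij: "i < j" "j < b" for i j
    proof
      assume e: "(f ^^ i) w = (f ^^ j) w"
      define k where "k = j - i"
      have k: "0 < k" "k < b" "b - i + i = b" "b - i + j = k + b" using ij unfolding k_def by auto
      have "(f ^^ (b - i)) ((f ^^ i) w) = (f ^^ (b - i)) ((f ^^ j) w)" using e by simp
      then have "(f ^^ (b - i + i)) w = (f ^^ (b - i + j)) w" by (simp only: funpow_add o_apply)
      then have "w = (f ^^ k) w" unfolding k(3,4) using less.prems(3)[OF w] by (simp add: funpow_add)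
      then have kx: "((f ^^ k) ^^ n) w = w" for n by (induction n) simp_all
      \<comment> \<open>A return after \<open>k < b\<close> steps, together with the return after
        \<open>b\<close> steps, gives a return after one step: the greatest common divisor is
        1.\<close>
      obtain d x y where d: "d dvd k" "d dvd b" "k * x = b * y + d" using bezout_add_strong_nat[of k b] k(1) by blast
      have "d = 1" using d(1,2) k(1,2) assms(1) by (metis dvd_imp_le not_le prime_nat_iff)
      have "w = (f ^^ (k * x)) w" using kx[of x] by (simp add: funpow_mult mult.commute)
      also have "\<dots> = f ((f ^^ (b * y)) w)" unfolding d(3) \<open>d = 1\<close> by simp
      also have "(f ^^ (b * y)) w = w"
      proof -
        have "((f ^^ b) ^^ n) w = w" for n by (induction n) (simp_all add: less.prems(3)[OF w])
        from this[of y] show ?thesis by (simp add: funpow_mult mult.commute)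
      qed
      finally show False using less.prems(4)[OF w] by simp
    qed
    have "inj_on (\<lambda>i. (f ^^ i) w) {..<b}"
    proof (rule inj_onI)
      fix i j assume "i \<in> {..<b}" "j \<in> {..<b}" "(f ^^ i) w = (f ^^ j) w"
      then show "i = j" using no[of i j] no[of j i] by (metis lessThan_iff linorder_neqE_nat)
    qed
    then have cW: "card W = b" unfolding W_def by (simp add: card_image)
    have WS: "W \<subseteq> S" unfolding W_def using pS by blast
    have s012_closed: "f x \<in> S - W" if x: "x \<in> S - W" for x
    proof -
      have xS: "x \<in> S" "x \<notin> W" using x by blast+
      have "f x \<notin> W"
      proof
        assume "f x \<in> W"
        then obtain i where i: "f x = (f ^^ i) w" unfolding W_def by blast
        have "Suc (b - 1) = b" using b1 by simp
        then have "x = (f ^^ (Suc (b - 1))) x" using less.prems(3)[OF xS(1)] by simp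
        also have "\<dots> = (f ^^ (b - 1)) (f x)" by (simp only: funpow_Suc_right o_apply)
        also have "\<dots> = (f ^^ (b - 1 + i)) w" unfolding i by (simp only: funpow_add o_apply)
        finally show False using W xS(2) by metis
      qed
      then show ?thesis using less.prems(2)[OF xS(1)] by simp
    qed
    have fW: "finite W" unfolding W_def by simp
    have "card (S - W) = card S - b" using card_Diff_subset[OF fW WS] cW by simp
    moreover have cS: "b \<le> card S" using card_mono[OF less.prems(1) WS] cW by simp
    ultimately have "card (S - W) < card S" using b1 by simp
    then have "b dvd card (S - W)"
      by (rule less.hyps) (use less.prems s012_closed in blast)+
    moreover have "card S = card (S - W) + b" using \<open>card (S - W) = card S - b\<close> cS by simp
    ultimately show ?thesis by simp
  qed
qed

section \<open>Fixed cosets and normalisers of subgroups of prime order\<close>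

context group
begin

lemma subgroup_card_dvd:
  assumes "subgroup A G" "subgroup H G" "A \<subseteq> H"
  shows "card A dvd card H"
proof -
  interpret H: group "G\<lparr>carrier := H\<rparr>" by (rule subgroup_imp_group[OF assms(2)])
  have A: "subgroup A (G\<lparr>carrier := H\<rparr>)" by (rule subgroup_incl[OF assms(1,2,3)])
  have "card A dvd order (G\<lparr>carrier := H\<rparr>)" unfolding H.lagrange[OF A, symmetric] by (rule dvd_triv_right)
  then show ?thesis by (simp add: order_def)
qed

text \<open>Right multiplication by \<open>x\<close> permutes the cosets and its \<open>b\<close>-th
  power is the identity, so the cosets that it moves fall into orbits of length
  \<open>b\<close>.\<close>

lemma rcosets_fixed:
  assumes fin: "finite (carrier G)" and K: "subgroup K G" and x: "x \<in> carrier G" "x [^] b = \<one>" and b: "prime b"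
  shows "b dvd card {C \<in> rcosets K. C #> x \<noteq> C}"
proof (rule prime_cycle_card[OF b, where f = "\<lambda>C. C #> x"])
  let ?S = "{C \<in> rcosets K. C #> x \<noteq> C}"
  have Ks: "K \<subseteq> carrier G" by (rule subgroup.subset[OF K])
  show "finite ?S" using fin Ks by (auto simp: RCOSETS_def)
  have rep: "\<exists>g\<in>carrier G. C = K #> g" if "C \<in> rcosets K" for C using that unfolding RCOSETS_def by blast
  fix C assume C: "C \<in> ?S"
  then obtain g where g: "g \<in> carrier G" "C = K #> g" using rep by blast
  have cx: "C #> x = K #> (g \<otimes> x)" unfolding g(2) by (rule coset_mult_assoc[OF Ks g(1) x(1)])
  show "C #> x \<noteq> C" using C by blast
  have pw: "((\<lambda>C. C #> x) ^^ i) C = K #> (g \<otimes> x [^] i)" for i :: nat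
  proof (induction i)
    case 0 then show ?case using g by simp
  next
    case (Suc i)
    then show ?case using coset_mult_assoc[OF Ks _ x(1), of "g \<otimes> x [^] i"] g(1) x(1) by (simp add: m_assoc)
  qed
  then show "((\<lambda>C. C #> x) ^^ b) C = C" using g x by simp
  have "(C #> x) #> x \<noteq> C #> x"
  proof
    assume "C #> x #> x = C #> x"
    then have "(C #> x) #> x #> inv x = C #> x #> inv x" by simp
    then have "C #> x = C" unfolding cx using coset_mult_assoc[OF Ks] g x by (simp add: m_assoc)
    then show False using C by blast
  qed
  moreover have "C #> x \<in> rcosets K" unfolding cx using rcosetsI[OF Ks] g x by simp
  ultimately show "C #> x \<in> ?S" by blast
qed

lemma coset_fixed_iff:
  assumes "subgroup K G" "x \<in> carrier G" "g \<in> carrier G"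
  shows "K #> g #> x = K #> g \<longleftrightarrow> g \<otimes> x \<otimes> inv g \<in> K"
proof -
  have Ks: "K \<subseteq> carrier G" by (rule subgroup.subset[OF assms(1)])
  have "K #> g #> x = K #> g \<longleftrightarrow> K #> (g \<otimes> x) = K #> g" using coset_mult_assoc[OF Ks assms(3,2)] by simp
  also have "\<dots> \<longleftrightarrow> g \<otimes> x \<otimes> inv g \<in> K"
  proof
    assume "K #> (g \<otimes> x) = K #> g"
    then have "g \<otimes> x \<in> K #> g" using rcos_self[OF _ assms(1), of "g \<otimes> x"] assms by simp
    then show "g \<otimes> x \<otimes> inv g \<in> K" using subgroup.rcos_module_imp[OF assms(1) is_group assms(3)] by simp
  next
    assume "g \<otimes> x \<otimes> inv g \<in> K"
    then have "g \<otimes> x \<in> K #> g" using subgroup.rcos_module_rev[OF assms(1) is_group assms(3)] assms by simp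
    then show "K #> (g \<otimes> x) = K #> g" using repr_independence[OF _ assms(3,1)] by simp
  qed
  finally show ?thesis .
qed

lemma Norm_powers_iff:
  assumes "x \<in> carrier G" "g \<in> carrier G"
  shows "g \<in> Norm (range (\<lambda>i::int. x [^] i)) \<longleftrightarrow> g \<otimes> x \<otimes> inv g \<in> range (\<lambda>i::int. x [^] i)"
proof
  have "x \<in> range (\<lambda>i::int. x [^] i)" using assms int_pow_1 by (metis rangeI)
  then show "g \<in> Norm (range (\<lambda>i::int. x [^] i)) \<Longrightarrow> g \<otimes> x \<otimes> inv g \<in> range (\<lambda>i::int. x [^] i)" unfolding Norm_def by blast
next
  assume "g \<otimes> x \<otimes> inv g \<in> range (\<lambda>i::int. x [^] i)"
  then obtain k :: int where k: "g \<otimes> x \<otimes> inv g = x [^] k" by blast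
  have "g \<otimes> x = (g \<otimes> x \<otimes> inv g) \<otimes> g" using assms by (simp add: m_assoc)
  then have "g \<otimes> x = x [^] k \<otimes> g" unfolding k .
  then have "g \<otimes> x [^] i = (x [^] k) [^] i \<otimes> g" for i :: int by (intro pow_conj) (use assms in simp_all)
  then have "g \<otimes> x [^] i \<otimes> inv g = x [^] (k * i)" for i :: int using assms by (simp add: m_assoc int_pow_pow)
  then show "g \<in> Norm (range (\<lambda>i::int. x [^] i))" unfolding Norm_def using assms by auto
qed

text \<open>The growth step for p-subgroups in Sylow theory. The number of cosets of the subgroup of
  order \<open>b\<close> is divisible by \<open>b\<close>, and so is the number of those moved by
  \<open>x\<close>; hence also the number of fixed ones, whose union is the normaliser.\<close>

lemma normalizer_card:
  assumes fin: "finite (carrier G)" and x: "x \<in> carrier G" "ord x = b" and b: "prime b" and card: "b\<^sup>2 dvd order G"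
  shows "b\<^sup>2 dvd card (Norm (range (\<lambda>i::int. x [^] i)))"
proof -
  define X where "X = range (\<lambda>i::int. x [^] i)"
  define FX where "FX = {C \<in> rcosets X. C #> x = C}"
  have X: "subgroup X G" unfolding X_def by (rule subgroup_of_powers[OF x(1)])
  have cX: "card X = b" unfolding X_def using card_powers[OF x(1)] x(2) by simp
  have Xs: "X \<subseteq> carrier G" by (rule subgroup.subset[OF X])
  have xX: "x [^] b = \<one>" using x by auto
  have fin1: "finite (rcosets X)" using fin by (simp add: RCOSETS_def)
  have rep: "\<exists>g\<in>carrier G. C = X #> g" if "C \<in> rcosets X" for C using that unfolding RCOSETS_def by blast
  have "b dvd card {C \<in> rcosets X. C #> x \<noteq> C}" by (rule rcosets_fixed[OF fin X x(1) xX b])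
  moreover have "card (rcosets X) = card FX + card {C \<in> rcosets X. C #> x \<noteq> C}"
  proof -
    have "rcosets X = FX \<union> {C \<in> rcosets X. C #> x \<noteq> C}" "FX \<inter> {C \<in> rcosets X. C #> x \<noteq> C} = {}" unfolding FX_def by auto
    moreover have "finite FX" "finite {C \<in> rcosets X. C #> x \<noteq> C}" using fin1 unfolding FX_def by simp_all
    ultimately show ?thesis using card_Un_disjoint[of FX "{C \<in> rcosets X. C #> x \<noteq> C}"] by simp
  qed
  moreover have "b dvd card (rcosets X)"
  proof -
    have "b\<^sup>2 dvd card (rcosets X) * b" using lagrange[OF X] cX card by simp
    then show ?thesis using b by (simp add: power2_eq_square prime_gt_0_nat)
  qed
  ultimately have bF: "b dvd card FX" using dvd_add_left_iff[of b "card {C \<in> rcosets X. C #> x \<noteq> C}" "card FX"] by simp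
  have "\<Union>FX = Norm X"
  proof
    show "\<Union>FX \<subseteq> Norm X"
    proof
      fix g assume "g \<in> \<Union>FX"
      then obtain C where C: "C \<in> rcosets X" "C #> x = C" "g \<in> C" unfolding FX_def by blast
      obtain h where h: "h \<in> carrier G" "C = X #> h" using rep[OF C(1)] by blast
      have gC: "g \<in> carrier G" using C(3) h Xs r_coset_subset_G[of X h] by blast
      have "C = X #> g" using repr_independence[of g X h] C(3) h X by simp
      then have "g \<otimes> x \<otimes> inv g \<in> X" using coset_fixed_iff[OF X x(1) gC] C(2) by simp
      then show "g \<in> Norm X" using Norm_powers_iff[OF x(1) gC] unfolding X_def by simp
    qed
    show "Norm X \<subseteq> \<Union>FX"
    proof
      fix g assume g: "g \<in> Norm X"
      then have gC: "g \<in> carrier G" unfolding Norm_def by blast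
      have "g \<otimes> x \<otimes> inv g \<in> X" using Norm_powers_iff[OF x(1) gC] g unfolding X_def by simp
      then have "X #> g #> x = X #> g" using coset_fixed_iff[OF X x(1) gC] by simp
      moreover have "X #> g \<in> rcosets X" by (rule rcosetsI[OF Xs gC])
      moreover have "g \<in> X #> g" by (rule rcos_self[OF gC X])
      ultimately show "g \<in> \<Union>FX" unfolding FX_def by blast
    qed
  qed
  moreover have "b * card FX = card (\<Union>FX)"
  proof (rule card_partition)
    show "finite FX" using fin1 unfolding FX_def by simp
    have "\<Union>FX \<subseteq> carrier G" unfolding \<open>\<Union>FX = Norm X\<close> Norm_def by blast
    then show "finite (\<Union>FX)" using fin by (rule finite_subset)
    show "card C = b" if "C \<in> FX" for C using card_rcosets_equal[of C X] that Xs cX unfolding FX_def by simp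
    show "C1 \<inter> C2 = {}" if "C1 \<in> FX" "C2 \<in> FX" "C1 \<noteq> C2" for C1 C2
      using rcos_disjoint[OF X] that unfolding FX_def pairwise_def disjnt_def by blast
  qed
  ultimately have "card (Norm X) = b * card FX" by simp
  then show ?thesis using bF unfolding X_def power2_eq_square by simp
qed

lemma Norm_powers2:
  assumes "n \<in> carrier G" "m \<in> carrier G" "n \<otimes> m = m \<otimes> n" "g \<in> carrier G"
    "g \<otimes> n \<otimes> inv g \<in> {n [^] i \<otimes> m [^] j | (i::int) (j::int). True}"
    "g \<otimes> m \<otimes> inv g \<in> {n [^] i \<otimes> m [^] j | (i::int) (j::int). True}"
  shows "g \<in> Norm {n [^] i \<otimes> m [^] j | (i::int) (j::int). True}"
proof -
  let ?T = "{n [^] i \<otimes> m [^] j | (i::int) (j::int). True}"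
  note s = powers2(1)[OF assms(1-3)]
  have 1: "g \<otimes> y [^] i = (g \<otimes> y \<otimes> inv g) [^] i \<otimes> g" if "y \<in> carrier G" for y and i :: int
    by (rule pow_conj) (use assms that in \<open>simp_all add: m_assoc\<close>)
  have "g \<otimes> (n [^] i \<otimes> m [^] j) \<otimes> inv g \<in> ?T" for i j :: int
  proof -
    have "g \<otimes> (n [^] i \<otimes> m [^] j) \<otimes> inv g = (g \<otimes> n [^] i) \<otimes> m [^] j \<otimes> inv g" using assms(1,2,4) by (simp add: m_assoc)
    also have "\<dots> = (g \<otimes> n \<otimes> inv g) [^] i \<otimes> (g \<otimes> m [^] j) \<otimes> inv g" unfolding 1[OF assms(1)] using assms(1,2,4) by (simp add: m_assoc)
    also have "\<dots> = (g \<otimes> n \<otimes> inv g) [^] i \<otimes> (g \<otimes> m \<otimes> inv g) [^] j" unfolding 1[OF assms(2)] using assms(1,2,4) by (simp add: m_assoc)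
    also have "\<dots> \<in> ?T" by (intro subgroup.m_closed[OF s] subgroup_int_pow_closed[OF s] assms(5,6))
    finally show ?thesis .
  qed
  then show ?thesis unfolding Norm_def using assms(4) by blast
qed

end

section \<open>Type {3,4} and quotients by a normal subgroup of order b\<close>

context string_group
begin

text \<open>
  The conjugates \<open>r2\<close>, \<open>r1 r2 r1\<close> and \<open>r0 r1 r2 r1 r0\<close> of \<open>r2\<close> commute, so they generate a normal subgroup of order at
  most 8, and its product with the group \<open>\<langle>r0, r1\<rangle>\<close> of order at most 6 is everything.
\<close>

lemma order_le_48:
  assumes p3: "r1 \<otimes> (r0 \<otimes> r1) = r0 \<otimes> (r1 \<otimes> r0)"
  shows "order G \<le> 48"
proof -
  define t2 where "t2 = r1 \<otimes> (r2 \<otimes> r1)"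
  define t3 where "t3 = r0 \<otimes> (t2 \<otimes> r0)"
  have tC [simp]: "t2 \<in> carrier G" "t3 \<in> carrier G" unfolding t2_def t3_def by simp_all
  have p3': "r1 \<otimes> (r0 \<otimes> (r1 \<otimes> x)) = r0 \<otimes> (r1 \<otimes> (r0 \<otimes> x))" if "x \<in> carrier G" for x
  proof -
    have "(r1 \<otimes> (r0 \<otimes> r1)) \<otimes> x = (r0 \<otimes> (r1 \<otimes> r0)) \<otimes> x" using p3 by simp
    then show ?thesis using that by (simp add: m_assoc)
  qed
  have s2: "t2 \<otimes> t2 = \<one>" "t3 \<otimes> t3 = \<one>" unfolding t3_def t2_def by (simp_all add: m_assoc sq sq')
  have c12: "t2 \<otimes> r2 = r2 \<otimes> t2" unfolding t2_def by (simp add: m_assoc braid)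
  have c13: "t3 \<otimes> r2 = r2 \<otimes> t3"
  proof -
    have "t3 \<otimes> r2 = r0 \<otimes> (t2 \<otimes> (r0 \<otimes> r2))" unfolding t3_def by (simp add: m_assoc)
    also have "\<dots> = r0 \<otimes> ((t2 \<otimes> r2) \<otimes> r0)" by (simp add: c20[symmetric] m_assoc)
    also have "\<dots> = (r0 \<otimes> r2) \<otimes> (t2 \<otimes> r0)" unfolding c12 by (simp add: m_assoc)
    also have "\<dots> = r2 \<otimes> t3" unfolding c20[symmetric] t3_def by (simp add: m_assoc)
    finally show ?thesis .
  qed
  have r1t3: "r1 \<otimes> t3 = t3 \<otimes> r1"
  proof -
    have "r1 \<otimes> t3 = (r1 \<otimes> (r0 \<otimes> r1)) \<otimes> (r2 \<otimes> (r1 \<otimes> r0))" unfolding t3_def t2_def by (simp add: m_assoc)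
    also have "\<dots> = r0 \<otimes> (r1 \<otimes> ((r0 \<otimes> r2) \<otimes> (r1 \<otimes> r0)))" unfolding p3 by (simp add: m_assoc)
    also have "\<dots> = r0 \<otimes> (r1 \<otimes> (r2 \<otimes> (r0 \<otimes> (r1 \<otimes> r0))))" unfolding c20[symmetric] by (simp add: m_assoc)
    also have "\<dots> = r0 \<otimes> (r1 \<otimes> (r2 \<otimes> (r1 \<otimes> (r0 \<otimes> r1))))" unfolding p3 ..
    also have "\<dots> = t3 \<otimes> r1" unfolding t3_def t2_def by (simp add: m_assoc)
    finally show ?thesis .
  qed
  have r1t2: "r1 \<otimes> t2 = r2 \<otimes> r1" "t2 \<otimes> r1 = r1 \<otimes> r2" unfolding t2_def by (simp_all add: m_assoc sq sq')
  have c23: "t3 \<otimes> t2 = t2 \<otimes> t3"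
  proof -
    have "t3 \<otimes> t2 = (t3 \<otimes> r1) \<otimes> (r2 \<otimes> r1)" unfolding t2_def by (simp add: m_assoc)
    also have "\<dots> = r1 \<otimes> ((t3 \<otimes> r2) \<otimes> r1)" unfolding r1t3[symmetric] by (simp add: m_assoc)
    also have "\<dots> = r1 \<otimes> (r2 \<otimes> (t3 \<otimes> r1))" unfolding c13 by (simp add: m_assoc)
    also have "\<dots> = t2 \<otimes> t3" unfolding r1t3[symmetric] t2_def by (simp add: m_assoc)
    finally show ?thesis .
  qed
  define E where "E = {\<one>, r2, t2, t3, r2 \<otimes> t2, r2 \<otimes> t3, t2 \<otimes> t3, r2 \<otimes> (t2 \<otimes> t3)}"
  define W where "W = {\<one>, r0, r1, r0 \<otimes> r1, r1 \<otimes> r0, r0 \<otimes> (r1 \<otimes> r0)}"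
  have s2': "t2 \<otimes> (t2 \<otimes> x) = x" "t3 \<otimes> (t3 \<otimes> x) = x" if "x \<in> carrier G" for x
    using that s2 by (simp_all add: m_assoc[symmetric])
  have cc: "t2 \<otimes> (r2 \<otimes> x) = r2 \<otimes> (t2 \<otimes> x)" "t3 \<otimes> (r2 \<otimes> x) = r2 \<otimes> (t3 \<otimes> x)" "t3 \<otimes> (t2 \<otimes> x) = t2 \<otimes> (t3 \<otimes> x)" if "x \<in> carrier G" for x
    using that by (simp_all add: m_assoc[symmetric] c12 c13 c23)
  have E: "e \<otimes> r2 \<in> E" "e \<otimes> t2 \<in> E" "e \<otimes> t3 \<in> E" if "e \<in> E" for e
    using that unfolding E_def by (auto simp: m_assoc s2 s2' sq sq' c12 c13 c23 cc)
  have EC: "e \<in> carrier G" if "e \<in> E" for e using that unfolding E_def by auto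
  have WC: "w \<in> carrier G" if "w \<in> W" for w using that unfolding W_def by auto
  have W01: "w \<otimes> r0 \<in> W" "w \<otimes> r1 \<in> W" if "w \<in> W" for w
    using that unfolding W_def by (auto simp: m_assoc sq sq' p3 p3')
  \<comment> \<open>Moving \<open>r2\<close> to the left past \<open>w\<close> replaces it by its
    conjugate under \<open>w\<close>, which is one of the three commuting involutions.\<close>
  have W2: "w \<otimes> r2 = r2 \<otimes> w \<or> w \<otimes> r2 = t2 \<otimes> w \<or> w \<otimes> r2 = t3 \<otimes> w" if "w \<in> W" for w
  proof -
    have "\<one> \<otimes> r2 = r2 \<otimes> \<one>" "r0 \<otimes> r2 = r2 \<otimes> r0" "r1 \<otimes> r2 = t2 \<otimes> r1" "(r0 \<otimes> r1) \<otimes> r2 = t3 \<otimes> (r0 \<otimes> r1)"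
      "(r1 \<otimes> r0) \<otimes> r2 = t2 \<otimes> (r1 \<otimes> r0)" "(r0 \<otimes> (r1 \<otimes> r0)) \<otimes> r2 = t3 \<otimes> (r0 \<otimes> (r1 \<otimes> r0))"
      unfolding t3_def t2_def by (simp_all add: m_assoc sq sq' c20 c20')
    then show ?thesis using that unfolding W_def by blast
  qed
  have "carrier G \<subseteq> {e \<otimes> w | e w. e \<in> E \<and> w \<in> W}"
  proof (rule gen)
    have "\<one> = \<one> \<otimes> \<one>" "\<one> \<in> E" "\<one> \<in> W" unfolding E_def W_def by simp_all
    then show "\<one> \<in> {e \<otimes> w | e w. e \<in> E \<and> w \<in> W}" by blast
    fix g assume "g \<in> {e \<otimes> w | e w. e \<in> E \<and> w \<in> W}"
    then obtain e w where ew: "e \<in> E" "w \<in> W" "g = e \<otimes> w" by blast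
    have "g \<otimes> r0 = e \<otimes> (w \<otimes> r0)" "g \<otimes> r1 = e \<otimes> (w \<otimes> r1)" using ew EC WC by (simp_all add: m_assoc)
    moreover have "\<exists>t\<in>{r2, t2, t3}. g \<otimes> r2 = (e \<otimes> t) \<otimes> w"
    proof -
      obtain t where t: "t \<in> {r2, t2, t3}" "w \<otimes> r2 = t \<otimes> w" using W2[OF ew(2)] by blast
      then have "t \<in> carrier G" by auto
      then have "g \<otimes> r2 = (e \<otimes> t) \<otimes> w" using t(2) ew EC[OF ew(1)] WC[OF ew(2)] by (simp add: m_assoc)
      then show ?thesis using t(1) by blast
    qed
    moreover have "e \<otimes> t \<in> E" if "t \<in> {r2, t2, t3}" for t using that E[OF ew(1)] by blast
    ultimately show "g \<otimes> r0 \<in> {e \<otimes> w | e w. e \<in> E \<and> w \<in> W} \<and> g \<otimes> r1 \<in> {e \<otimes> w | e w. e \<in> E \<and> w \<in> W} \<and> g \<otimes> r2 \<in> {e \<otimes> w | e w. e \<in> E \<and> w \<in> W}"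
      using ew W01[OF ew(2)] by blast
  qed
  also have "\<dots> = (\<lambda>(e, w). e \<otimes> w) ` (E \<times> W)" by auto
  finally have "card (carrier G) \<le> card ((\<lambda>(e, w). e \<otimes> w) ` (E \<times> W))" by (rule card_mono[rotated]) (simp add: E_def W_def)
  also have "\<dots> \<le> card (E \<times> W)" by (rule card_image_le) (simp add: E_def W_def)
  finally have "card (carrier G) \<le> card E * card W" by (simp add: card_cartesian_product)
  moreover have "card E \<le> 8" "card W \<le> 6"
    using card_length[of "[\<one>, r2, t2, t3, r2 \<otimes> t2, r2 \<otimes> t3, t2 \<otimes> t3, r2 \<otimes> (t2 \<otimes> t3)]"] card_length[of "[\<one>, r0, r1, r0 \<otimes> r1, r1 \<otimes> r0, r0 \<otimes> (r1 \<otimes> r0)]"]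
    unfolding E_def W_def by simp_all
  ultimately show ?thesis unfolding order_def using mult_le_mono[of "card E" 8 "card W" 6] by linarith
qed

text \<open>The quotient by \<open>X\<close> is again a string group, of order \<open>8 b\<close>,
  and its face rotation satisfies the {4,4} relation because the fourth power of
  \<open>r0 r1\<close> lies in \<open>X\<close>. This contradicts
  \<open>no_44_of_prime_index\<close>.\<close>

lemma normal_prime_contradiction:
  assumes X: "X \<lhd> G" and cX: "card X = b" and b: "prime b" "b \<ge> 3" "order G = 8 * b\<^sup>2"
    and p4: "(r0 \<otimes> r1) [^] (4::nat) \<in> X"
  shows False
proof -
  interpret X: normal X G by (rule X)
  let ?Q = "G Mod X"
  interpret Q: group ?Q by (rule X.factorgroup_is_group)
  have Xs: "subgroup X G" by (rule normal_imp_subgroup[OF X])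
  have m: "(X #> g) \<otimes>\<^bsub>?Q\<^esub> (X #> h) = X #> (g \<otimes> h)" if "g \<in> carrier G" "h \<in> carrier G" for g h
    using X.rcos_sum[OF that] by simp
  have o: "\<one>\<^bsub>?Q\<^esub> = X" by simp
  have one: "X #> \<one> = X" using X.subset by simp
  have cQ: "carrier ?Q = (\<lambda>g. X #> g) ` carrier G" by (rule carrier_FactGroup)
  have eq: "X #> g = X #> h \<longleftrightarrow> g \<otimes> inv h \<in> X" if gh: "g \<in> carrier G" "h \<in> carrier G" for g h
  proof
    assume "X #> g = X #> h"
    then have "g \<in> X #> h" using rcos_self[OF gh(1) Xs] by simp
    then show "g \<otimes> inv h \<in> X" by (rule X.rcos_module_imp[OF is_group gh(2)])
  next
    assume "g \<otimes> inv h \<in> X"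
    then have "g \<in> X #> h" by (rule X.rcos_module_rev[OF is_group gh(2,1)])
    then show "X #> g = X #> h" using repr_independence[OF _ gh(2) Xs] by simp
  qed
  have "string_group ?Q (X #> r0) (X #> r1) (X #> r2)"
  proof
    show "X #> r0 \<in> carrier ?Q" "X #> r1 \<in> carrier ?Q" "X #> r2 \<in> carrier ?Q" unfolding cQ by simp_all
    show "(X #> r0) \<otimes>\<^bsub>?Q\<^esub> (X #> r0) = \<one>\<^bsub>?Q\<^esub>" "(X #> r1) \<otimes>\<^bsub>?Q\<^esub> (X #> r1) = \<one>\<^bsub>?Q\<^esub>" "(X #> r2) \<otimes>\<^bsub>?Q\<^esub> (X #> r2) = \<one>\<^bsub>?Q\<^esub>"
      using m sq one o by simp_all
    show "(X #> r2) \<otimes>\<^bsub>?Q\<^esub> (X #> r0) = (X #> r0) \<otimes>\<^bsub>?Q\<^esub> (X #> r2)" by (simp only: m r_closed c20)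
    show "(X #> r2) \<otimes>\<^bsub>?Q\<^esub> ((X #> r1) \<otimes>\<^bsub>?Q\<^esub> ((X #> r2) \<otimes>\<^bsub>?Q\<^esub> (X #> r1))) = (X #> r1) \<otimes>\<^bsub>?Q\<^esub> ((X #> r2) \<otimes>\<^bsub>?Q\<^esub> ((X #> r1) \<otimes>\<^bsub>?Q\<^esub> (X #> r2)))"
      by (simp only: m r_closed m_closed braid)
    \<comment> \<open>\<open>X\<close> has odd order, so it does not contain the involution
      \<open>z\<close>, and the vertex stabiliser keeps its order 8 in the quotient.\<close>
    have "X #> z \<noteq> X #> \<one>"
    proof
      assume "X #> z = X #> \<one>"
      then have "z \<in> X" using eq[of z \<one>] by simp
      then have "z [^] b = \<one>" using subgroup_pow_card[OF Xs] cX by simp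
      moreover have "z [^] (2::nat) = \<one>" using z_props(1) by (simp add: numeral_2_eq_2)
      ultimately have "ord z dvd b" "ord z dvd 2" using pow_eq_id[OF z_closed] by blast+
      moreover have "odd b" using prime_odd_nat[of b] b by simp
      ultimately have "ord z = 1" using two_is_prime_nat by (metis prime_nat_iff)
      then show False using ord_eq_1[OF z_closed] z_ne unfolding z_def by simp
    qed
    then show "(X #> r1) \<otimes>\<^bsub>?Q\<^esub> ((X #> r2) \<otimes>\<^bsub>?Q\<^esub> ((X #> r1) \<otimes>\<^bsub>?Q\<^esub> (X #> r2))) \<noteq> \<one>\<^bsub>?Q\<^esub>"
      unfolding o one z_def by (simp only: m r_closed m_closed) simp
    show "finite (carrier ?Q)" unfolding cQ using fin by simp
    fix S assume S1: "\<one>\<^bsub>?Q\<^esub> \<in> S" and S2: "\<And>g. g \<in> carrier ?Q \<Longrightarrow> g \<in> S \<Longrightarrow> g \<otimes>\<^bsub>?Q\<^esub> (X #> r0) \<in> S \<and> g \<otimes>\<^bsub>?Q\<^esub> (X #> r1) \<in> S \<and> g \<otimes>\<^bsub>?Q\<^esub> (X #> r2) \<in> S"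
    have "carrier G \<subseteq> {g. X #> g \<in> S}"
    proof (rule gen)
      show "\<one> \<in> {g. X #> g \<in> S}" using S1 one o by simp
      fix g assume g: "g \<in> carrier G" "g \<in> {g. X #> g \<in> S}"
      then have "X #> g \<in> carrier ?Q" "X #> g \<in> S" unfolding cQ by simp_all
      from S2[OF this] show "g \<otimes> r0 \<in> {g. X #> g \<in> S} \<and> g \<otimes> r1 \<in> {g. X #> g \<in> S} \<and> g \<otimes> r2 \<in> {g. X #> g \<in> S}"
        unfolding m[OF g(1) r_closed(1)] m[OF g(1) r_closed(2)] m[OF g(1) r_closed(3)] by simp
    qed
    then show "carrier ?Q \<subseteq> S" unfolding cQ by blast
  qed
  then interpret S: string_group ?Q "X #> r0" "X #> r1" "X #> r2" .
  have "order ?Q * b = 8 * b\<^sup>2" using lagrange[OF Xs] cX b(3) by (simp add: order_def FactGroup_def)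
  then have oQ: "order ?Q = 8 * b" using b(2) by (simp add: power2_eq_square)
  have "(r0 \<otimes> r1) [^] (4::nat) = (r0 \<otimes> (r1 \<otimes> (r0 \<otimes> r1))) \<otimes> (r0 \<otimes> (r1 \<otimes> (r0 \<otimes> r1)))" by (simp add: eval_nat_numeral m_assoc)
  moreover have "inv (r1 \<otimes> (r0 \<otimes> (r1 \<otimes> r0))) = r0 \<otimes> (r1 \<otimes> (r0 \<otimes> r1))" by (simp add: inv_mult_group m_assoc)
  ultimately have "X #> (r0 \<otimes> (r1 \<otimes> (r0 \<otimes> r1))) = X #> (r1 \<otimes> (r0 \<otimes> (r1 \<otimes> r0)))" using p4 eq by simp
  then have "(X #> r0) \<otimes>\<^bsub>?Q\<^esub> ((X #> r1) \<otimes>\<^bsub>?Q\<^esub> ((X #> r0) \<otimes>\<^bsub>?Q\<^esub> (X #> r1))) = (X #> r1) \<otimes>\<^bsub>?Q\<^esub> ((X #> r0) \<otimes>\<^bsub>?Q\<^esub> ((X #> r1) \<otimes>\<^bsub>?Q\<^esub> (X #> r0)))"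
    by (simp only: m r_closed m_closed)
  from S.no_44_of_prime_index[OF this b(1,2) oQ] show False .
qed

end

section \<open>The relations for groups of order 8 b^2\<close>

context string_group
begin

text \<open>Index at most 2 puts \<open>r2 r1 r2\<close> into \<open>H\<close>, so the conjugate of
  the subgroup generated by \<open>r0\<close> and \<open>r1\<close> under \<open>r2\<close> also
  normalises \<open>X\<close>. Then \<open>X\<close> and its conjugate under \<open>r2\<close>
  normalise each other and commute, unless they coincide.\<close>

lemma torus_relations_of_normalizer:
  assumes b: "prime b" "b \<ge> 3" and o: "order G = 8 * b\<^sup>2" and t: "t dvd 4" and p: "ord (r0 \<otimes> r1) = b * t"
    and X_def: "X = range (\<lambda>i::int. ((r0 \<otimes> r1) [^] t) [^] i)"
    and r0D: "r0 \<notin> D"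
    and H: "subgroup H G" "H = Norm X" and h: "order G \<le> 2 * card H"
  shows "torus_relations b"
proof -
  have ob: "odd b" using prime_odd_nat[of b] b by simp
  let ?u = "r0 \<otimes> r1"
  define x where "x = ?u [^] t"
  have xC [simp]: "x \<in> carrier G" unfolding x_def by simp
  have t0: "t \<noteq> 0" using t by (cases "t = 0") simp_all
  have ox: "ord x = b" unfolding x_def using ord_pow[of ?u t] p t0 by simp
  have X: "X = range (\<lambda>i::int. x [^] i)" unfolding X_def x_def ..
  have Xs: "subgroup X G" unfolding X by (rule subgroup_of_powers[OF xC])
  have cX: "card X = b" unfolding X using card_powers[OF xC] ox by simp
  have xX: "x \<in> X" unfolding X using xC int_pow_1 by (metis rangeI)
  have XC: "y \<in> carrier G" if "y \<in> X" for y by (rule subgroup.mem_carrier[OF Xs that])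
  have NX: "g \<in> H \<longleftrightarrow> g \<otimes> x \<otimes> inv g \<in> X" if "g \<in> carrier G" for g
    unfolding H(2) X by (rule Norm_powers_iff[OF xC that])
  have ixX: "inv x \<in> X" by (rule subgroup.m_inv_closed[OF Xs xX])
  have r0x: "r0 \<otimes> x = inv x \<otimes> r0"
    using Dih_pow_x[OF r_closed(1,2) sq(1,2), of "int t"] unfolding x_def by (simp add: int_pow_neg_int int_pow_int)
  have r1x: "r1 \<otimes> x = inv x \<otimes> r1"
  proof -
    have iu: "inv ?u = r1 \<otimes> r0" by (simp add: inv_mult_group)
    have "r1 \<otimes> ?u = inv ?u \<otimes> r1" unfolding iu by (simp add: m_assoc)
    then have "r1 \<otimes> ?u [^] int t = (inv ?u) [^] int t \<otimes> r1" by (intro pow_conj) simp_all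
    then show ?thesis unfolding x_def by (simp add: int_pow_int nat_pow_inv)
  qed
  have r0x': "r0 \<otimes> x \<otimes> r0 = inv x" unfolding r0x by (simp add: m_assoc sq)
  have r1x': "r1 \<otimes> x \<otimes> r1 = inv x" unfolding r1x by (simp add: m_assoc sq)
  have rH: "r0 \<in> H" "r1 \<in> H" using NX[OF r_closed(1)] NX[OF r_closed(2)] r0x' r1x' ixX by simp_all
  have fR: "finite (rcosets H)" using fin by (simp add: RCOSETS_def)
  have Hs: "H \<subseteq> carrier G" by (rule subgroup.subset[OF H(1)])
  have cR: "card (rcosets H) \<le> 2"
  proof -
    have "card (rcosets H) * card H = order G" by (rule lagrange[OF H(1)])
    moreover have "card H > 0" using H(1) fin Hs subgroup.one_closed by (metis card_gt_0_iff empty_iff finite_subset)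
    ultimately show ?thesis using h by (metis mult_le_cancel2)
  qed
  \<comment> \<open>Otherwise the cosets of \<open>\<one>\<close>, \<open>r2\<close> and
    \<open>r2 r1\<close> are three different ones.\<close>
  have w: "r2 \<otimes> (r1 \<otimes> r2) \<in> H"
  proof (rule ccontr)
    assume no: "r2 \<otimes> (r1 \<otimes> r2) \<notin> H"
    have r2H: "r2 \<notin> H"
    proof
      assume "r2 \<in> H"
      then have "r2 \<otimes> (r1 \<otimes> r2) \<in> H" using rH by (simp add: subgroup.m_closed[OF H(1)])
      then show False using no by simp
    qed
    have r21: "r2 \<otimes> r1 \<notin> H"
    proof
      assume "r2 \<otimes> r1 \<in> H"
      then have "(r2 \<otimes> r1) \<otimes> r1 \<in> H" using rH by (simp only: subgroup.m_closed[OF H(1)])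
      then show False using r2H by (simp add: m_assoc sq)
    qed
    have ne: "H #> g \<noteq> H" if "g \<in> carrier G" "g \<notin> H" for g using rcos_self[OF that(1) H(1)] that by blast
    have d: "H \<noteq> H #> r2" "H \<noteq> H #> (r2 \<otimes> r1)" using ne[OF r_closed(3) r2H] ne[OF _ r21] by simp_all
    have d3: "H #> r2 \<noteq> H #> (r2 \<otimes> r1)"
    proof
      assume e: "H #> r2 = H #> (r2 \<otimes> r1)"
      have "H #> r2 #> r1 = H #> r2" using coset_mult_assoc[OF Hs r_closed(3,2)] e by simp
      then have "r2 \<otimes> r1 \<otimes> inv r2 \<in> H" unfolding coset_fixed_iff[OF H(1) r_closed(2,3)] .
      then show False using no by (simp add: m_assoc)
    qed
    have "card {H, H #> r2, H #> (r2 \<otimes> r1)} = 3" using d d3 by simp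
    moreover have "{H, H #> r2, H #> (r2 \<otimes> r1)} \<subseteq> rcosets H"
      using rcosetsI[OF Hs one_closed] rcosetsI[OF Hs r_closed(3)] rcosetsI[OF Hs, of "r2 \<otimes> r1"] coset_mult_one[OF Hs] by simp
    ultimately have "3 \<le> card (rcosets H)" using card_mono[OF fR, of "{H, H #> r2, H #> (r2 \<otimes> r1)}"] by simp
    then show False using cR by simp
  qed
  define x' where "x' = r2 \<otimes> (x \<otimes> r2)"
  have x'C [simp]: "x' \<in> carrier G" unfolding x'_def by simp
  have r2x: "r2 \<otimes> x \<otimes> r2 = x'" "r2 \<otimes> x' \<otimes> r2 = x" unfolding x'_def by (simp_all add: m_assoc sq sq')
  show ?thesis
  proof (cases "x' \<in> X")
    \<comment> \<open>Here \<open>r2\<close> normalises \<open>X\<close> as well, so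
      \<open>X\<close> is normal in \<open>G\<close>, which is impossible.\<close>
    case True
    then have r2H: "r2 \<in> H" using NX[OF r_closed(3)] r2x by simp
    have "X \<lhd> G"
    proof (rule Norm_all[OF Xs])
      have *: "g \<otimes> y \<otimes> g \<in> X" if "g \<in> H" "y \<in> X" "inv g = g" for g y
        using that unfolding H(2) Norm_def by auto
      show "r0 \<otimes> y \<otimes> r0 \<in> X" "r1 \<otimes> y \<otimes> r1 \<in> X" "r2 \<otimes> y \<otimes> r2 \<in> X" if "y \<in> X" for y
        using *[OF rH(1) that] *[OF rH(2) that] *[OF r2H that] by simp_all
    qed
    moreover have "?u [^] (4::nat) \<in> X"
    proof -
      obtain k where k: "4 = t * k" using t by blast
      have "?u [^] (4::nat) = x [^] int k" unfolding k x_def by (simp add: nat_pow_pow int_pow_int)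
      then show ?thesis unfolding X by blast
    qed
    ultimately show ?thesis using normal_prime_contradiction[OF _ cX b o] by blast
  next
    case False
    define X' where "X' = range (\<lambda>i::int. x' [^] i)"
    have X's: "subgroup X' G" unfolding X'_def by (rule subgroup_of_powers[OF x'C])
    have x'X': "x' \<in> X'" unfolding X'_def using x'C int_pow_1 by (metis rangeI)
    have pw2: "r2 \<otimes> x [^] i \<otimes> r2 = x' [^] i" for i :: int
    proof -
      have "r2 \<otimes> x [^] i = x' [^] i \<otimes> r2" by (rule pow_conj) (simp_all add: x'_def m_assoc sq sq')
      then show ?thesis by (simp add: m_assoc sq)
    qed
    have X'c: "r2 \<otimes> y \<otimes> r2 \<in> X'" if "y \<in> X" for y using that pw2 unfolding X X'_def by auto
    have cX': "card X' = b"
    proof -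
      have "X' = (\<lambda>y. r2 \<otimes> y \<otimes> r2) ` X" unfolding X X'_def image_image pw2 ..
      moreover have "inj_on (\<lambda>y. r2 \<otimes> y \<otimes> r2) X"
      proof (rule inj_onI)
        fix y y' assume y: "y \<in> X" "y' \<in> X" and e: "r2 \<otimes> y \<otimes> r2 = r2 \<otimes> y' \<otimes> r2"
        have "r2 \<otimes> (r2 \<otimes> y \<otimes> r2) \<otimes> r2 = r2 \<otimes> (r2 \<otimes> y' \<otimes> r2) \<otimes> r2" using e by simp
        then show "y = y'" using XC[OF y(1)] XC[OF y(2)] by (simp add: m_assoc sq sq')
      qed
      ultimately show ?thesis using card_image cX by metis
    qed
    have int1: "X \<inter> X' \<subseteq> {\<one>}"
    proof -
      have sI: "subgroup (X \<inter> X') G" by (rule subgroups_Inter_pair[OF Xs X's])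
      then have "card (X \<inter> X') dvd b" using subgroup_card_dvd[OF sI Xs] cX by simp
      then have "card (X \<inter> X') = 1 \<or> card (X \<inter> X') = b" using b(1) by (meson prime_nat_iff)
      then show ?thesis
      proof
        assume "card (X \<inter> X') = 1"
        then obtain y where "X \<inter> X' = {y}" by (meson card_1_singletonE)
        then show ?thesis using subgroup.one_closed[OF sI] by auto
      next
        assume c: "card (X \<inter> X') = b"
        have fX: "finite X" "finite X'" using cX cX' b(2) by (metis card.infinite not_numeral_le_zero)+
        have "X \<inter> X' = X" by (rule card_subset_eq[OF fX(1)]) (use c cX in auto)
        moreover have "X \<inter> X' = X'" by (rule card_subset_eq[OF fX(2)]) (use c cX' in auto)
        ultimately show ?thesis using False x'X' by blast
      qed
    qed
    \<comment> \<open>Conjugation by \<open>r2\<close> takes \<open>r0\<close> to \<open>r0\<close>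
      and \<open>r1\<close> to \<open>r2 r1 r2\<close>, both in \<open>H\<close>; so it takes the
      group generated by \<open>r0\<close> and \<open>r1\<close>, which contains \<open>x\<close>,
      into \<open>H\<close>.\<close>
    have x'H: "x' \<in> H"
    proof -
      define S where "S = {g \<in> carrier G. r2 \<otimes> g \<otimes> r2 \<in> H}"
      have Ss: "subgroup S G"
      proof (rule finite_subgroupI[OF fin])
        show "\<one> \<in> S" unfolding S_def using subgroup.one_closed[OF H(1)] by (simp add: sq)
        fix g k assume gk: "g \<in> S" "k \<in> S"
        then have c: "g \<in> carrier G" "k \<in> carrier G" unfolding S_def by blast+
        have "(r2 \<otimes> g \<otimes> r2) \<otimes> (r2 \<otimes> k \<otimes> r2) \<in> H" using gk subgroup.m_closed[OF H(1)] unfolding S_def by blast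
        moreover have "(r2 \<otimes> g \<otimes> r2) \<otimes> (r2 \<otimes> k \<otimes> r2) = r2 \<otimes> (g \<otimes> k) \<otimes> r2" using c by (simp add: m_assoc sq')
        ultimately show "g \<otimes> k \<in> S" unfolding S_def using c by simp
      qed (auto simp: S_def)
      have "r0 \<in> S" "r1 \<in> S" unfolding S_def using rH w by (simp_all add: m_assoc c20 c20' sq sq')
      then have "Dih r0 r1 \<subseteq> S" by (rule Dih_least[OF Ss])
      moreover have "x \<in> Dih r0 r1" unfolding Dih_def x_def by (metis UnI1 int_pow_int rangeI)
      ultimately have "r2 \<otimes> x \<otimes> r2 \<in> H" unfolding S_def by blast
      then show ?thesis using r2x by simp
    qed
    \<comment> \<open>The commutator of \<open>x'\<close> and \<open>x\<close> lies in
      \<open>X\<close> because \<open>x'\<close> normalises \<open>X\<close>, and in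
      \<open>X'\<close> because, conjugating by \<open>r2\<close>, \<open>x\<close> normalises
      \<open>X'\<close>.\<close>
    have comm: "x \<otimes> x' = x' \<otimes> x"
    proof -
      have 1: "x' \<otimes> x \<otimes> inv x' \<in> X" using NX[OF x'C] x'H by simp
      then have "r2 \<otimes> (x' \<otimes> x \<otimes> inv x') \<otimes> r2 \<in> X'" by (rule X'c)
      moreover have "r2 \<otimes> (x' \<otimes> x \<otimes> inv x') \<otimes> r2 = x \<otimes> x' \<otimes> inv x"
        unfolding x'_def by (simp add: m_assoc sq sq' inv_mult_group)
      ultimately have 2: "x \<otimes> x' \<otimes> inv x \<in> X'" by simp
      have c: "x' \<otimes> x \<otimes> inv x' \<otimes> inv x \<in> X" by (rule subgroup.m_closed[OF Xs 1 ixX])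
      have "x' \<otimes> inv (x \<otimes> x' \<otimes> inv x) \<in> X'" by (intro subgroup.m_closed[OF X's x'X'] subgroup.m_inv_closed[OF X's 2])
      moreover have "x' \<otimes> inv (x \<otimes> x' \<otimes> inv x) = x' \<otimes> x \<otimes> inv x' \<otimes> inv x" by (simp add: inv_mult_group m_assoc)
      ultimately have "x' \<otimes> x \<otimes> inv x' \<otimes> inv x = \<one>" using c int1 by auto
      then have "inv (inv x' \<otimes> inv x) = x' \<otimes> x" by (intro inv_equality) (simp_all add: m_assoc)
      then show ?thesis by (simp add: inv_mult_group)
    qed
    define N where "N = {x [^] i \<otimes> x' [^] j | (i::int) (j::int). True}"
    note pw = powers2[OF xC x'C comm, folded N_def]
    have inN: "x [^] i \<otimes> x' [^] j \<in> N" for i j :: int unfolding N_def by blast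
    have xN: "x \<in> N" "x' \<in> N" using inN[of 1 0] inN[of 0 1] by simp_all
    note mi = subgroup.m_inv_closed[OF pw(1)]
    have Nnorm: "N \<lhd> G"
    proof (rule Norm_all[OF pw(1)])
      have *: "g \<otimes> y \<otimes> g \<in> N" if "g \<in> carrier G" "inv g = g" "g \<otimes> x \<otimes> g \<in> N" "g \<otimes> x' \<otimes> g \<in> N" "y \<in> N" for g y
      proof -
        have "g \<in> Norm N" by (rule Norm_powers2[OF xC x'C comm that(1), folded N_def]) (use that in simp_all)
        then show ?thesis using that unfolding Norm_def by auto
      qed
      have "r0 \<otimes> x' \<otimes> r0 = r2 \<otimes> (r0 \<otimes> x \<otimes> r0) \<otimes> r2" unfolding x'_def by (simp add: m_assoc c20 c20')
      also have "\<dots> = inv x'" unfolding r0x' x'_def by (simp add: inv_mult_group m_assoc)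
      finally have 0: "r0 \<otimes> x' \<otimes> r0 \<in> N" using mi[OF xN(2)] by simp
      \<comment> \<open>Conjugating \<open>x'\<close> by \<open>r1\<close> amounts to conjugating
        \<open>x\<close> by \<open>r2 r1 r2\<close>, which stays in \<open>X\<close>, and then by
        \<open>r2\<close>.\<close>
      have "r2 \<otimes> (r1 \<otimes> r2) \<otimes> x \<otimes> inv (r2 \<otimes> (r1 \<otimes> r2)) \<in> X" using w NX by simp
      then have "r2 \<otimes> (r2 \<otimes> (r1 \<otimes> r2) \<otimes> x \<otimes> inv (r2 \<otimes> (r1 \<otimes> r2))) \<otimes> r2 \<in> X'" by (rule X'c)
      moreover have "r2 \<otimes> (r2 \<otimes> (r1 \<otimes> r2) \<otimes> x \<otimes> inv (r2 \<otimes> (r1 \<otimes> r2))) \<otimes> r2 = r1 \<otimes> x' \<otimes> r1"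
        unfolding x'_def by (simp add: m_assoc sq sq' inv_mult_group)
      moreover have "X' \<subseteq> N" unfolding X'_def using inN[of 0] by auto
      ultimately have 1: "r1 \<otimes> x' \<otimes> r1 \<in> N" by auto
      show "r0 \<otimes> y \<otimes> r0 \<in> N" "r1 \<otimes> y \<otimes> r1 \<in> N" "r2 \<otimes> y \<otimes> r2 \<in> N" if "y \<in> N" for y
        using *[OF r_closed(1) _ _ 0 that] *[OF r_closed(2) _ _ 1 that] *[OF r_closed(3) _ _ _ that] r0x' r1x' r2x xN mi[OF xN(1)] by simp_all
    qed
    have "N = (\<lambda>(a, c). a \<otimes> c) ` (X \<times> X')" unfolding N_def X X'_def by auto
    then have cN: "card N = b\<^sup>2" using subgroup_mult_card[OF Xs X's int1] cX cX' by (simp add: power2_eq_square)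
    have expN: "y [^] b = \<one>" if y: "y \<in> N" for y
    proof -
      obtain i j :: int where y: "y = x [^] i \<otimes> x' [^] j" using y unfolding N_def by blast
      have "x [^] i \<otimes> x' [^] j = x' [^] j \<otimes> x [^] i" using pw(2)[of "x [^] i" "x' [^] j"] inN[of i 0] inN[of 0 j] by simp
      then have "y [^] b = (x [^] i) [^] b \<otimes> (x' [^] j) [^] b" unfolding y by (intro pow_mult_distrib) simp_all
      moreover have "(x [^] i) [^] b = \<one>" using subgroup_pow_card[OF Xs] cX unfolding X by blast
      moreover have "(x' [^] j) [^] b = \<one>" using subgroup_pow_card[OF X's] cX' unfolding X'_def by blast
      ultimately show ?thesis by simp
    qed
    \<comment> \<open>Orders of elements divide the odd number \<open>b\<close> in \<open>N\<close>
      and divide 8 in \<open>D\<close>.\<close>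
    have ND: "N \<inter> D \<subseteq> {\<one>}"
    proof
      fix y assume y: "y \<in> N \<inter> D"
      then have yC: "y \<in> carrier G" using subgroup.mem_carrier[OF D_subgroup] by blast
      have "ord y dvd b" using expN[of y] y pow_eq_id[OF yC] by blast
      moreover have "ord y dvd 8" using subgroup_pow_card[OF D_subgroup, of y] y card_D pow_eq_id[OF yC] by simp
      moreover have "coprime b 8"
      proof -
        have "coprime b (2 ^ 3)" using ob by (intro coprime_power_right_iff[THEN iffD2]) simp
        then show ?thesis by simp
      qed
      ultimately have "ord y = 1" by (metis coprime_common_divisor_nat)
      then show "y \<in> {\<one>}" using ord_eq_1[OF yC] by simp
    qed
    show ?thesis by (rule torus_relations_of_normal[OF Nnorm pw(2) ND _ ob expN r0D]) (use o cN in simp_all)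
  qed
qed

text \<open>If \<open>p\<close> divides 4, the {4,4} relation holds. Otherwise \<open>p > 2\<close>,
  so \<open>r0\<close> and \<open>r1\<close> generate a group of order \<open>2 p\<close>, which
  divides \<open>8 b^2\<close>, and this forces \<open>b\<close> to divide \<open>p\<close>.\<close>

theorem torus_relations_of_order:
  assumes b: "prime b" "b \<ge> 3" and o: "order G = 8 * b\<^sup>2" and pb: "ord (r0 \<otimes> r1) < b\<^sup>2" and r0D: "r0 \<notin> D"
  shows "torus_relations b"
proof -
  have ob: "odd b" using prime_odd_nat[of b] b by simp
  let ?u = "r0 \<otimes> r1"
  define p where "p = ord ?u"
  have uC: "?u \<in> carrier G" by simp
  have u4: "?u [^] (4::nat) = (r0 \<otimes> (r1 \<otimes> (r0 \<otimes> r1))) \<otimes> (r0 \<otimes> (r1 \<otimes> (r0 \<otimes> r1)))" by (simp add: eval_nat_numeral m_assoc)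
  show ?thesis
  proof (cases "p dvd 4")
    case True
    then have "(r0 \<otimes> (r1 \<otimes> (r0 \<otimes> r1))) \<otimes> (r0 \<otimes> (r1 \<otimes> (r0 \<otimes> r1))) = \<one>" unfolding u4[symmetric] p_def by (simp add: pow_eq_id)
    then have "inv (r0 \<otimes> (r1 \<otimes> (r0 \<otimes> r1))) = r0 \<otimes> (r1 \<otimes> (r0 \<otimes> r1))" by (intro inv_equality) simp_all
    then have "r0 \<otimes> (r1 \<otimes> (r0 \<otimes> r1)) = r1 \<otimes> (r0 \<otimes> (r1 \<otimes> r0))" by (simp add: inv_mult_group m_assoc)
    then show ?thesis by (rule torus_relations_of_44[OF _ b o])
  next
    case False
    have p0: "p > 0" unfolding p_def using ord_ge_1[OF fin uC] by simp
    have "p \<noteq> 1" "p \<noteq> 2" using False by auto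
    then have p2: "p > 2" using p0 by linarith
    let ?A = "Dih r0 r1"
    have cA: "card ?A = 2 * p" unfolding p_def by (rule card_Dih(2)[OF fin r_closed(1,2) sq(1,2)]) (use p2 p_def in simp)
    have As: "subgroup ?A G" by (rule Dih_subgroup(1)[OF fin r_closed(1,2) sq(1,2)])
    have "2 * p dvd 8 * b\<^sup>2" using lagrange[OF As] cA o by (metis dvd_triv_right)
    then have p4b: "p dvd 4 * b\<^sup>2" by (auto simp: dvd_def)
    have "b dvd p"
    proof (rule ccontr)
      assume "\<not> b dvd p"
      then have "coprime p (b\<^sup>2)" using b(1) by (metis coprime_commute coprime_power_right_iff prime_imp_coprime_nat)
      then have "p dvd 4" using p4b by (simp add: coprime_dvd_mult_left_iff)
      then show False using False by simp
    qed
    then obtain t where t: "p = b * t" by blast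
    \<comment> \<open>The bound \<open>p < b^2\<close> enters here: it makes \<open>t\<close>
      coprime to \<open>b\<close>, so that \<open>t\<close> divides 4.\<close>
    have tb: "t < b" using pb b(2) unfolding p_def[symmetric] t power2_eq_square by simp
    have t0: "t > 0" using t p0 by simp
    have "coprime t b" using tb t0 b(1) by (metis coprime_commute dvd_imp_le not_le prime_imp_coprime_nat)
    moreover have "t dvd 4 * b" using p4b b(2) unfolding t power2_eq_square by (simp add: mult.left_commute)
    ultimately have t4: "t dvd 4" by (simp add: coprime_dvd_mult_left_iff)
    define x where "x = ?u [^] t"
    have xC: "x \<in> carrier G" unfolding x_def by simp
    have ox: "ord x = b" unfolding x_def using ord_pow[of ?u t] t t0 unfolding p_def by simp
    define X where "X = range (\<lambda>i::int. x [^] i)"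
    define H where "H = Norm X"
    have Xs: "subgroup X G" unfolding X_def by (rule subgroup_of_powers[OF xC])
    have Hs: "subgroup H G" unfolding H_def by (rule Norm_subgroup[OF fin subgroup.subset[OF Xs]])
    have XH: "X \<subseteq> H" unfolding H_def by (rule Norm_self[OF Xs])
    have xX: "x \<in> X" unfolding X_def using xC int_pow_1 by (metis rangeI)
    have bH: "b\<^sup>2 dvd card H" unfolding H_def X_def by (rule normalizer_card[OF fin xC ox b(1)]) (simp add: o)
    have r0x: "r0 \<otimes> x = inv x \<otimes> r0"
      using Dih_pow_x[OF r_closed(1,2) sq(1,2), of "int t"] unfolding x_def by (simp add: int_pow_neg_int int_pow_int)
    have "r1 \<otimes> x = inv x \<otimes> r1"
    proof -
      have iu: "inv ?u = r1 \<otimes> r0" by (simp add: inv_mult_group)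
      have "r1 \<otimes> ?u = inv ?u \<otimes> r1" unfolding iu by (simp add: m_assoc)
      then have "r1 \<otimes> ?u [^] int t = (inv ?u) [^] int t \<otimes> r1" by (intro pow_conj) simp_all
      then show ?thesis unfolding x_def by (simp add: int_pow_int nat_pow_inv)
    qed
    then have "r0 \<otimes> x \<otimes> inv r0 = inv x" "r1 \<otimes> x \<otimes> inv r1 = inv x" using r0x xC by (simp_all add: m_assoc sq)
    moreover have "inv x \<in> X" by (rule subgroup.m_inv_closed[OF Xs xX])
    ultimately have rH: "r0 \<in> H" "r1 \<in> H" unfolding H_def X_def using Norm_powers_iff[OF xC r_closed(1)] Norm_powers_iff[OF xC r_closed(2)] unfolding X_def by simp_all
    have "2 * p dvd card H" using subgroup_card_dvd[OF As Hs Dih_least[OF Hs rH]] cA by simp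
    \<comment> \<open>The index of \<open>H\<close> is \<open>8 / h\<close>; so
      \<open>h \<ge> 4\<close> is the case of index at most 2.\<close>
    obtain h where h: "card H = b\<^sup>2 * h" using bH by blast
    have "card (rcosets H) * card H = 8 * b\<^sup>2" using lagrange[OF Hs] o by simp
    then have kh: "card (rcosets H) * h = 8" using h b(2) by simp
    have "2 * t dvd b * h" using \<open>2 * p dvd card H\<close> b(2) unfolding h t power2_eq_square by (simp add: mult.assoc mult.left_commute)
    moreover have "coprime (2 * t) b" using \<open>coprime t b\<close> ob by simp
    ultimately have th: "2 * t dvd h" by (simp add: coprime_dvd_mult_right_iff)
    have hd: "h dvd 8" using kh by (metis dvd_triv_right)
    have "h \<noteq> 0" using kh by (cases "h = 0") simp_all
    show ?thesis
    proof (cases "h \<ge> 4")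
      case True
      have "order G \<le> 2 * card H" unfolding o h using True by simp
      then show ?thesis
        using torus_relations_of_normalizer[OF b o t4 _ _ r0D Hs, of X] t unfolding p_def H_def X_def x_def by blast
    next
      case False
      have h2: "h = 2"
      proof -
        have "2 dvd h" using th by (metis dvd_mult_left)
        then show ?thesis using \<open>h \<noteq> 0\<close> False by (auto simp: dvd_def)
      qed
      have "t = 1" using th t0 h2 by (metis dvd_imp_le mult_le_cancel1 nat_mult_1_right le_antisym One_nat_def Suc_leI zero_less_numeral)
      then have xu: "x = ?u" and pb': "p = b" unfolding x_def using t by simp_all
      \<comment> \<open>With \<open>h = 2\<close> the order of \<open>D \<inter> H\<close> divides
        both 8 and \<open>2 b^2\<close>, so it is at most 2. It contains \<open>\<one>\<close> and
        \<open>r1\<close>; adding \<open>z\<close> gives the contradiction.\<close>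
      have "z \<in> H"
      proof (cases "b = 3")
        case True
        \<comment> \<open>Four cosets leave room for an orbit of length 3, so counting does not
          help. Instead \<open>r0 r1\<close> has order 3, and the order 72 violates the bound
          48.\<close>
        have "?u [^] (3::nat) = \<one>" using pb' True unfolding p_def by (simp add: pow_eq_id)
        then have e: "(r0 \<otimes> (r1 \<otimes> r0)) \<otimes> (r1 \<otimes> (r0 \<otimes> r1)) = \<one>" by (simp add: eval_nat_numeral m_assoc)
        then have "inv (r1 \<otimes> (r0 \<otimes> r1)) = r0 \<otimes> (r1 \<otimes> r0)" by (intro inv_equality) simp_all
        then have "r1 \<otimes> (r0 \<otimes> r1) = r0 \<otimes> (r1 \<otimes> r0)" by (simp add: inv_mult_group m_assoc)
        then have "order G \<le> 48" by (rule order_le_48)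
        then show ?thesis using o True by simp
      next
        case False
        \<comment> \<open>\<open>x\<close> moves a multiple of \<open>b\<close> of the at most 4 cosets, so it fixes the coset of \<open>r2\<close>\<close>
        have b5: "b \<ge> 5"
        proof -
          have "b \<noteq> 4" using ob by auto
          then show ?thesis using b(2) False by linarith
        qed
        let ?S = "{C \<in> rcosets H. C #> x \<noteq> C}"
        have fR: "finite (rcosets H)" using fin by (simp add: RCOSETS_def)
        have "b dvd card ?S" by (rule rcosets_fixed[OF fin Hs xC _ b(1)]) (use ox xC in auto)
        moreover have "card ?S \<le> 4" using card_mono[OF fR, of ?S] kh h2 by auto
        ultimately have "card ?S = 0" using b5 by (auto dest: dvd_imp_le)
        then have "?S = {}" using fR by simp
        moreover have "H #> r2 \<in> rcosets H" by (rule rcosetsI[OF subgroup.subset[OF Hs] r_closed(3)])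
        ultimately have "H #> r2 #> x = H #> r2" by blast
        then have 1: "r2 \<otimes> x \<otimes> r2 \<in> H" using coset_fixed_iff[OF Hs xC r_closed(3)] by simp
        have "inv x \<in> H" using XH \<open>inv x \<in> X\<close> by blast
        then have "inv x \<otimes> (r2 \<otimes> x \<otimes> r2) \<in> H" using 1 by (rule subgroup.m_closed[OF Hs])
        \<comment> \<open>Here \<open>x = r0 r1\<close>, and since \<open>r0\<close> commutes with
          \<open>r2\<close> the product collapses to \<open>r1 r2 r1 r2\<close>.\<close>
        moreover have "inv x \<otimes> (r2 \<otimes> x \<otimes> r2) = z" unfolding xu z_def by (simp add: inv_mult_group m_assoc c20 c20' sq sq')
        ultimately show ?thesis by simp
      qed
      have DH: "subgroup (D \<inter> H) G" by (rule subgroups_Inter_pair[OF D_subgroup Hs])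
      have "card (D \<inter> H) dvd 8" using subgroup_card_dvd[OF DH D_subgroup] card_D by simp
      moreover have "card (D \<inter> H) dvd 2 * b\<^sup>2" using subgroup_card_dvd[OF DH Hs] h h2 by (simp add: mult.commute)
      ultimately have g: "card (D \<inter> H) dvd gcd 8 (2 * b\<^sup>2)" by simp
      have "coprime 4 (b\<^sup>2)"
      proof -
        have "coprime (2 ^ 2) (b\<^sup>2)" using ob by (simp only: coprime_power_left_iff coprime_power_right_iff) simp
        then show ?thesis by simp
      qed
      then have "gcd 8 (2 * b\<^sup>2) = 2" using gcd_mult_distrib_nat[of 2 4 "b\<^sup>2"] by simp
      then have c2: "card (D \<inter> H) \<le> 2" using g by (auto dest: dvd_imp_le)
      have zD: "z \<in> D" unfolding z_def using D_r by (simp add: subgroup.m_closed[OF D_subgroup])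
      have sub: "{\<one>, r1, z} \<subseteq> D \<inter> H" using zD \<open>z \<in> H\<close> D_r rH subgroup.one_closed[OF DH] by blast
      have "r1 \<noteq> \<one>" using z_ne sq(3) by auto
      moreover have "z \<noteq> \<one>" using z_ne unfolding z_def .
      moreover have "r1 \<noteq> z"
      proof
        assume "r1 = z"
        then have "r1 \<otimes> r1 = r1 \<otimes> z" by simp
        then have "r2 \<otimes> (r1 \<otimes> r2) = \<one>" unfolding z_def by (simp add: sq sq')
        then have "r2 \<otimes> (r2 \<otimes> (r1 \<otimes> r2)) \<otimes> r2 = r2 \<otimes> \<one> \<otimes> r2" by simp
        then have "r1 = \<one>" by (simp add: m_assoc sq sq')
        then show False using \<open>r1 \<noteq> \<one>\<close> by simp
      qed
      ultimately have "card {\<one>, r1, z} = 3" by (metis card_3_iff)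
      moreover have "card {\<one>, r1, z} \<le> card (D \<inter> H)"
        by (rule card_mono[OF _ sub]) (rule finite_subset[OF subgroup.subset[OF DH] fin])
      ultimately show ?thesis using c2 by simp
    qed
  qed
qed

end

section \<open>Classification\<close>

lemma card_fibres:
  assumes "finite A" "\<And>y. y \<in> f ` A \<Longrightarrow> card {x \<in> A. f x = y} = c"
  shows "card A = c * card (f ` A)"
proof -
  have "card A = (\<Sum>y\<in>f ` A. card {x \<in> A. f x = y})"
    using sum.image_gen[OF assms(1), of "\<lambda>_. 1 :: nat" f] by simp
  also have "\<dots> = c * card (f ` A)" using assms(2) by simp
  finally show ?thesis .
qed

lemma card_fibres_le:
  assumes "finite A" "\<And>y. y \<in> f ` A \<Longrightarrow> card {x \<in> A. f x = y} \<le> c"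
  shows "card A \<le> c * card (f ` A)"
proof -
  have "card A = (\<Sum>y\<in>f ` A. card {x \<in> A. f x = y})"
    using sum.image_gen[OF assms(1), of "\<lambda>_. 1 :: nat" f] by simp
  also have "\<dots> \<le> (\<Sum>y\<in>f ` A. c)" by (rule sum_mono[OF assms(2)])
  finally show ?thesis by (simp add: mult.commute)
qed

text \<open>If \<open>s 2\<close> commutes with \<open>s 0\<close> and \<open>s 1\<close>, it
  carries all flags of a 2-face into one other 2-face. So a flag at the fixed vertex can follow any
  path of flags through its 2-faces, staying at that vertex.\<close>

lemma (in flag_system) flat_if_commute:
  assumes c: "\<And>x. x \<in> X \<Longrightarrow> s 1 (s 2 x) = s 2 (s 1 x)"
  shows "flat P"
proof -
  have face: "q 3 (s 2 u) = q 3 (s 2 w)" if uw: "u \<in> X" "w \<in> X" "q 3 u = q 3 w" for u w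
  proof (rule path_induct[OF uw(1,2), where R = "\<lambda>y. q 3 (s 2 u) = q 3 (s 2 y)"])
    fix y and i :: nat assume y: "y \<in> X" "q 3 (s 2 u) = q 3 (s 2 y)" and i: "i < 3" "q (Suc i) u \<noteq> q (Suc i) w"
    have "Suc 2 = 3" by simp
    then have "i \<noteq> 2" using i(2) uw(3) by metis
    then have "i = 0 \<or> i = 1" using i(1) by auto
    then have "s 2 (s i y) = s i (s 2 y)" using c[OF y(1)] s_commute[OF y(1)] by (elim disjE) simp_all
    moreover have "q 3 (s i (s 2 y)) = q 3 (s 2 y)" by (rule q_s) (use \<open>i = 0 \<or> i = 1\<close> y s_closed in auto)
    ultimately show "q 3 (s 2 u) = q 3 (s 2 (s i y))" using y(2) by simp
  qed simp
  have "\<exists>z\<in>X. q 1 z = q 1 x \<and> q 3 z = q 3 y" if xy: "x \<in> X" "y \<in> X" for x y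
  proof (rule path_induct[OF xy, where R = "\<lambda>y. \<exists>z\<in>X. q 1 z = q 1 x \<and> q 3 z = q 3 y"])
    show "\<exists>z\<in>X. q 1 z = q 1 x \<and> q 3 z = q 3 x" using xy by blast
    fix u and i :: nat assume u: "u \<in> X" "\<exists>z\<in>X. q 1 z = q 1 x \<and> q 3 z = q 3 u" and i: "i < 3"
    then obtain z where z: "z \<in> X" "q 1 z = q 1 x" "q 3 z = q 3 u" by blast
    show "\<exists>z\<in>X. q 1 z = q 1 x \<and> q 3 z = q 3 (s i u)"
    proof (cases "i = 2")
      case True
      have "q 3 (s 2 z) = q 3 (s 2 u)" by (rule face[OF z(1) u(1) z(3)])
      moreover have "q 1 (s 2 z) = q 1 z" by (rule q_s) (use z in simp_all)
      moreover have "s 2 z \<in> X" by (rule s_closed[OF _ z(1)]) simp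
      ultimately show ?thesis unfolding True using z(2) by auto
    next
      case False
      have "q 3 (s i u) = q 3 u" by (rule q_s[OF i u(1)]) (use False in simp_all)
      then show ?thesis using z by auto
    qed
  qed
  then have "(q 1 x, q 3 y) \<in> P" if "x \<in> X" "y \<in> X" for x y
    using in_P[OF that, of 1 3] that by simp
  then show ?thesis unfolding flat_def faces_simps by blast
qed

text \<open>
  The group acts simply transitively on the flags; \<open>ev g\<close> is the image of a base flag under \<open>g\<close>.
\<close>

locale regular_flag_group = flag_system P X s q + group G for P X s q and G :: "('g, 'm) monoid_scheme" (structure) +
  fixes ev and r :: "nat \<Rightarrow> 'g"
  assumes ev_bij: "bij_betw ev (carrier G) X"
    and r_in [simp]: "i < 3 \<Longrightarrow> r i \<in> carrier G"
    and ev_r: "i < 3 \<Longrightarrow> g \<in> carrier G \<Longrightarrow> ev (g \<otimes> r i) = s i (ev g)"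
    and ev_left: "k \<in> carrier G \<Longrightarrow> g \<in> carrier G \<Longrightarrow> h \<in> carrier G \<Longrightarrow> i \<le> 4 \<Longrightarrow> q i (ev g) = q i (ev h) \<Longrightarrow> q i (ev (k \<otimes> g)) = q i (ev (k \<otimes> h))"
begin

lemma ev_in: "g \<in> carrier G \<Longrightarrow> ev g \<in> X" and ev_onto: "x \<in> X \<Longrightarrow> \<exists>g\<in>carrier G. x = ev g"
  and ev_inj: "g \<in> carrier G \<Longrightarrow> h \<in> carrier G \<Longrightarrow> ev g = ev h \<Longrightarrow> g = h"
  using ev_bij unfolding bij_betw_def inj_on_def by blast+

definition Stab :: "'g set" where "Stab = {g \<in> carrier G. q 1 (ev g) = q 1 (ev \<one>)}"

lemma Stab_subgroup: "subgroup Stab G"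
proof (rule subgroupI)
  fix g assume g: "g \<in> Stab"
  then have gc: "g \<in> carrier G" "q 1 (ev g) = q 1 (ev \<one>)" unfolding Stab_def by simp_all
  then have "q 1 (ev (inv g \<otimes> g)) = q 1 (ev (inv g \<otimes> \<one>))" by (intro ev_left) simp_all
  then show "inv g \<in> Stab" unfolding Stab_def using gc by simp
  fix h assume "h \<in> Stab"
  then have hc: "h \<in> carrier G" "q 1 (ev h) = q 1 (ev \<one>)" unfolding Stab_def by simp_all
  then have "q 1 (ev (g \<otimes> h)) = q 1 (ev (g \<otimes> \<one>))" using gc by (intro ev_left) simp_all
  then show "g \<otimes> h \<in> Stab" unfolding Stab_def using gc hc by simp
qed (auto simp: Stab_def)

lemma ev_one_r: "i < 3 \<Longrightarrow> ev (r i) = s i (ev \<one>)"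
  using ev_r[of i \<one>] by simp

lemma r_Stab: "r 1 \<in> Stab" "r 2 \<in> Stab" "r 0 \<notin> Stab"
proof -
  have "q 1 (s 1 (ev \<one>)) = q 1 (ev \<one>)" "q 1 (s 2 (ev \<one>)) = q 1 (ev \<one>)" by (rule q_s; simp add: ev_in)+
  then show "r 1 \<in> Stab" "r 2 \<in> Stab" unfolding Stab_def by (simp_all add: ev_one_r)
  show "r 0 \<notin> Stab" unfolding Stab_def using q_s_neq[of 0 "ev \<one>"] by (simp add: ev_one_r ev_in)
qed

lemma r_sq: assumes "i < 3" shows "r i \<otimes> r i = \<one>"
proof (rule ev_inj)
  show "ev (r i \<otimes> r i) = ev \<one>" using ev_r[OF assms, of "r i"] ev_one_r[OF assms] s_s[OF assms, of "ev \<one>"] assms by (simp add: ev_in)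
qed (use assms in simp_all)

lemma r_commute: "r 2 \<otimes> r 0 = r 0 \<otimes> r 2"
proof (rule ev_inj)
  show "ev (r 2 \<otimes> r 0) = ev (r 0 \<otimes> r 2)"
    using ev_r[of 0 "r 2"] ev_r[of 2 "r 0"] ev_one_r[of 0] ev_one_r[of 2] s_commute[of "ev \<one>"] by (simp add: ev_in)
qed simp_all

lemma r_distinct: "r 0 \<noteq> \<one>" "r 1 \<noteq> \<one>" "r 2 \<noteq> \<one>" "r 1 \<noteq> r 2" "r 0 \<noteq> r 2"
proof -
  have x: "ev \<one> \<in> X" by (simp add: ev_in)
  have e: "ev (r 0) = s 0 (ev \<one>)" "ev (r 1) = s 1 (ev \<one>)" "ev (r 2) = s 2 (ev \<one>)" by (simp_all add: ev_one_r)
  have N: "Suc 0 = 1" "Suc 1 = 2" "Suc 2 = 3" by simp_all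
  have n: "q 1 (s 0 (ev \<one>)) \<noteq> q 1 (ev \<one>)" "q 2 (s 1 (ev \<one>)) \<noteq> q 2 (ev \<one>)" "q 3 (s 2 (ev \<one>)) \<noteq> q 3 (ev \<one>)"
    using q_s_neq[OF _ x, of 0] q_s_neq[OF _ x, of 1] q_s_neq[OF _ x, of 2] unfolding N by simp_all
  have m: "q 2 (s 2 (ev \<one>)) = q 2 (ev \<one>)" "q 1 (s 2 (ev \<one>)) = q 1 (ev \<one>)" by (rule q_s[OF _ x]; simp)+
  show "r 0 \<noteq> \<one>" "r 1 \<noteq> \<one>" "r 2 \<noteq> \<one>" using n unfolding e[symmetric] by metis+
  show "r 1 \<noteq> r 2" using n(2) m(1) unfolding e[symmetric] by metis
  show "r 0 \<noteq> r 2" using n(1) m(2) unfolding e[symmetric] by metis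
qed

lemma generated:
  assumes "\<one> \<in> S" "\<And>g. g \<in> carrier G \<Longrightarrow> g \<in> S \<Longrightarrow> g \<otimes> r 0 \<in> S \<and> g \<otimes> r 1 \<in> S \<and> g \<otimes> r 2 \<in> S"
  shows "carrier G \<subseteq> S"
proof
  fix g assume g: "g \<in> carrier G"
  have "\<exists>h\<in>carrier G. h \<in> S \<and> ev h = ev g"
  proof (rule path_induct[of "ev \<one>" "ev g" "\<lambda>y. \<exists>h\<in>carrier G. h \<in> S \<and> ev h = y"])
    show "\<exists>h\<in>carrier G. h \<in> S \<and> ev h = ev \<one>" using assms(1) by blast
    fix u and i :: nat assume "\<exists>h\<in>carrier G. h \<in> S \<and> ev h = u" and i: "i < 3"
    then obtain h where h: "h \<in> carrier G" "h \<in> S" "ev h = u" by blast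
    have "i = 0 \<or> i = 1 \<or> i = 2" using i by auto
    then have "h \<otimes> r i \<in> S" using assms(2)[OF h(1,2)] by auto
    then show "\<exists>h\<in>carrier G. h \<in> S \<and> ev h = s i u" using ev_r[OF i h(1)] h i by (intro bexI[of _ "h \<otimes> r i"]) simp_all
  qed (use g in \<open>simp_all add: ev_in\<close>)
  then show "g \<in> S" using ev_inj[OF _ g] by blast
qed

text \<open>The path from the base flag to a flag with the same vertex uses only \<open>s 1\<close>
  and \<open>s 2\<close>.\<close>

lemma Stab_generated:
  assumes "subgroup S G" "r 1 \<in> S" "r 2 \<in> S"
  shows "Stab \<subseteq> S"
proof
  fix g assume "g \<in> Stab"
  then have g: "g \<in> carrier G" "q 1 (ev \<one>) = q 1 (ev g)" unfolding Stab_def by simp_all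
  have "\<exists>h\<in>S. ev h = ev g"
  proof (rule path_induct[of "ev \<one>" "ev g" "\<lambda>y. \<exists>h\<in>S. ev h = y"])
    show "\<exists>h\<in>S. ev h = ev \<one>" using subgroup.one_closed[OF assms(1)] by blast
    fix u and i :: nat assume "\<exists>h\<in>S. ev h = u" and i: "i < 3" "q (Suc i) (ev \<one>) \<noteq> q (Suc i) (ev g)"
    then obtain h where h: "h \<in> S" "ev h = u" by blast
    have hc: "h \<in> carrier G" by (rule subgroup.mem_carrier[OF assms(1) h(1)])
    have "i \<noteq> 0" using i(2) g(2) by (cases "i = 0") simp_all
    then have "i = 1 \<or> i = 2" using i(1) by auto
    then have "h \<otimes> r i \<in> S" using subgroup.m_closed[OF assms(1) h(1)] assms(2,3) by auto
    then show "\<exists>h\<in>S. ev h = s i u" using ev_r[OF i(1) hc] h(2) by (intro bexI[of _ "h \<otimes> r i"]) simp_all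
  qed (use g in \<open>simp_all add: ev_in\<close>)
  then show "g \<in> S" using ev_inj[OF _ g(1)] subgroup.mem_carrier[OF assms(1)] by blast
qed

text \<open>Orbit-stabiliser: the fibres of the map to the vertex are the left cosets of the
  stabiliser.\<close>

lemma card_Stab:
  assumes "finite X" shows "card X = card Stab * card (q 1 ` X)"
proof -
  have fin: "finite (carrier G)" using assms bij_betw_finite[OF ev_bij] by simp
  have X: "ev ` carrier G = X" using ev_bij unfolding bij_betw_def by simp
  have "card (carrier G) = card Stab * card ((\<lambda>g. q 1 (ev g)) ` carrier G)"
  proof (rule card_fibres[OF fin])
    fix y assume "y \<in> (\<lambda>g. q 1 (ev g)) ` carrier G"
    then obtain h where h: "h \<in> carrier G" "y = q 1 (ev h)" by blast
    have "{g \<in> carrier G. q 1 (ev g) = y} = (\<lambda>g. h \<otimes> g) ` Stab"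
    proof
      show "{g \<in> carrier G. q 1 (ev g) = y} \<subseteq> (\<lambda>g. h \<otimes> g) ` Stab"
      proof
        fix g assume "g \<in> {g \<in> carrier G. q 1 (ev g) = y}"
        then have g: "g \<in> carrier G" "q 1 (ev g) = q 1 (ev h)" using h by simp_all
        have "q 1 (ev (inv h \<otimes> g)) = q 1 (ev (inv h \<otimes> h))" by (rule ev_left) (use g h in simp_all)
        then have "inv h \<otimes> g \<in> Stab" unfolding Stab_def using g h by simp
        moreover have "g = h \<otimes> (inv h \<otimes> g)" using g h by (simp add: m_assoc[symmetric])
        ultimately show "g \<in> (\<lambda>g. h \<otimes> g) ` Stab" by blast
      qed
      show "(\<lambda>g. h \<otimes> g) ` Stab \<subseteq> {g \<in> carrier G. q 1 (ev g) = y}"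
      proof (rule image_subsetI)
        fix g assume "g \<in> Stab"
        then have g: "g \<in> carrier G" "q 1 (ev g) = q 1 (ev \<one>)" unfolding Stab_def by simp_all
        have "q 1 (ev (h \<otimes> g)) = q 1 (ev (h \<otimes> \<one>))" by (rule ev_left) (use g h in simp_all)
        then show "h \<otimes> g \<in> {g \<in> carrier G. q 1 (ev g) = y}" using g h by simp
      qed
    qed
    moreover have "inj_on (\<lambda>g. h \<otimes> g) Stab"
      by (rule inj_onI) (use h in \<open>simp add: Stab_def\<close>)
    ultimately show "card {g \<in> carrier G. q 1 (ev g) = y} = card Stab" by (simp add: card_image)
  qed
  moreover have "(\<lambda>g. q 1 (ev g)) ` carrier G = q 1 ` X" unfolding X[symmetric] by (simp add: image_image)
  ultimately show ?thesis using bij_betw_same_card[OF ev_bij] by simp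
qed

lemma four_dvd_card: assumes "finite X" shows "4 dvd card X"
proof -
  have fin: "finite (carrier G)" using assms bij_betw_finite[OF ev_bij] by simp
  let ?A = "{\<one>, r 0, r 2, r 0 \<otimes> r 2}"
  note sq = r_sq[of 0] r_sq[of 2]
  have c: "r 0 \<in> carrier G" "r 2 \<in> carrier G" by simp_all
  have a: "r 0 \<otimes> (r 0 \<otimes> r 2) = r 2" "r 2 \<otimes> (r 0 \<otimes> r 2) = r 0" "(r 0 \<otimes> r 2) \<otimes> r 0 = r 2" "(r 0 \<otimes> r 2) \<otimes> r 2 = r 0" "(r 0 \<otimes> r 2) \<otimes> (r 0 \<otimes> r 2) = \<one>"
  proof -
    show 1: "r 0 \<otimes> (r 0 \<otimes> r 2) = r 2" "(r 0 \<otimes> r 2) \<otimes> r 2 = r 0" using c sq by (simp_all add: m_assoc) (simp add: m_assoc[symmetric] sq)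
    show 2: "r 2 \<otimes> (r 0 \<otimes> r 2) = r 0" using 1(2) c r_commute by (simp add: m_assoc[symmetric])
    show "(r 0 \<otimes> r 2) \<otimes> r 0 = r 2" using 1(1) c r_commute by (simp add: m_assoc)
    show "(r 0 \<otimes> r 2) \<otimes> (r 0 \<otimes> r 2) = \<one>" using 2 c sq by (simp add: m_assoc)
  qed
  have "subgroup ?A G"
  proof (rule finite_subgroupI[OF fin])
    show "x \<otimes> y \<in> ?A" if "x \<in> ?A" "y \<in> ?A" for x y
      using that a sq r_commute c by (elim insertE emptyE) simp_all
  qed auto
  from subgroup_card_dvd[OF this subgroup_self] have "card ?A dvd card (carrier G)" by (simp add: subset_iff)
  moreover have "r 0 \<otimes> r 2 \<noteq> \<one>" "r 0 \<otimes> r 2 \<noteq> r 0" "r 0 \<otimes> r 2 \<noteq> r 2"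
  proof -
    show "r 0 \<otimes> r 2 \<noteq> \<one>" using a(1) c r_distinct(5) by (metis r_one)
    show "r 0 \<otimes> r 2 \<noteq> r 0" "r 0 \<otimes> r 2 \<noteq> r 2" using r_distinct by simp_all
  qed
  then have "card ?A = 4" using r_distinct by (simp add: eq_commute[of _ "r 0 \<otimes> r 2"] eq_commute[of \<one>])
  ultimately show ?thesis using bij_betw_same_card[OF ev_bij] by simp
qed

lemma card_Stab_ge:
  assumes fin: "finite X" and odd: "odd (card (q 1 ` X))" and nf: "\<not> flat P"
  shows "card Stab \<ge> 8"
proof -
  have "4 dvd card Stab * card (q 1 ` X)" using four_dvd_card[OF fin] card_Stab[OF fin] by simp
  moreover have "coprime (4::nat) (card (q 1 ` X))" using odd coprime_power_left_iff[of 2 2 "card (q 1 ` X)"] by simp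
  ultimately have dvd: "4 dvd card Stab" by (simp add: coprime_dvd_mult_left_iff)
  have finS: "finite Stab" using fin bij_betw_finite[OF ev_bij] unfolding Stab_def by simp
  have one: "\<one> \<in> Stab" unfolding Stab_def by simp
  have pos: "card Stab > 0" using one finS by (auto simp: card_gt_0_iff)
  have "card Stab \<noteq> 4"
  proof
    assume c4: "card Stab = 4"
    have c: "r 1 \<in> carrier G" "r 2 \<in> carrier G" by simp_all
    have m: "r 1 \<otimes> r 2 \<in> Stab" "r 2 \<otimes> r 1 \<in> Stab" by (intro subgroup.m_closed[OF Stab_subgroup] r_Stab)+
    have sq: "r 1 \<otimes> r 1 = \<one>" "r 2 \<otimes> r 2 = \<one>" by (simp_all add: r_sq)
    have ne: "x \<otimes> y \<notin> {\<one>, x, y}" if "x \<in> carrier G" "y \<in> carrier G" "x \<otimes> x = \<one>" "x \<noteq> \<one>" "y \<noteq> \<one>" "x \<noteq> y" for x y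
    proof -
      have "x \<otimes> (x \<otimes> y) = y" using that by (simp add: m_assoc[symmetric])
      then have "x \<otimes> y \<noteq> \<one>" using that by auto
      then show ?thesis using that by simp
    qed
    have n12: "r 1 \<otimes> r 2 \<notin> {\<one>, r 1, r 2}" by (rule ne[OF c sq(1) r_distinct(2,3,4)])
    have n21: "r 2 \<otimes> r 1 \<notin> {\<one>, r 2, r 1}" by (rule ne[OF c(2,1) sq(2) r_distinct(3,2) r_distinct(4)[symmetric]])
    have "card {\<one>, r 1, r 2, r 1 \<otimes> r 2} = 4"
    proof -
      have d: "\<one> \<notin> {r 1, r 2, r 1 \<otimes> r 2}" "r 1 \<notin> {r 2, r 1 \<otimes> r 2}" "r 2 \<notin> {r 1 \<otimes> r 2}"
        using n12 r_distinct by (metis insert_iff singletonD)+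
      show ?thesis unfolding card_insert_disjoint[OF finite.intros(2)[OF finite.intros(2)[OF finite.intros(2)[OF finite.intros(1)]]] d(1)]
          card_insert_disjoint[OF finite.intros(2)[OF finite.intros(2)[OF finite.intros(1)]] d(2)]
          card_insert_disjoint[OF finite.intros(2)[OF finite.intros(1)] d(3)] by simp
    qed
    moreover have "{\<one>, r 1, r 2, r 1 \<otimes> r 2} \<subseteq> Stab" using one m r_Stab by blast
    ultimately have "{\<one>, r 1, r 2, r 1 \<otimes> r 2} = Stab" using card_subset_eq[OF finS] c4 by simp
    then have "r 2 \<otimes> r 1 \<in> {\<one>, r 1, r 2, r 1 \<otimes> r 2}" using m(2) by simp
    then have e: "r 2 \<otimes> r 1 = r 1 \<otimes> r 2" using n21 by blast
    have "s 1 (s 2 x) = s 2 (s 1 x)" if "x \<in> X" for x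
    proof -
      obtain g where g: "g \<in> carrier G" "x = ev g" using ev_onto[OF \<open>x \<in> X\<close>] by blast
      have "ev (g \<otimes> (r 2 \<otimes> r 1)) = s 1 (s 2 (ev g))" "ev (g \<otimes> (r 1 \<otimes> r 2)) = s 2 (s 1 (ev g))"
        using ev_r[of 1 "g \<otimes> r 2"] ev_r[of 2 g] ev_r[of 2 "g \<otimes> r 1"] ev_r[of 1 g] g(1) c by (simp_all add: m_assoc)
      then show ?thesis using e g by simp
    qed
    then show False using flat_if_commute nf by blast
  qed
  then show ?thesis using dvd pos by auto
qed

text \<open>The group generated by \<open>r 0\<close> and \<open>r 1\<close> gives
  \<open>2 p\<close> flags of the base 2-face, where \<open>p\<close> is the order in question, with
  at most two at each vertex, so that face has at least \<open>p\<close> vertices. It misses a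
  vertex, because a non-incident pair can be moved by \<open>inv g\<close> so that its 2-face
  becomes the base one.\<close>

lemma ord_lt:
  assumes fin: "finite X" and nf: "\<not> flat P" and V: "card (q 1 ` X) > 2"
  shows "ord (r 0 \<otimes> r 1) < card (q 1 ` X)"
proof (cases "ord (r 0 \<otimes> r 1) > 2")
  case False
  then show ?thesis using V by simp
next
  case True
  have finG: "finite (carrier G)" using fin bij_betw_finite[OF ev_bij] by simp
  have c: "r 0 \<in> carrier G" "r 1 \<in> carrier G" "r 0 \<otimes> r 0 = \<one>" "r 1 \<otimes> r 1 = \<one>" by (simp_all add: r_sq)
  let ?D = "Dih (r 0) (r 1)"
  let ?S = "{g \<in> carrier G. q 3 (ev g) = q 3 (ev \<one>)}"
  have S: "subgroup ?S G"
  proof (rule finite_subgroupI[OF finG])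
    fix g h assume "g \<in> ?S" "h \<in> ?S"
    then have gh: "g \<in> carrier G" "q 3 (ev g) = q 3 (ev \<one>)" "h \<in> carrier G" "q 3 (ev h) = q 3 (ev \<one>)" by simp_all
    then have "q 3 (ev (g \<otimes> h)) = q 3 (ev (g \<otimes> \<one>))" by (intro ev_left) simp_all
    then show "g \<otimes> h \<in> ?S" using gh by simp
  qed auto
  have "q 3 (s 0 (ev \<one>)) = q 3 (ev \<one>)" "q 3 (s 1 (ev \<one>)) = q 3 (ev \<one>)" by (rule q_s; simp add: ev_in)+
  then have "r 0 \<in> ?S" "r 1 \<in> ?S" by (simp_all add: ev_one_r)
  then have DS: "?D \<subseteq> ?S" by (rule Dih_least[OF S])
  have finD: "finite ?D" using DS finG finite_subset[OF DS] by simp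
  let ?f = "\<lambda>g. q 1 (ev g)"
  have "card ?D \<le> 2 * card (?f ` ?D)"
  proof (rule card_fibres_le[OF finD])
    fix y assume "y \<in> ?f ` ?D"
    then obtain d where d: "d \<in> ?D" "y = ?f d" by blast
    have dS: "d \<in> carrier G" "q 3 (ev d) = q 3 (ev \<one>)" using DS d(1) by blast+
    have "{g \<in> ?D. ?f g = y} \<subseteq> {d, d \<otimes> r 1}"
    proof
      fix g assume "g \<in> {g \<in> ?D. ?f g = y}"
      then have g: "g \<in> carrier G" "q 3 (ev g) = q 3 (ev \<one>)" "q 1 (ev g) = q 1 (ev d)" using DS d by blast+
      have "ev g = ev d \<or> ev g = s 1 (ev d)"
      proof (rule eq_except[OF ev_in[OF dS(1)] ev_in[OF g(1)]])
        fix j :: nat assume "j < 3" "j \<noteq> 1"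
        then have "j = 0 \<or> j = 2" by auto
        moreover have "Suc 0 = 1" "Suc 2 = 3" by simp_all
        ultimately show "q (Suc j) (ev d) = q (Suc j) (ev g)" using dS g by metis
      qed simp
      then have "ev g = ev d \<or> ev g = ev (d \<otimes> r 1)" using ev_r[of 1 d] dS by simp
      then show "g \<in> {d, d \<otimes> r 1}" using ev_inj[OF g(1)] dS(1) c by blast
    qed
    then have "card {g \<in> ?D. ?f g = y} \<le> card {d, d \<otimes> r 1}" by (intro card_mono) simp_all
    also have "\<dots> \<le> 2" by (simp add: card_insert_if)
    finally show "card {g \<in> ?D. ?f g = y} \<le> 2" .
  qed
  moreover have "card (?f ` ?D) < card (q 1 ` X)"
  proof (rule psubset_card_mono)
    show "finite (q 1 ` X)" using fin by simp
    obtain x y where xy: "x \<in> X" "y \<in> X" "(q 1 x, q 3 y) \<notin> P" using nf unfolding flat_def faces_simps by blast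
    obtain g h where gh: "g \<in> carrier G" "y = ev g" "h \<in> carrier G" "x = ev h" using ev_onto[OF xy(1)] ev_onto[OF xy(2)] by blast
    have "q 1 (ev (inv g \<otimes> h)) \<notin> ?f ` ?D"
    proof
      assume "q 1 (ev (inv g \<otimes> h)) \<in> ?f ` ?D"
      then obtain d where d: "d \<in> ?D" "q 1 (ev (inv g \<otimes> h)) = q 1 (ev d)" by blast
      have dS: "d \<in> carrier G" "q 3 (ev d) = q 3 (ev \<one>)" using DS d(1) by blast+
      have "q 1 (ev (g \<otimes> (inv g \<otimes> h))) = q 1 (ev (g \<otimes> d))" by (rule ev_left) (use gh d dS in simp_all)
      then have 1: "q 1 (ev (g \<otimes> d)) = q 1 x" using gh by (simp add: m_assoc[symmetric])
      have "q 3 (ev (g \<otimes> d)) = q 3 (ev (g \<otimes> \<one>))" by (rule ev_left) (use gh dS in simp_all)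
      then have "q 3 (ev (g \<otimes> d)) = q 3 y" using gh by simp
      moreover have "ev (g \<otimes> d) \<in> X" using gh dS by (simp add: ev_in)
      ultimately show False using 1 xy(3) in_P[OF xy(1,2), of 1 3] by auto
    qed
    moreover have "q 1 (ev (inv g \<otimes> h)) \<in> q 1 ` X" using gh by (simp add: ev_in)
    moreover have "?f ` ?D \<subseteq> q 1 ` X" using DS ev_in by auto
    ultimately show "?f ` ?D \<subset> q 1 ` X" by blast
  qed
  moreover have "card ?D = 2 * ord (r 0 \<otimes> r 1)" by (rule card_Dih(2)[OF finG c True])
  ultimately show ?thesis by simp
qed

lemma string_groupI:
  assumes fin: "finite X" and S8: "card Stab = 8"
  shows "string_group G (r 0) (r 1) (r 2)"
    and "Dih (r 1) (r 2) = Stab"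
proof -
  have finG: "finite (carrier G)" using fin bij_betw_finite[OF ev_bij] by simp
  have c: "r 1 \<in> carrier G" "r 2 \<in> carrier G" "r 1 \<otimes> r 1 = \<one>" "r 2 \<otimes> r 2 = \<one>" by (simp_all add: r_sq)
  note D = Dih_subgroup[OF finG c]
  show DS: "Dih (r 1) (r 2) = Stab"
    using Dih_least[OF Stab_subgroup r_Stab(1,2)] Stab_generated[OF D] by (rule equalityI)
  let ?u = "r 1 \<otimes> r 2"
  have u: "?u \<in> carrier G" using c by simp
  \<comment> \<open>The inequality of \<open>card_Dih\<close> comes first: it supplies the order
    above 2 that the equality asks for.\<close>
  have "ord ?u \<ge> 4" using card_Dih(1)[OF finG c] S8 unfolding DS by simp
  then have o: "ord ?u = 4" using card_Dih(2)[OF finG c] S8 unfolding DS by simp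
  have "\<not> ord ?u dvd 2" unfolding o by (simp add: dvd_imp_le nat_dvd_not_less)
  then have u2: "?u \<otimes> ?u \<noteq> \<one>" using pow_eq_id[OF u, of 2] u by (simp add: eval_nat_numeral)
  have "?u [^] (4::nat) = \<one>" unfolding pow_eq_id[OF u] o by simp
  then have u4: "(?u \<otimes> ?u) \<otimes> (?u \<otimes> ?u) = \<one>" using u by (simp add: eval_nat_numeral m_assoc)
  have inv: "inv (r 1) = r 1" "inv (r 2) = r 2" using c by (simp_all add: inv_equality)
  have "?u \<otimes> ?u = inv (?u \<otimes> ?u)" by (rule inv_equality[OF u4, symmetric]) (use u in simp_all)
  also have "\<dots> = (r 2 \<otimes> r 1) \<otimes> (r 2 \<otimes> r 1)" using c u inv by (simp add: inv_mult_group)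
  finally have br: "r 2 \<otimes> (r 1 \<otimes> (r 2 \<otimes> r 1)) = r 1 \<otimes> (r 2 \<otimes> (r 1 \<otimes> r 2))" using c by (simp add: m_assoc)
  show "string_group G (r 0) (r 1) (r 2)"
  proof
    show "r 0 \<in> carrier G" "r 1 \<in> carrier G" "r 2 \<in> carrier G" by simp_all
    show "r 0 \<otimes> r 0 = \<one>" "r 1 \<otimes> r 1 = \<one>" "r 2 \<otimes> r 2 = \<one>" by (simp_all add: r_sq)
    show "r 2 \<otimes> r 0 = r 0 \<otimes> r 2" by (rule r_commute)
    show "r 2 \<otimes> (r 1 \<otimes> (r 2 \<otimes> r 1)) = r 1 \<otimes> (r 2 \<otimes> (r 1 \<otimes> r 2))" by (rule br)
    show "r 1 \<otimes> (r 2 \<otimes> (r 1 \<otimes> r 2)) \<noteq> \<one>" using u2 c by (simp add: m_assoc)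
    show "\<And>S. \<one> \<in> S \<Longrightarrow> (\<And>g. g \<in> carrier G \<Longrightarrow> g \<in> S \<Longrightarrow> g \<otimes> r 0 \<in> S \<and> g \<otimes> r 1 \<in> S \<and> g \<otimes> r 2 \<in> S) \<Longrightarrow> carrier G \<subseteq> S"
      by (rule generated)
    show "finite (carrier G)" by (rule finG)
  qed
qed

end

context flag_system
begin

text \<open>Evaluation at a base flag: regularity makes it onto, connectedness makes it injective,
  and right multiplication by a generator becomes an adjacency map because automorphisms commute
  with these.\<close>

lemma regular_flag_group_Aut:
  assumes reg: "regular_polyhedron P"
  obtains ev r where "regular_flag_group P X s q (Aut P) ev r"
proof -
  obtain x0 where x0: "x0 \<in> X" using X_nonempty by blast
  have "\<exists>\<gamma>\<in>carrier (Aut P). act \<gamma> x0 = s i x0" if "i < 3" for i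
    by (rule regularD[OF reg x0 s_closed[OF that x0]])
  then obtain r where r: "\<And>i. i < 3 \<Longrightarrow> r i \<in> carrier (Aut P)" "\<And>i. i < 3 \<Longrightarrow> act (r i) x0 = s i x0" by metis
  interpret G: group "Aut P" by (rule group_Aut)
  have "regular_flag_group P X s q (Aut P) (\<lambda>\<gamma>. act \<gamma> x0) r"
  proof (intro regular_flag_group.intro regular_flag_group_axioms.intro fs group_Aut)
    show "bij_betw (\<lambda>\<gamma>. act \<gamma> x0) (carrier (Aut P)) X"
      unfolding bij_betw_def
    proof
      show "inj_on (\<lambda>\<gamma>. act \<gamma> x0) (carrier (Aut P))" by (rule inj_onI) (rule act_inj[OF _ _ x0])
      show "(\<lambda>\<gamma>. act \<gamma> x0) ` carrier (Aut P) = X"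
        using act_closed[OF _ x0] regularD[OF reg x0] by (fastforce simp: image_iff)
    qed
    show "r i \<in> carrier (Aut P)" if "i < 3" for i by (rule r(1)[OF that])
    show "act (g \<otimes>\<^bsub>Aut P\<^esub> r i) x0 = s i (act g x0)" if "i < 3" "g \<in> carrier (Aut P)" for i g
      using act_mult[OF that(2) r(1)[OF that(1)] x0] r(2)[OF that(1)] act_props(2)[OF that(2,1) x0] by simp
    show "q i (act (k \<otimes>\<^bsub>Aut P\<^esub> g) x0) = q i (act (k \<otimes>\<^bsub>Aut P\<^esub> h) x0)"
      if "k \<in> carrier (Aut P)" "g \<in> carrier (Aut P)" "h \<in> carrier (Aut P)" "i \<le> 4" "q i (act g x0) = q i (act h x0)" for k g h i
      using that by (simp add: act_mult[OF _ _ x0] act_props(3) act_closed[OF _ x0])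
  qed
  then show thesis by (rule that)
qed

end

section \<open>Identification of the group with the flags of the torus\<close>

context string_group
begin

text \<open>
  The element of \<open>D\<close> that takes the standard frame at the origin to the frame \<open>(d, e)\<close>.
\<close>

definition delta :: "int \<times> int \<Rightarrow> int \<times> int \<Rightarrow> 'a" where
  "delta d e =
     (if d = (1, 0) then (if e = (0, 1) then \<one> else r2)
      else if d = (-1, 0) then (if e = (0, 1) then r1 \<otimes> (r2 \<otimes> r1) else z)
      else if d = (0, 1) then (if e = (1, 0) then r1 else r1 \<otimes> r2)
      else (if e = (1, 0) then r2 \<otimes> r1 else r2 \<otimes> (r1 \<otimes> r2)))"

lemma delta_closed [simp]: "delta d e \<in> carrier G"
  unfolding delta_def by simp

lemma delta_r: assumes "(d, e) \<in> frames"
  shows "delta e d = delta d e \<otimes> r1" "delta d (-e) = delta d e \<otimes> r2"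
  using assms unfolding delta_def z_def by (elim framesE; simp add: word_simps)+

text \<open>Conjugation by the element that rotates the standard frame to \<open>(d, e)\<close>
  turns the unit translation along the first axis into the translation by \<open>d\<close>.\<close>

lemma delta_n: assumes tp: "trans_pair n m" and f: "(d, e) \<in> frames"
  shows "delta d e \<otimes> n = (n [^] fst d \<otimes> m [^] snd d) \<otimes> delta d e"
proof -
  note t = trans_pairD[OF tp]
  have neg1: "x [^] (-1::int) = inv x" if "x \<in> carrier G" for x using that by (simp add: int_pow_neg)
  have i: "r1 \<otimes> inv n = inv m \<otimes> r1" "r1 \<otimes> inv m = inv n \<otimes> r1" "r2 \<otimes> inv n = inv n \<otimes> r2"
    using pow_conj[OF r_closed(2) t(1,2,4), of "-1"] pow_conj[OF r_closed(2) t(2,1,7), of "-1"] pow_conj[OF r_closed(3) t(1,1,5), of "-1"] t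
    by (simp_all add: neg1)
  have j: "r2 \<otimes> inv m = m \<otimes> r2"
    using pow_conj[OF r_closed(3) t(2) inv_closed[OF t(2)] t(6), of "-1"] t by (simp add: neg1)
  have ext: "x \<otimes> (y \<otimes> w) = y' \<otimes> (x \<otimes> w)" if "x \<otimes> y = y' \<otimes> x" "x \<in> carrier G" "y \<in> carrier G" "y' \<in> carrier G" "w \<in> carrier G" for x y y' w
    using that by (simp add: m_assoc[symmetric])
  note a = t(4-7) i j
  note a' = ext[OF t(4)] ext[OF t(5)] ext[OF t(6)] ext[OF t(7)] ext[OF i(1)] ext[OF i(2)] ext[OF i(3)] ext[OF j]
  show ?thesis using f unfolding delta_def z_def
    by (elim framesE; simp add: t(1,2) neg1 m_assoc a a')
qed

end

locale torus_cover = string_group G r0 r1 r2 + torus b for G (structure) and r0 r1 r2 b +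
  fixes n m
  assumes tp: "trans_pair n m" and nb: "n [^] b = \<one>" and mb: "m [^] b = \<one>"
    and order_G: "order G = 8 * b\<^sup>2"
begin

definition phi where "phi x = (case x of (v, d, e) \<Rightarrow> (n [^] (fst v :: int) \<otimes> m [^] (snd v :: int)) \<otimes> delta d e)"

lemma nm [simp]: "n \<in> carrier G" "m \<in> carrier G" and nm_commute: "n \<otimes> m = m \<otimes> n"
  using trans_pairD[OF tp] by simp_all

lemma phi_closed: "phi x \<in> carrier G"
  unfolding phi_def by (simp split: prod.split)

lemma pow_mod: "x \<in> carrier G \<Longrightarrow> x [^] b = \<one> \<Longrightarrow> x [^] (i mod int b) = x [^] i"
proof -
  assume x: "x \<in> carrier G" "x [^] b = \<one>"
  then have "ord x dvd b" using pow_eq_id by blast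
  then have "int (ord x) dvd int b" by simp
  moreover have "int b dvd i - i mod int b" by (simp add: minus_mod_eq_mult_div)
  ultimately have "int (ord x) dvd i - i mod int b" by (rule dvd_trans)
  then show ?thesis using int_pow_eq[OF x(1), of "i mod int b" i] by simp
qed

lemma phi_12: assumes "x \<in> X" shows "phi (s 1 x) = phi x \<otimes> r1" "phi (s 2 x) = phi x \<otimes> r2"
proof -
  obtain v d e where x: "x = (v, d, e)" by (cases x)
  have f: "(d, e) \<in> frames" using assms unfolding x by (simp add: X_iff)
  show "phi (s 1 x) = phi x \<otimes> r1" "phi (s 2 x) = phi x \<otimes> r2"
    unfolding x phi_def s_simps prod.case delta_r[OF f] by (simp_all add: m_assoc)
qed

lemma phi_shift: assumes "(d, e) \<in> frames" shows "phi (md (v + d), d, e) = phi (v, d, e) \<otimes> n"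
proof -
  have "phi (md (v + d), d, e) = (n [^] (fst v + fst d) \<otimes> m [^] (snd v + snd d)) \<otimes> delta d e"
    unfolding phi_def md_def by (simp add: pow_mod nb mb)
  also have "\<dots> = ((n [^] fst v \<otimes> m [^] snd v) \<otimes> (n [^] fst d \<otimes> m [^] snd d)) \<otimes> delta d e"
    unfolding powers2(3)[OF nm nm_commute] ..
  also have "\<dots> = phi (v, d, e) \<otimes> n" unfolding phi_def prod.case using delta_n[OF tp assms] by (simp add: m_assoc)
  finally show ?thesis .
qed

text \<open>Multiplying by \<open>n\<close> shifts the flag by \<open>d\<close>; the moves 1, 2, 1
  then reverse \<open>d\<close> and lead to \<open>s 0 x\<close>, and a further move 2 leads to
  \<open>s 0 (s 2 x)\<close>. These words are the two possible factors of \<open>r0\<close> from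
  \<open>D\<close>.\<close>

lemma phi_0: assumes "x \<in> X"
  shows "r0 = n \<otimes> (r1 \<otimes> (r2 \<otimes> r1)) \<Longrightarrow> phi (s 0 x) = phi x \<otimes> r0"
    and "r0 = n \<otimes> z \<Longrightarrow> phi (petrie_s 0 x) = phi x \<otimes> r0"
proof -
  obtain v d e where x: "x = (v, d, e)" by (cases x)
  have f: "(d, e) \<in> frames" using assms unfolding x by (simp add: X_iff)
  let ?y = "(md (v + d), d, e)"
  have y: "?y \<in> X" using f by (simp add: X_iff md_box)
  note c = y s012_closed(2)[OF y] s012_closed(3)[OF s012_closed(2)[OF y]] s012_closed(2)[OF s012_closed(3)[OF s012_closed(2)[OF y]]]
  have 1: "s 1 (s 2 (s 1 ?y)) = s 0 x" "s 2 (s 1 (s 2 (s 1 ?y))) = petrie_s 0 x" unfolding x by simp_all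
  have 2: "phi (s 1 (s 2 (s 1 ?y))) = phi ?y \<otimes> (r1 \<otimes> (r2 \<otimes> r1))"
    using phi_12(1)[OF c(1)] phi_12(2)[OF c(2)] phi_12(1)[OF c(3)] by (simp add: m_assoc phi_closed)
  have 3: "phi (s 2 (s 1 (s 2 (s 1 ?y)))) = phi ?y \<otimes> z"
    using 2 phi_12(2)[OF c(4)] by (simp add: m_assoc phi_closed z_def)
  show "phi (s 0 x) = phi x \<otimes> r0" if "r0 = n \<otimes> (r1 \<otimes> (r2 \<otimes> r1))"
    using 2 unfolding 1 phi_shift[OF f] x that by (simp add: m_assoc phi_closed)
  show "phi (petrie_s 0 x) = phi x \<otimes> r0" if "r0 = n \<otimes> z"
    using 3 unfolding 1 phi_shift[OF f] x that by (simp add: m_assoc phi_closed)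
qed

text \<open>The image absorbs the generators, so \<open>phi\<close> is onto; both sides have
  \<open>8 b^2\<close> elements, so it is injective. No normal form for the group has to be proved
  unique.\<close>

lemma phi_bij:
  assumes t: "\<And>(i::nat) x. i < 3 \<Longrightarrow> x \<in> X \<Longrightarrow> t i x \<in> X"
    and c: "\<And>x. x \<in> X \<Longrightarrow> phi (t 0 x) = phi x \<otimes> r0 \<and> phi (t 1 x) = phi x \<otimes> r1 \<and> phi (t 2 x) = phi x \<otimes> r2"
  shows "bij_betw phi X (carrier G)"
proof -
  have "carrier G \<subseteq> phi ` X"
  proof (rule gen)
    have "phi ((0, 0), (1, 0), (0, 1)) = \<one>" unfolding phi_def delta_def by simp
    then show "\<one> \<in> phi ` X" using x0 by (metis imageI)
    fix g assume "g \<in> phi ` X"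
    then obtain x where x: "x \<in> X" "g = phi x" by blast
    have "t 0 x \<in> X" "t 1 x \<in> X" "t 2 x \<in> X" using t[OF _ x(1)] by simp_all
    then have "phi (t 0 x) \<in> phi ` X" "phi (t 1 x) \<in> phi ` X" "phi (t 2 x) \<in> phi ` X" by (simp_all only: imageI)
    then show "g \<otimes> r0 \<in> phi ` X \<and> g \<otimes> r1 \<in> phi ` X \<and> g \<otimes> r2 \<in> phi ` X" using c[OF x(1)] x(2) by simp
  qed
  then have im: "phi ` X = carrier G" using phi_closed by blast
  moreover have "inj_on phi X"
    by (rule eq_card_imp_inj_on[OF finite_X]) (use im card_X order_G in \<open>simp add: order_def\<close>)
  ultimately show ?thesis unfolding bij_betw_def by simp
qed

end

lemma (in regular_flag_group) isomorphic:
  assumes b: "prime b" "b \<ge> 3" and nf: "\<not> flat P" and V: "card (q 1 ` X) = b\<^sup>2"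
    and fin: "finite X" and cX: "card X = 8 * b\<^sup>2"
  shows "poset_isomorphic P (toroidal_map b) \<or> poset_isomorphic P (petrial (toroidal_map b))"
proof -
  interpret tor: torus b by (rule torus.intro[OF b(2)])
  have b2: "b\<^sup>2 \<ge> 9" using power_mono[OF b(2), of 2] by simp
  have S8: "card Stab = 8" using card_Stab[OF fin] cX b(2) unfolding V by simp
  interpret sg: string_group G "r 0" "r 1" "r 2" by (rule string_groupI(1)[OF fin S8])
  have o: "order G = 8 * b\<^sup>2" using bij_betw_same_card[OF ev_bij] cX by (simp add: order_def)
  have "ord (r 0 \<otimes> r 1) < b\<^sup>2" using ord_lt[OF fin nf] b2 unfolding V by simp
  moreover have "r 0 \<notin> sg.D" unfolding sg.D_def string_groupI(2)[OF fin S8] by (rule r_Stab(3))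
  ultimately have "sg.torus_relations b" by (rule sg.torus_relations_of_order[OF b o])
  then obtain n m where nm: "sg.trans_pair n m" "n [^] b = \<one>" "m [^] b = \<one>"
    "r 0 = n \<otimes> (r 1 \<otimes> (r 2 \<otimes> r 1)) \<or> r 0 = n \<otimes> sg.z" unfolding sg.torus_relations_def by blast
  interpret tc: torus_cover G "r 0" "r 1" "r 2" b n m by unfold_locales (use nm o in auto)
  \<comment> \<open>Stated for an arbitrary flag system on \<open>tor.X\<close>, because the torus
    and its Petrial share their flags while their posets have different types.\<close>
  have iso: "poset_isomorphic P R"
    if R: "flag_system R tor.X t u" and c: "\<And>x. x \<in> tor.X \<Longrightarrow> tc.phi (t 0 x) = tc.phi x \<otimes> r 0 \<and> tc.phi (t 1 x) = tc.phi x \<otimes> r 1 \<and> tc.phi (t 2 x) = tc.phi x \<otimes> r 2" for R :: "'w rel" and t u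
  proof -
    have bij: "bij_betw tc.phi tor.X (carrier G)"
      by (rule tc.phi_bij[where t = t, OF flag_system.s_closed[OF R] c])
    have "bij_betw (ev \<circ> tc.phi) tor.X X" by (rule bij_betw_trans[OF bij ev_bij])
    moreover have "(ev \<circ> tc.phi) (t i x) = s i ((ev \<circ> tc.phi) x)" if "i < 3" "x \<in> tor.X" for i x
    proof -
      have "i = 0 \<or> i = 1 \<or> i = 2" using that by auto
      then have "tc.phi (t i x) = tc.phi x \<otimes> r i" using c[OF that(2)] by auto
      then show ?thesis using ev_r[OF that(1) tc.phi_closed] by simp
    qed
    ultimately show ?thesis by (rule flag_bij_poset_isomorphic(2)[where f = "ev \<circ> tc.phi" and s = t and t = s, OF R fs])
  qed
  from nm(4) show ?thesis
  proof
    assume "r 0 = n \<otimes> (r 1 \<otimes> (r 2 \<otimes> r 1))"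
    then have "poset_isomorphic P (toroidal_map b)"
      by (intro iso[OF tor.torus_flag_system] conjI tc.phi_0(1) tc.phi_12)
    then show ?thesis ..
  next
    assume "r 0 = n \<otimes> sg.z"
    then have "poset_isomorphic P (petrial (toroidal_map b))"
      by (intro iso[OF tor.petrial_flag_system] conjI tc.phi_0(2)) (use tc.phi_12 in \<open>simp_all add: tor.petrie_s_def\<close>)
    then show ?thesis ..
  qed
qed

lemma nonflat_regular_lower_bound:
  fixes P :: "'a rel"
  assumes b: "prime b" "b \<ge> 3" and P: "nonflat_regular_polyhedron (b\<^sup>2) P"
  shows "finite (flags P) \<Longrightarrow> card (flags P) \<ge> 8 * b\<^sup>2"
    and "finite (flags P) \<Longrightarrow> card (flags P) = 8 * b\<^sup>2 \<Longrightarrow>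
      poset_isomorphic P (toroidal_map b) \<or> poset_isomorphic P (petrial (toroidal_map b))"
proof -
  have reg: "regular_polyhedron P" and nf: "\<not> flat P" and V: "card (faces P 0) = b\<^sup>2"
    using P unfolding nonflat_regular_polyhedron_def by blast+
  interpret A: polytope3 P using reg unfolding regular_polyhedron_def by unfold_locales blast
  interpret B: flag_system P "flags P" A.s A.q by (rule A.flag_system)
  obtain ev r where "regular_flag_group P (flags P) A.s A.q (Aut P) ev r" by (rule B.regular_flag_group_Aut[OF reg])
  then interpret C: regular_flag_group P "flags P" A.s A.q "Aut P" ev r .
  have V': "card (A.q 1 ` flags P) = b\<^sup>2" using V unfolding B.faces_simps .
  have "odd b" using prime_odd_nat[of b] b by simp
  then show "card (flags P) \<ge> 8 * b\<^sup>2" if "finite (flags P)"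
    using C.card_Stab[OF that] C.card_Stab_ge[OF that _ nf] unfolding V' by simp
  show "poset_isomorphic P (toroidal_map b) \<or> poset_isomorphic P (petrial (toroidal_map b))" if "finite (flags P)" "card (flags P) = 8 * b\<^sup>2"
    by (rule C.isomorphic[OF b nf V' that])
qed

theorem theorem6p2:
  fixes b :: nat
  assumes "prime b" and "b \<ge> 3"
  shows "nonflat_regular_polyhedron (b\<^sup>2) (toroidal_map b) \<and>
    nonflat_regular_polyhedron (b\<^sup>2) (petrial (toroidal_map b)) \<and>
    has_type (petrial (toroidal_map b)) (2 * b) 4 \<and>
    \<not> poset_isomorphic (toroidal_map b) (petrial (toroidal_map b)) \<and>
    (\<forall>P :: 'a rel. nonflat_regular_polyhedron (b\<^sup>2) P \<longrightarrow>
       flags (toroidal_map b) \<lesssim> flags P \<and>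
       flags (petrial (toroidal_map b)) \<lesssim> flags P \<and>
       (flags P \<lesssim> flags (toroidal_map b) \<longrightarrow>
          poset_isomorphic P (toroidal_map b) \<or>
          poset_isomorphic P (petrial (toroidal_map b))))"
proof (intro conjI allI impI)
  interpret tor: torus b by (rule torus.intro[OF assms(2)])
  show "nonflat_regular_polyhedron (b\<^sup>2) (toroidal_map b)" by (rule tor.torus_nonflat)
  show "nonflat_regular_polyhedron (b\<^sup>2) (petrial (toroidal_map b))" by (rule tor.petrial_nonflat)
  show "has_type (petrial (toroidal_map b)) (2 * b) 4" by (rule tor.petrial_type)
  show "\<not> poset_isomorphic (toroidal_map b) (petrial (toroidal_map b))" by (rule tor.petrial_not_isomorphic)
  interpret T: flag_system "toroidal_map b" tor.X tor.s tor.q by (rule tor.torus_flag_system)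
  interpret T': flag_system "petrial (toroidal_map b)" tor.X tor.petrie_s tor.petrie_q by (rule tor.petrial_flag_system)
  have cT: "finite (flags (toroidal_map b))" "card (flags (toroidal_map b)) = 8 * b\<^sup>2"
    unfolding T.flags_eq by (simp_all add: tor.finite_X card_image[OF T.F_inj] tor.card_X)
  have cT': "finite (flags (petrial (toroidal_map b)))" "card (flags (petrial (toroidal_map b))) = 8 * b\<^sup>2"
    unfolding T'.flags_eq by (simp_all add: tor.finite_X card_image[OF T'.F_inj] tor.card_X)
  fix P :: "'a rel" assume P: "nonflat_regular_polyhedron (b\<^sup>2) P"
  note lb = nonflat_regular_lower_bound[OF assms P]
  show "flags (toroidal_map b) \<lesssim> flags P"
  \<comment> \<open>A finite vertex set does not by itself bound the number of flags, so an infinite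
    \<open>flags P\<close> is treated separately.\<close>
  proof (cases "finite (flags P)")
    case True
    then show ?thesis using lepoll_iff_card_le[OF cT(1) True] lb(1) cT(2) by simp
  next
    case False
    then show ?thesis by (rule finite_lepoll_infinite[OF _ cT(1)])
  qed
  show "flags (petrial (toroidal_map b)) \<lesssim> flags P"
  proof (cases "finite (flags P)")
    case True
    then show ?thesis using lepoll_iff_card_le[OF cT'(1) True] lb(1) cT'(2) by simp
  next
    case False
    then show ?thesis by (rule finite_lepoll_infinite[OF _ cT'(1)])
  qed
  assume l: "flags P \<lesssim> flags (toroidal_map b)"
  then obtain f where "inj_on f (flags P)" "f ` flags P \<subseteq> flags (toroidal_map b)" unfolding lepoll_def by blast
  then have fin: "finite (flags P)" using cT(1) by (rule inj_on_finite)
  then have "card (flags P) = 8 * b\<^sup>2" using l lepoll_iff_card_le[OF fin cT(1)] cT(2) lb(1) by simp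
  then show "poset_isomorphic P (toroidal_map b) \<or> poset_isomorphic P (petrial (toroidal_map b))" by (rule lb(2)[OF fin])
qed

end
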